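(* Let $t\ge 1$ and let $n=p_1p_2\cdots p_tq$, where $p_1,\dots,p_t,q$ are pairwise distinct primes with $p_i\equiv 1 \pmod 8$ for all $i$ and $q\equiv 3\pmod 8$. Put $n_q:=n/q=p_1p_2\cdots p_t$. Assume that (i) $\left(\frac{q}{p_i}\right)=1$ for every $i\in\{1,2,\dots,t\}$; (ii) $\operatorname{rank}_{\mathbb{F}_2} A_n=t-1$, where $A_n$ is the $t\times t$ matrix over $\mathbb{F}_2$ defined in the context. If $n$ is a congruent number, then $$h(-n)\equiv h(-n_q)\pmod{2^{t+2}}.$$
   Context: $\left(\frac{\cdot}{\cdot}\right)$ is the Legendre symbol. A positive integer $n$ is a congruent number if there exist $a,b,c\in\mathbb{Q}^\times$ with $a^2+b^2=c^2$ and $n=\frac12 ab$. For a square-free positive integer $m$, $h(-m)$ denotes the class number of the imaginary quadratic field $\mathbb{Q}(\sqrt{-m})$. The matrix $A_n=[a_{i,j}]_{1\le i,j\le t}$ over $\mathbb{F}_2$ is defined by: for $j\ne i$, $a_{i,j}=0$ if $\left(\frac{p_j}{p_i}\right)=1$ and $a_{i,j}=1$ if $\left(\frac{p_j}{p_i}\right)=-1$; and $a_{i,i}=\sum_{j\neq i}a_{i,j}$. For $t=1$, $A_n=[0]$ is the $1\times 1$ zero matrix. *)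

theory Defs
  imports
    Complex_Main
    "HOL-Library.Z2"
    "HOL-Computational_Algebra.Computational_Algebra"
    "HOL-Number_Theory.Number_Theory"
    "HOL-Algebra.Ideal"
    "Jordan_Normal_Form.DL_Rank"
begin

definition congruent_number :: "nat \<Rightarrow> bool" where
  "congruent_number n \<longleftrightarrow> n > 0 \<and>
     (\<exists>a b c :: rat. a \<noteq> 0 \<and> b \<noteq> 0 \<and> c \<noteq> 0 \<and>
        a\<^sup>2 + b\<^sup>2 = c\<^sup>2 \<and> of_nat n = a * b / 2)"

definition imag_quadratic_field :: "nat \<Rightarrow> complex set" where
  "imag_quadratic_field m = {x + y * csqrt (- of_nat m) | x y. x \<in> \<rat> \<and> y \<in> \<rat>}"

definition ring_of_integers :: "complex set \<Rightarrow> complex ring" where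
  "ring_of_integers K =
     \<lparr>carrier = {x \<in> K. algebraic_int x}, monoid.mult = (*), one = 1, zero = 0, add = (+)\<rparr>"

definition nonzero_ideals :: "('a, 'b) ring_scheme \<Rightarrow> 'a set set" where
  "nonzero_ideals R = {I. ideal I R \<and> I \<noteq> {\<zero>\<^bsub>R\<^esub>}}"

definition ideal_class_rel :: "('a, 'b) ring_scheme \<Rightarrow> ('a set \<times> 'a set) set" where
  "ideal_class_rel R = {(I, J). I \<in> nonzero_ideals R \<and> J \<in> nonzero_ideals R \<and>
     (\<exists>a \<in> carrier R - {\<zero>\<^bsub>R\<^esub>}. \<exists>b \<in> carrier R - {\<zero>\<^bsub>R\<^esub>}.
        (\<lambda>x. a \<otimes>\<^bsub>R\<^esub> x) ` I = (\<lambda>x. b \<otimes>\<^bsub>R\<^esub> x) ` J)}"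

(* Every fractional ideal has an integral multiple, so the classes of nonzero integral ideals
   under aI = bJ are the elements of the ideal class group. *)
definition class_number :: "complex set \<Rightarrow> nat" where
  "class_number K =
     card (nonzero_ideals (ring_of_integers K) // ideal_class_rel (ring_of_integers K))"

(* h_neg m is h(-m), for square-free m > 0. *)
definition h_neg :: "nat \<Rightarrow> nat" where
  "h_neg m = class_number (imag_quadratic_field m)"

definition legendre_bit :: "(nat \<Rightarrow> nat) \<Rightarrow> nat \<Rightarrow> nat \<Rightarrow> bit" where
  "legendre_bit p i j = (if Legendre (int (p j)) (int (p i)) = 1 then 0 else 1)"

(* The primes are p 0, ..., p (t - 1), since matrices are indexed from 0.  For distinct primes
   the Legendre symbol is never 0, so the value 1 of legendre_bit stands for the symbol -1. *)
definition A_mat :: "nat \<Rightarrow> (nat \<Rightarrow> nat) \<Rightarrow> bit mat" where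
  "A_mat t p = mat t t (\<lambda>(i, j).
     if i = j then (\<Sum>k \<in> {..<t} - {i}. legendre_bit p i k) else legendre_bit p i j)"

end

theory Submission
  imports Defs
    "HOL-Analysis.Kronecker_Approximation_Theorem"
    "HOL-Library.Discrete_Functions"
    "HOL-Algebra.Sylow"
    "HOL-Algebra.Ideal_Product"
begin

text \<open>Write \<open>N = n_q\<close>. The rank condition makes the \<open>4\<close>-rank of the class groups of \<open>\<rat>(\<surd>-n)\<close> and
  \<open>\<rat>(\<surd>-N)\<close> equal to one, so that \<open>2 ^ (t + 1)\<close> divides both class numbers and \<open>2 ^ (t + 2)\<close> does iff the
  nontrivial square among the classes of order two is a fourth power. That class has an explicit
  square root, of norm \<open>z\<close> up to a ramified factor, read off from a solution of
  \<open>N X\<^sup>2 + q Y\<^sup>2 = 4 z\<^sup>2\<close> or of \<open>x\<^sup>2 + N y\<^sup>2 = 2 z\<^sup>2\<close>, and by genus theory it is a fourth power iff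
  \<open>\<Prod>\<^sub>i (z / p\<^sub>i) = 1\<close>. If \<open>n\<close> is congruent, infinite descent yields a system
  \<open>a r\<^sup>2 + b s\<^sup>2 = c u\<^sup>2\<close>, \<open>a r\<^sup>2 - b s\<^sup>2 = d w\<^sup>2\<close> with \<open>a b c d = n\<close>, not of the trivial shape \<open>a = c = d = 1\<close>;
  conditions modulo \<open>8\<close> and the rank condition leave \<open>b = q\<close> with one of \<open>a\<close>, \<open>c\<close>, \<open>d\<close> equal to \<open>N\<close>. In
  each case the system solves at least one of the two conics, and comparing it with a solution of the
  other one by means of Jacobi symbols shows that the two products of Legendre symbols agree.\<close>

section \<open>Rings of integers of imaginary quadratic fields\<close>

text \<open>All ideal arithmetic rests on one identity: an ideal times its conjugate is generated by
  a rational integer, its norm. It gives inverses, multiplicative norms, and a criterion for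
  equality of ideals: an inclusion plus equal norms. The two fields lead to different conics because
  different ramified divisors carry the class of order two that is a square: \<open>N\<close> in the
  field of \<open>sqrt(-N q)\<close>, where 2 is unramified, and 2 in the field of
  \<open>sqrt(-N)\<close>, where 2 ramifies. Divisibility of the class number depends on the field
  alone, so the product of symbols is the same for every solution of one conic. Hence whichever
  solution the system supplies may be used, and on the other conic any solution that Legendre's
  theorem supplies. The system arises because the area \<open>u v (u + v) (u - v)\<close> of a
  primitive triangle has four coprime factors. Its trivial shape solves neither conic, which is why
  a descent is required: halving such a system yields a smaller triangle.\<close>

lemma square_times_squarefree_Ints:
  fixes r :: rat and m :: nat
  assumes "squarefree m" "of_nat m * r\<^sup>2 \<in> \<int>"
  shows "r \<in> \<int>"
proof -
  obtain a b where ab: "quotient_of r = (a, b)" by force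
  have b0: "b > 0" and cop: "coprime a b" and r: "r = of_int a / of_int b"
    using ab quotient_of_denom_pos quotient_of_coprime quotient_of_div by blast+
  obtain k where k: "of_nat m * r\<^sup>2 = of_int k" using assms(2) by (auto elim: Ints_cases)
  have "(of_int (int m * a\<^sup>2) :: rat) = of_int (k * b\<^sup>2)"
    using k b0 unfolding r by (simp add: field_simps power2_eq_square)
  hence eq: "int m * a\<^sup>2 = k * b\<^sup>2" using of_int_eq_iff by blast
  hence "b\<^sup>2 dvd int m * a\<^sup>2" by simp
  moreover have "coprime (b\<^sup>2) (a\<^sup>2)" using cop by (simp add: coprime_commute)
  ultimately have "b\<^sup>2 dvd int m" using coprime_dvd_mult_left_iff by blast
  hence "int (nat b)^2 dvd int m" using b0 by simp
  hence "(nat b)^2 dvd m" by (metis of_nat_dvd_iff of_nat_power)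
  hence "nat b = 1" using assms(1) squarefreeD[of m "nat b"] by simp
  hence "b = 1" using b0 by simp
  thus ?thesis by (simp add: r)
qed

text \<open>Every power of the denominator of \<open>r\<close> divides \<open>D\<close>, so the
  denominator is 1. Integrality of the norms of algebraic integers is obtained in this way.\<close>

lemma bounded_denominator_powers_Ints:
  fixes r :: rat and D :: int
  assumes "D \<noteq> 0" "\<And>k. of_int D * r ^ k \<in> \<int>"
  shows "r \<in> \<int>"
proof -
  obtain a b where ab: "quotient_of r = (a, b)" by force
  have b0: "b > 0" and cop: "coprime a b" and r: "r = of_int a / of_int b"
    using ab quotient_of_denom_pos quotient_of_coprime quotient_of_div by blast+
  have dv: "b ^ k dvd D" for k
  proof -
    obtain j where j: "of_int D * r ^ k = of_int j" using assms(2) by (auto elim: Ints_cases)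
    have "(of_int (D * a ^ k) :: rat) = of_int (j * b ^ k)"
      using j b0 unfolding r by (simp add: field_simps power_divide)
    hence "D * a ^ k = j * b ^ k" using of_int_eq_iff by blast
    hence "b ^ k dvd D * a ^ k" by simp
    moreover have "coprime (b ^ k) (a ^ k)" using cop by (simp add: coprime_commute)
    ultimately show ?thesis using coprime_dvd_mult_left_iff by blast
  qed
  have "b = 1"
  proof (rule ccontr)
    assume "b \<noteq> 1"
    hence b2: "b \<ge> 2" using b0 by simp
    define k where "k = nat \<bar>D\<bar>"
    have "b ^ k \<le> \<bar>D\<bar>" using dv[of k] assms(1) by (metis dvd_abs_iff zdvd_imp_le zero_less_abs_iff)
    moreover have "2 ^ k \<le> b ^ k" using b2 by (intro power_mono) auto
    moreover have "int k < 2 ^ k" by (metis of_nat_less_two_power)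
    ultimately show False unfolding k_def by simp
  qed
  thus ?thesis by (simp add: r)
qed

lemma complex_of_real_of_rat: "complex_of_real (of_rat q) = of_rat q"
  by (cases q) (simp add: of_rat_rat)

locale imag_quad =
  fixes m :: nat
  assumes sqf: "squarefree m" and odd_m: "odd m"
begin

abbreviation K :: "complex set" where "K \<equiv> imag_quadratic_field m"

definition w :: complex where "w = Complex 0 (sqrt m)"

lemma m_pos: "m > 0" using sqf by (metis gr0I not_squarefree_0)

lemma csqrt_w: "csqrt (- of_nat m) = w"
proof -
  have "csqrt (- complex_of_real (real m)) = \<i> * of_real (sqrt \<bar>- real m\<bar>)"
    using csqrt_of_real_nonpos[of "- real m"] by simp
  thus ?thesis by (simp add: w_def complex_eq_iff)
qed

lemma w_sq: "w * w = - of_nat m"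
  by (simp add: w_def complex_eq_iff)

lemma cnj_w [simp]: "cnj w = - w" by (simp add: w_def complex_eq_iff)

lemma w_nz [simp]: "w \<noteq> 0" using m_pos by (simp add: w_def complex_eq_iff)

lemma K_iff: "z \<in> K \<longleftrightarrow> (\<exists>x y :: rat. z = of_rat x + of_rat y * w)"
  unfolding imag_quadratic_field_def csqrt_w Rats_def by auto

lemma K_of_rat [simp]: "of_rat r \<in> K" unfolding K_iff by (rule exI[of _ r], rule exI[of _ 0]) simp
lemma K_w [simp]: "w \<in> K" unfolding K_iff by (rule exI[of _ 0], rule exI[of _ 1]) simp
lemma K_of_int [simp]: "of_int r \<in> K" using K_of_rat[of "of_int r"] by simp
lemma K_of_nat [simp]: "of_nat r \<in> K" using K_of_rat[of "of_nat r"] by simp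
lemma K_1 [simp]: "1 \<in> K" using K_of_nat[of 1] by simp

lemma K_add [intro]: "a \<in> K \<Longrightarrow> b \<in> K \<Longrightarrow> a + b \<in> K"
proof -
  assume "a \<in> K" "b \<in> K"
  then obtain x y x' y' where "a = of_rat x + of_rat y * w" "b = of_rat x' + of_rat y' * w"
    unfolding K_iff by blast
  hence "a + b = of_rat (x + x') + of_rat (y + y') * w" by (simp add: of_rat_add algebra_simps)
  thus ?thesis unfolding K_iff by blast
qed

lemma K_uminus [intro]: "a \<in> K \<Longrightarrow> - a \<in> K"
  unfolding K_iff by (metis (no_types, opaque_lifting) add_uminus_conv_diff minus_add_distrib
      minus_mult_left of_rat_minus)


lemma K_mult [intro]: "a \<in> K \<Longrightarrow> b \<in> K \<Longrightarrow> a * b \<in> K"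
proof -
  assume "a \<in> K" "b \<in> K"
  then obtain x y x' y' where ab: "a = of_rat x + of_rat y * w" "b = of_rat x' + of_rat y' * w"
    unfolding K_iff by blast
  have "a * b = of_rat x * of_rat x' + of_rat y * of_rat y' * (w * w)
      + (of_rat x * of_rat y' + of_rat y * of_rat x') * w"
    unfolding ab by (simp add: algebra_simps)
  also have "\<dots> = of_rat (x * x' - of_nat m * (y * y')) + of_rat (x * y' + y * x') * w"
    unfolding w_sq by (simp add: of_rat_add of_rat_mult of_rat_diff)
  finally show ?thesis unfolding K_iff by blast
qed

lemma K_cnj [intro]: "a \<in> K \<Longrightarrow> cnj a \<in> K"
proof -
  assume "a \<in> K"
  then obtain x y where "a = of_rat x + of_rat y * w" unfolding K_iff by blast
  moreover have "cnj (of_rat r) = of_rat r" for r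
    by (metis complex_of_real_of_rat complex_cnj_complex_of_real)
  ultimately have "cnj a = of_rat x + of_rat (- y) * w" by (simp add: of_rat_minus)
  thus ?thesis unfolding K_iff by blast
qed

lemma w_norm: "(cmod w)\<^sup>2 = real m" by (simp add: w_def cmod_power2)

lemma K_coords:
  assumes "z \<in> K"
  obtains x y :: rat where "z = of_rat x + of_rat y * w" "Re z = of_rat x" "Im z = of_rat y * sqrt m"
    "(cmod z)\<^sup>2 = of_rat (x\<^sup>2 + of_nat m * y\<^sup>2)"
proof -
  obtain x y where z: "z = of_rat x + of_rat y * w" using assms unfolding K_iff by blast
  have R: "Re (of_rat r) = of_rat r" "Im (of_rat r) = 0" for r
    by (metis Re_complex_of_real complex_of_real_of_rat, metis Im_complex_of_real complex_of_real_of_rat)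
  have 1: "Re z = of_rat x" "Im z = of_rat y * sqrt m" unfolding z by (simp_all add: R w_def)
  have "(cmod z)\<^sup>2 = of_rat (x\<^sup>2 + of_nat m * y\<^sup>2)"
    unfolding cmod_power2 1 by (simp add: of_rat_add of_rat_mult of_rat_power power_mult_distrib)
  thus ?thesis using that z 1 by blast
qed

lemma K_norm_rat: assumes "z \<in> K" obtains r :: rat where "(cmod z)\<^sup>2 = of_rat r"
  using K_coords[OF assms] by metis

lemma K_divide [intro]: assumes a: "a \<in> K" and b: "b \<in> K" shows "a / b \<in> K"
proof -
  obtain r where r: "(cmod b)\<^sup>2 = of_rat r" using K_norm_rat[OF b] .
  have "a / b = a * cnj b * of_rat (inverse r)"
  proof (cases "b = 0")
    case False
    have "a / b = a * cnj b / of_real ((cmod b)\<^sup>2)"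
      using complex_div_cnj[of a b] by simp
    also have "\<dots> = a * cnj b / of_rat r" unfolding r by (simp add: complex_of_real_of_rat)
    finally show ?thesis by (simp add: of_rat_inverse field_class.field_divide_inverse)
  qed simp
  thus ?thesis using assms by (metis K_cnj K_mult K_of_rat)
qed

text \<open>The ring of integers, described by integrality of trace and norm; its elements are the
  \<open>(X + Y \<surd>-m) / 2\<close> with \<open>X\<close> and \<open>Y\<close> subject to the parity condition \<open>par\<close>.\<close>

definition OK :: "complex set" where
  "OK = {z \<in> K. 2 * Re z \<in> \<int> \<and> (cmod z)\<^sup>2 \<in> \<int>}"

definition el :: "int \<Rightarrow> int \<Rightarrow> complex" where
  "el X Y = Complex (of_int X / 2) (of_int Y / 2 * sqrt m)"

definition par :: "int \<Rightarrow> int \<Rightarrow> bool" where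
  "par X Y \<longleftrightarrow> (if m mod 4 = 3 then even (X - Y) else even X \<and> even Y)"

text \<open>Four times the norm of \<open>el X Y\<close> is \<open>X^2 + m Y^2\<close> and its trace
  is \<open>X\<close>, so \<open>par\<close> is exactly integrality of the norm. Squares are 0 or 1
  modulo 4 and \<open>m\<close> is odd.\<close>

lemma par_iff: "par X Y \<longleftrightarrow> 4 dvd X\<^sup>2 + int m * Y\<^sup>2"
proof -
  have sq: "z\<^sup>2 mod 4 = (if even z then 0 else 1)" for z :: int
  proof (cases "even z")
    case True then show ?thesis by (auto simp: power2_eq_square elim!: evenE)
  next
    case False
    then obtain j where "z = 2 * j + 1" by (auto elim: oddE)
    hence "z\<^sup>2 = 4 * (j * j + j) + 1" by (simp add: power2_eq_square algebra_simps)
    then show ?thesis using False by presburger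
  qed
  have m4: "m mod 4 = 1 \<or> m mod 4 = 3" using odd_m by presburger
  have m4': "int m mod 4 = int (m mod 4)" by (simp add: zmod_int)
  have e: "(X\<^sup>2 + int m * Y\<^sup>2) mod 4 = (X\<^sup>2 mod 4 + (int m mod 4) * (Y\<^sup>2 mod 4)) mod 4"
  proof -
    have "[X\<^sup>2 + int m * Y\<^sup>2 = X\<^sup>2 mod 4 + (int m mod 4) * (Y\<^sup>2 mod 4)] (mod 4)"
      by (intro cong_add cong_mult) (simp_all add: cong_iff_dvd_diff mod_eq_dvd_iff minus_mod_eq_mult_div)
    thus ?thesis unfolding cong_iff_dvd_diff mod_eq_dvd_iff .
  qed
  show ?thesis using m4 unfolding dvd_eq_mod_eq_0 e m4' sq par_def by (auto; presburger)
qed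

lemma el_K: "el X Y \<in> K"
proof -
  have "el X Y = of_rat (of_int X / 2) + of_rat (of_int Y / 2) * w"
    by (simp add: el_def w_def complex_eq_iff of_rat_divide)
  thus ?thesis unfolding K_iff by blast
qed

lemma el_Re: "Re (el X Y) = of_int X / 2" by (simp add: el_def)

lemma el_norm: "4 * (cmod (el X Y))\<^sup>2 = of_int (X\<^sup>2 + int m * Y\<^sup>2)"
  by (simp add: el_def cmod_power2 field_simps power_mult_distrib)

text \<open>Four times the norm minus the square of the trace is \<open>m (2 y)^2\<close>. It is an
  integer, so \<open>2 y\<close> is one because \<open>m\<close> is squarefree.\<close>

lemma OK_iff: "z \<in> OK \<longleftrightarrow> (\<exists>X Y. par X Y \<and> z = el X Y)"
proof
  assume "z \<in> OK"
  hence zK: "z \<in> K" and tr: "2 * Re z \<in> \<int>" and nm: "(cmod z)\<^sup>2 \<in> \<int>" by (auto simp: OK_def)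
  obtain x y where xy: "Re z = of_rat x" "Im z = of_rat y * sqrt m"
    "(cmod z)\<^sup>2 = of_rat (x\<^sup>2 + of_nat m * y\<^sup>2)" using K_coords[OF zK] by metis
  obtain X where X: "2 * Re z = of_int X" using tr by (auto elim: Ints_cases)
  obtain k where k: "(cmod z)\<^sup>2 = of_int k" using nm by (auto elim: Ints_cases)
  have "(of_rat (2 * x) :: real) = of_rat (of_int X)" using X xy by (simp add: of_rat_mult)
  hence x2: "2 * x = of_int X" using of_rat_eq_iff by blast
  have "(of_rat (x\<^sup>2 + of_nat m * y\<^sup>2) :: real) = of_rat (of_int k)" using k xy by simp
  hence k2: "x\<^sup>2 + of_nat m * y\<^sup>2 = of_int k" using of_rat_eq_iff by blast
  have "of_nat m * (2 * y)\<^sup>2 = 4 * of_int k - (2 * x)\<^sup>2" unfolding k2[symmetric]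
    by (simp add: power2_eq_square algebra_simps)
  also have "\<dots> = of_int (4 * k - X\<^sup>2)" unfolding x2 by simp
  finally have "of_nat m * (2 * y)\<^sup>2 \<in> \<int>" by (metis Ints_of_int)
  hence "2 * y \<in> \<int>" using square_times_squarefree_Ints sqf by blast
  then obtain Y where Y: "2 * y = of_int Y" by (auto elim: Ints_cases)
  have y': "(of_rat y :: real) = of_int Y / 2"
    using arg_cong[OF Y, of "of_rat :: rat \<Rightarrow> real"] by (simp add: of_rat_mult)
  have zel: "z = el X Y" using X xy(2) y' by (simp add: el_def complex_eq_iff)
  have "of_int (X\<^sup>2 + int m * Y\<^sup>2) = (of_int (4 * k) :: real)" using el_norm[of X Y] k zel by simp
  hence "X\<^sup>2 + int m * Y\<^sup>2 = 4 * k" using of_int_eq_iff by blast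
  hence "par X Y" unfolding par_iff by simp
  thus "\<exists>X Y. par X Y \<and> z = el X Y" using zel by blast
next
  assume "\<exists>X Y. par X Y \<and> z = el X Y"
  then obtain X Y where XY: "par X Y" "z = el X Y" by blast
  obtain k where "X\<^sup>2 + int m * Y\<^sup>2 = 4 * k" using XY(1) unfolding par_iff by blast
  hence "(cmod z)\<^sup>2 = of_int k" using el_norm[of X Y] XY by simp
  moreover have "2 * Re z = of_int X" using XY by (simp add: el_Re)
  ultimately show "z \<in> OK" unfolding OK_def using el_K XY(2) by (metis (mono_tags, lifting) Ints_of_int mem_Collect_eq)
qed

lemma OK_E: assumes "z \<in> OK" obtains X Y where "par X Y" "z = el X Y"
  using assms OK_iff by blast

lemma el_add: "el X Y + el X' Y' = el (X + X') (Y + Y')"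
  by (simp add: el_def complex_eq_iff field_simps)

lemma OK_add [intro]: "a \<in> OK \<Longrightarrow> b \<in> OK \<Longrightarrow> a + b \<in> OK"
proof -
  assume "a \<in> OK" "b \<in> OK"
  then obtain X Y X' Y' where "par X Y" "a = el X Y" "par X' Y'" "b = el X' Y'" by (metis OK_E)
  hence "a + b = el (X + X') (Y + Y')" "par (X + X') (Y + Y')"
    by (auto simp: el_add par_def split: if_splits)
  thus ?thesis unfolding OK_iff by blast
qed

lemma OK_mult [intro]: "a \<in> OK \<Longrightarrow> b \<in> OK \<Longrightarrow> a * b \<in> OK"
proof -
  assume ab: "a \<in> OK" "b \<in> OK"
  then obtain X Y X' Y' where h: "par X Y" "a = el X Y" "par X' Y'" "b = el X' Y'" by (metis OK_E)
  have K: "a * b \<in> K" using ab by (auto simp: OK_def)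
  have N: "(cmod (a * b))\<^sup>2 \<in> \<int>" using ab by (auto simp: OK_def norm_mult power_mult_distrib)
  have "even (X * X' - int m * (Y * Y'))"
    using h odd_m by (auto simp: par_def split: if_splits)
  then obtain k where k: "X * X' - int m * (Y * Y') = 2 * k" by blast
  have "4 * Re (a * b) = of_int (X * X' - int m * (Y * Y'))"
    using h by (simp add: el_def field_simps)
  hence "2 * Re (a * b) = of_int k" unfolding k by simp
  thus ?thesis using K N unfolding OK_def by (metis (mono_tags, lifting) Ints_of_int mem_Collect_eq)
qed

lemma OK_cnj [intro]: "a \<in> OK \<Longrightarrow> cnj a \<in> OK" by (auto simp: OK_def)
lemma OK_uminus [intro]: "a \<in> OK \<Longrightarrow> - a \<in> OK" by (auto simp: OK_def)
lemma OK_of_int [simp]: "of_int k \<in> OK"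
proof -
  have "2 * Re (of_int k) = of_int (2 * k)" "(cmod (of_int k))\<^sup>2 = of_int (k\<^sup>2)"
    by (simp_all add: cmod_power2)
  thus ?thesis unfolding OK_def by (metis (mono_tags, lifting) Ints_of_int K_of_int mem_Collect_eq)
qed
lemma OK_of_nat [simp]: "of_nat k \<in> OK" using OK_of_int[of "int k"] by simp
lemma OK_0 [simp]: "0 \<in> OK" using OK_of_int[of 0] by simp
lemma OK_1 [simp]: "1 \<in> OK" using OK_of_int[of 1] by simp
lemma OK_w [simp]: "w \<in> OK" by (simp add: OK_def w_norm) (simp add: w_def)
lemma OK_K: "a \<in> OK \<Longrightarrow> a \<in> K" by (simp add: OK_def)

lemma OK_sum [intro]: "(\<And>x. x \<in> S \<Longrightarrow> f x \<in> OK) \<Longrightarrow> sum f S \<in> OK"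
  by (induction S rule: infinite_finite_induct) auto


lemma OK_norm: assumes "a \<in> OK" obtains k :: nat where "(cmod a)\<^sup>2 = real k" "a * cnj a = of_nat k"
proof -
  obtain j where j: "(cmod a)\<^sup>2 = of_int j" using assms by (auto simp: OK_def elim: Ints_cases)
  have "j \<ge> 0" using j by (metis of_int_0_le_iff zero_le_power2)
  hence *: "(cmod a)\<^sup>2 = real (nat j)" using j by simp
  moreover have "a * cnj a = of_nat (nat j)"
    using * by (metis complex_norm_square of_real_of_nat_eq)
  ultimately show ?thesis using that by blast
qed

lemma K_scale: assumes "z \<in> K" obtains d :: nat where "d > 0" "of_nat d * z \<in> OK"
proof -
  obtain x y where z: "z = of_rat x + of_rat y * w" using assms unfolding K_iff by blast
  obtain a b where ab: "quotient_of x = (a, b)" by force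
  obtain a' b' where ab': "quotient_of y = (a', b')" by force
  have b: "b > 0" "x = of_int a / of_int b" using ab quotient_of_denom_pos quotient_of_div by blast+
  have b': "b' > 0" "y = of_int a' / of_int b'" using ab' quotient_of_denom_pos quotient_of_div by blast+
  define d where "d = nat (b * b')"
  have d: "d > 0" "of_nat d = (of_int (b * b') :: complex)" using b b' by (simp_all add: d_def)
  have "of_nat d * z = of_int (a * b') + of_int (a' * b) * w"
    unfolding d z b(2) b'(2) using b(1) b'(1) by (simp add: of_rat_divide field_simps)
  moreover have "of_int (a * b') + of_int (a' * b) * w \<in> OK" by (intro OK_add OK_mult OK_of_int OK_w)
  ultimately have "of_nat d * z \<in> OK" by metis
  thus ?thesis using d that by blast
qed

text \<open>A monic equation of degree \<open>d\<close> expresses each power of \<open>x\<close>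
  through the first \<open>d\<close> powers with integral coefficients, so a common denominator of
  these serves for all powers.\<close>

lemma algebraic_int_bounded_denominator:
  assumes "x \<in> K" "algebraic_int x"
  obtains D :: nat where "D > 0" "\<And>k. of_nat D * x ^ k \<in> OK"
proof -
  obtain q :: "complex poly" where q: "lead_coeff q = 1" "\<And>i. Polynomial.coeff q i \<in> \<int>" "poly q x = 0"
    using assms(2) by (auto elim: algebraic_int.cases)
  define d where "d = Polynomial.degree q"
  have "\<exists>D :: nat. D > 0 \<and> (\<forall>i<n. of_nat D * x ^ i \<in> OK)" for n
  proof (induction n)
    case (Suc n)
    then obtain D where D: "D > 0" "\<forall>i<n. of_nat D * x ^ i \<in> OK" by blast
    have "x ^ n \<in> K" using assms(1) by (induction n) auto
    then obtain e where e: "e > 0" "of_nat e * x ^ n \<in> OK" using K_scale by blast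
    have "of_nat (D * e) * x ^ i \<in> OK" if "i < Suc n" for i
    proof (cases "i = n")
      case True
      have "of_nat D * (of_nat e * x ^ n) \<in> OK" by (rule OK_mult[OF OK_of_nat e(2)])
      thus ?thesis using True by (simp add: mult_ac)
    next
      case False
      hence "i < n" using that by simp
      hence "of_nat D * x ^ i \<in> OK" using D(2) by blast
      hence "of_nat e * (of_nat D * x ^ i) \<in> OK" by (rule OK_mult[OF OK_of_nat])
      thus ?thesis by (simp add: mult_ac)
    qed
    thus ?case using D e by (intro exI[of _ "D * e"]) auto
  qed (auto intro: exI[of _ 1])
  then obtain D where D: "D > 0" "\<And>i. i < d \<Longrightarrow> of_nat D * x ^ i \<in> OK" by blast
  have "of_nat D * x ^ k \<in> OK" for k
  proof (induction k rule: less_induct)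
    case (less k)
    show ?case
    proof (cases "k < d")
      case False
      have "0 = (\<Sum>i\<le>d. Polynomial.coeff q i * x ^ i)" using q(3) by (simp add: poly_altdef d_def)
      also have "\<dots> = (\<Sum>i<d. Polynomial.coeff q i * x ^ i) + x ^ d"
        using q(1) by (simp add: lessThan_Suc_atMost[symmetric] d_def)
      finally have xd: "x ^ d = - (\<Sum>i<d. Polynomial.coeff q i * x ^ i)" by (simp add: eq_neg_iff_add_eq_0 add.commute)
      have "of_nat D * x ^ k = of_nat D * (x ^ (k - d) * x ^ d)"
        using False by (simp flip: power_add)
      also have "\<dots> = - (\<Sum>i<d. Polynomial.coeff q i * (of_nat D * x ^ (k - d + i)))"
        unfolding xd by (simp add: sum_distrib_left power_add mult_ac)
      also have "\<dots> \<in> OK"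
      proof (rule OK_uminus, rule OK_sum)
        fix i assume "i \<in> {..<d}"
        hence "of_nat D * x ^ (k - d + i) \<in> OK" using False by (intro less) auto
        moreover have "Polynomial.coeff q i \<in> OK" using q(2)[of i] by (auto elim: Ints_cases)
        ultimately show "Polynomial.coeff q i * (of_nat D * x ^ (k - d + i)) \<in> OK" by (rule OK_mult[rotated])
      qed
      finally show ?thesis .
    qed (use D in auto)
  qed
  thus ?thesis using that D by blast
qed

lemma norm_Ints_of_bounded_denominator:
  assumes "x \<in> K" "D > 0" "\<And>k. of_nat D * x ^ k \<in> OK"
  shows "(cmod x)\<^sup>2 \<in> \<int>"
proof -
  obtain r where r: "(cmod x)\<^sup>2 = of_rat r" using K_norm_rat[OF assms(1)] .
  have "of_int (int (D\<^sup>2)) * r ^ k \<in> \<int>" for k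
  proof -
    obtain j where "(cmod (of_nat D * x ^ k))\<^sup>2 = real j" using assms(3)[of k] OK_norm by metis
    moreover have "(cmod (of_nat D * x ^ k))\<^sup>2 = of_rat (of_int (int (D\<^sup>2)) * r ^ k)"
      by (simp add: norm_mult norm_power power_mult_distrib of_rat_mult of_rat_power flip: r)
         (simp add: power_mult[symmetric] mult.commute)
    ultimately have "(of_rat (of_int (int (D\<^sup>2)) * r ^ k) :: real) = of_rat (of_nat j)" by simp
    hence "of_int (int (D\<^sup>2)) * r ^ k = of_nat j" using of_rat_eq_iff by blast
    thus ?thesis by simp
  qed
  hence "r \<in> \<int>" using bounded_denominator_powers_Ints[of "int (D\<^sup>2)" r] assms(2) by simp
  thus ?thesis unfolding r by (auto elim: Ints_cases)
qed

text \<open>Links the ring of the definitions with the description by trace and norm. Bounded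
  denominators give integral norms only; the trace is extracted from the norms of \<open>x\<close>
  and \<open>x + 1\<close>, whose difference is \<open>2 Re x + 1\<close>. Conversely
  \<open>x\<close> is a root of the monic quadratic polynomial built from its trace and
  norm.\<close>

lemma carrier_eq_OK: "{x \<in> K. algebraic_int x} = OK"
proof (intro Set.set_eqI iffI)
  fix x assume "x \<in> {x \<in> K. algebraic_int x}"
  hence x: "x \<in> K" "algebraic_int x" by auto
  obtain D where D: "D > 0" "\<And>k. of_nat D * x ^ k \<in> OK" using algebraic_int_bounded_denominator[OF x] by metis
  have "of_nat D * (x + 1) ^ k \<in> OK" for k
  proof -
    have "of_nat D * (x + 1) ^ k = (\<Sum>i\<le>k. of_nat (k choose i) * (of_nat D * x ^ i))"
      by (simp add: binomial_ring sum_distrib_left mult_ac)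
    moreover have "(\<Sum>i\<le>k. of_nat (k choose i) * (of_nat D * x ^ i)) \<in> OK"
      by (rule OK_sum, rule OK_mult[OF OK_of_nat D(2)])
    ultimately show ?thesis by metis
  qed
  hence "(cmod (x + 1))\<^sup>2 \<in> \<int>" "(cmod x)\<^sup>2 \<in> \<int>"
    using norm_Ints_of_bounded_denominator D x(1) K_add[OF x(1) K_1] by blast+
  moreover from this have "(cmod (x + 1))\<^sup>2 - (cmod x)\<^sup>2 - 1 \<in> \<int>" by auto
  moreover have "(cmod (x + 1))\<^sup>2 - (cmod x)\<^sup>2 - 1 = 2 * Re x"
    unfolding cmod_power2 by (simp add: power2_eq_square algebra_simps)
  ultimately show "x \<in> OK" using x(1) by (simp add: OK_def)
next
  fix x assume x: "x \<in> OK"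
  obtain t where t: "2 * Re x = of_int t" using x by (auto simp: OK_def elim: Ints_cases)
  obtain k where k: "x * cnj x = of_nat k" using OK_norm[OF x] by metis
  have tr: "x + cnj x = of_int t" using t by (simp add: complex_eq_iff)
  have "poly [:of_nat k, - of_int t, 1:] x = 0"
    unfolding k[symmetric] tr[symmetric] by (simp add: algebra_simps)
  moreover have "Polynomial.coeff [:of_nat k, - of_int t, 1 :: complex:] i \<in> \<int>" for i
    by (cases i; cases "i - 1"; cases "i - 2") (auto simp: coeff_pCons split: nat.splits)
  ultimately have "algebraic_int x" by (intro algebraic_int.intros[of "[:of_nat k, - of_int t, 1 :: complex:]"]) auto
  thus "x \<in> {x \<in> K. algebraic_int x}" using x by (auto simp: OK_K)
qed

end

section \<open>The 2-part of the order of an abelian group\<close>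

context comm_group begin

text \<open>Squaring is an endomorphism of \<open>H\<close>, and its nonempty fibres are translates
  of its kernel.\<close>

lemma card_eq_card_torsion_mult_card_squares:
  assumes fin: "finite (carrier G)" and H: "subgroup H G"
  shows "card H = card {x \<in> H. x \<otimes> x = \<one>} * card ((\<lambda>x. x \<otimes> x) ` H)"
proof -
  define f where "f = (\<lambda>x. x \<otimes> x)"
  define T where "T = {x \<in> H. x \<otimes> x = \<one>}"
  have HG: "\<And>x. x \<in> H \<Longrightarrow> x \<in> carrier G" using H subgroup.mem_carrier by fast
  have finH: "finite H" using fin H by (meson finite_subset subgroup.subset)
  have fib: "card {x \<in> H. f x = y} = card T" if y: "y \<in> f ` H" for y
  proof -
    obtain a where a: "a \<in> H" "y = f a" using y by blast
    have aG: "a \<in> carrier G" using a HG by blast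
    have ia: "inv a \<in> H" using H a by (simp add: subgroup.m_inv_closed)
    have "bij_betw (\<lambda>x. a \<otimes> x) T {x \<in> H. f x = y}"
    proof (rule bij_betwI[where g = "\<lambda>x. inv a \<otimes> x"])
      show "(\<lambda>x. a \<otimes> x) \<in> T \<rightarrow> {x \<in> H. f x = y}"
      proof
        fix x assume x: "x \<in> T"
        hence xH: "x \<in> H" "x \<in> carrier G" "x \<otimes> x = \<one>" using HG by (auto simp: T_def)
        have "f (a \<otimes> x) = (a \<otimes> a) \<otimes> (x \<otimes> x)" using xH aG unfolding f_def by (simp add: m_ac)
        also have "\<dots> = y" using xH aG a by (simp add: f_def)
        finally show "a \<otimes> x \<in> {x \<in> H. f x = y}" using subgroup.m_closed[OF H a(1) xH(1)] by auto
      qed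
      show "(\<lambda>x. inv a \<otimes> x) \<in> {x \<in> H. f x = y} \<rightarrow> T"
      proof
        fix x assume x: "x \<in> {x \<in> H. f x = y}"
        hence xH: "x \<in> H" "x \<in> carrier G" "x \<otimes> x = a \<otimes> a" using HG a by (auto simp: f_def)
        have iG: "inv a \<in> carrier G" using aG by simp
        have "(inv a \<otimes> x) \<otimes> (inv a \<otimes> x) = (x \<otimes> x) \<otimes> (inv a \<otimes> inv a)"
          using xH(2) iG by (simp add: m_ac)
        also have "\<dots> = (a \<otimes> a) \<otimes> (inv a \<otimes> inv a)" by (simp only: xH(3))
        also have "\<dots> = (a \<otimes> inv a) \<otimes> (a \<otimes> inv a)" using aG iG by (simp only: m_ac m_closed)
        also have "\<dots> = \<one>" using aG by simp
        finally have "(inv a \<otimes> x) \<otimes> (inv a \<otimes> x) = \<one>" .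
        moreover have "inv a \<otimes> x \<in> H" by (rule subgroup.m_closed[OF H ia xH(1)])
        ultimately show "inv a \<otimes> x \<in> T" unfolding T_def by blast
      qed
    qed (use aG HG in \<open>auto simp: T_def m_assoc[symmetric]\<close>)
    thus ?thesis using bij_betw_same_card by metis
  qed
  have "H = (\<Union>y\<in>f ` H. {x \<in> H. f x = y})" by blast
  hence "card H = card (\<Union>y\<in>f ` H. {x \<in> H. f x = y})" by simp
  also have "\<dots> = (\<Sum>y\<in>f ` H. card {x \<in> H. f x = y})"
    using finH by (intro card_UN_disjoint) auto
  also have "\<dots> = (\<Sum>y\<in>f ` H. card T)" using fib by simp
  also have "\<dots> = card T * card (f ` H)" by simp
  finally show ?thesis unfolding T_def f_def .
qed

lemma subgroup_squares:
  assumes H: "subgroup H G"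
  shows "subgroup ((\<lambda>x. x \<otimes> x) ` H) G"
proof (rule subgroupI)
  have HG: "\<And>x. x \<in> H \<Longrightarrow> x \<in> carrier G" using H subgroup.mem_carrier by fast
  show "(\<lambda>x. x \<otimes> x) ` H \<subseteq> carrier G" using HG by auto
  show "(\<lambda>x. x \<otimes> x) ` H \<noteq> {}" using H subgroup.one_closed by blast
  show "inv a \<in> (\<lambda>x. x \<otimes> x) ` H" if "a \<in> (\<lambda>x. x \<otimes> x) ` H" for a
  proof -
    obtain x where x: "x \<in> H" "a = x \<otimes> x" using \<open>a \<in> _\<close> by blast
    have "inv a = inv x \<otimes> inv x" using x HG by (simp add: inv_mult)
    thus ?thesis using x H by (simp add: subgroup.m_inv_closed image_eqI)
  qed
  show "a \<otimes> b \<in> (\<lambda>x. x \<otimes> x) ` H" if ab: "a \<in> (\<lambda>x. x \<otimes> x) ` H" "b \<in> (\<lambda>x. x \<otimes> x) ` H" for a b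
  proof -
    obtain x y where x: "x \<in> H" "a = x \<otimes> x" "y \<in> H" "b = y \<otimes> y" using ab by blast
    have "a \<otimes> b = (x \<otimes> y) \<otimes> (x \<otimes> y)" using x HG by (simp add: m_ac)
    thus ?thesis using x H by (simp add: subgroup.m_closed image_eqI)
  qed
qed

text \<open>Cauchy's theorem for the prime 2: an even order yields a subgroup with two elements.
  Conversely Lagrange's theorem applies to \<open>{1, x}\<close>.\<close>

lemma even_card_iff_involution:
  assumes fin: "finite (carrier G)" and H: "subgroup H G"
  shows "even (card H) \<longleftrightarrow> (\<exists>x\<in>H. x \<noteq> \<one> \<and> x \<otimes> x = \<one>)"
proof
  have HG: "\<And>x. x \<in> H \<Longrightarrow> x \<in> carrier G" using H subgroup.mem_carrier by fast
  have finH: "finite H" using fin H by (meson finite_subset subgroup.subset)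
  have GH: "group (G\<lparr>carrier := H\<rparr>)" using H subgroup.subgroup_is_group is_group by blast
  interpret GH: group "G\<lparr>carrier := H\<rparr>" by (rule GH)
  show "\<exists>x\<in>H. x \<noteq> \<one> \<and> x \<otimes> x = \<one>" if ev: "even (card H)"
  proof -
    obtain k where "card H = 2 * k" using ev by blast
    hence "Coset.order (G\<lparr>carrier := H\<rparr>) = 2 ^ 1 * k" by (simp add: Coset.order_def)
    then obtain S where S: "subgroup S (G\<lparr>carrier := H\<rparr>)" "card S = 2 ^ 1"
      using sylow_thm[of 2 "G\<lparr>carrier := H\<rparr>" 1 k] GH finH by auto
    have SH: "S \<subseteq> H" using subgroup.subset[OF S(1)] by simp
    have oneS: "\<one> \<in> S" using subgroup.one_closed[OF S(1)] by simp
    have "card (S - {\<one>}) = 1" using S(2) oneS by simp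
    then obtain x where x: "S - {\<one>} = {x}" using card_1_singletonE by blast
    hence xS: "x \<in> S" "x \<noteq> \<one>" "S = {\<one>, x}" using oneS by blast+
    have xx: "x \<otimes> x \<in> S" using subgroup.m_closed[OF S(1) xS(1) xS(1)] by simp
    have xG: "x \<in> carrier G" using xS SH HG by blast
    have "x \<otimes> x \<noteq> x" using xG xS(2) l_cancel_one by blast
    hence "x \<otimes> x = \<one>" using xx xS by blast
    thus ?thesis using xS SH by blast
  qed
  show "even (card H)" if ex: "\<exists>x\<in>H. x \<noteq> \<one> \<and> x \<otimes> x = \<one>"
  proof -
    obtain x where x: "x \<in> H" "x \<noteq> \<one>" "x \<otimes> x = \<one>" using ex by blast
    have "subgroup {\<one>, x} (G\<lparr>carrier := H\<rparr>)"
    proof (rule GH.subgroupI)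
      show "inv\<^bsub>G\<lparr>carrier := H\<rparr>\<^esub> a \<in> {\<one>, x}" if "a \<in> {\<one>, x}" for a
      proof -
        have "inv x = x" using x HG by (simp add: inv_equality)
        thus ?thesis using that x H m_inv_consistent[OF H] subgroup.one_closed[OF H] by auto
      qed
    qed (use x H HG subgroup.one_closed[OF H] in auto)
    from GH.lagrange[OF this] have "card (rcosets\<^bsub>G\<lparr>carrier := H\<rparr>\<^esub> {\<one>, x}) * card {\<one>, x} = card H"
      by (simp add: Coset.order_def)
    hence "card {\<one>, x} dvd card H" using dvd_triv_right by metis
    moreover have "card {\<one>, x} = 2" using x(2) by simp
    ultimately show "even (card H)" by simp
  qed
qed

text \<open>With \<open>S\<close> the squares and \<open>Q\<close> the fourth powers,
  \<open>|G| = |G[2]| |S|\<close> and \<open>|S| = |S[2]| |Q|\<close>. As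
  \<open>S[2] = {1, c}\<close>, the order is \<open>2^(t+1) |Q|\<close>, and \<open>Q\<close> has
  even order iff it contains an involution, which can only be \<open>c\<close>.\<close>

lemma order_two_part:
  assumes fin: "finite (carrier G)"
    and T: "card {x \<in> carrier G. x \<otimes> x = \<one>} = 2 ^ t"
    and c: "c \<noteq> \<one>" and cT: "{x \<in> carrier G. x \<otimes> x = \<one>} \<inter> (\<lambda>x. x \<otimes> x) ` carrier G = {\<one>, c}"
  shows "2 ^ (t + 1) dvd card (carrier G)"
    and "2 ^ (t + 2) dvd card (carrier G) \<longleftrightarrow> (\<exists>b\<in>carrier G. c = (b \<otimes> b) \<otimes> (b \<otimes> b))"
proof -
  let ?sq = "\<lambda>x. x \<otimes> x"
  let ?S = "?sq ` carrier G"
  let ?Q = "?sq ` ?S"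
  have S: "subgroup ?S G" by (rule subgroup_squares[OF subgroup_self])
  have Q: "subgroup ?Q G" by (rule subgroup_squares[OF S])
  have "{x \<in> ?S. x \<otimes> x = \<one>} = {\<one>, c}" using cT by auto
  hence "card ?S = 2 * card ?Q"
    using card_eq_card_torsion_mult_card_squares[OF fin S] c by simp
  hence card: "card (carrier G) = 2 ^ (t + 1) * card ?Q"
    using card_eq_card_torsion_mult_card_squares[OF fin subgroup_self] T by simp
  thus "2 ^ (t + 1) dvd card (carrier G)" by simp
  have "2 ^ (t + 2) dvd card (carrier G) \<longleftrightarrow> (2::nat) ^ (t + 1) * 2 dvd 2 ^ (t + 1) * card ?Q"
    unfolding card by simp
  also have "\<dots> \<longleftrightarrow> even (card ?Q)"
    by (rule nat_mult_dvd_cancel1) simp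
  also have "\<dots> \<longleftrightarrow> (\<exists>x\<in>?Q. x \<noteq> \<one> \<and> x \<otimes> x = \<one>)" by (rule even_card_iff_involution[OF fin Q])
  also have "\<dots> \<longleftrightarrow> c \<in> ?Q"
  proof
    assume "\<exists>x\<in>?Q. x \<noteq> \<one> \<and> x \<otimes> x = \<one>"
    then obtain x where x: "x \<in> ?Q" "x \<noteq> \<one>" "x \<otimes> x = \<one>" by blast
    have "x \<in> ?S" "x \<in> carrier G" using x(1) by auto
    hence "x \<in> {\<one>, c}" using x cT by blast
    thus "c \<in> ?Q" using x by blast
  next
    assume "c \<in> ?Q"
    moreover have "c \<otimes> c = \<one>" using cT by blast
    ultimately show "\<exists>x\<in>?Q. x \<noteq> \<one> \<and> x \<otimes> x = \<one>" using c by blast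
  qed
  also have "\<dots> \<longleftrightarrow> (\<exists>b\<in>carrier G. c = (b \<otimes> b) \<otimes> (b \<otimes> b))" by auto
  finally show "2 ^ (t + 2) dvd card (carrier G) \<longleftrightarrow> (\<exists>b\<in>carrier G. c = (b \<otimes> b) \<otimes> (b \<otimes> b))" .
qed

end

section \<open>Norms from imaginary quadratic fields and Legendre's theorem\<close>

text \<open>The number \<open>a\<close> is a norm from \<open>\<rat>(\<surd>-m)\<close>.\<close>

definition knorm :: "nat \<Rightarrow> nat \<Rightarrow> bool" where
  "knorm m a \<longleftrightarrow> (\<exists>u v y :: int. u \<noteq> 0 \<and> int a * u\<^sup>2 = v\<^sup>2 + int m * y\<^sup>2)"

lemma knorm_mult: assumes "knorm m a" "knorm m b" shows "knorm m (a * b)"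
proof -
  obtain u v y where 1: "u \<noteq> 0" "int a * u\<^sup>2 = v\<^sup>2 + int m * y\<^sup>2" using assms(1) unfolding knorm_def by blast
  obtain u' v' y' where 2: "u' \<noteq> 0" "int b * u'\<^sup>2 = v'\<^sup>2 + int m * y'\<^sup>2" using assms(2) unfolding knorm_def by blast
  have "int (a * b) * (u * u')\<^sup>2 = (int a * u\<^sup>2) * (int b * u'\<^sup>2)" by (simp add: power_mult_distrib mult_ac)
  also have "\<dots> = (v * v' - int m * y * y')\<^sup>2 + int m * (v * y' + v' * y)\<^sup>2"
    unfolding 1(2) 2(2) by (simp add: power2_eq_square algebra_simps)
  finally have "int (a * b) * (u * u')\<^sup>2 = (v * v' - int m * y * y')\<^sup>2 + int m * (v * y' + v' * y)\<^sup>2" .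
  moreover have "u * u' \<noteq> 0" using 1(1) 2(1) by simp
  ultimately show ?thesis unfolding knorm_def by blast
qed

lemma knorm_mult_square_iff: assumes "k > 0" shows "knorm m (a * k\<^sup>2) \<longleftrightarrow> knorm m a"
proof
  assume "knorm m (a * k\<^sup>2)"
  then obtain u v y where 1: "u \<noteq> 0" "int (a * k\<^sup>2) * u\<^sup>2 = v\<^sup>2 + int m * y\<^sup>2" unfolding knorm_def by blast
  hence "int a * (int k * u)\<^sup>2 = v\<^sup>2 + int m * y\<^sup>2" by (simp add: power_mult_distrib mult_ac)
  moreover have "int k * u \<noteq> 0" using 1(1) assms by simp
  ultimately show "knorm m a" unfolding knorm_def by blast
next
  assume "knorm m a"
  then obtain u v y where 1: "u \<noteq> 0" "int a * u\<^sup>2 = v\<^sup>2 + int m * y\<^sup>2" unfolding knorm_def by blast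
  have "int (a * k\<^sup>2) * u\<^sup>2 = (int k)\<^sup>2 * (int a * u\<^sup>2)" by (simp add: mult_ac)
  also have "\<dots> = (int k * v)\<^sup>2 + int m * (int k * y)\<^sup>2"
    unfolding 1(2) by (simp add: power2_eq_square algebra_simps)
  finally show "knorm m (a * k\<^sup>2)" unfolding knorm_def using 1(1) by blast
qed

lemma knorm_self: "knorm m m" unfolding knorm_def by (rule exI[of _ 1], rule exI[of _ 0], rule exI[of _ 1]) simp

lemma knorm_cancel_right: assumes "b > 0" "knorm m (a * b)" "knorm m b" shows "knorm m a"
proof -
  have "knorm m (a * b\<^sup>2)" using knorm_mult[OF assms(2,3)] by (simp add: power2_eq_square mult_ac)
  thus ?thesis using knorm_mult_square_iff assms(1) by blast
qed

text \<open>\<open>m\<close> is the norm of \<open>sqrt(-m)\<close>, so up to squares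
  \<open>e\<close> and \<open>m div e\<close> differ by a norm.\<close>

lemma knorm_complement: assumes "m > 0" "e dvd m" "knorm m (z * e)" shows "knorm m (z * (m div e))"
proof -
  have e: "e > 0" "m = (m div e) * e" using assms by (auto intro: Nat.gr0I)
  have "knorm m ((z * e) * m)" using assms(3) knorm_self knorm_mult by blast
  also have "(z * e) * m = (z * (m div e)) * e\<^sup>2" by (subst e(2)) (simp add: power2_eq_square)
  finally show ?thesis using knorm_mult_square_iff e by blast
qed

text \<open>Reducing \<open>a u^2 = v^2 + m y^2\<close> modulo \<open>p\<close> shows that
  \<open>a\<close> is a square if \<open>p\<close> does not divide \<open>u\<close>. Otherwise
  \<open>p\<close> divides \<open>v\<close>, and then \<open>y\<close> because \<open>p\<close>
  divides \<open>m\<close> only once; dividing all three by \<open>p\<close> is a descent on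
  \<open>|u|\<close>.\<close>

lemma knorm_QuadRes:
  assumes p: "prime p" "p dvd m" "\<not> p\<^sup>2 dvd m" "\<not> p dvd a" and kn: "knorm m a"
  shows "QuadRes (int p) (int a)"
proof -
  obtain u v y where "u \<noteq> 0" "int a * u\<^sup>2 = v\<^sup>2 + int m * y\<^sup>2" using kn unfolding knorm_def by blast
  thus ?thesis
  proof (induction "nat \<bar>u\<bar>" arbitrary: u v y rule: less_induct)
    case less
    have pp: "prime (int p)" using p by simp
    obtain m' where m': "int m = int p * m'" using p(2) by (metis dvd_def of_nat_mult)
    have pm': "\<not> int p dvd m'"
    proof
      assume "int p dvd m'"
      then obtain j where "m' = int p * j" by blast
      hence "int m = int (p\<^sup>2) * j" using m' by (simp add: power2_eq_square)
      hence "int (p\<^sup>2) dvd int m" by (metis dvd_triv_left)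
      thus False using p(3) by (metis of_nat_dvd_iff)
    qed
    show ?case
    proof (cases "int p dvd u")
      case True
      then obtain u' where u': "u = int p * u'" by blast
      have "v\<^sup>2 = int p * (int a * int p * u'\<^sup>2 - m' * y\<^sup>2)"
        using less(3) unfolding u' m' by (simp add: power2_eq_square algebra_simps)
      hence "int p dvd v\<^sup>2" by simp
      hence "int p dvd v" using pp prime_dvd_power by blast
      then obtain v' where v': "v = int p * v'" by blast
      have "int p * (m' * y\<^sup>2) = int p * (int p * (int a * u'\<^sup>2 - v'\<^sup>2))"
        using less(3) unfolding u' m' v' by (simp add: power2_eq_square algebra_simps)
      hence "m' * y\<^sup>2 = int p * (int a * u'\<^sup>2 - v'\<^sup>2)" using p(1) by (simp add: prime_gt_0_nat)
      hence "int p dvd m' * y\<^sup>2" by simp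
      hence "int p dvd y" using pp pm' by (metis prime_dvd_mult_iff prime_dvd_power)
      then obtain y' where y': "y = int p * y'" by blast
      have "(int p)\<^sup>2 * (int a * u'\<^sup>2) = (int p)\<^sup>2 * (v'\<^sup>2 + int m * y'\<^sup>2)"
        using less(3) unfolding u' v' y' by (simp add: power2_eq_square algebra_simps)
      hence e: "int a * u'\<^sup>2 = v'\<^sup>2 + int m * y'\<^sup>2" using p(1) by (simp add: prime_gt_0_nat)
      have "u' \<noteq> 0" using u' less(2) by simp
      moreover have "nat \<bar>u'\<bar> < nat \<bar>u\<bar>" using \<open>u' \<noteq> 0\<close> p(1) prime_gt_1_nat[of p] unfolding u'
        by (simp add: abs_mult)
      ultimately show ?thesis using less(1)[of u' v' y'] e by blast
    next
      case False
      hence "coprime u (int p)" using pp by (metis coprime_commute prime_imp_coprime)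
      then obtain i where i: "[u * i = 1] (mod int p)" using cong_solve_coprime_int by blast
      have "[v\<^sup>2 = int a * u\<^sup>2] (mod int p)" unfolding less(3) m' by (simp add: cong_iff_dvd_diff)
      hence "[v\<^sup>2 * i\<^sup>2 = int a * u\<^sup>2 * i\<^sup>2] (mod int p)" by (rule cong_scalar_right)
      hence "[(v * i)\<^sup>2 = int a * (u * i)\<^sup>2] (mod int p)" by (simp add: power_mult_distrib mult_ac)
      moreover have "[int a * (u * i)\<^sup>2 = int a * 1\<^sup>2] (mod int p)" using i by (intro cong_mult cong_pow cong_refl)
      ultimately show ?thesis unfolding QuadRes_def by (metis cong_trans mult.right_neutral power_one)
    qed
  qed
qed

text \<open>Legendre's theorem on \<open>a x^2 + b y^2 = c z^2\<close>, by the pigeonhole principle.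
  The congruences make \<open>F\<close> divisible by \<open>a b c\<close> at a small nonzero point,
  and the size bounds leave \<open>F = j a b c\<close> with \<open>j\<close> one of -1, 0, 1, 2. A
  solution enters the conclusion through \<open>a c z^2 = (a x)^2 + a b y^2\<close>.\<close>

lemma legendre_conic:
  fixes a b c :: nat and r1 r2 r3 :: int
  assumes pos: "a > 0" "b > 0" "c > 0"
    and cop: "coprime a b" "coprime a c" "coprime b c"
    and nsq: "\<And>k. a * b \<noteq> k\<^sup>2"
    and r1: "[r1\<^sup>2 = int b * int c] (mod int a)"
    and r2: "[r2\<^sup>2 = int a * int c] (mod int b)"
    and r3: "[r3\<^sup>2 = - (int a * int b)] (mod int c)"
  shows "knorm (a * b) (a * c)"
proof -
  \<comment> \<open>The box has sides about \<open>sqrt(b c)\<close>, \<open>sqrt(a c)\<close> and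
    \<open>sqrt(a b)\<close>: it contains more integral points than there are residue triples,
    namely \<open>a b c\<close>, while each term of \<open>F\<close> stays at most
    \<open>a b c\<close>.\<close>
  define X Y Z where "X = floor_sqrt (b * c)" and "Y = floor_sqrt (a * c)" and "Z = floor_sqrt (a * b)"
  define D where "D = {0..int X} \<times> {0..int Y} \<times> {0..int Z}"
  define f where "f = (\<lambda>(x, y, z). ((int b * y - r1 * z) mod int a, (int a * x - r2 * z) mod int b,
      (int a * x - r3 * y) mod int c))"
  define R where "R = {0..<int a} \<times> {0..<int b} \<times> {0..<int c}"
  have fR: "f ` D \<subseteq> R" using pos by (auto simp: f_def R_def)
  have lt: "k < (floor_sqrt k + 1)\<^sup>2" for k using Suc_floor_sqrt_power2_gt[of k] by simp
  have "(a * b * c)\<^sup>2 = (b * c) * (a * c) * (a * b)" by (simp add: power2_eq_square mult_ac)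
  also have "\<dots> < (X + 1)\<^sup>2 * (Y + 1)\<^sup>2 * (Z + 1)\<^sup>2"
    unfolding X_def Y_def Z_def using lt by (intro mult_strict_mono) (auto intro: mult_strict_mono)
  also have "\<dots> = ((X + 1) * (Y + 1) * (Z + 1))\<^sup>2" by (simp only: power_mult_distrib)
  finally have "a * b * c < (X + 1) * (Y + 1) * (Z + 1)" using power_less_imp_less_base by blast
  moreover have "card R = a * b * c" by (simp add: R_def card_cartesian_product)
  moreover have "card D = (X + 1) * (Y + 1) * (Z + 1)" by (simp add: D_def card_cartesian_product nat_add_distrib algebra_simps)
  moreover have "card (f ` D) \<le> card R" using fR by (intro card_mono) (auto simp: R_def)
  ultimately have "card (f ` D) < card D" by simp
  hence "\<not> inj_on f D" using pigeonhole by blast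
  then obtain P Q where PQ: "P \<in> D" "Q \<in> D" "f P = f Q" "P \<noteq> Q" unfolding inj_on_def by blast
  obtain x1 y1 z1 x2 y2 z2 where P: "P = (x1, y1, z1)" and Q: "Q = (x2, y2, z2)" by (metis prod_cases3)
  define x y z where "x = x1 - x2" and "y = y1 - y2" and "z = z1 - z2"
  have nz: "\<not> (x = 0 \<and> y = 0 \<and> z = 0)" using PQ(4) by (auto simp: P Q x_def y_def z_def)
  have "\<bar>x\<bar> \<le> int X" "\<bar>y\<bar> \<le> int Y" "\<bar>z\<bar> \<le> int Z"
    using PQ(1,2) by (auto simp: P Q D_def x_def y_def z_def)
  hence "x\<^sup>2 \<le> (int X)\<^sup>2" "y\<^sup>2 \<le> (int Y)\<^sup>2" "z\<^sup>2 \<le> (int Z)\<^sup>2"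
    by (auto simp: abs_le_square_iff[symmetric])
  moreover have "(int X)\<^sup>2 \<le> int (b * c)" "(int Y)\<^sup>2 \<le> int (a * c)" "(int Z)\<^sup>2 \<le> int (a * b)"
    unfolding X_def Y_def Z_def of_nat_power[symmetric] of_nat_le_iff by auto
  ultimately have bd: "x\<^sup>2 \<le> int b * int c" "y\<^sup>2 \<le> int a * int c" "z\<^sup>2 \<le> int a * int b" by auto
  have c1: "[int b * y = r1 * z] (mod int a)"
  proof -
    have "[int b * y1 - r1 * z1 = int b * y2 - r1 * z2] (mod int a)"
      using PQ(3) by (simp add: f_def P Q cong_iff_dvd_diff mod_eq_dvd_iff)
    thus ?thesis by (simp add: cong_iff_dvd_diff y_def z_def algebra_simps)
  qed
  have c2: "[int a * x = r2 * z] (mod int b)"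
  proof -
    have "[int a * x1 - r2 * z1 = int a * x2 - r2 * z2] (mod int b)"
      using PQ(3) by (simp add: f_def P Q cong_iff_dvd_diff mod_eq_dvd_iff)
    thus ?thesis by (simp add: cong_iff_dvd_diff x_def z_def algebra_simps)
  qed
  have c3: "[int a * x = r3 * y] (mod int c)"
  proof -
    have "[int a * x1 - r3 * y1 = int a * x2 - r3 * y2] (mod int c)"
      using PQ(3) by (simp add: f_def P Q cong_iff_dvd_diff mod_eq_dvd_iff)
    thus ?thesis by (simp add: cong_iff_dvd_diff x_def y_def algebra_simps)
  qed
  define F where "F = int a * x\<^sup>2 + int b * y\<^sup>2 - int c * z\<^sup>2"
  have key: "[A\<^sup>2 = B * C\<^sup>2] (mod n)" if "[A = r * C] (mod n)" "[r\<^sup>2 = B] (mod n)" for A B C r n :: int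
  proof -
    have "[A\<^sup>2 = r\<^sup>2 * C\<^sup>2] (mod n)" using cong_pow[OF that(1), of 2] by (simp add: power_mult_distrib)
    moreover have "[r\<^sup>2 * C\<^sup>2 = B * C\<^sup>2] (mod n)" using that(2) by (rule cong_scalar_right)
    ultimately show ?thesis by (rule cong_trans)
  qed
  have "int a dvd (int b * y)\<^sup>2 - int b * int c * z\<^sup>2"
    using key[OF c1 r1] by (simp add: cong_iff_dvd_diff)
  hence "int a dvd ((int b * y)\<^sup>2 - int b * int c * z\<^sup>2) + int a * (int b * x\<^sup>2)" by simp
  also have "((int b * y)\<^sup>2 - int b * int c * z\<^sup>2) + int a * (int b * x\<^sup>2) = int b * F"
    by (simp add: F_def power2_eq_square algebra_simps)
  finally have d1: "int a dvd F" using cop(1) by (simp add: coprime_dvd_mult_right_iff)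
  have "int b dvd (int a * x)\<^sup>2 - int a * int c * z\<^sup>2"
    using key[OF c2 r2] by (simp add: cong_iff_dvd_diff)
  hence "int b dvd ((int a * x)\<^sup>2 - int a * int c * z\<^sup>2) + int b * (int a * y\<^sup>2)" by simp
  also have "((int a * x)\<^sup>2 - int a * int c * z\<^sup>2) + int b * (int a * y\<^sup>2) = int a * F"
    by (simp add: F_def power2_eq_square algebra_simps)
  finally have d2: "int b dvd F" using cop(1) by (simp add: coprime_dvd_mult_right_iff coprime_commute)
  have "int c dvd (int a * x)\<^sup>2 - (- (int a * int b)) * y\<^sup>2"
    using key[OF c3 r3] unfolding cong_iff_dvd_diff .
  hence "int c dvd ((int a * x)\<^sup>2 - (- (int a * int b)) * y\<^sup>2) - int c * (int a * z\<^sup>2)" by (rule dvd_diff) simp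
  also have "((int a * x)\<^sup>2 - (- (int a * int b)) * y\<^sup>2) - int c * (int a * z\<^sup>2) = int a * F"
    by (simp add: F_def power2_eq_square algebra_simps)
  finally have d3: "int c dvd F" using cop(2) by (simp add: coprime_dvd_mult_right_iff coprime_commute)
  have "int a * int b dvd F" using d1 d2 cop(1) by (intro divides_mult) auto
  hence "int a * int b * int c dvd F" by (rule divides_mult[OF _ d3]) (use cop in auto)
  then obtain j where j: "F = int a * int b * int c * j" by blast
  define M where "M = int a * int b * int c"
  have M0: "M > 0" using pos by (simp add: M_def)
  have e1: "int a * x\<^sup>2 \<le> M" and e2: "int b * y\<^sup>2 \<le> M" and e3: "int c * z\<^sup>2 \<le> M"
    using mult_left_mono[OF bd(1), of "int a"] mult_left_mono[OF bd(2), of "int b"] mult_left_mono[OF bd(3), of "int c"]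
    by (simp_all add: M_def mult_ac)
  have p0: "int a * x\<^sup>2 \<ge> 0" "int b * y\<^sup>2 \<ge> 0" "int c * z\<^sup>2 \<ge> 0" by auto
  have "- M \<le> M * j" "M * j \<le> 2 * M" using e1 e2 e3 p0 j unfolding F_def M_def by linarith+
  hence "M * (-1) \<le> M * j" "M * j \<le> M * 2" by auto
  hence "-1 \<le> j" "j \<le> 2" using M0 by (auto simp only: mult_le_cancel_left_pos)
  then consider "j = -1" | "j = 0" | "j = 1" | "j = 2" by linarith
  thus ?thesis
  proof cases
    \<comment> \<open>The extreme values -1 and 2 force equality in the size bounds, and this makes
      \<open>a b\<close> a square.\<close>
    case 1
    hence "int a * x\<^sup>2 + int b * y\<^sup>2 + (M - int c * z\<^sup>2) = 0" using j unfolding F_def M_def by simp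
    hence "int c * z\<^sup>2 = M" using e3 p0 by linarith
    hence "int c * z\<^sup>2 = int c * (int a * int b)" by (simp add: M_def mult_ac)
    hence "z\<^sup>2 = int a * int b" using pos by simp
    hence "int ((nat \<bar>z\<bar>)\<^sup>2) = int (a * b)" by simp
    hence "a * b = (nat \<bar>z\<bar>)\<^sup>2" using of_nat_eq_iff by metis
    thus ?thesis using nsq by blast
  next
    case 2
    hence e: "int a * x\<^sup>2 + int b * y\<^sup>2 = int c * z\<^sup>2" using j unfolding F_def by simp
    have "z \<noteq> 0"
    proof
      assume "z = 0"
      hence "int a * x\<^sup>2 + int b * y\<^sup>2 = 0" using e by simp
      hence "int a * x\<^sup>2 = 0" "int b * y\<^sup>2 = 0" using p0 by linarith+
      thus False using pos nz \<open>z = 0\<close> by simp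
    qed
    moreover have "int (a * c) * z\<^sup>2 = (int a * x)\<^sup>2 + int (a * b) * y\<^sup>2"
    proof -
      have "int (a * c) * z\<^sup>2 = int a * (int c * z\<^sup>2)" by (simp add: mult_ac)
      also have "\<dots> = (int a * x)\<^sup>2 + int (a * b) * y\<^sup>2" unfolding e[symmetric]
        by (simp add: power2_eq_square algebra_simps)
      finally show ?thesis .
    qed
    ultimately show ?thesis unfolding knorm_def by blast
  next
    case 3
    \<comment> \<open>\<open>u\<close> is the norm of \<open>z + sqrt(-a b)\<close>. Multiplying
      \<open>a x + y sqrt(-a b)\<close> by this number turns \<open>a x^2 + b y^2 = c u\<close> into
      a representation of \<open>a c u^2\<close> by the norm form.\<close>
    define u where "u = z\<^sup>2 + int a * int b"
    have u: "u \<noteq> 0" using pos by (simp add: u_def) (metis add_nonneg_pos less_irrefl mult_pos_pos of_nat_0_less_iff zero_le_power2)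
    have "int a * x\<^sup>2 + int b * y\<^sup>2 = int c * u" using j 3 unfolding F_def u_def by (simp add: algebra_simps)
    hence "int (a * c) * u\<^sup>2 = int a * (int a * x\<^sup>2 + int b * y\<^sup>2) * u" by (simp add: power2_eq_square mult_ac)
    also have "\<dots> = (int a * x * z - int (a * b) * y)\<^sup>2 + int (a * b) * (int a * x + y * z)\<^sup>2"
      unfolding u_def by (simp add: power2_eq_square algebra_simps)
    finally show ?thesis unfolding knorm_def using u by blast
  next
    case 4
    hence "(M - int a * x\<^sup>2) + (M - int b * y\<^sup>2) + int c * z\<^sup>2 = 0" using j unfolding F_def M_def by simp
    hence "int a * x\<^sup>2 = M" "int b * y\<^sup>2 = M" using e1 e2 p0 by linarith+
    hence "int a * x\<^sup>2 = int a * (int b * int c)" "int b * y\<^sup>2 = int b * (int a * int c)" by (simp_all add: M_def mult_ac)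
    hence "x\<^sup>2 = int b * int c" "y\<^sup>2 = int a * int c" using pos by simp_all
    hence "x\<^sup>2 * y\<^sup>2 = (int b * int c) * (int a * int c)" by simp
    hence "(x * y)\<^sup>2 = int (a * b * c\<^sup>2)" unfolding power_mult_distrib by (simp add: power2_eq_square)
    hence "int ((nat \<bar>x * y\<bar>)\<^sup>2) = int (a * b * c\<^sup>2)" by simp
    hence e: "(nat \<bar>x * y\<bar>)\<^sup>2 = a * b * c\<^sup>2" using of_nat_eq_iff by blast
    hence "c\<^sup>2 dvd (nat \<bar>x * y\<bar>)\<^sup>2" by simp
    hence "c dvd nat \<bar>x * y\<bar>" by simp
    then obtain k where "nat \<bar>x * y\<bar> = c * k" by blast
    hence "a * b = k\<^sup>2" using e pos by (simp add: power_mult_distrib)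
    thus ?thesis using nsq by blast
  qed
qed

section \<open>Legendre and Jacobi symbols, and their values on factors of quadratic forms\<close>

lemma Legendre_cong: "[a = b] (mod p) \<Longrightarrow> Legendre a p = Legendre b p"
proof -
  assume ab: "[a = b] (mod p)"
  have "[y = a] (mod p) \<longleftrightarrow> [y = b] (mod p)" for y using ab by (meson cong_sym cong_trans)
  moreover have "[a = 0] (mod p) \<longleftrightarrow> [b = 0] (mod p)" using ab by (meson cong_sym cong_trans)
  ultimately show ?thesis unfolding Legendre_def QuadRes_def by simp
qed

lemma Legendre_values: "Legendre a p = 0 \<or> Legendre a p = 1 \<or> Legendre a p = -1"
  by (simp add: Legendre_def)

lemma Legendre_eq_0_iff: "Legendre a p = 0 \<longleftrightarrow> p dvd a"
  by (simp add: Legendre_def cong_0_iff)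

lemma Legendre_eq_1_iff: "\<not> p dvd a \<Longrightarrow> Legendre a p = 1 \<longleftrightarrow> QuadRes p a"
  by (simp add: Legendre_def cong_0_iff)

text \<open>Two such values differ by at most 2, which is less than \<open>p\<close>. Congruences
  from Euler's criterion become equations in this way.\<close>

lemma signs_cong_imp_eq:
  fixes x y p :: int
  assumes "p > 2" "[x = y] (mod p)" "x \<in> {0, 1, -1}" "y \<in> {0, 1, -1}"
  shows "x = y"
proof (rule ccontr)
  assume "x \<noteq> y"
  have "p dvd x - y" using assms(2) by (simp add: cong_iff_dvd_diff)
  hence "\<bar>p\<bar> \<le> \<bar>x - y\<bar>" using \<open>x \<noteq> y\<close> by (intro dvd_imp_le_int) auto
  moreover have "\<bar>x - y\<bar> \<le> 2" using assms(3,4) by auto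
  ultimately show False using assms(1) by simp
qed

lemma Legendre_mult:
  assumes "prime p" "p > 2"
  shows "Legendre (a * b) (int p) = Legendre a (int p) * Legendre b (int p)"
proof (rule signs_cong_imp_eq[of "int p"])
  let ?h = "(p - 1) div 2"
  have "[Legendre (a * b) p = (a * b) ^ ?h] (mod p)" by (rule euler_criterion[OF assms])
  also have "(a * b) ^ ?h = a ^ ?h * b ^ ?h" by (rule power_mult_distrib)
  also have "[a ^ ?h * b ^ ?h = Legendre a p * Legendre b p] (mod p)"
    using euler_criterion[OF assms] by (intro cong_mult) (auto intro: cong_sym)
  finally show "[Legendre (a * b) p = Legendre a p * Legendre b p] (mod p)" .
qed (use assms Legendre_values[of _ p] in \<open>auto simp: Legendre_def\<close>)

lemma Legendre_square: "\<not> p dvd a \<Longrightarrow> prime p \<Longrightarrow> Legendre (a\<^sup>2) p = 1"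
  unfolding Legendre_def QuadRes_def by (auto simp: cong_0_iff prime_dvd_power_iff intro: cong_refl)

lemma Legendre_1: "p > 1 \<Longrightarrow> Legendre 1 p = 1"
  by (auto simp: Legendre_def QuadRes_def cong_0_iff intro: exI[of _ 1])

lemma Legendre_minus_1:
  assumes "prime p" "p > 2"
  shows "Legendre (- 1) (int p) = (if p mod 4 = 1 then 1 else - 1)"
proof -
  let ?h = "(p - 1) div 2"
  have odd: "odd p" using assms prime_odd_nat by blast
  have "Legendre (- 1) (int p) = (- 1) ^ ?h"
  proof (rule signs_cong_imp_eq[of "int p"])
    show "[Legendre (- 1) (int p) = (- 1) ^ ?h] (mod int p)" by (rule euler_criterion[OF assms])
  qed (use assms in \<open>auto simp: Legendre_def minus_one_power_iff\<close>)
  moreover have "even ?h \<longleftrightarrow> p mod 4 = 1" using odd by presburger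
  ultimately show ?thesis by (simp add: minus_one_power_iff)
qed

text \<open>Gauss's lemma: the doubles of \<open>1..h\<close> with \<open>h = (p - 1) / 2\<close>
  are already reduced modulo \<open>p\<close>, and those exceeding \<open>h\<close> come from
  \<open>h div 2 < x\<close>. Their number \<open>h - h div 2\<close> is even exactly if
  \<open>p\<close> is 1 or 7 modulo 8.\<close>

lemma Legendre_2:
  assumes "prime p" "p > 2"
  shows "Legendre 2 (int p) = (if p mod 8 = 1 \<or> p mod 8 = 7 then 1 else - 1)"
proof -
  have odd: "odd p" using assms prime_odd_nat by blast
  have nc: "[2 \<noteq> 0] (mod int p)"
  proof
    assume "[2 = 0] (mod int p)"
    hence "int p dvd 2" by (simp add: cong_0_iff)
    hence "int p \<le> 2" by (rule zdvd_imp_le) simp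
    thus False using assms by simp
  qed
  interpret GAUSS p 2 by unfold_locales (use assms nc in auto)
  define h where "h = (int p - 1) div 2"
  have h: "int p = 2 * h + 1" "h > 0" using odd assms unfolding h_def by presburger+
  have C: "C = (\<lambda>x. x * 2) ` A"
  proof -
    have "C = (\<lambda>x. (x * 2) mod int p) ` A" unfolding C_def B_def by (simp add: image_image)
    also have "\<dots> = (\<lambda>x. x * 2) ` A"
      by (intro image_cong refl mod_pos_pos_trivial) (use h in \<open>auto simp: A_def h_def[symmetric]\<close>)
    finally show ?thesis .
  qed
  have hd: "h < x * 2 \<longleftrightarrow> h div 2 < x" for x by presburger
  have "E = (\<lambda>x. x * 2) ` {x \<in> A. h < x * 2}"
    unfolding E_def C h_def[symmetric] by blast
  also have "{x \<in> A. h < x * 2} = {h div 2 <.. h}"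
    unfolding A_def h_def[symmetric] hd using h(2) by auto
  finally have "E = (\<lambda>x. x * 2) ` {h div 2 <.. h}" .
  hence "card E = card {h div 2 <.. h}" by (simp add: card_image inj_on_def)
  hence "card E = nat (h - h div 2)" by simp
  hence L: "Legendre 2 (int p) = (- 1) ^ nat (h - h div 2)" using gauss_lemma by simp
  have ge: "h - h div 2 \<ge> 0" using h(2) by presburger
  have "even (nat (h - h div 2)) \<longleftrightarrow> even (h - h div 2)" using ge by (simp add: even_nat_iff)
  also have "\<dots> \<longleftrightarrow> (2 * h + 1) mod 8 = 1 \<or> (2 * h + 1) mod 8 = 7"
  proof -
    define k r where "k = h div 4" and "r = h mod 4"
    have kr: "h = 4 * k + r" "r = 0 \<or> r = 1 \<or> r = 2 \<or> r = 3"
      unfolding k_def r_def by (simp, presburger)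
    have 1: "h div 2 = 2 * k + r div 2"
      unfolding kr(1) using div_mult_self3[of 2 "2 * k" r] by (simp add: mult.commute add.commute)
    have "2 * h + 1 = (2 * r + 1) + k * 8" unfolding kr(1) by simp
    hence 2: "(2 * h + 1) mod 8 = (2 * r + 1) mod 8" by (simp only: mod_mult_self1)
    have 3: "h - h div 2 = 2 * k + (r - r div 2)" unfolding 1 by (subst kr(1)) simp
    show ?thesis unfolding 2 3 using kr(2) by (elim disjE) simp_all
  qed
  also have "\<dots> \<longleftrightarrow> int (p mod 8) = 1 \<or> int (p mod 8) = 7" unfolding h(1)[symmetric] by (simp add: zmod_int)
  also have "\<dots> \<longleftrightarrow> p mod 8 = 1 \<or> p mod 8 = 7" by linarith
  finally show ?thesis unfolding L by (simp add: minus_one_power_iff)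
qed

text \<open>The Jacobi symbol \<open>(a/n)\<close>, to be used for odd \<open>n\<close>.\<close>

definition jac :: "int \<Rightarrow> nat \<Rightarrow> int" where
  "jac a n = (\<Prod>l\<in>#prime_factorization n. Legendre a (int l))"

lemma jac_Suc_0 [simp]: "jac a (Suc 0) = 1" by (simp add: jac_def)

lemma jac_mult_right: "n > 0 \<Longrightarrow> k > 0 \<Longrightarrow> jac a (n * k) = jac a n * jac a k"
  by (simp add: jac_def prime_factorization_mult)

lemma jac_prime: "prime l \<Longrightarrow> jac a l = Legendre a (int l)"
  by (simp add: jac_def prime_factorization_prime)

lemma odd_prime_induct [consumes 1, case_names one mult]:
  fixes n :: nat
  assumes "odd n" "P 1" "\<And>l n. prime l \<Longrightarrow> l > 2 \<Longrightarrow> odd l \<Longrightarrow> odd n \<Longrightarrow> n > 0 \<Longrightarrow> P n \<Longrightarrow> P (l * n)"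
  shows "P n"
  using assms(1)
proof (induction n rule: prime_divisors_induct)
  case (unit x)
  thus ?case using assms(2) by simp
next
  case (factor l x)
  have "odd l" "odd x" using factor by auto
  moreover from this have "l > 2" using factor(1) prime_ge_2_nat[of l] by (cases "l = 2") auto
  ultimately show ?case using assms(3)[of l x] factor by (auto intro!: Nat.gr0I)
qed simp

lemma jac_mult_left: "odd n \<Longrightarrow> jac (a * b) n = jac a n * jac b n"
  by (induction n rule: odd_prime_induct) (auto simp: jac_mult_right jac_prime Legendre_mult prime_gt_0_nat)

lemma jac_eq_1I:
  assumes "\<And>l. prime l \<Longrightarrow> l dvd n \<Longrightarrow> Legendre a (int l) = 1"
  shows "jac a n = 1"
proof -
  have "jac a n = (\<Prod>l\<in>#prime_factorization n. 1)"
    unfolding jac_def by (intro arg_cong[of _ _ prod_mset] image_mset_cong) (auto simp: assms in_prime_factors_iff)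
  thus ?thesis by simp
qed

text \<open>Modulo each prime divisor of \<open>n\<close> the number \<open>a\<close> is a quotient
  of two nonzero squares, since a unit \<open>y\<close> forces \<open>x\<close> to be a unit as
  well.\<close>

lemma jac_square_class:
  assumes "odd n" "[a * x\<^sup>2 = y\<^sup>2] (mod int n)" "coprime y (int n)"
  shows "jac a n = 1"
proof (rule jac_eq_1I)
  fix l assume l: "prime l" "l dvd n"
  have l2: "l > 2" using l assms(1) prime_ge_2_nat[of l] by (cases "l = 2") auto
  have c: "[a * x\<^sup>2 = y\<^sup>2] (mod int l)" using assms(2) l(2) by (meson cong_dvd_modulus int_dvd_int_iff)
  have ny: "\<not> int l dvd y"
  proof
    assume "int l dvd y"
    moreover have "int l dvd int n" using l by simp
    ultimately have "is_unit (int l)" using assms(3) by (meson coprime_common_divisor)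
    thus False using l2 by simp
  qed
  have 1: "Legendre (a * x\<^sup>2) (int l) = 1"
    using Legendre_cong[OF c] Legendre_square[OF ny] l by simp
  hence "\<not> int l dvd x"
    using Legendre_eq_0_iff[of "a * x\<^sup>2" "int l"] by (auto simp: power2_eq_square)
  hence "Legendre (x\<^sup>2) (int l) = 1" using Legendre_square l by simp
  thus "Legendre a (int l) = 1" using 1 Legendre_mult[OF l(1) l2, of a "x\<^sup>2"] by simp
qed

lemma jac_minus_1: "odd n \<Longrightarrow> jac (- 1) n = (if n mod 4 = 1 then 1 else - 1)"
proof (induction n rule: odd_prime_induct)
  case (mult l n)
  have e: "(l * n) mod 4 = ((l mod 4) * (n mod 4)) mod 4" by (simp add: mod_mult_eq)
  have c: "l mod 4 = 1 \<or> l mod 4 = 3" "n mod 4 = 1 \<or> n mod 4 = 3"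
    using \<open>odd l\<close> \<open>odd n\<close> by presburger+
  have "jac (- 1) (l * n) = Legendre (- 1) (int l) * jac (- 1) n"
    using mult by (simp add: jac_mult_right jac_prime)
  thus ?case unfolding mult.IH Legendre_minus_1[OF mult(1,2)] e using c by (elim disjE) simp_all
qed simp

lemma jac_2: "odd n \<Longrightarrow> jac 2 n = (if n mod 8 = 1 \<or> n mod 8 = 7 then 1 else - 1)"
proof (induction n rule: odd_prime_induct)
  case (mult l n)
  have e: "(l * n) mod 8 = ((l mod 8) * (n mod 8)) mod 8" by (simp add: mod_mult_eq)
  have c: "l mod 8 = 1 \<or> l mod 8 = 3 \<or> l mod 8 = 5 \<or> l mod 8 = 7"
    "n mod 8 = 1 \<or> n mod 8 = 3 \<or> n mod 8 = 5 \<or> n mod 8 = 7" using \<open>odd l\<close> \<open>odd n\<close> by presburger+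
  have "jac 2 (l * n) = Legendre 2 (int l) * jac 2 n"
    using mult by (simp add: jac_mult_right jac_prime)
  thus ?case unfolding mult.IH Legendre_2[OF mult(1,2)] e using c by (elim disjE) simp_all
qed simp

lemma Legendre_reciprocity_1_mod_4:
  assumes "prime p" "p mod 4 = 1" "prime l" "l > 2"
  shows "Legendre (int p) (int l) = Legendre (int l) (int p)"
proof (cases "p = l")
  case False
  have p2: "p > 2" using assms(1,2) prime_ge_2_nat[of p] by (cases "p = 2") auto
  have "Legendre (int p) (int l) * Legendre (int l) (int p) = (- 1) ^ ((p - 1) div 2 * ((l - 1) div 2))"
    using Quadratic_Reciprocity[of p l] assms p2 False by simp
  moreover have "even ((p - 1) div 2)" using assms(2) by presburger
  ultimately have "Legendre (int p) (int l) * Legendre (int l) (int p) = 1" by simp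
  thus ?thesis using Legendre_values[of "int p" "int l"] Legendre_values[of "int l" "int p"] by auto
qed simp

text \<open>As \<open>(q - 1) div 2\<close> is odd, the sign in the reciprocity law is the symbol of
  -1 at \<open>l\<close>.\<close>

lemma Legendre_reciprocity_3_mod_4:
  assumes "prime q" "q mod 4 = 3" "prime l" "l > 2"
  shows "Legendre (int q) (int l) = Legendre (- 1) (int l) * Legendre (int l) (int q)"
proof (cases "q = l")
  case True
  thus ?thesis using Legendre_eq_0_iff[of "int l" "int l"] by simp
next
  case False
  have q2: "q > 2" using assms(1,2) prime_ge_2_nat[of q] by (cases "q = 2") auto
  have e: "Legendre (int q) (int l) * Legendre (int l) (int q) = (- 1) ^ ((q - 1) div 2 * ((l - 1) div 2))"
    using Quadratic_Reciprocity[of q l] assms q2 False by simp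
  have oq: "odd ((q - 1) div 2)" using assms(2) by presburger
  have "odd l" using assms(3,4) prime_odd_nat by blast
  hence "even ((l - 1) div 2) \<longleftrightarrow> l mod 4 = 1" by presburger
  hence "Legendre (int q) (int l) * Legendre (int l) (int q) = Legendre (- 1) (int l)"
    using e oq Legendre_minus_1[OF assms(3,4)] by (auto simp: minus_one_power_iff)
  thus ?thesis using Legendre_values[of "int q" "int l"] Legendre_values[of "int l" "int q"]
      Legendre_minus_1[OF assms(3,4)] by (auto split: if_splits)
qed

lemma jac_reciprocity_1_mod_4:
  assumes "prime p" "p mod 4 = 1"
  shows "odd n \<Longrightarrow> jac (int p) n = Legendre (int n) (int p)"
proof (induction n rule: odd_prime_induct)
  case one
  thus ?case using assms prime_gt_1_nat[of p] by (simp add: Legendre_1)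
next
  case (mult l n)
  have p2: "p > 2" using assms(1,2) prime_ge_2_nat[of p] by (cases "p = 2") auto
  show ?case using mult Legendre_reciprocity_1_mod_4[OF assms mult(1,2)] Legendre_mult[OF assms(1) p2, of l n]
    by (simp add: jac_mult_right jac_prime)
qed

lemma jac_reciprocity_3_mod_4:
  assumes "prime q" "q mod 4 = 3"
  shows "odd n \<Longrightarrow> jac (int q) n = jac (- 1) n * Legendre (int n) (int q)"
proof (induction n rule: odd_prime_induct)
  case one
  thus ?case using assms prime_gt_1_nat[of q] by (simp add: Legendre_1)
next
  case (mult l n)
  have q2: "q > 2" using assms(1,2) prime_ge_2_nat[of q] by (cases "q = 2") auto
  show ?case using mult Legendre_reciprocity_3_mod_4[OF assms mult(1,2)] Legendre_mult[OF assms(1) q2, of l n]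
    by (simp add: jac_mult_right jac_prime)
qed

lemma jac_prod_left: "finite S \<Longrightarrow> odd n \<Longrightarrow> jac (\<Prod>i\<in>S. f i) n = (\<Prod>i\<in>S. jac (f i) n)"
proof (induction S rule: finite_induct)
  case empty
  have "jac 1 n = 1" using empty
    by (intro jac_eq_1I Legendre_1) (metis of_nat_1 of_nat_less_iff prime_gt_1_nat)
  thus ?case by simp
qed (simp add: jac_mult_left)

text \<open>If \<open>Y\<close> were a unit modulo \<open>l\<close>, then \<open>-d\<close> would be
  the square of \<open>X / Y\<close>.\<close>

lemma bad_prime_dvd_form:
  assumes "prime l" "l > 2" "Legendre (- d) (int l) = - 1" "int l dvd X\<^sup>2 + d * Y\<^sup>2"
  shows "int l dvd X \<and> int l dvd Y"
proof -
  have "int l dvd Y"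
  proof (rule ccontr)
    assume nY: "\<not> int l dvd Y"
    have "[(- d) * Y\<^sup>2 = X\<^sup>2] (mod int l)"
    proof -
      have "(- d) * Y\<^sup>2 - X\<^sup>2 = - (X\<^sup>2 + d * Y\<^sup>2)" by simp
      thus ?thesis using assms(4) unfolding cong_iff_dvd_diff by (metis dvd_minus_iff)
    qed
    hence "Legendre ((- d) * Y\<^sup>2) (int l) = Legendre (X\<^sup>2) (int l)" by (rule Legendre_cong)
    moreover have "Legendre ((- d) * Y\<^sup>2) (int l) = - 1"
      using Legendre_mult[OF assms(1,2), of "- d" "Y\<^sup>2"] Legendre_square[OF nY] assms by simp
    moreover have "Legendre (X\<^sup>2) (int l) = 0 \<or> Legendre (X\<^sup>2) (int l) = 1"
      using Legendre_square[of "int l" X] Legendre_eq_0_iff[of "X\<^sup>2" "int l"] assms(1)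
      by (cases "int l dvd X") (auto simp: power2_eq_square)
    ultimately show False by auto
  qed
  moreover from this have "int l dvd d * Y\<^sup>2" by (simp add: power2_eq_square)
  hence "int l dvd X\<^sup>2" using assms(4) dvd_add_left_iff by blast
  hence "int l dvd X" using assms(1) prime_dvd_power[of "int l" X 2] by simp
  ultimately show ?thesis by blast
qed

text \<open>A prime \<open>l\<close> of \<open>m\<close> at which \<open>-d\<close> is a nonresidue
  divides \<open>X\<close> and \<open>Y\<close>, so \<open>l^2\<close> divides \<open>m m'\<close>.
  The last hypothesis keeps \<open>l\<close> away from \<open>m'\<close>, hence \<open>l^2\<close>
  divides \<open>m\<close> and can be removed: such primes occur to an even power and do not affect
  the symbol. The comparisons of the two conics rest on this.\<close>

lemma jac_factor_of_form:
  fixes d :: int and m :: nat and m' X Y :: int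
  assumes "odd m" "\<And>l. prime l \<Longrightarrow> l dvd m \<Longrightarrow> \<not> int l dvd d" "int m * m' = X\<^sup>2 + d * Y\<^sup>2"
    and "\<And>l. prime l \<Longrightarrow> l dvd m \<Longrightarrow> int l dvd m' \<Longrightarrow> int l dvd X \<Longrightarrow> int l dvd Y \<Longrightarrow> Legendre (- d) (int l) = - 1 \<Longrightarrow> False"
  shows "jac (- d) m = 1"
  using assms
proof (induction m arbitrary: X Y rule: less_induct)
  case (less m)
  show ?case
  proof (cases "\<exists>l. prime l \<and> l dvd m \<and> Legendre (- d) (int l) = - 1")
    case False
    show ?thesis
    proof (rule jac_eq_1I)
      fix l assume l: "prime l" "l dvd m"
      thus "Legendre (- d) (int l) = 1"
        using False Legendre_values[of "- d" "int l"] Legendre_eq_0_iff[of "- d" "int l"] less.prems(2)[OF l] by auto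
    qed
  next
    case True
    then obtain l where l: "prime l" "l dvd m" "Legendre (- d) (int l) = - 1" by blast
    have l2: "l > 2" using l less.prems(1) prime_ge_2_nat[of l] by (cases "l = 2") auto
    have "int l dvd X\<^sup>2 + d * Y\<^sup>2" using l(2) unfolding less.prems(3)[symmetric] by simp
    hence XY: "int l dvd X" "int l dvd Y" using bad_prime_dvd_form[OF l(1) l2 l(3)] by blast+
    then obtain X' Y' where X': "X = int l * X'" "Y = int l * Y'" by blast
    have nm': "\<not> int l dvd m'" using less.prems(4)[OF l(1,2)] XY l(3) by blast
    obtain k where k: "m = l * k" using l(2) by blast
    have "int l * (int k * m') = int l * (int l * (X'\<^sup>2 + d * Y'\<^sup>2))"
      using less.prems(3) unfolding k X' by (simp add: power2_eq_square algebra_simps)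
    hence "int k * m' = int l * (X'\<^sup>2 + d * Y'\<^sup>2)" using l2 by simp
    hence "int l dvd int k * m'" by simp
    hence "int l dvd int k" using nm' l(1) prime_dvd_mult_iff[of "int l"] by auto
    hence "l dvd k" by simp
    then obtain m1 where m1: "k = l * m1" by blast
    have "int l * (int m1 * m') = int l * (X'\<^sup>2 + d * Y'\<^sup>2)"
      using \<open>int k * m' = _\<close> unfolding m1 by simp
    hence e: "int m1 * m' = X'\<^sup>2 + d * Y'\<^sup>2" using l2 by simp
    have m: "m = l * l * m1" using k m1 by simp
    have m10: "m1 > 0" "odd m1" using less.prems(1) m by (auto intro!: Nat.gr0I)
    have "2 * 2 < l * l" using l2 by (intro mult_strict_mono) auto
    hence "1 * m1 < (l * l) * m1" using m10(1) by (intro mult_strict_right_mono) auto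
    hence "m1 < m" using m by simp
    have "jac (- d) m1 = 1"
    proof (rule less.IH[OF \<open>m1 < m\<close> m10(2) _ e])
      show "\<not> int l' dvd d" if "prime l'" "l' dvd m1" for l' using less.prems(2)[of l'] that m by simp
      show False if "prime l'" "l' dvd m1" "int l' dvd m'" "int l' dvd X'" "int l' dvd Y'" "Legendre (- d) (int l') = - 1" for l'
        using less.prems(4)[of l'] that m X' by simp
    qed
    moreover have "jac (- d) m = jac (- d) l * jac (- d) l * jac (- d) m1"
      unfolding m using l(1) m10 by (simp add: jac_mult_right prime_gt_0_nat)
    ultimately show ?thesis using l by (simp add: jac_prime)
  qed
qed

section \<open>From rational right triangles to systems of two quadratic equations\<close>

lemma square_dvd_squarefree_mult_square:
  fixes g D s :: nat
  assumes "squarefree s" "g\<^sup>2 dvd s * D\<^sup>2" "D > 0"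
  shows "g dvd D"
proof -
  define d where "d = gcd g D"
  have d0: "d > 0" using assms(3) by (simp add: d_def)
  obtain g1 D1 where g1: "g = g1 * d" "D = D1 * d" "coprime g1 D1"
    using gcd_coprime_exists[of g D] d0 unfolding d_def by auto
  have "g1\<^sup>2 * d\<^sup>2 dvd (s * D1\<^sup>2) * d\<^sup>2" using assms(2) unfolding g1 by (simp add: power_mult_distrib mult_ac)
  hence "g1\<^sup>2 dvd s * D1\<^sup>2" using d0 by simp
  moreover have "coprime (g1\<^sup>2) (D1\<^sup>2)" using g1(3) by simp
  ultimately have "g1\<^sup>2 dvd s" using coprime_dvd_mult_left_iff by blast
  hence "is_unit g1" using assms(1) squarefreeD by blast
  hence "g1 = 1" by simp
  thus ?thesis using g1 by simp
qed

lemma squarefree_mult_square_unique: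
  fixes s s' k l :: nat
  assumes "squarefree s" "squarefree s'" "s * k\<^sup>2 = s' * l\<^sup>2" "k > 0" "l > 0"
  shows "s = s'" "k = l"
proof -
  have "k\<^sup>2 dvd s' * l\<^sup>2" "l\<^sup>2 dvd s * k\<^sup>2" using assms(3) by (metis dvd_triv_right)+
  hence "k dvd l" "l dvd k" using square_dvd_squarefree_mult_square assms by blast+
  thus "k = l" by (rule dvd_antisym)
  thus "s = s'" using assms by simp
qed

lemma coprime_mult_eq_squarefree_mult_square:
  fixes x y n k :: nat
  assumes "squarefree n" "coprime x y" "x * y = n * k\<^sup>2" "k > 0"
  obtains a b r s where "x = a * r\<^sup>2" "y = b * s\<^sup>2" "n = a * b" "k = r * s"
proof -
  define a r b s where "a = squarefree_part x" and "r = square_part x"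
    and "b = squarefree_part y" and "s = square_part y"
  have x: "x = a * r\<^sup>2" and y: "y = b * s\<^sup>2"
    unfolding a_def r_def b_def s_def by (rule squarefree_decompose)+
  have n0: "n > 0" using assms(1) by (metis gr0I not_squarefree_0)
  have "x * y > 0" using assms n0 by simp
  hence pos: "x > 0" "y > 0" by auto
  have "a dvd x" "b dvd y" using x y by (metis dvd_triv_left)+
  hence "coprime a b" using assms(2) by (meson coprime_divisors)
  hence sq: "squarefree (a * b)" unfolding a_def b_def
    by (intro squarefree_mult_coprime squarefree_squarefree_part)
  have "n * k\<^sup>2 = (a * b) * (r * s)\<^sup>2" using assms(3) x y by (simp add: power_mult_distrib mult_ac)
  moreover have "r * s > 0" using pos x y by (auto intro!: Nat.gr0I)
  ultimately have "n = a * b" "k = r * s"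
    using squarefree_mult_square_unique[OF assms(1) sq _ assms(4)] by blast+
  thus ?thesis using that x y by blast
qed

lemma not_coprime_common_prime:
  fixes x y :: nat
  assumes "\<not> coprime x y"
  obtains p where "prime p" "p dvd x" "p dvd y"
proof -
  have "gcd x y \<noteq> 1" using assms coprime_iff_gcd_eq_1 by blast
  then obtain p where "prime p" "p dvd gcd x y" using prime_factor_nat by blast
  thus ?thesis using that by simp
qed

text \<open>With \<open>g = 2 h\<close>, the numbers \<open>x = (r - f) / 2\<close> and
  \<open>y = (r + f) / 2\<close> are coprime with product \<open>h^2\<close>, hence they are squares
  \<open>v^2\<close> and \<open>u^2\<close>.\<close>

lemma primitive_triple_parametrization:
  fixes f g r :: nat
  assumes "coprime f g" "f\<^sup>2 + g\<^sup>2 = r\<^sup>2" "even g" "f > 0" "g > 0"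
  obtains u v where "coprime u v" "v < u" "v > 0" "odd (u + v)" "f = u\<^sup>2 - v\<^sup>2" "g = 2 * u * v"
proof -
  have odd_f: "odd f" using assms(1,3) by (meson coprime_common_divisor odd_one)
  hence "odd (r\<^sup>2)" unfolding assms(2)[symmetric] using assms(3) by simp
  hence odd_r: "odd r" by simp
  have "f\<^sup>2 < r\<^sup>2" using assms(2,5) by (metis less_add_same_cancel1 zero_less_power)
  hence fr: "f < r" using power_less_imp_less_base by blast
  have "even (r - f)" using odd_f odd_r by simp
  then obtain x where x: "r - f = 2 * x" by blast
  obtain h where h: "g = 2 * h" using assms(3) by blast
  define y where "y = x + f"
  have r: "r = x + y" "f = y - x" "x < y" using x fr assms(4) unfolding y_def by linarith+
  have rr: "r = 2 * x + f" using x fr by linarith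
  have "f\<^sup>2 + 4 * h\<^sup>2 = (2 * x + f)\<^sup>2" using assms(2) unfolding h rr by (simp add: power_mult_distrib)
  hence "h\<^sup>2 = x * y" unfolding y_def by (simp add: power2_eq_square algebra_simps)
  have cxy: "coprime x y"
  proof (rule ccontr)
    assume "\<not> coprime x y"
    then obtain p where p: "prime p" "p dvd x" "p dvd y" using not_coprime_common_prime by metis
    have "p dvd f" using p unfolding y_def by (simp add: dvd_add_right_iff)
    moreover have "p dvd h\<^sup>2" using p \<open>h\<^sup>2 = x * y\<close> by simp
    hence "p dvd h" using p(1) prime_dvd_power by blast
    hence "p dvd g" using h by simp
    ultimately have "p dvd 1" using assms(1) by (meson coprime_common_divisor)
    thus False using p(1) by simp
  qed
  have h0: "h > 0" using h assms(5) by simp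
  have "x * y = 1 * h\<^sup>2" using \<open>h\<^sup>2 = x * y\<close> by simp
  from coprime_mult_eq_squarefree_mult_square[OF _ cxy this h0]
  obtain a b v u where ab: "x = a * v\<^sup>2" "y = b * u\<^sup>2" "1 = a * b" "h = v * u" by auto
  hence xy: "x = v\<^sup>2" "y = u\<^sup>2" by (metis mult_1 nat_1_eq_mult_iff)+
  have 1: "coprime u v" using cxy unfolding xy by (simp add: coprime_commute)
  have 2: "v < u" using r(3) unfolding xy using power_less_imp_less_base by blast
  have 3: "v > 0" using h0 ab(4) by (auto intro!: Nat.gr0I)
  have "odd (v\<^sup>2 + u\<^sup>2)" using odd_r r(1) xy by simp
  hence 4: "odd (u + v)" by simp
  have 5: "f = u\<^sup>2 - v\<^sup>2" using r(2) xy by simp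
  have 6: "g = 2 * u * v" using h ab(4) by simp
  show ?thesis by (rule that[OF 1 2 3 4 5 6])
qed

text \<open>\<open>n k\<^sup>2\<close> is the area of a primitive Pythagorean triangle; the descent is on \<open>k\<close>.\<close>

definition triple_area :: "nat \<Rightarrow> nat \<Rightarrow> bool" where
  "triple_area n k \<longleftrightarrow> k > 0 \<and> (\<exists>f g r. f > 0 \<and> g > 0 \<and> coprime f g \<and> f\<^sup>2 + g\<^sup>2 = r\<^sup>2 \<and> f * g = 2 * n * k\<^sup>2)"

text \<open>Denominators are cleared by \<open>D\<close>, then the legs are divided by their gcd
  \<open>g\<close>. The area keeps its shape: \<open>g^2\<close> divides \<open>2 n D^2\<close> and
  \<open>2 n\<close> is squarefree, so \<open>g\<close> divides \<open>D\<close>.\<close>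

lemma triple_area_of_rational_triangle:
  fixes a b c :: rat
  assumes "squarefree n" "odd n" "a\<^sup>2 + b\<^sup>2 = c\<^sup>2" "of_nat n = a * b / 2"
  obtains k where "triple_area n k"
proof -
  have n0: "n > 0" using assms(1) by (metis gr0I not_squarefree_0)
  obtain a1 a2 where "quotient_of a = (a1, a2)" by force
  hence a: "a = of_int a1 / of_int a2" "a2 > 0" using quotient_of_div quotient_of_denom_pos by blast+
  obtain b1 b2 where "quotient_of b = (b1, b2)" by force
  hence b: "b = of_int b1 / of_int b2" "b2 > 0" using quotient_of_div quotient_of_denom_pos by blast+
  obtain c1 c2 where "quotient_of c = (c1, c2)" by force
  hence c: "c = of_int c1 / of_int c2" "c2 > 0" using quotient_of_div quotient_of_denom_pos by blast+
  define D where "D = nat (a2 * b2 * c2)"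
  define A B C where "A = nat \<bar>a1 * b2 * c2\<bar>" and "B = nat \<bar>b1 * a2 * c2\<bar>" and "C = nat \<bar>c1 * a2 * b2\<bar>"
  have D: "D > 0" "(of_nat D :: rat) = of_int (a2 * b2 * c2)" using a b c by (simp_all add: D_def)
  have "(of_int (a1 * b2 * c2) :: rat) = a * of_nat D" "(of_int (b1 * a2 * c2) :: rat) = b * of_nat D"
    "(of_int (c1 * a2 * b2) :: rat) = c * of_nat D" unfolding D(2) using a b c by simp_all
  hence ABC: "(of_nat A :: rat) = \<bar>a * of_nat D\<bar>" "(of_nat B :: rat) = \<bar>b * of_nat D\<bar>" "(of_nat C :: rat) = \<bar>c * of_nat D\<bar>"
    unfolding A_def B_def C_def by (metis abs_ge_zero of_int_abs of_nat_nat)+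
  have "(of_nat (A\<^sup>2 + B\<^sup>2) :: rat) = (a\<^sup>2 + b\<^sup>2) * (of_nat D)\<^sup>2"
    by (simp add: ABC power_mult_distrib algebra_simps)
  also have "\<dots> = of_nat (C\<^sup>2)" unfolding assms(3) by (simp add: ABC power_mult_distrib)
  finally have pyt: "A\<^sup>2 + B\<^sup>2 = C\<^sup>2" using of_nat_eq_iff by blast
  have ab0: "a * b = 2 * of_nat n" using assms(4) by simp
  have "(of_nat (A * B) :: rat) = \<bar>a * b\<bar> * (of_nat D)\<^sup>2" by (simp add: ABC abs_mult power2_eq_square)
  also have "\<dots> = of_nat (2 * n * D\<^sup>2)" unfolding ab0 by simp
  finally have area: "A * B = 2 * n * D\<^sup>2" using of_nat_eq_iff by blast
  have "A * B > 0" unfolding area using n0 D(1) by simp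
  hence AB0: "A > 0" "B > 0" by auto
  define g where "g = gcd A B"
  have g0: "g > 0" using AB0 by (simp add: g_def)
  obtain A' B' where A': "A = A' * g" "B = B' * g" "coprime A' B'"
    using gcd_coprime_exists[of A B] g0 unfolding g_def by auto
  have "g\<^sup>2 dvd C\<^sup>2" unfolding pyt[symmetric] A' by (simp add: power_mult_distrib)
  hence "g dvd C" by simp
  then obtain C' where C': "C = g * C'" by blast
  have "squarefree (2 * n)"
    by (rule squarefree_mult_coprime) (use assms(1,2) in \<open>auto intro: squarefree_prime\<close>)
  moreover have "g\<^sup>2 dvd 2 * n * D\<^sup>2" unfolding area[symmetric] A' by (simp add: power2_eq_square)
  ultimately have "g dvd D" using square_dvd_squarefree_mult_square D(1) by blast
  then obtain k where k: "D = g * k" by blast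
  have k0: "k > 0" using k D(1) by (auto intro!: Nat.gr0I)
  have "g\<^sup>2 * (A'\<^sup>2 + B'\<^sup>2) = g\<^sup>2 * C'\<^sup>2" using pyt unfolding A' C' by (simp add: power_mult_distrib algebra_simps)
  hence "A'\<^sup>2 + B'\<^sup>2 = C'\<^sup>2" using g0 by simp
  moreover have "g\<^sup>2 * (A' * B') = g\<^sup>2 * (2 * n * k\<^sup>2)" using area unfolding A' k by (simp add: power2_eq_square algebra_simps)
  hence "A' * B' = 2 * n * k\<^sup>2" using g0 by simp
  moreover have "A' > 0" "B' > 0" using AB0 A' by (auto intro!: Nat.gr0I)
  ultimately have "triple_area n k" unfolding triple_area_def using k0 A'(3) by blast
  thus ?thesis using that by blast
qed

text \<open>The area is \<open>n k^2 = u v (u + v) (u - v)\<close> with four pairwise coprime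
  factors, so each factor is a divisor of \<open>n\<close> times a square: \<open>u = a r^2\<close>,
  \<open>v = b s^2\<close>, \<open>u + v = c t^2\<close>, \<open>u - v = d w^2\<close>.\<close>

lemma triple_area_quadratic_system:
  assumes "squarefree n" "triple_area n k"
  obtains a b c d r s t w :: nat where "a * b * c * d = n" "k = r * s * t * w"
    "a * r\<^sup>2 + b * s\<^sup>2 = c * t\<^sup>2" "a * r\<^sup>2 = b * s\<^sup>2 + d * w\<^sup>2" "coprime (a * r\<^sup>2) (b * s\<^sup>2)"
    "odd (c * t\<^sup>2)" "odd (d * w\<^sup>2)" "coprime (c * t\<^sup>2) (d * w\<^sup>2)" "r > 0" "s > 0" "t > 0" "w > 0"
proof -
  obtain f0 g0 h where fg0: "f0 > 0" "g0 > 0" "coprime f0 g0" "f0\<^sup>2 + g0\<^sup>2 = h\<^sup>2" "f0 * g0 = 2 * n * k\<^sup>2" and k0: "k > 0"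
    using assms(2) unfolding triple_area_def by blast
  have "even (f0 * g0)" unfolding fg0(5) by simp
  then obtain f g where fg: "f > 0" "g > 0" "coprime f g" "f\<^sup>2 + g\<^sup>2 = h\<^sup>2" "f * g = 2 * n * k\<^sup>2" "even g"
  proof (cases "even g0")
    case True
    thus ?thesis using that[of f0 g0] fg0 by blast
  next
    case False
    hence "even f0" using \<open>even (f0 * g0)\<close> by simp
    moreover have "coprime g0 f0" "g0\<^sup>2 + f0\<^sup>2 = h\<^sup>2" "g0 * f0 = 2 * n * k\<^sup>2"
      using fg0(3-5) by (simp_all add: coprime_commute add.commute mult.commute)
    ultimately show ?thesis using that[of g0 f0] fg0(1,2) by blast
  qed
  obtain u v where uv: "coprime u v" "v < u" "v > 0" "odd (u + v)" "f = u\<^sup>2 - v\<^sup>2" "g = 2 * u * v"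
    using primitive_triple_parametrization[OF fg(3,4,6,1,2)] by blast
  define x y where "x = u + v" and "y = u - v"
  have y: "u = v + y" "x = 2 * v + y" "y > 0" "odd y" using uv(2,4) unfolding x_def y_def by auto
  have f: "f = x * y" unfolding uv(5) x_def y_def unfolding y(1) by (simp add: power2_eq_square algebra_simps)
  have "2 * ((u * v) * (x * y)) = 2 * (n * k\<^sup>2)" using fg(5) f uv(6) by (simp add: mult_ac)
  hence prod: "(u * v) * (x * y) = n * k\<^sup>2" by simp
  have cop: "coprime (u * v) (x * y)"
  proof (rule ccontr)
    assume "\<not> coprime (u * v) (x * y)"
    then obtain p where p: "prime p" "p dvd u * v" "p dvd x * y" using not_coprime_common_prime by metis
    have "p dvd u \<or> p dvd v" "p dvd x \<or> p dvd y" using p by (auto simp: prime_dvd_mult_iff)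
    moreover have "p dvd x \<Longrightarrow> p dvd u \<longleftrightarrow> p dvd v" unfolding x_def by (metis dvd_add_right_iff dvd_add_left_iff)
    moreover have "p dvd y \<Longrightarrow> p dvd u \<longleftrightarrow> p dvd v" unfolding y(1) by (metis dvd_add_left_iff)
    ultimately have "p dvd u" "p dvd v" by blast+
    thus False using uv(1) p(1) by (meson coprime_common_divisor not_prime_unit)
  qed
  have copxy: "coprime x y"
  proof (rule ccontr)
    assume "\<not> coprime x y"
    then obtain p where p: "prime p" "p dvd x" "p dvd y" using not_coprime_common_prime by metis
    have "p dvd 2 * v" using p unfolding y(2) by (metis dvd_add_left_iff)
    moreover have "p \<noteq> 2" using p(3) y(4) by auto
    hence "\<not> p dvd 2" using p(1) by (metis primes_dvd_imp_eq two_is_prime_nat)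
    ultimately have "p dvd v" using p(1) by (simp add: prime_dvd_mult_iff)
    moreover from this have "p dvd u" unfolding y(1) using p by simp
    ultimately show False using uv(1) p(1) by (meson coprime_common_divisor not_prime_unit)
  qed
  obtain n1 n2 k1 k2 where 1: "u * v = n1 * k1\<^sup>2" "x * y = n2 * k2\<^sup>2" "n = n1 * n2" "k = k1 * k2"
    using coprime_mult_eq_squarefree_mult_square[OF assms(1) cop prod k0] by metis
  have k12: "k1 > 0" "k2 > 0" using 1(4) k0 by auto
  have sq12: "squarefree n1" "squarefree n2" using assms(1) 1(3) by (metis squarefree_mono dvd_triv_left dvd_triv_right)+
  obtain a b r s where 2: "u = a * r\<^sup>2" "v = b * s\<^sup>2" "n1 = a * b" "k1 = r * s"
    using coprime_mult_eq_squarefree_mult_square[OF sq12(1) uv(1) 1(1) k12(1)] by metis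
  obtain c d t w where 3: "x = c * t\<^sup>2" "y = d * w\<^sup>2" "n2 = c * d" "k2 = t * w"
    using coprime_mult_eq_squarefree_mult_square[OF sq12(2) copxy 1(2) k12(2)] by metis
  show ?thesis
  proof (rule that[of a b c d r s t w])
    show "a * b * c * d = n" using 1(3) 2(3) 3(3) by (simp add: mult_ac)
    show "k = r * s * t * w" using 1(4) 2(4) 3(4) by (simp add: mult_ac)
    show "a * r\<^sup>2 + b * s\<^sup>2 = c * t\<^sup>2" using x_def 2 3 by simp
    show "a * r\<^sup>2 = b * s\<^sup>2 + d * w\<^sup>2" using y(1) 2 3 by simp
    show "coprime (a * r\<^sup>2) (b * s\<^sup>2)" using uv(1) 2 by simp
    show "odd (c * t\<^sup>2)" using uv(4) 3(1) unfolding x_def by metis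
    show "odd (d * w\<^sup>2)" using y(4) 3(2) by metis
    show "coprime (c * t\<^sup>2) (d * w\<^sup>2)" using copxy 3 by simp
    show "r > 0" "s > 0" "t > 0" "w > 0" using k12 2(4) 3(4) by auto
  qed
qed

text \<open>Here \<open>t^2 + w^2 = 2 r^2\<close> and \<open>t^2 - w^2 = 2 n s^2\<close>, so
  \<open>f = (t + w) / 2\<close> and \<open>g = (t - w) / 2\<close> are the legs of a primitive
  triangle with hypotenuse \<open>r\<close> and area \<open>n (s / 2)^2\<close>.\<close>

lemma trivial_class_descent:
  fixes n r s t w :: nat
  assumes "odd n" and e: "r\<^sup>2 + n * s\<^sup>2 = t\<^sup>2" "r\<^sup>2 = n * s\<^sup>2 + w\<^sup>2"
    and "odd (t\<^sup>2)" "odd (w\<^sup>2)" "coprime (t\<^sup>2) (w\<^sup>2)" "r > 0" "s > 0" "w > 0"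
  obtains k where "triple_area n k" "k < s"
proof -
  have ot: "odd t" "odd w" using assms by auto
  \<comment> \<open>An odd \<open>s\<close> would make \<open>r\<close> even, so that
    \<open>2 r^2\<close> is divisible by 8, while \<open>t^2 + w^2\<close> is 2 modulo 4.\<close>
  have "even s"
  proof (rule ccontr)
    assume "odd s"
    hence os: "odd (n * s\<^sup>2)" using assms(1) by simp
    have "even (r\<^sup>2)" using e(2) os \<open>odd (w\<^sup>2)\<close> by simp
    hence "even r" by simp
    then obtain i where i: "r = 2 * i" by blast
    obtain j where j: "t = 2 * j + 1" using ot by (auto elim: oddE)
    obtain l where l: "w = 2 * l + 1" using ot by (auto elim: oddE)
    have "2 * r\<^sup>2 = t\<^sup>2 + w\<^sup>2" using e by simp
    hence "8 * i\<^sup>2 = 4 * (j\<^sup>2 + j + l\<^sup>2 + l) + 2" unfolding i j l by (simp add: power2_eq_square algebra_simps)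
    thus False by presburger
  qed
  then obtain k where k: "s = 2 * k" by blast
  have k0: "k > 0" "k < s" using k assms(8) by auto
  have "n * s\<^sup>2 > 0" using assms(1,8) by (auto intro!: Nat.gr0I)
  hence "w\<^sup>2 < t\<^sup>2" using e by linarith
  hence wt: "w < t" using power_less_imp_less_base by blast
  have "even (t - w)" using ot by simp
  then obtain g where g: "t - w = 2 * g" by blast
  have g0: "g > 0" "t = w + 2 * g" using g wt by linarith+
  define f where "f = w + g"
  have fg: "t = f + g" "f = w + g" using g0(2) by (simp_all add: f_def)
  have cop: "coprime f g"
  proof (rule ccontr)
    assume "\<not> coprime f g"
    then obtain p where p: "prime p" "p dvd f" "p dvd g" using not_coprime_common_prime by metis
    have "p dvd t" using p fg(1) by simp
    moreover have "p dvd w" using p fg(2) by (metis dvd_add_left_iff)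
    ultimately have "p dvd t\<^sup>2" "p dvd w\<^sup>2" by (simp_all add: power2_eq_square)
    thus False using assms(6) p(1) by (meson coprime_common_divisor not_prime_unit)
  qed
  have w': "w = f - g" "g \<le> f" using fg by auto
  have i: "int t = int f + int g" "int w = int f - int g" using fg by auto
  have ie: "(int r)\<^sup>2 + int n * (int s)\<^sup>2 = (int t)\<^sup>2" "(int r)\<^sup>2 = int n * (int s)\<^sup>2 + (int w)\<^sup>2"
    using arg_cong[OF e(1), of int] arg_cong[OF e(2), of int] by simp_all
  have "2 * ((int f)\<^sup>2 + (int g)\<^sup>2) = 2 * (int r)\<^sup>2" using ie unfolding i by (simp add: power2_eq_square algebra_simps)
  hence "int (f\<^sup>2 + g\<^sup>2) = int (r\<^sup>2)" by simp
  hence 1: "f\<^sup>2 + g\<^sup>2 = r\<^sup>2" using of_nat_eq_iff by blast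
  have "4 * (int f * int g) = 2 * (int n * (int s)\<^sup>2)" using ie unfolding i by (simp add: power2_eq_square algebra_simps)
  hence "4 * (int f * int g) = 4 * (2 * int n * (int k)\<^sup>2)" unfolding k by (simp add: power2_eq_square)
  hence "int (f * g) = int (2 * n * k\<^sup>2)" by simp
  hence 2: "f * g = 2 * n * k\<^sup>2" using of_nat_eq_iff by blast
  have "f > 0" using g0 unfolding f_def by simp
  hence "triple_area n k" unfolding triple_area_def using k0 g0 cop 1 2 by blast
  thus ?thesis using that k0 by blast
qed

text \<open>For the least possible \<open>k\<close> the trivial shape is excluded: \<open>s\<close>
  is at most \<open>k\<close>, and the descent would produce a value below \<open>s\<close>.\<close>

lemma nontrivial_quadratic_system:
  assumes "squarefree n" "odd n" "triple_area n k0"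
  obtains a b c d r s t w :: nat where "a * b * c * d = n"
    "a * r\<^sup>2 + b * s\<^sup>2 = c * t\<^sup>2" "a * r\<^sup>2 = b * s\<^sup>2 + d * w\<^sup>2" "coprime (a * r\<^sup>2) (b * s\<^sup>2)"
    "odd (c * t\<^sup>2)" "odd (d * w\<^sup>2)" "coprime (c * t\<^sup>2) (d * w\<^sup>2)" "r > 0" "s > 0" "t > 0" "w > 0"
    "\<not> (a = 1 \<and> c = 1 \<and> d = 1)"
proof -
  define k where "k = (LEAST k. triple_area n k)"
  have k: "triple_area n k" unfolding k_def using assms(3) by (rule LeastI)
  obtain a b c d r s t w where 1: "a * b * c * d = n" "k = r * s * t * w"
    "a * r\<^sup>2 + b * s\<^sup>2 = c * t\<^sup>2" "a * r\<^sup>2 = b * s\<^sup>2 + d * w\<^sup>2" "coprime (a * r\<^sup>2) (b * s\<^sup>2)"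
    "odd (c * t\<^sup>2)" "odd (d * w\<^sup>2)" "coprime (c * t\<^sup>2) (d * w\<^sup>2)" "r > 0" "s > 0" "t > 0" "w > 0"
    using triple_area_quadratic_system[OF assms(1) k] by metis
  have "\<not> (a = 1 \<and> c = 1 \<and> d = 1)"
  proof
    assume acd: "a = 1 \<and> c = 1 \<and> d = 1"
    hence b: "b = n" using 1(1) by simp
    obtain k' where k': "triple_area n k'" "k' < s"
      using trivial_class_descent[of n r s t w] 1 assms(2) acd b by auto
    have "s * 1 \<le> s * (r * t * w)" using 1(9,11,12) by (intro mult_left_mono) (auto simp: Suc_le_eq)
    hence "s \<le> k" using 1(2) by (simp add: mult_ac)
    hence "k' < k" using k' by simp
    thus False using k'(1) not_less_Least unfolding k_def by blast
  qed
  thus ?thesis using that 1 by metis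
qed

section \<open>The ideal class group\<close>

context imag_quad
begin

abbreviation R :: "complex ring" where "R \<equiv> ring_of_integers K"

lemma R_simps [simp]:
  "carrier R = OK" "x \<otimes>\<^bsub>R\<^esub> y = x * y" "\<one>\<^bsub>R\<^esub> = 1" "\<zero>\<^bsub>R\<^esub> = 0" "x \<oplus>\<^bsub>R\<^esub> y = x + y"
  by (simp_all add: ring_of_integers_def carrier_eq_OK)

lemma cring_R: "cring R"
proof (rule cringI)
  show "abelian_group R"
  proof (rule abelian_groupI)
    show "\<exists>y\<in>carrier R. y \<oplus>\<^bsub>R\<^esub> x = \<zero>\<^bsub>R\<^esub>" if "x \<in> carrier R" for x
      using that by (intro bexI[of _ "- x"]) auto
  qed auto
  show "Group.comm_monoid R" by (rule comm_monoidI) auto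
qed (auto simp: algebra_simps)

interpretation cring R by (rule cring_R)

definition nzi :: "complex set \<Rightarrow> bool" where
  "nzi I \<longleftrightarrow> I \<subseteq> OK \<and> 0 \<in> I \<and> (\<forall>a\<in>I. \<forall>b\<in>I. a + b \<in> I) \<and> (\<forall>a\<in>I. \<forall>x\<in>OK. x * a \<in> I) \<and> I \<noteq> {0}"

lemma nziI:
  assumes "I \<subseteq> OK" "0 \<in> I" "\<And>a b. a \<in> I \<Longrightarrow> b \<in> I \<Longrightarrow> a + b \<in> I"
    "\<And>a x. a \<in> I \<Longrightarrow> x \<in> OK \<Longrightarrow> x * a \<in> I" "z \<in> I" "z \<noteq> 0"
  shows "nzi I"
  using assms unfolding nzi_def by blast

lemma nzi_OK_mem: "nzi I \<Longrightarrow> a \<in> I \<Longrightarrow> a \<in> OK" by (auto simp: nzi_def)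
lemma nzi_0: "nzi I \<Longrightarrow> 0 \<in> I" by (auto simp: nzi_def)
lemma nzi_add: "nzi I \<Longrightarrow> a \<in> I \<Longrightarrow> b \<in> I \<Longrightarrow> a + b \<in> I" by (auto simp: nzi_def)
lemma nzi_mult: "nzi I \<Longrightarrow> a \<in> I \<Longrightarrow> x \<in> OK \<Longrightarrow> x * a \<in> I" by (auto simp: nzi_def)
lemma nzi_mult_right: "nzi I \<Longrightarrow> a \<in> I \<Longrightarrow> x \<in> OK \<Longrightarrow> a * x \<in> I" using nzi_mult by (simp add: mult.commute)
lemma OK_minus_1 [simp]: "- 1 \<in> OK" using OK_uminus[OF OK_1] .
lemma nzi_uminus: "nzi I \<Longrightarrow> a \<in> I \<Longrightarrow> - a \<in> I" using nzi_mult[of I a "- 1"] by simp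
lemma nzi_diff: "nzi I \<Longrightarrow> a \<in> I \<Longrightarrow> b \<in> I \<Longrightarrow> a - b \<in> I" using nzi_add[of I a "- b"] nzi_uminus by auto
lemma nzi_nonzero: "nzi I \<Longrightarrow> \<exists>a\<in>I. a \<noteq> 0" by (auto simp: nzi_def)

lemma ideal_closed_iff:
  "ideal I R \<longleftrightarrow> I \<subseteq> OK \<and> 0 \<in> I \<and> (\<forall>a\<in>I. \<forall>b\<in>I. a + b \<in> I) \<and> (\<forall>a\<in>I. \<forall>x\<in>OK. x * a \<in> I)" (is "_ \<longleftrightarrow> ?P")
proof
  assume "ideal I R"
  then interpret J: ideal I R .
  show ?P using J.a_subset J.zero_closed J.a_closed J.I_l_closed by auto
next
  assume P: ?P
  show "ideal I R"
  proof (rule idealI)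
    show "ring R" by (rule ring_axioms)
    show "subgroup I (add_monoid R)"
    proof (rule add.subgroupI)
      show "\<ominus>\<^bsub>R\<^esub> a \<in> I" if "a \<in> I" for a
      proof -
        have aO: "a \<in> OK" using P that by blast
        have "\<ominus>\<^bsub>R\<^esub> a = - a" using minus_equality[of "- a" a] aO by auto
        moreover have "(- 1) * a \<in> I" using P that by (metis OK_1 OK_uminus)
        ultimately show ?thesis by simp
      qed
    qed (use P in auto)
  qed (use P in \<open>auto simp: mult.commute\<close>)
qed

lemma nonzero_ideals_iff: "I \<in> nonzero_ideals R \<longleftrightarrow> nzi I"
  unfolding nonzero_ideals_def nzi_def by (auto simp: ideal_closed_iff)

lemma nzi_ideal: "nzi I \<Longrightarrow> ideal I R"
  unfolding nzi_def ideal_closed_iff by blast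

abbreviation prd :: "complex set \<Rightarrow> complex set \<Rightarrow> complex set" (infixl "\<odot>" 70) where
  "I \<odot> J \<equiv> ideal_prod R I J"

lemma prd_mem: "a \<in> I \<Longrightarrow> b \<in> J \<Longrightarrow> a * b \<in> I \<odot> J"
  using ideal_prod.prod[of a I b J R] by simp

lemma prd_subset:
  assumes "\<And>a b. a \<in> I \<Longrightarrow> b \<in> J \<Longrightarrow> a * b \<in> L" "\<And>x y. x \<in> L \<Longrightarrow> y \<in> L \<Longrightarrow> x + y \<in> L"
  shows "I \<odot> J \<subseteq> L"
proof
  fix x assume "x \<in> I \<odot> J"
  thus "x \<in> L" by (induction rule: ideal_prod.induct) (use assms in auto)
qed

lemma prd_mono: "I \<subseteq> I' \<Longrightarrow> J \<subseteq> J' \<Longrightarrow> I \<odot> J \<subseteq> I' \<odot> J'"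
  using ideal_prod.sum[of _ R I' J'] by (intro prd_subset) (auto intro!: prd_mem)

lemma prd_ideal: "ideal I R \<Longrightarrow> ideal J R \<Longrightarrow> ideal (I \<odot> J) R" by (rule ideal_prod_is_ideal)

lemma nzi_iff: "nzi I \<longleftrightarrow> ideal I R \<and> I \<noteq> {0}"
  unfolding nzi_def ideal_closed_iff by blast

lemma nzi_prd [intro]: assumes "nzi I" "nzi J" shows "nzi (I \<odot> J)"
proof -
  obtain a b where "a \<in> I" "a \<noteq> 0" "b \<in> J" "b \<noteq> 0" using assms nzi_nonzero by blast
  hence "a * b \<in> I \<odot> J" "a * b \<noteq> 0" using prd_mem by auto
  hence "I \<odot> J \<noteq> {0}" by blast
  thus ?thesis unfolding nzi_iff using assms prd_ideal nzi_ideal by blast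
qed

lemma prd_assoc: "nzi I \<Longrightarrow> nzi J \<Longrightarrow> nzi L \<Longrightarrow> (I \<odot> J) \<odot> L = I \<odot> (J \<odot> L)"
  using ideal_prod_assoc nzi_ideal by blast

lemma prd_commute: "nzi I \<Longrightarrow> nzi J \<Longrightarrow> I \<odot> J = J \<odot> I"
  using ideal_prod_commute nzi_ideal by blast

lemma nzi_OK [simp]: "nzi OK"
  by (rule nziI[of _ 1]) auto

lemma prd_OK: "nzi I \<Longrightarrow> I \<odot> OK = I"
  using ideal_prod_one(1)[OF nzi_ideal] by simp

lemma OK_prd: "nzi I \<Longrightarrow> OK \<odot> I = I"
  using prd_OK prd_commute nzi_OK by metis

definition smul :: "complex \<Rightarrow> complex set \<Rightarrow> complex set" where
  "smul c I = (\<lambda>x. c * x) ` I"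

lemma smulI: "x \<in> I \<Longrightarrow> c * x \<in> smul c I" unfolding smul_def by (rule imageI)
lemma smul_smul [simp]: "smul a (smul b I) = smul (a * b) I" by (simp add: smul_def image_image mult.assoc)
lemma smul_1 [simp]: "smul 1 I = I" by (simp add: smul_def)
lemma smul_inject: "c \<noteq> 0 \<Longrightarrow> smul c I = smul c J \<longleftrightarrow> I = J"
  unfolding smul_def by (rule inj_image_eq_iff) (simp add: inj_on_def)
lemma smul_mem_iff: "c \<noteq> 0 \<Longrightarrow> x \<in> smul c I \<longleftrightarrow> x / c \<in> I"
  by (auto simp: smul_def intro!: image_eqI[of _ _ "x / c"])

lemma smul_prd: "smul c I \<odot> J = smul c (I \<odot> J)"
proof
  show "smul c I \<odot> J \<subseteq> smul c (I \<odot> J)"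
  proof (rule prd_subset)
    fix a b assume "a \<in> smul c I" "b \<in> J"
    thus "a * b \<in> smul c (I \<odot> J)" by (auto simp: smul_def image_iff mult.assoc intro!: bexI[of _ "_ * _"] prd_mem)
  next
    fix x y assume "x \<in> smul c (I \<odot> J)" "y \<in> smul c (I \<odot> J)"
    then obtain x' y' where "x = c * x'" "y = c * y'" "x' \<in> I \<odot> J" "y' \<in> I \<odot> J" by (auto simp: smul_def)
    moreover from this have "x' + y' \<in> I \<odot> J" using ideal_prod.sum[of x' R I J y'] by simp
    ultimately show "x + y \<in> smul c (I \<odot> J)" by (metis distrib_left smulI)
  qed
  show "smul c (I \<odot> J) \<subseteq> smul c I \<odot> J"
  proof
    fix z assume "z \<in> smul c (I \<odot> J)"
    then obtain x where x: "x \<in> I \<odot> J" "z = c * x" by (auto simp: smul_def)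
    from x(1) have "c * x \<in> smul c I \<odot> J"
    proof (induction rule: ideal_prod.induct)
      case (prod i j)
      have "(c * i) * j \<in> smul c I \<odot> J" using prod by (intro prd_mem smulI)
      thus ?case by (simp add: mult.assoc)
    next
      case (sum a b)
      thus ?case using ideal_prod.sum[of "c * a" R "smul c I" J "c * b"] by (simp add: distrib_left)
    qed
    thus "z \<in> smul c I \<odot> J" using x by simp
  qed
qed

lemma nzi_smul:
  assumes "nzi I" "c \<noteq> 0" "smul c I \<subseteq> OK"
  shows "nzi (smul c I)"
proof -
  obtain a where a: "a \<in> I" "a \<noteq> 0" using assms nzi_nonzero by blast
  show ?thesis
  proof (rule nziI[of _ "c * a"])
    show "0 \<in> smul c I" using nzi_0[OF assms(1)] by (force simp: smul_def)
    show "x + y \<in> smul c I" if xy: "x \<in> smul c I" "y \<in> smul c I" for x y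
    proof -
      obtain x' y' where "x = c * x'" "y = c * y'" "x' \<in> I" "y' \<in> I" using xy by (auto simp: smul_def)
      thus ?thesis using smulI[OF nzi_add[OF assms(1), of x' y'], of c] by (simp add: distrib_left)
    qed
    show "y * x \<in> smul c I" if xy: "x \<in> smul c I" "y \<in> OK" for x y
    proof -
      obtain x' where "x = c * x'" "x' \<in> I" using xy by (auto simp: smul_def)
      thus ?thesis using smulI[OF nzi_mult[OF assms(1), of x' y], of c] xy(2) by (simp add: mult_ac)
    qed
  qed (use a assms in \<open>auto simp: smul_def\<close>)
qed

lemma smul_OK_subset: "nzi I \<Longrightarrow> c \<in> OK \<Longrightarrow> smul c I \<subseteq> OK"
  using nzi_OK_mem by (auto simp: smul_def)

lemma nzi_smul_OK: "nzi I \<Longrightarrow> c \<in> OK \<Longrightarrow> c \<noteq> 0 \<Longrightarrow> nzi (smul c I)"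
  using nzi_smul smul_OK_subset by blast

lemma prd_smul: "nzi I \<Longrightarrow> nzi J \<Longrightarrow> c \<in> OK \<Longrightarrow> c \<noteq> 0 \<Longrightarrow> I \<odot> smul c J = smul c (I \<odot> J)"
  by (metis nzi_smul_OK prd_commute smul_prd)

lemma smul_OK_prd: "nzi J \<Longrightarrow> smul c OK \<odot> J = smul c J"
  by (simp add: smul_prd OK_prd)

definition cj :: "complex set \<Rightarrow> complex set" where "cj I = cnj ` I"

lemma cj_cj [simp]: "cj (cj I) = I" by (simp add: cj_def image_image)
lemma cjI: "a \<in> I \<Longrightarrow> cnj a \<in> cj I" by (simp add: cj_def)
lemma cj_iff: "a \<in> cj I \<longleftrightarrow> cnj a \<in> I" unfolding cj_def by (metis complex_cnj_cnj image_iff)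

lemma nzi_cj [intro]: assumes "nzi I" shows "nzi (cj I)"
proof -
  obtain a where a: "a \<in> I" "a \<noteq> 0" using assms nzi_nonzero by blast
  show ?thesis
  proof (rule nziI[of _ "cnj a"])
    show "cj I \<subseteq> OK" using nzi_OK_mem[OF assms] by (auto simp: cj_def)
    show "y * x \<in> cj I" if "x \<in> cj I" "y \<in> OK" for x y
      using that nzi_mult[OF assms, of "cnj x" "cnj y"] by (auto simp: cj_iff)
  qed (use a assms nzi_0 nzi_add in \<open>auto simp: cj_iff\<close>)
qed

lemma cj_smul: "cj (smul c I) = smul (cnj c) (cj I)" by (simp add: cj_def smul_def image_image)

lemma cj_prd_subset: "cj (I \<odot> J) \<subseteq> cj I \<odot> cj J"
proof
  fix x assume "x \<in> cj (I \<odot> J)"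
  hence "cnj x \<in> I \<odot> J" by (simp add: cj_iff)
  hence "cnj (cnj x) \<in> cj I \<odot> cj J"
  proof (induction rule: ideal_prod.induct)
    case (prod i j)
    show ?case using prd_mem[OF cjI[OF prod(1)] cjI[OF prod(2)]] by simp
  next
    case (sum a b)
    thus ?case using ideal_prod.sum[of "cnj a" R "cj I" "cj J" "cnj b"] by simp
  qed
  thus "x \<in> cj I \<odot> cj J" by simp
qed

lemma cj_prd: "cj (I \<odot> J) = cj I \<odot> cj J"
proof
  have "cj (cj I \<odot> cj J) \<subseteq> I \<odot> J" using cj_prd_subset[of "cj I" "cj J"] by simp
  hence "cj (cj (cj I \<odot> cj J)) \<subseteq> cj (I \<odot> J)" unfolding cj_def by blast
  thus "cj I \<odot> cj J \<subseteq> cj (I \<odot> J)" by simp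
qed (rule cj_prd_subset)

lemma cj_OK [simp]: "cj OK = OK" by (auto simp: cj_iff) (metis OK_cnj complex_cnj_cnj)

text \<open>The absolute norm of an ideal, available without \<open>\<int>\<close>-bases.\<close>

definition nrm :: "complex set \<Rightarrow> nat" where
  "nrm I = Gcd {k. \<exists>a\<in>I. real k = (cmod a)\<^sup>2}"

lemma nrm_dvd: "a \<in> I \<Longrightarrow> (cmod a)\<^sup>2 = real k \<Longrightarrow> nrm I dvd k"
  unfolding nrm_def by (intro Gcd_dvd CollectI bexI[of _ a]) auto

lemma nrm_greatest: "(\<And>a k. a \<in> I \<Longrightarrow> (cmod a)\<^sup>2 = real k \<Longrightarrow> d dvd k) \<Longrightarrow> d dvd nrm I"
  unfolding nrm_def by (intro Gcd_greatest) auto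

lemma nrm_pos: assumes "nzi I" shows "nrm I > 0"
proof -
  obtain a where a: "a \<in> I" "a \<noteq> 0" using assms nzi_nonzero by blast
  obtain k where k: "(cmod a)\<^sup>2 = real k" using OK_norm nzi_OK_mem assms a by metis
  have "k > 0" using k a by (metis gr0I of_nat_0 zero_eq_power2 norm_eq_zero)
  thus ?thesis using nrm_dvd[OF a(1) k] by (metis gr0I dvd_0_left_iff less_irrefl)
qed

text \<open>Division with remainder shows that the least positive element of \<open>M\<close>
  divides every member of \<open>S\<close>, hence their gcd.\<close>

lemma int_subgroup_contains_Gcd:
  fixes M :: "int set" and S :: "nat set"
  assumes sub: "\<And>x y. x \<in> M \<Longrightarrow> y \<in> M \<Longrightarrow> x - y \<in> M" and mul: "\<And>x k. x \<in> M \<Longrightarrow> k * x \<in> M"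
    and S: "\<And>k. k \<in> S \<Longrightarrow> int k \<in> M" and nz: "k0 \<in> S" "k0 > 0"
  shows "int (Gcd S) \<in> M"
proof -
  define d where "d = (LEAST d. d > 0 \<and> int d \<in> M)"
  have d: "d > 0" "int d \<in> M" using LeastI[of "\<lambda>d. d > 0 \<and> int d \<in> M" k0] nz S unfolding d_def by auto
  have "d dvd k" if k: "k \<in> S" for k
  proof -
    have "int k - int (k div d) * int d \<in> M" using S[OF k] d mul sub by blast
    moreover have "int k - int (k div d) * int d = int (k mod d)"
      by (metis add_diff_cancel_left' mod_div_mult_eq mult.commute of_nat_add of_nat_mult add.commute)
    ultimately have "int (k mod d) \<in> M" by simp
    hence "\<not> (k mod d > 0)" using not_less_Least[of "k mod d" "\<lambda>d. d > 0 \<and> int d \<in> M"] d(1)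
      unfolding d_def[symmetric] by auto
    thus ?thesis by auto
  qed
  hence "d dvd Gcd S" by (intro Gcd_greatest)
  then obtain j where "Gcd S = d * j" by blast
  thus ?thesis using mul[OF d(2), of "int j"] by (simp add: mult.commute)
qed

lemma cmod_sq_add: "(cmod (a + b))\<^sup>2 = (cmod a)\<^sup>2 + (cmod b)\<^sup>2 + 2 * Re (a * cnj b)"
  unfolding cmod_power2 by (simp add: power2_eq_square algebra_simps)

text \<open>Hurwitz's trick: for \<open>a, b \<in> I\<close> the number \<open>a * cnj b / nrm I\<close> has integral trace and norm.\<close>

lemma prd_cj: assumes I: "nzi I" shows "I \<odot> cj I = smul (of_nat (nrm I)) OK"
proof
  let ?g = "nrm I"
  have g0: "?g > 0" by (rule nrm_pos[OF I])
  have nm: "\<exists>k. (cmod a)\<^sup>2 = real (?g * k)" if a: "a \<in> I" for a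
  proof -
    obtain k where k: "(cmod a)\<^sup>2 = real k" using OK_norm nzi_OK_mem I a by metis
    thus ?thesis using nrm_dvd[OF a k] by (metis dvd_def)
  qed
  show "I \<odot> cj I \<subseteq> smul (of_nat ?g) OK"
  proof (rule prd_subset)
    fix a b' assume a: "a \<in> I" and b': "b' \<in> cj I"
    define b where "b = cnj b'"
    have b: "b \<in> I" "b' = cnj b" using b' by (simp_all add: cj_iff b_def)
    define z where "z = a * b' / of_nat ?g"
    obtain ka kb kc where k: "(cmod a)\<^sup>2 = real (?g * ka)" "(cmod b)\<^sup>2 = real (?g * kb)" "(cmod (a + b))\<^sup>2 = real (?g * kc)"
      using nm a b(1) nzi_add[OF I a b(1)] by metis
    have "(cmod z)\<^sup>2 = (cmod a)\<^sup>2 * (cmod b)\<^sup>2 / (real ?g)\<^sup>2"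
      by (simp add: z_def b(2) norm_mult norm_divide power_mult_distrib power_divide)
    also have "\<dots> = of_int (int (ka * kb))" unfolding k using g0 by (simp add: power2_eq_square)
    finally have 1: "(cmod z)\<^sup>2 \<in> \<int>" by (metis Ints_of_int)
    have "2 * Re (a * cnj b) = real ?g * (real kc - real ka - real kb)"
      using cmod_sq_add[of a b] unfolding k by (simp add: algebra_simps)
    hence "2 * Re z = real kc - real ka - real kb" using g0 by (simp add: z_def b(2) Re_divide_of_nat field_simps)
    hence "2 * Re z = of_int (int kc - int ka - int kb)" by simp
    hence 2: "2 * Re z \<in> \<int>" by (metis Ints_of_int)
    have "z \<in> K" unfolding z_def b(2) using OK_K nzi_OK_mem[OF I] a b(1) by (intro K_divide K_mult K_cnj) auto
    hence "z \<in> OK" using 1 2 by (simp add: OK_def)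
    moreover have "a * b' = of_nat ?g * z" using g0 by (simp add: z_def)
    ultimately show "a * b' \<in> smul (of_nat ?g) OK" by (metis smulI)
  next
    fix x y assume "x \<in> smul (of_nat ?g) OK" "y \<in> smul (of_nat ?g) OK"
    thus "x + y \<in> smul (of_nat ?g) OK"
      using nzi_add[OF nzi_smul_OK[OF nzi_OK, of "of_nat ?g"]] g0 by simp
  qed
  have P: "nzi (I \<odot> cj I)" using I by blast
  \<comment> \<open>For the converse inclusion: the rational integers in the product form a group
    that contains every norm \<open>a cnj a\<close>, hence also the gcd of these norms, which is
    \<open>nrm I\<close>.\<close>
  define M where "M = {x :: int. of_int x \<in> I \<odot> cj I}"
  define S where "S = {k. \<exists>a\<in>I. real k = (cmod a)\<^sup>2}"
  obtain a where a: "a \<in> I" "a \<noteq> 0" using I nzi_nonzero by blast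
  obtain k where k: "(cmod a)\<^sup>2 = real k" using OK_norm nzi_OK_mem I a by metis
  have k0: "k \<in> S" "k > 0"
  proof -
    show "k \<in> S" unfolding S_def using a k by force
    show "k > 0" using k a by (metis gr0I of_nat_0 zero_eq_power2 norm_eq_zero)
  qed
  have "int (Gcd S) \<in> M"
  proof (rule int_subgroup_contains_Gcd[OF _ _ _ k0])
    show "x - y \<in> M" if "x \<in> M" "y \<in> M" for x y using that nzi_diff[OF P] by (auto simp: M_def)
    show "k * x \<in> M" if "x \<in> M" for x k using that nzi_mult[OF P, of "of_int x" "of_int k"] by (auto simp: M_def)
    show "int k \<in> M" if "k \<in> S" for k
    proof -
      obtain a where a: "a \<in> I" "real k = (cmod a)\<^sup>2" using \<open>k \<in> S\<close> unfolding S_def by blast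
      have "a * cnj a = of_nat k" using a(2) by (metis complex_norm_square of_real_of_nat_eq)
      thus ?thesis using prd_mem[OF a(1) cjI[OF a(1)]] by (simp add: M_def)
    qed
  qed
  hence "of_nat ?g \<in> I \<odot> cj I" by (simp add: M_def S_def nrm_def)
  thus "smul (of_nat ?g) OK \<subseteq> I \<odot> cj I" using nzi_mult_right[OF P] by (auto simp: smul_def)
qed

text \<open>The quotient of \<open>a\<close> and \<open>b\<close> and its inverse both lie in
  \<open>OK\<close>, so their squares are natural numbers with product 1.\<close>

lemma pos_real_smul_OK_eq:
  fixes a b :: real
  assumes "a > 0" "b > 0" and e: "smul (of_real a) OK = smul (of_real b) OK"
  shows "a = b"
proof -
  have "of_real a * 1 \<in> smul (of_real b) OK" unfolding e[symmetric] by (rule smulI) simp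
  hence 1: "of_real a / of_real b \<in> OK" using smul_mem_iff[of "of_real b" "of_real a" OK] assms by simp
  have "of_real b * 1 \<in> smul (of_real a) OK" unfolding e by (rule smulI) simp
  hence 2: "of_real b / of_real a \<in> OK" using smul_mem_iff[of "of_real a" "of_real b" OK] assms by simp
  obtain k where k: "(cmod (of_real a / of_real b))\<^sup>2 = real k" using OK_norm[OF 1] by metis
  obtain l where l: "(cmod (of_real b / of_real a))\<^sup>2 = real l" using OK_norm[OF 2] by metis
  have kl: "(a / b)\<^sup>2 = real k" "(b / a)\<^sup>2 = real l" using k l assms by (simp_all add: norm_divide)
  have "real (k * l) = 1" unfolding of_nat_mult kl[symmetric] using assms by (simp add: power_divide)
  hence "k = 1" by (metis nat_mult_eq_1_iff of_nat_1 of_nat_eq_iff)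
  hence "(a / b)\<^sup>2 = 1\<^sup>2" using kl by simp
  hence "a / b = 1" using assms by (subst (asm) power2_eq_iff_nonneg) auto
  thus ?thesis using assms by simp
qed

lemma nrm_unique:
  assumes "nzi I" "I \<odot> cj I = smul (of_real x) OK" "x > 0"
  shows "real (nrm I) = x"
  using pos_real_smul_OK_eq[of "real (nrm I)" x] assms prd_cj[OF assms(1)] nrm_pos[OF assms(1)] by simp


lemma nrm_prd:
  assumes I: "nzi I" and J: "nzi J"
  shows "nrm (I \<odot> J) = nrm I * nrm J"
proof -
  have c: "nzi (cj I)" "nzi (cj J)" using I J by blast+
  have "(I \<odot> J) \<odot> cj (I \<odot> J) = I \<odot> (J \<odot> (cj I \<odot> cj J))"
    unfolding cj_prd using I J c by (simp add: prd_assoc nzi_prd)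
  also have "J \<odot> (cj I \<odot> cj J) = cj I \<odot> (J \<odot> cj J)"
    using I J c by (metis prd_assoc prd_commute)
  also have "I \<odot> (cj I \<odot> (J \<odot> cj J)) = (I \<odot> cj I) \<odot> (J \<odot> cj J)"
    using I J c by (simp add: prd_assoc nzi_prd)
  also have "\<dots> = smul (of_nat (nrm I) * of_nat (nrm J)) OK"
    unfolding prd_cj[OF I] prd_cj[OF J] using nrm_pos[OF J] by (subst smul_OK_prd) (auto intro!: nzi_smul_OK)
  finally have "real (nrm (I \<odot> J)) = real (nrm I) * real (nrm J)"
    by (intro nrm_unique) (use I J nrm_pos in \<open>auto intro!: mult_pos_pos\<close>)
  thus ?thesis by (simp flip: of_nat_mult)
qed

lemma nrm_smul:
  assumes I: "nzi I" and cI: "nzi (smul c I)" and c: "c \<noteq> 0"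
  shows "real (nrm (smul c I)) = (cmod c)\<^sup>2 * real (nrm I)"
proof (rule nrm_unique[OF cI])
  have cc: "nzi (cj (smul c I))" using cI by blast
  have "smul c I \<odot> cj (smul c I) = smul c (cj (smul c I) \<odot> I)"
    unfolding smul_prd using prd_commute[OF I cc] by simp
  also have "cj (smul c I) \<odot> I = smul (cnj c) (I \<odot> cj I)"
    unfolding cj_smul smul_prd using prd_commute[OF nzi_cj[OF I] I] by simp
  finally show "smul c I \<odot> cj (smul c I) = smul (of_real ((cmod c)\<^sup>2 * real (nrm I))) OK"
    unfolding prd_cj[OF I] by (simp only: of_real_mult complex_norm_square smul_smul of_real_of_nat_eq mult.assoc)
qed (use c nrm_pos[OF I] in auto)

lemma nrm_cj: assumes "nzi I" shows "nrm (cj I) = nrm I"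
proof -
  have "real (nrm (cj I)) = real (nrm I)"
    using nrm_unique[OF nzi_cj[OF assms], of "real (nrm I)"] nrm_pos[OF assms] prd_cj[OF assms]
      prd_commute[OF nzi_cj[OF assms] assms] by simp
  thus ?thesis by simp
qed


text \<open>The products \<open>I cj I\<close>, \<open>I cj J\<close> and \<open>J cj J\<close> form
  an increasing chain whose ends agree, so \<open>I cj J = J cj J\<close>. Multiplying by
  \<open>J\<close> and cancelling the integer \<open>nrm J\<close> gives the claim.\<close>

lemma eq_if_subset_nrm_eq:
  assumes I: "nzi I" and J: "nzi J" and "I \<subseteq> J" "nrm I = nrm J"
  shows "I = J"
proof -
  let ?g = "of_nat (nrm J) :: complex"
  have g0: "?g \<noteq> 0" using nrm_pos[OF J] by simp
  have c: "nzi (cj I)" "nzi (cj J)" using I J by blast+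
  have sub: "cj I \<subseteq> cj J" using assms(3) unfolding cj_def by blast
  have "I \<odot> cj J \<subseteq> J \<odot> cj J" using assms(3) by (intro prd_mono) auto
  moreover have "J \<odot> cj J = I \<odot> cj I" using prd_cj I J assms(4) by simp
  moreover have "I \<odot> cj I \<subseteq> I \<odot> cj J" using sub by (intro prd_mono) auto
  ultimately have e: "I \<odot> cj J = J \<odot> cj J" by blast
  have "smul ?g I = smul ?g OK \<odot> I" using smul_OK_prd[OF I] by simp
  also have "\<dots> = (J \<odot> cj J) \<odot> I" unfolding prd_cj[OF J] ..
  also have "\<dots> = (I \<odot> cj J) \<odot> J" using I J c by (metis prd_assoc prd_commute nzi_prd)
  also have "\<dots> = (J \<odot> cj J) \<odot> J" unfolding e ..
  also have "\<dots> = smul ?g J" unfolding prd_cj[OF J] by (rule smul_OK_prd[OF J])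
  finally show ?thesis using smul_inject[OF g0] by blast
qed

section \<open>The class group and its finiteness\<close>

abbreviation rel :: "(complex set \<times> complex set) set" where "rel \<equiv> ideal_class_rel R"

lemma rel_iff: "(I, J) \<in> rel \<longleftrightarrow> nzi I \<and> nzi J \<and> (\<exists>c\<in>K. c \<noteq> 0 \<and> J = smul c I)"
proof -
  have "(I, J) \<in> rel \<longleftrightarrow> nzi I \<and> nzi J \<and> (\<exists>a\<in>OK - {0}. \<exists>b\<in>OK - {0}. smul a I = smul b J)"
    unfolding ideal_class_rel_def by (simp add: nonzero_ideals_iff smul_def)
  also have "(\<exists>a\<in>OK - {0}. \<exists>b\<in>OK - {0}. smul a I = smul b J) \<longleftrightarrow> (\<exists>c\<in>K. c \<noteq> 0 \<and> J = smul c I)"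
  proof
    assume "\<exists>a\<in>OK - {0}. \<exists>b\<in>OK - {0}. smul a I = smul b J"
    then obtain a b where ab: "a \<in> OK" "b \<in> OK" "a \<noteq> 0" "b \<noteq> 0" "smul a I = smul b J" by blast
    have "J = smul (1 / b) (smul b J)" using ab by simp
    also have "\<dots> = smul (a / b) I" unfolding ab(5)[symmetric] by simp
    finally show "\<exists>c\<in>K. c \<noteq> 0 \<and> J = smul c I" using ab OK_K by (intro bexI[of _ "a / b"]) auto
  next
    assume "\<exists>c\<in>K. c \<noteq> 0 \<and> J = smul c I"
    then obtain c where c: "c \<in> K" "c \<noteq> 0" "J = smul c I" by blast
    obtain d where d: "d > 0" "of_nat d * c \<in> OK" using K_scale[OF c(1)] .
    show "\<exists>a\<in>OK - {0}. \<exists>b\<in>OK - {0}. smul a I = smul b J"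
      by (rule bexI[of _ "of_nat d * c"], rule bexI[of _ "of_nat d"]) (use c d in auto)
  qed
  finally show ?thesis by blast
qed

lemma relI: "nzi I \<Longrightarrow> nzi J \<Longrightarrow> c \<in> K \<Longrightarrow> c \<noteq> 0 \<Longrightarrow> J = smul c I \<Longrightarrow> (I, J) \<in> rel"
  unfolding rel_iff by blast

lemma equiv_rel: "equiv (nonzero_ideals R) rel"
proof (rule equivI)
  show "rel \<subseteq> nonzero_ideals R \<times> nonzero_ideals R" by (auto simp: rel_iff nonzero_ideals_iff)
  show "refl_on (nonzero_ideals R) rel"
    by (rule refl_onI) (auto simp: nonzero_ideals_iff intro!: relI[of _ _ 1])
  show "sym rel"
  proof (rule symI)
    fix I J assume "(I, J) \<in> rel"
    then obtain c where c: "nzi I" "nzi J" "c \<in> K" "c \<noteq> 0" "J = smul c I" unfolding rel_iff by blast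
    show "(J, I) \<in> rel" by (rule relI[of _ _ "1 / c"]) (use c in auto)
  qed
  show "trans rel"
  proof (rule transI)
    fix I J L assume "(I, J) \<in> rel" "(J, L) \<in> rel"
    then obtain c d where c: "nzi I" "nzi L" "c \<in> K" "c \<noteq> 0" "J = smul c I" "d \<in> K" "d \<noteq> 0" "L = smul d J"
      unfolding rel_iff by blast
    show "(I, L) \<in> rel" by (rule relI[of _ _ "d * c"]) (use c in auto)
  qed
qed

definition cls :: "complex set \<Rightarrow> complex set set" where "cls I = rel `` {I}"

lemma cls_eq_iff: "nzi I \<Longrightarrow> nzi J \<Longrightarrow> cls I = cls J \<longleftrightarrow> (\<exists>c\<in>K. c \<noteq> 0 \<and> J = smul c I)"
  unfolding cls_def using eq_equiv_class_iff[OF equiv_rel, of I J] by (simp add: nonzero_ideals_iff rel_iff)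

lemma cls_eqI: "nzi I \<Longrightarrow> nzi J \<Longrightarrow> c \<in> K \<Longrightarrow> c \<noteq> 0 \<Longrightarrow> J = smul c I \<Longrightarrow> cls I = cls J"
  using cls_eq_iff by blast

lemma cls_smul: "nzi I \<Longrightarrow> c \<in> OK \<Longrightarrow> c \<noteq> 0 \<Longrightarrow> cls (smul c I) = cls I"
  using cls_eqI[of I "smul c I" c] nzi_smul_OK OK_K by auto

lemma mem_cls: "J \<in> cls I \<longleftrightarrow> nzi I \<and> nzi J \<and> (\<exists>c\<in>K. c \<noteq> 0 \<and> J = smul c I)"
  unfolding cls_def by (simp add: rel_iff)

lemma self_cls: "nzi I \<Longrightarrow> I \<in> cls I"
  unfolding mem_cls by (auto intro!: bexI[of _ 1])

text \<open>The carrier is the set counted by \<open>class_number\<close>. Multiplication is a union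
  over all representatives, so that none has to be chosen; \<open>cls_mult\<close> shows that the
  united classes coincide.\<close>

definition CG :: "complex set set monoid" where
  "CG = \<lparr>carrier = nonzero_ideals R // rel, monoid.mult = (\<lambda>X Y. \<Union>I\<in>X. \<Union>J\<in>Y. cls (I \<odot> J)), one = cls OK\<rparr>"

lemma CG_one: "\<one>\<^bsub>CG\<^esub> = cls OK" by (simp add: CG_def)

lemma cls_carrier: "nzi I \<Longrightarrow> cls I \<in> carrier CG"
  unfolding CG_def cls_def by (simp add: quotientI nonzero_ideals_iff)

lemma carrier_cls: assumes "X \<in> carrier CG" obtains I where "nzi I" "X = cls I"
  using assms unfolding CG_def cls_def by (auto elim!: quotientE simp: nonzero_ideals_iff)

lemma cls_mult:
  assumes I: "nzi I" and J: "nzi J"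
  shows "cls I \<otimes>\<^bsub>CG\<^esub> cls J = cls (I \<odot> J)"
proof -
  have c: "cls (I' \<odot> J') = cls (I \<odot> J)" if IJ: "I' \<in> cls I" "J' \<in> cls J" for I' J'
  proof -
    obtain a where a: "nzi I'" "a \<in> K" "a \<noteq> 0" "I' = smul a I" using IJ(1) unfolding mem_cls by blast
    obtain b where b: "nzi J'" "b \<in> K" "b \<noteq> 0" "J' = smul b J" using IJ(2) unfolding mem_cls by blast
    have "I' \<odot> J' = smul a (I \<odot> J')" unfolding a(4) by (rule smul_prd)
    also have "I \<odot> J' = J' \<odot> I" using prd_commute I b(1) by blast
    also have "J' \<odot> I = smul b (J \<odot> I)" unfolding b(4) by (rule smul_prd)
    also have "J \<odot> I = I \<odot> J" using prd_commute I J by blast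
    finally have e: "I' \<odot> J' = smul (a * b) (I \<odot> J)" by simp
    show ?thesis by (rule cls_eqI[OF nzi_prd[OF I J] nzi_prd[OF a(1) b(1)] _ _ e, symmetric]) (use a b in auto)
  qed
  have "cls I \<otimes>\<^bsub>CG\<^esub> cls J = (\<Union>I'\<in>cls I. \<Union>J'\<in>cls J. cls (I' \<odot> J'))" by (simp add: CG_def)
  also have "\<dots> = cls (I \<odot> J)" using c self_cls[OF I] self_cls[OF J] by blast
  finally show ?thesis .
qed

lemma comm_group_CG: "comm_group CG"
proof (rule comm_groupI)
  show "\<one>\<^bsub>CG\<^esub> \<in> carrier CG" by (simp add: CG_one cls_carrier)
next
  fix X Y assume "X \<in> carrier CG" "Y \<in> carrier CG"
  then obtain I J where IJ: "nzi I" "nzi J" "X = cls I" "Y = cls J" by (metis carrier_cls)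
  thus "X \<otimes>\<^bsub>CG\<^esub> Y \<in> carrier CG" by (simp add: cls_mult cls_carrier nzi_prd)
  show "X \<otimes>\<^bsub>CG\<^esub> Y = Y \<otimes>\<^bsub>CG\<^esub> X" using IJ by (simp add: cls_mult prd_commute)
next
  fix X Y Z assume "X \<in> carrier CG" "Y \<in> carrier CG" "Z \<in> carrier CG"
  then obtain I J L where IJ: "nzi I" "nzi J" "nzi L" "X = cls I" "Y = cls J" "Z = cls L" by (metis carrier_cls)
  thus "X \<otimes>\<^bsub>CG\<^esub> Y \<otimes>\<^bsub>CG\<^esub> Z = X \<otimes>\<^bsub>CG\<^esub> (Y \<otimes>\<^bsub>CG\<^esub> Z)" by (simp add: cls_mult prd_assoc nzi_prd)
next
  fix X assume "X \<in> carrier CG"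
  then obtain I where I: "nzi I" "X = cls I" by (metis carrier_cls)
  show "\<one>\<^bsub>CG\<^esub> \<otimes>\<^bsub>CG\<^esub> X = X" using I by (simp add: CG_one cls_mult OK_prd)
  have "cls (cj I) \<otimes>\<^bsub>CG\<^esub> X = cls (smul (of_nat (nrm I)) OK)"
    using I prd_cj[OF I(1)] prd_commute[of "cj I" I] by (simp add: cls_mult nzi_cj)
  also have "\<dots> = \<one>\<^bsub>CG\<^esub>" using nrm_pos[OF I(1)] by (simp add: CG_one cls_smul)
  finally show "\<exists>Y\<in>carrier CG. Y \<otimes>\<^bsub>CG\<^esub> X = \<one>\<^bsub>CG\<^esub>" using I by (intro bexI[of _ "cls (cj I)"]) (auto intro: cls_carrier)
qed

lemma h_neg_card: "h_neg m = card (carrier CG)"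
  by (simp add: h_neg_def class_number_def CG_def)

text \<open>An ideal containing \<open>F\<close> is a union of residue classes modulo
  \<open>F\<close>, so it is determined by its members among finitely many representatives.\<close>

lemma finite_ideals_containing:
  assumes "F > 0"
  shows "finite {J. nzi J \<and> of_nat F \<in> J}"
proof -
  \<comment> \<open>Coordinates are reduced modulo \<open>2 F\<close>: a shift by multiples of
    \<open>2 F\<close> is \<open>F\<close> times an element with even coordinates, which is integral
    whatever \<open>m\<close> is modulo 4.\<close>
  define Rep where "Rep = (\<lambda>(X, Y). el X Y) ` ({0..<2 * int F} \<times> {0..<2 * int F})"
  have sub: "J \<subseteq> J'" if J: "nzi J" "of_nat F \<in> J" and J': "nzi J'" "of_nat F \<in> J'" and e: "J \<inter> Rep = J' \<inter> Rep" for J J'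
  proof
    fix x assume x: "x \<in> J"
    obtain X Y where XY: "par X Y" "x = el X Y" using nzi_OK_mem[OF J(1) x] OK_E by metis
    define x' where "x' = el (X mod (2 * int F)) (Y mod (2 * int F))"
    define z where "z = el (2 * (X div (2 * int F))) (2 * (Y div (2 * int F)))"
    have zO: "z \<in> OK" unfolding OK_iff z_def by (intro exI conjI) (auto simp: par_def)
    have shift: "el (i + 2 * int F * k) (j + 2 * int F * l) = el i j + of_nat F * el (2 * k) (2 * l)" for i j k l
      by (simp add: el_def complex_eq_iff field_simps)
    have xz: "x = x' + of_nat F * z"
      unfolding XY(2) x'_def z_def shift[symmetric] by (simp only: mod_mult_div_eq)
    have Rx: "x' \<in> Rep" unfolding Rep_def x'_def using assms by (intro image_eqI[of _ _ "(X mod (2 * int F), Y mod (2 * int F))"]) auto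
    have "x' = x - of_nat F * z" using xz by simp
    hence "x' \<in> J" using nzi_diff[OF J(1) x nzi_mult_right[OF J zO]] by simp
    hence "x' \<in> J'" using Rx e by blast
    thus "x \<in> J'" unfolding xz using nzi_add[OF J'(1) _ nzi_mult_right[OF J' zO]] by blast
  qed
  have "inj_on (\<lambda>J. J \<inter> Rep) {J. nzi J \<and> of_nat F \<in> J}"
    by (rule inj_onI) (use sub in blast)
  moreover have "(\<lambda>J. J \<inter> Rep) ` {J. nzi J \<and> of_nat F \<in> J} \<subseteq> Pow Rep" by blast
  moreover have "finite (Pow Rep)" by (simp add: Rep_def)
  ultimately show ?thesis by (meson finite_imageD finite_subset)
qed

text \<open>Simultaneous Dirichlet approximation of the two coordinates with multipliers up to
  \<open>N^2\<close> leaves errors below \<open>1 / N\<close>, and \<open>N >= 1 + sqrt m\<close>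
  brings the distance below 1. The bound \<open>M\<close> is uniform in \<open>z\<close>.\<close>

lemma multiple_near_integer:
  obtains M :: nat where "\<And>z. z \<in> K \<Longrightarrow> \<exists>k\<in>{1..M}. \<exists>c\<in>OK. cmod (of_nat k * z - c) < 1"
proof -
  define N where "N = nat \<lceil>1 + sqrt m\<rceil>"
  have N: "real N \<ge> 1 + sqrt m" unfolding N_def by (rule of_nat_ceiling)
  have "sqrt m \<ge> 0" by simp
  hence "real N > 0" using N by linarith
  hence N0: "N > 0" by simp
  show ?thesis
  proof (rule that[of "N ^ 2"])
    fix z assume "z \<in> K"
    define th where "th = (\<lambda>i::nat. if i = 0 then Re z else Im z / sqrt m)"
    obtain q p where q: "0 < q" "q \<le> int (N ^ 2)" "\<And>i. i < 2 \<Longrightarrow> \<bar>of_int q * th i - of_int (p i)\<bar> < 1 / N"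
      using Dirichlet_approx_simult[OF N0, of 2 th] by metis
    define c where "c = of_int (p 0) + of_int (p 1) * w"
    have cO: "c \<in> OK" unfolding c_def by (intro OK_add OK_mult) auto
    have s0: "sqrt m > 0" using m_pos by simp
    have q0: "\<bar>of_int q * Re z - of_int (p 0)\<bar> < 1 / N" using q(3)[of 0] by (simp add: th_def)
    have q1: "\<bar>of_int q * (Im z / sqrt m) - of_int (p 1)\<bar> < 1 / N" using q(3)[of 1] by (simp add: th_def)
    have "cmod (of_int q * z - c) \<le> \<bar>Re (of_int q * z - c)\<bar> + \<bar>Im (of_int q * z - c)\<bar>" by (rule cmod_le)
    also have "Re (of_int q * z - c) = of_int q * Re z - of_int (p 0)" by (simp add: c_def w_def)
    also have "Im (of_int q * z - c) = (of_int q * (Im z / sqrt m) - of_int (p 1)) * sqrt m"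
      using s0 by (simp add: c_def w_def field_simps)
    also have "\<bar>(of_int q * (Im z / sqrt m) - of_int (p 1)) * sqrt m\<bar> = \<bar>of_int q * (Im z / sqrt m) - of_int (p 1)\<bar> * sqrt m"
      using s0 by (simp add: abs_mult)
    also have "\<bar>of_int q * Re z - of_int (p 0)\<bar> + \<bar>of_int q * (Im z / sqrt m) - of_int (p 1)\<bar> * sqrt m < 1 / N + 1 / N * sqrt m"
      using q0 q1 s0 by (intro add_strict_mono mult_strict_right_mono) auto
    also have "\<dots> = (1 + sqrt m) / N" by (simp add: add_divide_distrib)
    also have "\<dots> \<le> 1" using N N0 by simp
    finally have lt: "cmod (of_int q * z - c) < 1" .
    have "of_nat (nat q) = (of_int q :: complex)" using q(1) by simp
    moreover have "nat q \<in> {1..N ^ 2}" using q(1,2) by (auto simp: nat_le_iff)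
    ultimately show "\<exists>k\<in>{1..N ^ 2}. \<exists>c\<in>OK. cmod (of_nat k * z - c) < 1"
      using lt cO by metis
  qed
qed

text \<open>Hurwitz's argument: let \<open>b\<close> be a nonzero element of least norm in
  \<open>I\<close>. For \<open>a\<close> in \<open>I\<close> some \<open>k a - c b\<close> with
  \<open>k <= M\<close> has smaller norm, hence is 0, so \<open>M! a / b\<close> is integral. Thus
  each class contains an ideal containing \<open>M!\<close>.\<close>

lemma finite_CG: "finite (carrier CG)"
proof -
  obtain M :: nat where M: "\<And>z. z \<in> K \<Longrightarrow> \<exists>k\<in>{1..M}. \<exists>c\<in>OK. cmod (of_nat k * z - c) < 1"
    using multiple_near_integer by blast
  define F where "F = (fact M :: nat)"
  have "carrier CG \<subseteq> cls ` {J. nzi J \<and> of_nat F \<in> J}"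
  proof
    fix X assume "X \<in> carrier CG"
    then obtain I where I: "nzi I" "X = cls I" by (metis carrier_cls)
    define P where "P = (\<lambda>k. \<exists>b\<in>I. b \<noteq> 0 \<and> (cmod b)\<^sup>2 = real k)"
    have "\<exists>k. P k"
    proof -
      obtain a where a: "a \<in> I" "a \<noteq> 0" using I(1) nzi_nonzero by blast
      obtain k where "(cmod a)\<^sup>2 = real k" using OK_norm nzi_OK_mem I(1) a by metis
      thus ?thesis unfolding P_def using a by blast
    qed
    hence PL: "P (LEAST k. P k)" by (rule LeastI_ex)
    then obtain b where b: "b \<in> I" "b \<noteq> 0" "(cmod b)\<^sup>2 = real (LEAST k. P k)" unfolding P_def by blast
    have bO: "b \<in> OK" using nzi_OK_mem[OF I(1) b(1)] .
    have dvd: "of_nat F * a / b \<in> OK" if a: "a \<in> I" for a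
    proof -
      have aO: "a \<in> OK" using nzi_OK_mem[OF I(1) a] .
      have "a / b \<in> K" using aO bO OK_K by blast
      then obtain k c where k: "k \<in> {1..M}" "c \<in> OK" "cmod (of_nat k * (a / b) - c) < 1" using M by blast
      define x where "x = of_nat k * a - c * b"
      have xI: "x \<in> I" unfolding x_def using nzi_diff[OF I(1)] nzi_mult[OF I(1)] a b(1) k(2) by simp
      have "x = (of_nat k * (a / b) - c) * b" using b(2) by (simp add: x_def field_simps)
      hence "cmod x = cmod (of_nat k * (a / b) - c) * cmod b" by (simp add: norm_mult)
      also have "\<dots> < 1 * cmod b" using k(3) b(2) by (intro mult_strict_right_mono) auto
      finally have "(cmod x)\<^sup>2 < (cmod b)\<^sup>2" by (intro power_strict_mono) auto
      hence lt: "(cmod x)\<^sup>2 < real (LEAST k. P k)" unfolding b(3) .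
      obtain j where j: "(cmod x)\<^sup>2 = real j" using OK_norm nzi_OK_mem I(1) xI by metis
      have "j < (LEAST k. P k)" using lt unfolding j by simp
      hence "\<not> P j" by (rule not_less_Least)
      hence "x = 0" using xI j unfolding P_def by blast
      hence kab: "of_nat k * a = c * b" by (simp add: x_def)
      have "k dvd F" unfolding F_def using k(1) by (intro dvd_fact) auto
      then obtain l where l: "F = l * k" by (metis dvd_def mult.commute)
      have "of_nat F * a / b = of_nat l * (of_nat k * a) / b" by (simp add: l)
      also have "\<dots> = of_nat l * c" unfolding kab using b(2) by simp
      finally show ?thesis using k(2) by auto
    qed
    define J where "J = smul (of_nat F / b) I"
    have F0: "F > 0" by (simp add: F_def)
    have fb: "of_nat F / b \<noteq> 0" "of_nat F / b \<in> K" using F0 b(2) bO OK_K by auto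
    have J: "nzi J" unfolding J_def
      by (rule nzi_smul[OF I(1) fb(1)]) (use dvd in \<open>auto simp: smul_def\<close>)
    have "of_nat F / b * b \<in> J" unfolding J_def by (rule smulI[OF b(1)])
    hence "of_nat F \<in> J" using b(2) by simp
    moreover have "cls I = cls J" by (rule cls_eqI[OF I(1) J fb(2,1)]) (simp add: J_def)
    ultimately show "X \<in> cls ` {J. nzi J \<and> of_nat F \<in> J}" using I(2) J by blast
  qed
  moreover have "finite {J. nzi J \<and> of_nat F \<in> J}" by (rule finite_ideals_containing) (simp add: F_def)
  ultimately show ?thesis by (meson finite_surj)
qed

end

section \<open>Squares in the class group, norms, and ideals above ramified primes\<close>

context imag_quad
begin

interpretation CG: comm_group CG by (rule comm_group_CG)

lemma knorm_iff_K: assumes "a > 0" shows "knorm m a \<longleftrightarrow> (\<exists>c\<in>K. c \<noteq> 0 \<and> (cmod c)\<^sup>2 = real a)"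
proof
  assume "knorm m a"
  then obtain u v y where 1: "u \<noteq> 0" "int a * u\<^sup>2 = v\<^sup>2 + int m * y\<^sup>2" unfolding knorm_def by blast
  define c where "c = (of_int v + of_int y * w) / of_int u"
  have cK: "c \<in> K" unfolding c_def by (intro K_divide K_add K_mult) auto
  have "(cmod (of_int v + of_int y * w))\<^sup>2 = of_int (v\<^sup>2 + int m * y\<^sup>2)"
    unfolding cmod_power2 by (simp add: w_def power_mult_distrib)
  also have "\<dots> = real a * (of_int u)\<^sup>2" unfolding 1(2)[symmetric] by simp
  finally have "(cmod c)\<^sup>2 = real a" using 1(1) by (simp add: c_def norm_divide power_divide)
  moreover from this have "c \<noteq> 0" using assms by auto
  ultimately show "\<exists>c\<in>K. c \<noteq> 0 \<and> (cmod c)\<^sup>2 = real a" using cK by blast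
next
  assume "\<exists>c\<in>K. c \<noteq> 0 \<and> (cmod c)\<^sup>2 = real a"
  then obtain c where c: "c \<in> K" "(cmod c)\<^sup>2 = real a" by blast
  obtain d where d: "d > 0" "of_nat d * c \<in> OK" using K_scale[OF c(1)] .
  obtain X Y where XY: "of_nat d * c = el X Y" using OK_E[OF d(2)] by metis
  have "of_int (X\<^sup>2 + int m * Y\<^sup>2) = 4 * (cmod (of_nat d * c))\<^sup>2" unfolding XY el_norm ..
  also have "\<dots> = of_int (int a * (2 * int d)\<^sup>2)" by (simp add: norm_mult power_mult_distrib c(2))
  finally have "int a * (2 * int d)\<^sup>2 = X\<^sup>2 + int m * Y\<^sup>2" using of_int_eq_iff by metis
  moreover have "2 * int d \<noteq> 0" using d(1) by simp
  ultimately show "knorm m a" unfolding knorm_def by blast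
qed

definition sm :: "complex set \<Rightarrow> complex set \<Rightarrow> complex set" where
  "sm I J = {x + y |x y. x \<in> I \<and> y \<in> J}"

lemma smI: "x \<in> I \<Longrightarrow> y \<in> J \<Longrightarrow> x + y \<in> sm I J" unfolding sm_def by blast

lemma sm_left: "nzi J \<Longrightarrow> x \<in> I \<Longrightarrow> x \<in> sm I J" using smI[of x I 0 J] nzi_0 by simp
lemma sm_right: "nzi I \<Longrightarrow> x \<in> J \<Longrightarrow> x \<in> sm I J" using smI[of 0 I x J] nzi_0 by simp

lemma nzi_sm: assumes I: "nzi I" and J: "nzi J" shows "nzi (sm I J)"
proof -
  obtain a where a: "a \<in> I" "a \<noteq> 0" using I nzi_nonzero by blast
  show ?thesis
  proof (rule nziI[of _ a])
    show "sm I J \<subseteq> OK" using nzi_OK_mem I J by (auto simp: sm_def)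
    show "0 \<in> sm I J" using sm_left[OF J nzi_0[OF I]] .
    show "a \<in> sm I J" using sm_left[OF J a(1)] .
    show "x + y \<in> sm I J" if xy: "x \<in> sm I J" "y \<in> sm I J" for x y
    proof -
      obtain x1 x2 y1 y2 where h: "x = x1 + x2" "y = y1 + y2" "x1 \<in> I" "x2 \<in> J" "y1 \<in> I" "y2 \<in> J"
        using xy unfolding sm_def by blast
      have "x + y = (x1 + y1) + (x2 + y2)" unfolding h by simp
      thus ?thesis using smI[OF nzi_add[OF I h(3,5)] nzi_add[OF J h(4,6)]] by simp
    qed
    show "y * x \<in> sm I J" if xy: "x \<in> sm I J" "y \<in> OK" for x y
    proof -
      obtain x1 x2 where h: "x = x1 + x2" "x1 \<in> I" "x2 \<in> J" using xy unfolding sm_def by blast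
      thus ?thesis using smI[OF nzi_mult[OF I h(2) xy(2)] nzi_mult[OF J h(3) xy(2)]] by (simp add: distrib_left)
    qed
  qed (rule a)
qed

lemma cls_cj_mult: "nzi I \<Longrightarrow> cls I \<otimes>\<^bsub>CG\<^esub> cls (cj I) = \<one>\<^bsub>CG\<^esub>"
  using nrm_pos[of I] by (simp add: cls_mult nzi_cj prd_cj CG_one cls_smul)

text \<open>\<open>J J = c I\<close> implies \<open>nrm J ^ 2 = |c|^2 nrm I\<close>, so
  \<open>nrm J / c\<close> is an element of norm \<open>nrm I\<close>. Together with
  \<open>square_if_knorm_nrm\<close> this is the principal genus theorem.\<close>

lemma knorm_nrm_if_square:
  assumes I: "nzi I" and J: "nzi J" and e: "cls I = cls J \<otimes>\<^bsub>CG\<^esub> cls J"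
  shows "knorm m (nrm I)"
proof -
  have JJ: "nzi (J \<odot> J)" using J by blast
  have "cls I = cls (J \<odot> J)" using e J by (simp add: cls_mult)
  then obtain c where c: "c \<in> K" "c \<noteq> 0" "J \<odot> J = smul c I" using cls_eq_iff[OF I JJ] by blast
  have "real (nrm (J \<odot> J)) = (cmod c)\<^sup>2 * real (nrm I)"
    using nrm_smul[OF I _ c(2)] JJ unfolding c(3) by blast
  hence n: "(real (nrm J))\<^sup>2 = (cmod c)\<^sup>2 * real (nrm I)" using J by (simp add: nrm_prd power2_eq_square)
  have "(cmod (of_nat (nrm J) / c))\<^sup>2 = real (nrm I)"
    using n c(2) by (simp add: norm_divide power_divide field_simps)
  moreover have "of_nat (nrm J) / c \<in> K" "of_nat (nrm J) / c \<noteq> 0" using c nrm_pos[OF J] by auto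
  ultimately show ?thesis using knorm_iff_K[OF nrm_pos[OF I]] by blast
qed

text \<open>Ideal version of Hilbert 90: if \<open>I\<close> has the norm of an element \<open>c\<close>, then \<open>I / c\<close> has
  norm one, hence it is \<open>J / cj J\<close> with \<open>J\<close> generated by \<open>I / c\<close> and \<open>1\<close>.\<close>

lemma square_if_knorm_nrm:
  assumes I: "nzi I" and kn: "knorm m (nrm I)"
  obtains J where "nzi J" "cls I = cls J \<otimes>\<^bsub>CG\<^esub> cls J"
proof -
  obtain c0 where c0: "c0 \<in> K" "c0 \<noteq> 0" "(cmod c0)\<^sup>2 = real (nrm I)"
    using kn knorm_iff_K[OF nrm_pos[OF I]] by blast
  obtain d where d: "d > 0" "of_nat d * c0 \<in> OK" using K_scale[OF c0(1)] .
  define c where "c = of_nat d * c0"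
  define D where "D = (of_nat d :: complex)"
  have cO: "c \<in> OK" "c \<noteq> 0" using d c0 by (auto simp: c_def)
  have D: "D \<in> OK" "D \<noteq> 0" "cnj D = D" using d by (auto simp: D_def)
  have cc: "c * cnj c = D * D * of_nat (nrm I)"
  proof -
    have "c0 * cnj c0 = of_nat (nrm I)" using c0(3) by (metis complex_norm_square of_real_of_nat_eq)
    thus ?thesis unfolding c_def D_def by (simp add: mult_ac)
  qed
  \<comment> \<open>As \<open>c = D c0\<close>, this is \<open>c\<close> times the fractional ideal
    generated by 1 and \<open>I / c0\<close>, made integral.\<close>
  define J where "J = sm (smul c OK) (smul D I)"
  have nc: "nzi (smul c OK)" and nd: "nzi (smul D I)" using nzi_smul_OK I cO D by auto
  have J: "nzi J" unfolding J_def by (rule nzi_sm[OF nc nd])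
  have cJ: "nzi (cj J)" using J by blast
  have ncJ: "nzi (smul (cnj c) J)" using nzi_smul_OK[OF J] cO by auto
  \<comment> \<open>Conjugation inverts \<open>I / c0\<close>: for \<open>x\<close>,
    \<open>y\<close> in \<open>I\<close> the product \<open>D^2 x cnj y\<close> lies in the ideal
    generated by \<open>D^2 nrm I = c cnj c\<close>.\<close>
  have e: "smul D I \<odot> cj J = smul (cnj c) J"
  proof
    show "smul D I \<odot> cj J \<subseteq> smul (cnj c) J"
    proof (rule prd_subset)
      fix a b assume "a \<in> smul D I" "b \<in> cj J"
      then obtain x y o' where x: "x \<in> I" "a = D * x" and y: "o' \<in> OK" "y \<in> I" "cnj b = c * o' + D * y"
        unfolding cj_iff J_def sm_def smul_def by blast
      have b: "b = cnj c * cnj o' + D * cnj y" using arg_cong[OF y(3), of cnj] D(3) by simp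
      have "x * cnj y \<in> smul (of_nat (nrm I)) OK" unfolding prd_cj[OF I, symmetric]
        using prd_mem[OF x(1) cjI[OF y(2)]] .
      then obtain z where z: "z \<in> OK" "x * cnj y = of_nat (nrm I) * z" by (auto simp: smul_def)
      have "a * b = cnj c * (D * (x * cnj o')) + D * D * (x * cnj y)" unfolding x b by (simp add: algebra_simps)
      also have "\<dots> = cnj c * (c * z + D * (x * cnj o'))"
        unfolding z(2) using cc by (simp add: algebra_simps)
      also have "\<dots> \<in> smul (cnj c) J" unfolding J_def
        by (intro smulI smI nzi_mult_right[OF I x(1)]) (use z y in auto)
      finally show "a * b \<in> smul (cnj c) J" .
    qed (rule nzi_add[OF ncJ])
    have P: "nzi (smul D I \<odot> cj J)" using nd cJ by blast
    show "smul (cnj c) J \<subseteq> smul D I \<odot> cj J"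
    proof
      fix v assume "v \<in> smul (cnj c) J"
      then obtain o' x where h: "o' \<in> OK" "x \<in> I" "v = cnj c * (c * o' + D * x)"
        unfolding J_def sm_def smul_def by blast
      have v: "v = D * D * (of_nat (nrm I) * o') + (D * x) * cnj c"
        unfolding h using cc by (simp add: algebra_simps)
      have "c * 1 \<in> smul c OK" by (rule smulI) simp
      hence "c \<in> J" unfolding J_def using sm_left[OF nd] by simp
      hence 2: "(D * x) * cnj c \<in> smul D I \<odot> cj J" by (intro prd_mem smulI h cjI)
      have "of_nat (nrm I) * o' \<in> I \<odot> cj I" unfolding prd_cj[OF I] by (rule smulI[OF h(1)])
      hence "D * D * (of_nat (nrm I) * o') \<in> smul (D * D) (I \<odot> cj I)" by (rule smulI)
      also have "smul (D * D) (I \<odot> cj I) = smul D (smul D (cj I) \<odot> I)"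
        unfolding smul_prd using prd_commute[OF I nzi_cj[OF I]] by simp
      also have "smul D (smul D (cj I) \<odot> I) = smul D I \<odot> smul D (cj I)"
        unfolding smul_prd[of D I] using prd_commute[OF I nzi_smul_OK[OF nzi_cj[OF I] D(1,2)]] by simp
      also have "\<dots> \<subseteq> smul D I \<odot> cj J"
      proof (rule prd_mono[OF subset_refl])
        have "smul D I \<subseteq> J" unfolding J_def using sm_right[OF nc] by blast
        hence "cj (smul D I) \<subseteq> cj J" unfolding cj_def by blast
        thus "smul D (cj I) \<subseteq> cj J" unfolding cj_smul D(3) .
      qed
      finally have 1: "D * D * (of_nat (nrm I) * o') \<in> smul D I \<odot> cj J" .
      show "v \<in> smul D I \<odot> cj J" unfolding v by (rule nzi_add[OF P 1 2])
    qed
  qed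
  have "cls I \<otimes>\<^bsub>CG\<^esub> cls (cj J) = cls (smul D I) \<otimes>\<^bsub>CG\<^esub> cls (cj J)" using cls_smul[OF I D(1,2)] by simp
  also have "\<dots> = cls (smul (cnj c) J)" using cls_mult[OF nd cJ] e by simp
  also have "\<dots> = cls J" using cls_smul[OF J] cO by auto
  finally have 1: "cls I \<otimes>\<^bsub>CG\<^esub> cls (cj J) = cls J" .
  have car: "cls I \<in> carrier CG" "cls J \<in> carrier CG" "cls (cj J) \<in> carrier CG" using cls_carrier I J cJ by blast+
  have "cls J \<otimes>\<^bsub>CG\<^esub> cls J = (cls I \<otimes>\<^bsub>CG\<^esub> cls (cj J)) \<otimes>\<^bsub>CG\<^esub> cls J" unfolding 1 ..
  also have "\<dots> = cls I \<otimes>\<^bsub>CG\<^esub> (cls J \<otimes>\<^bsub>CG\<^esub> cls (cj J))" using car by (simp add: CG.m_ac)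
  also have "\<dots> = cls I" using cls_cj_mult[OF J] car by simp
  finally show ?thesis using that[OF J] by simp
qed

text \<open>A rational number with integral square is integral. This is applied to
  \<open>|b|^2\<close>, whose square is the norm of \<open>b b\<close>, and then to
  \<open>2 Re b\<close>, whose square is the trace of \<open>b b\<close> plus twice the norm of
  \<open>b\<close>.\<close>

lemma OK_of_square:
  assumes b: "b \<in> K" and bb: "b * b \<in> OK"
  shows "b \<in> OK"
proof -
  have sq: "r \<in> \<int>" if "r\<^sup>2 \<in> \<int>" for r :: rat
    using square_times_squarefree_Ints[of 1 r] that by simp
  have sqr: "(of_rat r :: real) \<in> \<int>" if r: "(of_rat r :: real)\<^sup>2 \<in> \<int>" for r
  proof -
    obtain k where "(of_rat r :: real)\<^sup>2 = of_int k" using r by (auto elim: Ints_cases)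
    hence "(of_rat (r\<^sup>2) :: real) = of_rat (of_int k)" by (simp add: of_rat_power)
    hence "r\<^sup>2 = of_int k" using of_rat_eq_iff by blast
    hence "r \<in> \<int>" using sq by simp
    thus ?thesis by (auto elim: Ints_cases)
  qed
  obtain x y where xy: "Re b = of_rat x" "(cmod b)\<^sup>2 = of_rat (x\<^sup>2 + of_nat m * y\<^sup>2)" using K_coords[OF b] by metis
  have "((cmod b)\<^sup>2)\<^sup>2 = (cmod (b * b))\<^sup>2" by (simp add: norm_mult power2_eq_square)
  also have "\<dots> \<in> \<int>" using bb by (simp add: OK_def)
  finally have n: "(cmod b)\<^sup>2 \<in> \<int>" unfolding xy(2) by (rule sqr)
  have "(2 * Re b)\<^sup>2 = 2 * Re (b * b) + 2 * (cmod b)\<^sup>2" unfolding cmod_power2 by (simp add: power2_eq_square)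
  also have "\<dots> \<in> \<int>" using bb n by (auto simp: OK_def)
  finally have "(of_rat (2 * x) :: real)\<^sup>2 \<in> \<int>" unfolding xy(1) by (simp add: of_rat_mult)
  hence "(of_rat (2 * x) :: real) \<in> \<int>" by (rule sqr)
  hence "2 * Re b \<in> \<int>" unfolding xy(1) by (simp add: of_rat_mult)
  thus ?thesis using n b by (simp add: OK_def)
qed

text \<open>For \<open>e\<close> a product of ramified primes this is the ideal with square \<open>e OK\<close>.\<close>

definition De :: "nat \<Rightarrow> complex set" where
  "De e = {a \<in> OK. a * a \<in> smul (of_nat e) OK}"

text \<open>The square of \<open>a b / e\<close> is the product of the integral elements
  \<open>a^2 / e\<close> and \<open>b^2 / e\<close>, so \<open>a b / e\<close> is integral. Closure
  of \<open>De e\<close> under addition depends on this mixed product.\<close>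

lemma De_mult: assumes "e > 0" "a \<in> De e" "b \<in> De e" shows "a * b \<in> smul (of_nat e) OK"
proof -
  define c where "c = a * b / of_nat e"
  have O: "a \<in> OK" "b \<in> OK" "a * a / of_nat e \<in> OK" "b * b / of_nat e \<in> OK"
    using assms smul_mem_iff[of "of_nat e"] by (auto simp: De_def)
  have "c \<in> K" unfolding c_def by (intro K_divide K_mult K_of_nat OK_K O)
  moreover have cc: "c * c = (a * a / of_nat e) * (b * b / of_nat e)" by (simp add: c_def)
  have "c * c \<in> OK" unfolding cc by (rule OK_mult[OF O(3,4)])
  ultimately have "c \<in> OK" by (rule OK_of_square)
  thus ?thesis using assms(1) smul_mem_iff[of "of_nat e" "a * b" OK] by (simp add: c_def)
qed

lemma self_De: "of_nat e \<in> De e" unfolding De_def by (auto intro: smulI)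

lemma nzi_smul_nat: "nzi I \<Longrightarrow> e > 0 \<Longrightarrow> nzi (smul (of_nat e) I)" by (rule nzi_smul_OK) auto

lemma nzi_De: assumes e: "e > 0" shows "nzi (De e)"
proof (rule nziI[of _ "of_nat e"])
  let ?P = "smul (of_nat e) OK"
  have P: "nzi ?P" using nzi_smul_nat[OF nzi_OK e] .
  show "De e \<subseteq> OK" by (auto simp: De_def)
  show "0 \<in> De e" using nzi_0[OF P] by (simp add: De_def)
  show "a + b \<in> De e" if "a \<in> De e" "b \<in> De e" for a b
  proof -
    have "(a + b) * (a + b) = (a * a + b * b) + (a * b + a * b)" by (simp add: algebra_simps)
    also have "\<dots> \<in> ?P" using De_mult[OF e that] that by (intro nzi_add[OF P]) (auto simp: De_def)
    finally show ?thesis using that by (auto simp: De_def)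
  qed
  show "x * a \<in> De e" if "a \<in> De e" "x \<in> OK" for a x
  proof -
    have "(x * a) * (x * a) = (x * x) * (a * a)" by simp
    also have "\<dots> \<in> ?P" by (rule nzi_mult[OF P]) (use that in \<open>auto simp: De_def\<close>)
    finally show ?thesis using that by (auto simp: De_def)
  qed
  show "of_nat e \<in> De e" by (rule self_De)
qed (use e in auto)

lemma De_prd_subset: "e > 0 \<Longrightarrow> De e \<odot> De e \<subseteq> smul (of_nat e) OK"
  by (rule prd_subset) (auto intro: De_mult nzi_add[OF nzi_smul_nat[OF nzi_OK]])

lemma cnj_De: "a \<in> De e \<Longrightarrow> cnj a \<in> De e"
  using cjI[of "a * a" "smul (of_nat e) OK"] by (auto simp: De_def cj_smul)

lemma cj_De [simp]: "cj (De e) = De e"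
  by (auto simp: cj_iff) (metis cnj_De complex_cnj_cnj, metis cnj_De)

lemma De_1 [simp]: "De 1 = OK" by (auto simp: De_def)

lemma nzi_gcd_mem:
  assumes P: "nzi P" and "of_int x \<in> P" "of_int y \<in> P"
  shows "of_int (gcd x y) \<in> P"
proof -
  obtain u v where "u * x + v * y = gcd x y" using bezout_int by blast
  hence "of_int (gcd x y) = (of_int u * of_int x + of_int v * of_int y :: complex)" by (metis of_int_add of_int_mult)
  thus ?thesis using nzi_add[OF P nzi_mult[OF P assms(2) OK_of_int] nzi_mult[OF P assms(3) OK_of_int]] by simp
qed

lemma w_De: assumes "e dvd m" shows "w \<in> De e"
proof -
  obtain k where k: "m = e * k" using assms by blast
  have "(of_nat m :: complex) = of_nat e * of_nat k" using k by (metis of_nat_mult)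
  hence "w * w = of_nat e * (- of_nat k)" unfolding w_sq by simp
  moreover have "of_nat e * (- of_nat k) \<in> smul (of_nat e) OK" by (rule smulI) auto
  ultimately show ?thesis unfolding De_def by simp
qed

end

text \<open>\<open>M\<close> is the product of the ramified primes.\<close>

locale ramified = imag_quad +
  fixes M :: nat
  assumes M_cases: "(M = m \<and> m mod 8 = 3) \<or> (M = 2 * m \<and> m mod 4 = 1)" and m_gt: "m > 4"
begin

interpretation CG: comm_group CG by (rule comm_group_CG)

lemma M_pos: "M > 0" using M_cases m_pos by auto
lemma m_dvd_M: "m dvd M" using M_cases by auto

lemma sqf_M: "squarefree M"
proof -
  have "squarefree (2 * m)"
    by (rule squarefree_mult_coprime) (use sqf odd_m in \<open>auto intro: squarefree_prime\<close>)
  thus ?thesis using M_cases sqf by auto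
qed

lemma squarefree_coprime_cofactor: "squarefree (a * b) \<Longrightarrow> coprime a (b :: nat)"
proof (rule ccontr)
  assume sq: "squarefree (a * b)" and "\<not> coprime a b"
  then obtain p where p: "prime p" "p dvd a" "p dvd b" using not_coprime_common_prime by blast
  then obtain a' b' where "a = p * a'" "b = p * b'" by (auto elim!: dvdE)
  hence "a * b = p\<^sup>2 * (a' * b')" by (simp add: power2_eq_square)
  hence "p\<^sup>2 dvd a * b" by simp
  hence "is_unit p" using sq squarefreeD by blast
  thus False using p(1) by simp
qed

text \<open>The point is to find \<open>e\<close> in the product, as the gcd of two rational
  integers there. One is \<open>e^2\<close>. The other is \<open>-m = w w\<close> if
  \<open>e\<close> divides \<open>m\<close>; if \<open>e = 2 f\<close> with \<open>m = f k\<close>,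
  it is \<open>f (f + k)\<close>.\<close>

lemma De_prd: assumes e: "e dvd M" shows "De e \<odot> De e = smul (of_nat e) OK"
proof
  have e0: "e > 0" using e M_pos by (auto intro!: Nat.gr0I)
  show "De e \<odot> De e \<subseteq> smul (of_nat e) OK" by (rule De_prd_subset[OF e0])
  let ?P = "De e \<odot> De e"
  have P: "nzi ?P" using nzi_De[OF e0] by blast
  have ee: "of_int (int e * int e) \<in> ?P" using prd_mem[OF self_De self_De, of e e] by simp
  have "of_int (int e) \<in> ?P"
  proof (cases "e dvd m")
    case True
    then obtain k where k: "m = e * k" by blast
    have "w * w \<in> ?P" using w_De[OF True] by (intro prd_mem)
    hence "of_int (- int m) \<in> ?P" unfolding w_sq by simp
    hence "of_int (gcd (int e * int e) (- int m)) \<in> ?P" using nzi_gcd_mem[OF P ee] by blast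
    moreover have "gcd (int e * int e) (- int m) = int e"
    proof -
      have "coprime e k" using sqf squarefree_coprime_cofactor unfolding k by blast
      hence "gcd (int e) (int k) = 1" by simp
      hence "gcd (int e * int e) (int e * int k) = int e" by (metis abs_of_nat gcd_mult_distrib_int mult.right_neutral)
      thus ?thesis unfolding k by simp
    qed
    ultimately show ?thesis by simp
  next
    case False
    hence M: "M = 2 * m" "m mod 4 = 1" using M_cases e by auto
    have "even e"
    proof (rule ccontr)
      assume "odd e"
      hence "coprime e 2" by simp
      hence "e dvd m" using e unfolding M by (simp add: coprime_dvd_mult_right_iff)
      thus False using False by blast
    qed
    then obtain f where f: "e = 2 * f" by blast
    have "f dvd m" using e unfolding M f by simp
    then obtain k where k: "m = f * k" by blast
    have odds: "odd f" "odd k" using odd_m k by auto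
    have fk: "(f * k) mod 4 = 1" using M(2) k by simp
    have "(f + k) mod 4 = 2"
    proof -
      have c: "f mod 4 = 1 \<or> f mod 4 = 3" "k mod 4 = 1 \<or> k mod 4 = 3" using odds by presburger+
      have "((f mod 4) * (k mod 4)) mod 4 = 1" using fk by (simp add: mod_mult_eq)
      hence "((f mod 4) + (k mod 4)) mod 4 = 2" using c by (elim disjE) simp_all
      thus ?thesis by (simp add: mod_add_eq)
    qed
    hence fk2: "even (f + k)" "\<not> 4 dvd f + k" by presburger+
    have mk: "(of_nat m :: complex) = of_nat f * of_nat k" using k by (metis of_nat_mult)
    \<comment> \<open>\<open>a^2 = f (f - k) + 2 f w\<close> is divisible by \<open>e = 2 f\<close>
      because \<open>f - k\<close> is even. The norm of \<open>a\<close> is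
      \<open>f (f + k)\<close>, where \<open>f + k\<close> is 2 modulo 4 and prime to
      \<open>f\<close>, so its gcd with \<open>e^2\<close> is \<open>2 f\<close>.\<close>
    define a where "a = of_nat f + w"
    have "even (int f - int k)" using odds by simp
    then obtain j where j: "int f - int k = 2 * j" by blast
    have "a * a = of_int (int f * (int f - int k)) + 2 * of_nat f * w"
      unfolding a_def by (simp add: algebra_simps w_sq mk)
    also have "\<dots> = of_nat e * (of_int j + w)" unfolding j f by (simp add: algebra_simps)
    finally have "a * a = of_nat e * (of_int j + w)" .
    moreover have "of_nat e * (of_int j + w) \<in> smul (of_nat e) OK" by (rule smulI) auto
    ultimately have aD: "a \<in> De e" unfolding De_def a_def by auto
    have "a * cnj a \<in> ?P" using prd_mem[OF aD cnj_De[OF aD]] .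
    moreover have "a * cnj a = of_int (int f * (int f + int k))" unfolding a_def by (simp add: algebra_simps w_sq mk)
    ultimately have "of_int (int f * (int f + int k)) \<in> ?P" by simp
    hence "of_int (gcd (int e * int e) (int f * (int f + int k))) \<in> ?P" using nzi_gcd_mem[OF P ee] by blast
    moreover have "gcd (int e * int e) (int f * (int f + int k)) = int e"
    proof -
      have "coprime f k" using sqf squarefree_coprime_cofactor unfolding k by blast
      hence "coprime f (f + k)" unfolding coprime_iff_gcd_eq_1 by simp
      hence "gcd (4 * f) (f + k) = gcd 4 (f + k)" by (simp add: gcd_mult_right_right_cancel gcd_mult_left_right_cancel coprime_commute)
      also have "\<dots> = 2"
      proof -
        define g where "g = gcd 4 (f + k)"
        have "g dvd 4" unfolding g_def by simp
        hence "g \<le> 4" by (rule dvd_imp_le) simp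
        moreover have "\<not> (3::nat) dvd 4" by presburger
        hence "g \<noteq> 3" using \<open>g dvd 4\<close> by metis
        moreover have "g \<noteq> 0" unfolding g_def by simp
        ultimately have "g = 1 \<or> g = 2 \<or> g = 4" by presburger
        hence "gcd 4 (f + k) = 1 \<or> gcd 4 (f + k) = 2 \<or> gcd 4 (f + k) = 4" unfolding g_def .
        moreover have "gcd 4 (f + k) \<noteq> 4" using fk2(2) by (metis gcd_dvd2)
        moreover have "2 dvd gcd 4 (f + k)" by (rule gcd_greatest) (use fk2(1) in auto)
        hence "gcd 4 (f + k) \<noteq> 1" by (metis odd_one)
        ultimately show ?thesis by blast
      qed
      finally have "f * gcd (4 * f) (f + k) = e" unfolding f by simp
      hence "gcd (f * (4 * f)) (f * (f + k)) = e" by (simp add: gcd_mult_distrib_nat)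
      hence "int (gcd (f * (4 * f)) (f * (f + k))) = int e" by simp
      hence "gcd (int (f * (4 * f))) (int (f * (f + k))) = int e" by (simp only: gcd_int_int_eq)
      moreover have "int (f * (4 * f)) = int e * int e" "int (f * (f + k)) = int f * (int f + int k)" unfolding f by simp_all
      ultimately show ?thesis by simp
    qed
    ultimately show ?thesis by simp
  qed
  hence "of_nat e \<in> ?P" by simp
  thus "smul (of_nat e) OK \<subseteq> ?P" using nzi_mult_right[OF P] by (auto simp: smul_def)
qed

lemma dvd_M_pos: "e dvd M \<Longrightarrow> e > 0" using M_pos by (auto intro!: Nat.gr0I)

lemma nrm_De: assumes "e dvd M" shows "nrm (De e) = e"
proof -
  have "real (nrm (De e)) = real e"
    by (rule nrm_unique) (use nzi_De De_prd assms dvd_M_pos in auto)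
  thus ?thesis by simp
qed

text \<open>If \<open>l\<close> divides \<open>a^2\<close>, it divides the norm of \<open>a\<close>,
  and also its trace \<open>X\<close>, since the squared trace of \<open>a\<close> is the trace of
  \<open>a^2\<close> plus twice the norm of \<open>a\<close>. As \<open>l\<close> is prime to
  \<open>m\<close>, it divides \<open>Y\<close> too. For \<open>l = 2\<close> one has
  \<open>m\<close> equal to 3 modulo 4, and the halved coordinates only need equal parity.\<close>

lemma divisible_if_square_divisible:
  assumes l: "prime l" "\<not> l dvd M" and a: "a \<in> OK" "a * a \<in> smul (of_nat l) OK"
  shows "a / of_nat l \<in> OK"
proof -
  obtain X Y where XY: "par X Y" "a = el X Y" using a(1) OK_E by metis
  obtain z where z: "z \<in> OK" "a * a = of_nat l * z" using a(2) by (auto simp: smul_def)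
  obtain k where k: "(cmod a)\<^sup>2 = real k" using OK_norm[OF a(1)] by metis
  obtain j where j: "(cmod z)\<^sup>2 = real j" using OK_norm[OF z(1)] by metis
  obtain s where s: "2 * Re z = of_int s" using z(1) by (auto simp: OK_def elim: Ints_cases)
  have "(real k)\<^sup>2 = (cmod (a * a))\<^sup>2" by (simp add: norm_mult power2_eq_square flip: k)
  also have "\<dots> = (real l)\<^sup>2 * real j" unfolding z(2) by (simp add: norm_mult power_mult_distrib j)
  finally have "real (k\<^sup>2) = real (l\<^sup>2 * j)" by simp
  hence "k\<^sup>2 = l\<^sup>2 * j" using of_nat_eq_iff by blast
  hence "l dvd k\<^sup>2" by (simp add: power2_eq_square)
  hence lk: "l dvd k" using l(1) prime_dvd_power by blast
  have "of_int (X\<^sup>2) = (2 * Re a)\<^sup>2" unfolding XY(2) el_Re by simp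
  also have "\<dots> = 2 * Re (a * a) + 2 * (cmod a)\<^sup>2" unfolding cmod_power2 by (simp add: power2_eq_square)
  also have "\<dots> = of_int (int l * s + 2 * int k)" unfolding z(2) k using s by simp
  finally have "X\<^sup>2 = int l * s + 2 * int k" using of_int_eq_iff by blast
  hence "int l dvd X\<^sup>2" using lk by simp
  hence lX: "int l dvd X" using l(1) prime_dvd_power[of "int l" X 2] by simp
  have "of_int (X\<^sup>2 + int m * Y\<^sup>2) = real_of_int (4 * int k)" using el_norm[of X Y] k unfolding XY(2) by simp
  hence eq: "X\<^sup>2 + int m * Y\<^sup>2 = 4 * int k" using of_int_eq_iff by blast
  have lm: "\<not> l dvd m" using l(2) m_dvd_M dvd_trans by blast
  show ?thesis
  proof (cases "l = 2")
    case False
    have "int l dvd (X\<^sup>2 + int m * Y\<^sup>2) - X\<^sup>2" unfolding eq using lk \<open>int l dvd X\<^sup>2\<close> by (intro dvd_diff) auto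
    hence "int l dvd int m * Y\<^sup>2" by simp
    hence "int l dvd Y\<^sup>2" using l(1) lm prime_dvd_mult_iff[of "int l" "int m" "Y\<^sup>2"] by simp
    hence "int l dvd Y" using l(1) prime_dvd_power[of "int l" Y 2] by simp
    then obtain X' Y' where XY': "X = int l * X'" "Y = int l * Y'" using lX by blast
    have "odd l" using False l(1) by (simp add: prime_odd_nat prime_ge_2_nat le_neq_implies_less)
    hence "coprime (4::int) ((int l)\<^sup>2)" using coprime_power_left_iff[of "2::int" 2 "(int l)\<^sup>2"] by simp
    moreover have "4 dvd (int l)\<^sup>2 * (X'\<^sup>2 + int m * Y'\<^sup>2)"
      using eq unfolding XY' by (simp add: power_mult_distrib distrib_left mult.left_commute)
    ultimately have "par X' Y'" unfolding par_iff by (simp add: coprime_dvd_mult_right_iff)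
    moreover have "a / of_nat l = el X' Y'" unfolding XY(2) XY' using l(1) prime_gt_0_nat[of l]
      by (simp add: el_def complex_eq_iff Re_divide_of_nat Im_divide_of_nat)
    ultimately show ?thesis unfolding OK_iff by blast
  next
    case True
    hence Mm: "M = m" "m mod 8 = 3" using l(2) M_cases by auto
    have "even (X\<^sup>2 + int m * Y\<^sup>2)" "even X" unfolding eq using lX True by auto
    hence "even (int m * Y\<^sup>2)" by simp
    hence "even Y" using odd_m by simp
    then obtain X' Y' where XY': "X = 2 * X'" "Y = 2 * Y'" using lX True by (metis dvd_def of_nat_numeral)
    have "X'\<^sup>2 + int m * Y'\<^sup>2 = int k" using eq unfolding XY' by (simp add: power_mult_distrib)
    hence "even (X'\<^sup>2 + int m * Y'\<^sup>2)" using lk True by simp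
    hence "even (X' - Y')" using odd_m by simp
    moreover have "m mod 4 = 3" using Mm(2) by presburger
    ultimately have "par X' Y'" unfolding par_def by simp
    moreover have "a / of_nat l = el X' Y'" unfolding XY(2) XY' True
      by (simp add: el_def complex_eq_iff)
    ultimately show ?thesis unfolding OK_iff by blast
  qed
qed

end

lemma squarefree_dvdI:
  fixes e M :: nat
  assumes "squarefree e" "M > 0" "\<And>l. prime l \<Longrightarrow> l dvd e \<Longrightarrow> l dvd M"
  shows "e dvd M"
proof (rule multiplicity_le_imp_dvd)
  have e0: "e \<noteq> 0" using assms(1) by (metis not_squarefree_0)
  thus "e \<noteq> 0" .
  fix l :: nat assume l: "prime l"
  show "multiplicity l e \<le> multiplicity l M"
  proof (cases "l dvd e")
    case True
    have "multiplicity l e \<le> 1" using assms(1) e0 l squarefree_factorial_semiring''[OF e0] by blast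
    moreover have "multiplicity l M \<ge> 1" using assms(2) l assms(3)[OF l True]
      by (intro multiplicity_geI) auto
    ultimately show ?thesis by linarith
  qed (simp add: not_dvd_imp_multiplicity_0)
qed

lemma squarefree_dvd_square:
  fixes h x :: nat
  assumes "squarefree h" "h dvd x\<^sup>2" "x > 0"
  shows "h dvd x"
proof (rule squarefree_dvdI[OF assms(1,3)])
  fix l :: nat assume "prime l" "l dvd h"
  thus "l dvd x" using assms(2) by (meson dvd_trans prime_dvd_power)
qed

lemma squarefree_prod_prime_factors:
  fixes n :: nat
  assumes "squarefree n"
  shows "\<Prod>(prime_factors n) = n"
proof -
  have n0: "n \<noteq> 0" using assms by (metis not_squarefree_0)
  have "n = (\<Prod>p\<in>prime_factors n. p ^ multiplicity p n)" using n0 by (intro prime_factorization_nat) simp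
  also have "\<dots> = (\<Prod>p\<in>prime_factors n. p)"
    using assms squarefree_factorial_semiring'[OF n0] by (intro prod.cong refl) auto
  finally show ?thesis by simp
qed

lemma card_divisors_prod_primes:
  fixes Q :: "nat set"
  assumes "finite Q" "\<And>q. q \<in> Q \<Longrightarrow> prime q"
  shows "finite {d. d dvd \<Prod>Q} \<and> card {d. d dvd \<Prod>Q} = 2 ^ card Q"
  using assms
proof (induction Q rule: finite_induct)
  case (insert q Q)
  let ?D = "{d. d dvd \<Prod>Q}"
  have q: "prime q" using insert by simp
  have IH: "finite ?D" "card ?D = 2 ^ card Q" using insert by auto
  have nd: "\<not> q dvd \<Prod>Q"
  proof
    assume "q dvd \<Prod>Q"
    then obtain r where "r \<in> Q" "q dvd r" using prime_dvd_prod_iff[OF insert(1) q, of "\<lambda>x. x"] by auto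
    thus False using insert q primes_dvd_imp_eq[of q r] by auto
  qed
  have e: "{d. d dvd \<Prod>(insert q Q)} = ?D \<union> (\<lambda>d. q * d) ` ?D"
  proof (intro equalityI subsetI)
    fix d assume "d \<in> {d. d dvd \<Prod>(insert q Q)}"
    hence d: "d dvd q * \<Prod>Q" using insert by simp
    show "d \<in> ?D \<union> (\<lambda>d. q * d) ` ?D"
    proof (cases "q dvd d")
      case True
      then obtain d' where "d = q * d'" by blast
      thus ?thesis using d q prime_gt_0_nat[OF q] by auto
    next
      case False
      hence "coprime d q" using q by (metis coprime_commute prime_imp_coprime)
      thus ?thesis using d by (simp add: coprime_dvd_mult_right_iff)
    qed
  next
    fix d assume "d \<in> ?D \<union> (\<lambda>d. q * d) ` ?D"
    thus "d \<in> {d. d dvd \<Prod>(insert q Q)}" using insert by auto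
  qed
  have inj: "inj_on (\<lambda>d. q * d) ?D" using prime_gt_0_nat[OF q] by (auto simp: inj_on_def)
  have "card (?D \<union> (\<lambda>d. q * d) ` ?D) = card ?D + card ((\<lambda>d. q * d) ` ?D)"
    by (rule card_Un_disjoint) (use IH nd in \<open>auto dest: dvd_mult_left\<close>)
  also have "\<dots> = 2 ^ card (insert q Q)" using card_image[OF inj] IH insert by simp
  finally show ?case using e IH by simp
qed simp

section \<open>The classes of order two and the 2-part of the class number\<close>

context ramified
begin

interpretation CG: comm_group CG by (rule comm_group_CG)

abbreviation Dc :: "nat \<Rightarrow> complex set set" where "Dc e \<equiv> cls (De e)"

lemma nzi_De_M: "e dvd M \<Longrightarrow> nzi (De e)" using nzi_De dvd_M_pos by blast

lemma Dc_carrier: "e dvd M \<Longrightarrow> Dc e \<in> carrier CG" using cls_carrier nzi_De_M by blast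

lemma Dc_square: "e dvd M \<Longrightarrow> Dc e \<otimes>\<^bsub>CG\<^esub> Dc e = \<one>\<^bsub>CG\<^esub>"
  using nzi_De_M[of e] De_prd[of e] dvd_M_pos[of e] by (simp add: cls_mult cls_smul CG_one)

lemma Dc_1: "Dc 1 = \<one>\<^bsub>CG\<^esub>" by (simp only: De_1 CG_one)

text \<open>An ambiguous class contains, by Hilbert 90, an ideal \<open>J\<close> with \<open>cj J = J\<close>; then
  \<open>J \<odot> J = (k\<^sup>2 e)\<close> with \<open>e\<close> squarefree, and \<open>J = k De e\<close> with \<open>e\<close> ramified.\<close>

lemma ambiguous_class:
  assumes I: "nzi I" and sq: "cls I \<otimes>\<^bsub>CG\<^esub> cls I = \<one>\<^bsub>CG\<^esub>"
  obtains e where "e dvd M" "cls I = Dc e"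
proof -
  have cI: "nzi (cj I)" using I by blast
  have car: "cls I \<in> carrier CG" "cls (cj I) \<in> carrier CG" using cls_carrier I cI by blast+
  have "cls I \<otimes>\<^bsub>CG\<^esub> cls I = cls I \<otimes>\<^bsub>CG\<^esub> cls (cj I)" using sq cls_cj_mult[OF I] by simp
  hence "cls I = cls (cj I)" using car by (metis CG.inv_equality CG.inv_inv cls_cj_mult I sq CG.m_comm)
  then obtain c where c: "c \<in> K" "c \<noteq> 0" "cj I = smul c I" using cls_eq_iff[OF I cI] by blast
  have "real (nrm (cj I)) = (cmod c)\<^sup>2 * real (nrm I)" using nrm_smul[OF I _ c(2)] cI unfolding c(3) by blast
  hence "(cmod c)\<^sup>2 = 1" using nrm_cj[OF I] nrm_pos[OF I] by simp
  hence cc: "c * cnj c = 1" by (metis complex_norm_square of_real_1)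
  \<comment> \<open>Hilbert 90 for \<open>c\<close> of norm 1: \<open>1 + c\<close> satisfies
    \<open>cnj d0 c = d0\<close>, and \<open>w\<close> replaces it when it vanishes.\<close>
  define d0 where "d0 = (if c = - 1 then w else 1 + c)"
  have d0K: "d0 \<in> K" using c(1) by (auto simp: d0_def)
  have d0nz: "d0 \<noteq> 0" by (auto simp: d0_def) (metis add.inverse_unique)
  have d0c: "cnj d0 * c = d0"
  proof (cases "c = - 1")
    case False
    have "cnj (1 + c) * c = c + c * cnj c" by (simp add: algebra_simps)
    thus ?thesis using False cc by (simp add: d0_def add.commute)
  qed (simp add: d0_def)
  obtain k0 where k0: "k0 > 0" "of_nat k0 * d0 \<in> OK" using K_scale[OF d0K] .
  define d where "d = of_nat k0 * d0"
  have d: "d \<in> OK" "d \<noteq> 0" "cnj d * c = d" using k0 d0nz d0c by (simp_all add: d_def mult.assoc)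
  define J where "J = smul d I"
  have J: "nzi J" unfolding J_def by (rule nzi_smul_OK[OF I d(1,2)])
  have cJ: "cj J = J" unfolding J_def cj_smul c(3) using d(3) by simp
  have clsJ: "cls I = cls J" unfolding J_def using cls_smul[OF I d(1,2)] by simp
  define g where "g = nrm J"
  have g0: "g > 0" unfolding g_def by (rule nrm_pos[OF J])
  have JJ: "J \<odot> J = smul (of_nat g) OK" using prd_cj[OF J] unfolding cJ g_def .
  define e k where "e = squarefree_part g" and "k = square_part g"
  have g: "g = e * k\<^sup>2" unfolding e_def k_def by (rule squarefree_decompose)
  have sqe: "squarefree e" unfolding e_def by auto
  have ek0: "e > 0" "k > 0" using g g0 by (auto intro!: Nat.gr0I)
  have ak: "a / of_nat k \<in> De e" if a: "a \<in> J" for a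
  proof -
    have "a * a \<in> smul (of_nat g) OK" using prd_mem[OF a a] JJ by simp
    then obtain z where z: "z \<in> OK" "a * a = of_nat g * z" by (auto simp: smul_def)
    have e1: "(a / of_nat k) * (a / of_nat k) = of_nat e * z"
      using z(2) ek0 unfolding g by (simp add: power2_eq_square field_simps)
    have "of_nat e * z \<in> OK" by (rule OK_mult[OF OK_of_nat z(1)])
    hence "(a / of_nat k) * (a / of_nat k) \<in> OK" unfolding e1 .
    moreover have "a / of_nat k \<in> K" by (intro K_divide K_of_nat OK_K nzi_OK_mem[OF J a])
    ultimately have "a / of_nat k \<in> OK" using OK_of_square by blast
    thus ?thesis unfolding De_def e1 using smulI[OF z(1)] e1 by simp
  qed
  define c1 where "c1 = (1 / of_nat k :: complex)"
  have c1: "c1 \<noteq> 0" "c1 \<in> K" "cnj c1 = c1" using ek0 by (auto simp: c1_def)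
  define J' where "J' = smul c1 J"
  have J'sub: "J' \<subseteq> De e" unfolding J'_def smul_def c1_def using ak by auto
  have J': "nzi J'" unfolding J'_def
    by (rule nzi_smul[OF J c1(1)]) (use J'sub in \<open>auto simp: J'_def De_def\<close>)
  have clsJ': "cls J = cls J'" by (rule cls_eqI[OF J J' c1(2,1)]) (simp add: J'_def)
  have cJ': "cj J' = J'" unfolding J'_def cj_smul cJ c1(3) ..
  have "J' \<odot> J' = smul c1 (J \<odot> J')" unfolding J'_def smul_prd ..
  also have "J \<odot> J' = J' \<odot> J" using prd_commute[OF J J'] .
  also have "J' \<odot> J = smul c1 (J \<odot> J)" unfolding J'_def smul_prd ..
  finally have JJ': "J' \<odot> J' = smul (of_nat e) OK" unfolding JJ smul_smul g c1_def
    using ek0 by (simp add: power2_eq_square)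
  have nJ': "nrm J' = e"
  proof -
    have "real (nrm J') = real e" by (rule nrm_unique[OF J']) (use JJ' cJ' ek0 in auto)
    thus ?thesis by simp
  qed
  \<comment> \<open>An unramified prime of \<open>e\<close> would divide every element of
    \<open>J'\<close>, so its square would divide \<open>nrm J' = e\<close>, which is
    squarefree.\<close>
  have "l dvd M" if l: "prime l" "l dvd e" for l
  proof (rule ccontr)
    assume lM: "\<not> l dvd M"
    obtain e' where e': "e = l * e'" using l(2) by blast
    have "l\<^sup>2 dvd nrm J'"
    proof (rule nrm_greatest)
      fix a j assume a: "a \<in> J'" "(cmod a)\<^sup>2 = real j"
      have aO: "a \<in> OK" "a * a \<in> smul (of_nat e) OK" using a(1) J'sub by (auto simp: De_def)
      then obtain z where z: "z \<in> OK" "a * a = of_nat e * z" by (auto simp: smul_def)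
      have "a * a = of_nat l * (of_nat e' * z)" unfolding z(2) e' by simp
      moreover have "of_nat l * (of_nat e' * z) \<in> smul (of_nat l) OK" by (intro smulI OK_mult OK_of_nat z(1))
      ultimately have al: "a / of_nat l \<in> OK" using divisible_if_square_divisible[OF l(1) lM aO(1)] by simp
      obtain i where i: "(cmod (a / of_nat l))\<^sup>2 = real i" using OK_norm[OF al] by metis
      have "real j = (real l)\<^sup>2 * (cmod (a / of_nat l))\<^sup>2"
        using a(2) prime_gt_0_nat[OF l(1)] by (simp add: norm_divide power_divide)
      hence "real j = real (l\<^sup>2 * i)" unfolding i by simp
      hence "j = l\<^sup>2 * i" using of_nat_eq_iff by blast
      thus "l\<^sup>2 dvd j" by simp
    qed
    hence "is_unit l" using sqe squarefreeD unfolding nJ' by blast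
    thus False using l(1) by simp
  qed
  hence eM: "e dvd M" by (rule squarefree_dvdI[OF sqe M_pos])
  have "J' = De e" by (rule eq_if_subset_nrm_eq[OF J' nzi_De_M[OF eM] J'sub]) (simp add: nJ' nrm_De[OF eM])
  thus ?thesis using that[OF eM] clsJ clsJ' by simp
qed

text \<open>For \<open>c = g w / e\<close> one has \<open>c^2 e = - f\<close>, so multiplication by
  \<open>c\<close> carries \<open>De e\<close> into \<open>De f\<close>. Equality follows by
  comparing norms.\<close>

lemma Dc_eqI:
  assumes e: "e dvd M" "f dvd M" and g: "e * f = g\<^sup>2 * m"
  shows "Dc e = Dc f"
proof -
  have pos: "e > 0" "f > 0" using e dvd_M_pos by blast+
  hence g0: "g > 0" using g by (auto intro!: Nat.gr0I)
  define c where "c = of_nat g * w / of_nat e"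
  have c: "c \<in> K" "c \<noteq> 0" unfolding c_def using g0 pos by (auto intro!: K_divide K_mult)
  have sub: "smul c (De e) \<subseteq> De f"
  proof
    fix b assume "b \<in> smul c (De e)"
    then obtain a where a: "a \<in> De e" "b = c * a" by (auto simp: smul_def)
    obtain z where z: "z \<in> OK" "a * a = of_nat e * z" using a(1) by (auto simp: De_def smul_def)
    have gm: "(of_nat g)\<^sup>2 * of_nat m = (of_nat e * of_nat f :: complex)" using g by (metis of_nat_mult of_nat_power)
    have "b * b = (of_nat g)\<^sup>2 * (w * w) * (a * a) / (of_nat e)\<^sup>2"
      unfolding a(2) c_def by (simp add: power2_eq_square field_simps)
    also have "\<dots> = - ((of_nat g)\<^sup>2 * of_nat m) * (of_nat e * z) / (of_nat e)\<^sup>2" unfolding w_sq z(2) by simp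
    also have "\<dots> = of_nat f * (- z)" unfolding gm using pos by (simp add: power2_eq_square field_simps)
    finally have bb: "b * b = of_nat f * (- z)" .
    have "b \<in> K" unfolding a(2) using c(1) a(1) OK_K by (auto simp: De_def)
    moreover have "b * b \<in> OK" unfolding bb by (intro OK_mult OK_of_nat OK_uminus z(1))
    ultimately have "b \<in> OK" by (rule OK_of_square)
    thus "b \<in> De f" unfolding De_def bb using smulI[OF OK_uminus[OF z(1)]] bb by simp
  qed
  have n: "nzi (smul c (De e))" by (rule nzi_smul[OF nzi_De_M[OF e(1)] c(2)]) (use sub in \<open>auto simp: De_def\<close>)
  have "real (nrm (smul c (De e))) = (cmod c)\<^sup>2 * real e" using nrm_smul[OF nzi_De_M[OF e(1)] n c(2)] nrm_De[OF e(1)] by simp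
  also have "(cmod c)\<^sup>2 = (real g)\<^sup>2 * real m / (real e)\<^sup>2"
    unfolding c_def by (simp add: norm_mult norm_divide power_mult_distrib power_divide w_norm)
  also have "(real g)\<^sup>2 * real m = real e * real f" using g by (metis of_nat_mult of_nat_power)
  also have "real e * real f / (real e)\<^sup>2 * real e = real f" using pos by (simp add: power2_eq_square)
  finally have "nrm (smul c (De e)) = nrm (De f)" using nrm_De[OF e(2)] by simp
  hence "smul c (De e) = De f" by (intro eq_if_subset_nrm_eq n nzi_De_M e sub)
  thus ?thesis by (intro cls_eqI[OF nzi_De_M[OF e(1)] nzi_De_M[OF e(2)] c]) simp
qed

text \<open>The only relations between ramified ideals come from 1 and \<open>w\<close>. A
  multiplier between the ideals, scaled to \<open>b\<close>, has norm \<open>h = e f / g^2\<close>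
  and a square divisible by \<open>h\<close>, so \<open>h\<close> divides its first coordinate
  \<open>X\<close>. Then \<open>X^2 + m Y^2 = 4 h\<close> with \<open>m > 4\<close> leaves only
  \<open>h = m\<close> and \<open>h = 1\<close>.\<close>

lemma Dc_eqD:
  assumes e: "e dvd M" "f dvd M" and eq: "Dc e = Dc f"
  shows "e = f \<or> (\<exists>g. e * f = g\<^sup>2 * m)"
proof -
  have pos: "e > 0" "f > 0" using e dvd_M_pos by blast+
  have n: "nzi (De e)" "nzi (De f)" using nzi_De_M e by blast+
  obtain c where c: "c \<in> K" "c \<noteq> 0" "De f = smul c (De e)" using eq cls_eq_iff[OF n] by blast
  define g where "g = gcd e f"
  have g0: "g > 0" using pos by (simp add: g_def)
  obtain e1 f1 where ef: "e = e1 * g" "f = f1 * g" "coprime e1 f1"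
    using gcd_coprime_exists[of e f] g0 unfolding g_def by auto
  define h where "h = e1 * f1"
  have efh: "e * f = g\<^sup>2 * h" unfolding ef h_def by (simp add: power2_eq_square)
  have "lcm e f dvd M" using e by simp
  moreover have "lcm f1 e1 = e1 * f1" using ef(3) by (simp add: lcm_coprime coprime_commute mult.commute)
  hence "lcm e f = g * h" unfolding ef(1,2) h_def by (simp add: lcm_mult_right mult.commute)
  ultimately have "h dvd M" by (metis dvd_mult_right)
  hence sqh: "squarefree h" using squarefree_mono sqf_M by blast
  have h0: "h > 0" using pos unfolding h_def ef by auto
  have "real (nrm (De f)) = (cmod c)\<^sup>2 * real (nrm (De e))" using nrm_smul[OF n(1) _ c(2)] n(2) unfolding c(3) by blast
  hence nc: "real f = (cmod c)\<^sup>2 * real e" using nrm_De e by simp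
  have f1e1: "of_nat f1 * of_nat e = (of_nat e1 * of_nat f :: complex)" unfolding ef by simp
  define b where "b = of_nat e1 * c"
  have bK: "b \<in> K" unfolding b_def using c(1) by (intro K_mult) auto
  have "De f \<odot> De f = smul c (De e \<odot> De f)" unfolding c(3) smul_prd ..
  also have "De e \<odot> De f = De f \<odot> De e" using prd_commute[OF n] .
  also have "De f \<odot> De e = smul c (De e \<odot> De e)" unfolding c(3) smul_prd ..
  finally have sm: "smul (of_nat f) OK = smul (c * c * of_nat e) OK" using De_prd e by (simp add: mult.assoc)
  have "c * c * of_nat e * 1 \<in> smul (of_nat f) OK" unfolding sm by (rule smulI) simp
  then obtain u where u: "u \<in> OK" "c * c * of_nat e = of_nat f * u" by (auto simp: smul_def)
  have "of_nat e * (b * b) = (of_nat e1 * of_nat e1) * (c * c * of_nat e)" by (simp add: b_def mult_ac)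
  also have "\<dots> = of_nat e1 * (of_nat e1 * of_nat f) * u" unfolding u(2) by (simp add: mult_ac)
  also have "\<dots> = of_nat e * (of_nat h * u)" unfolding f1e1[symmetric] h_def by (simp add: mult_ac)
  finally have bb: "b * b = of_nat h * u" using pos(1) by simp
  have "b * b \<in> OK" unfolding bb by (intro OK_mult OK_of_nat u(1))
  hence bO: "b \<in> OK" by (rule OK_of_square[OF bK])
  have "real e * (cmod b)\<^sup>2 = (real e1)\<^sup>2 * real f" unfolding nc b_def by (simp add: norm_mult power_mult_distrib)
  also have "\<dots> = real e * real h" unfolding ef h_def by (simp add: power2_eq_square)
  finally have nb: "(cmod b)\<^sup>2 = real h" using pos(1) by simp
  obtain X Y where XY: "par X Y" "b = el X Y" using bO OK_E by metis
  obtain s where s: "2 * Re u = of_int s" using u(1) by (auto simp: OK_def elim: Ints_cases)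
  have "of_int (X\<^sup>2 + int m * Y\<^sup>2) = real_of_int (4 * int h)" using el_norm[of X Y] nb unfolding XY(2) by simp
  hence eqn: "X\<^sup>2 + int m * Y\<^sup>2 = 4 * int h" using of_int_eq_iff by blast
  have "of_int (X\<^sup>2) = (2 * Re b)\<^sup>2" unfolding XY(2) el_Re by simp
  also have "\<dots> = 2 * Re (b * b) + 2 * (cmod b)\<^sup>2" unfolding cmod_power2 by (simp add: power2_eq_square)
  also have "\<dots> = of_int (int h * (s + 2))" unfolding bb nb using s by (simp add: algebra_simps)
  finally have X2: "X\<^sup>2 = int h * (s + 2)" using of_int_eq_iff by blast
  have hX: "int h dvd X"
  proof (cases "X = 0")
    case False
    have "h dvd (nat \<bar>X\<bar>)\<^sup>2"
    proof -
      have "int h dvd (int (nat \<bar>X\<bar>))\<^sup>2" using X2 by simp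
      thus ?thesis by (metis int_dvd_int_iff of_nat_power)
    qed
    hence "h dvd nat \<bar>X\<bar>" by (rule squarefree_dvd_square[OF sqh]) (use False in simp)
    thus ?thesis by simp
  qed simp
  then obtain X' where X': "X = int h * X'" by blast
  show ?thesis
  proof (cases "X' = 0")
    case True
    hence mY: "int m * Y\<^sup>2 = 4 * int h" using eqn X' by simp
    hence "even (int m * Y\<^sup>2)" by simp
    hence "even Y" using odd_m by simp
    then obtain y where y: "Y = 2 * y" by blast
    have "int m * y\<^sup>2 = int h" using mY unfolding y by (simp add: power_mult_distrib)
    hence "int (m * (nat \<bar>y\<bar>)\<^sup>2) = int h" by simp
    hence my: "m * (nat \<bar>y\<bar>)\<^sup>2 = h" using of_nat_eq_iff by blast
    hence "(nat \<bar>y\<bar>)\<^sup>2 dvd h" by (metis dvd_triv_right)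
    hence "nat \<bar>y\<bar> = 1" using sqh squarefreeD by fastforce
    hence "h = m" using my by simp
    thus ?thesis using efh by blast
  next
    case False
    have Xp: "X'\<^sup>2 \<ge> 1" using False by (simp add: int_one_le_iff_zero_less)
    have eqn': "(int h)\<^sup>2 * X'\<^sup>2 + int m * Y\<^sup>2 = 4 * int h" using eqn unfolding X' by (simp add: power_mult_distrib)
    \<comment> \<open>Otherwise \<open>h^2 + m <= 4 h\<close>, against \<open>(h - 2)^2 >= 0\<close>
      and \<open>m > 4\<close>.\<close>
    have Y0: "Y = 0"
    proof (rule ccontr)
      assume "Y \<noteq> 0"
      hence "Y\<^sup>2 \<ge> 1" by (simp add: int_one_le_iff_zero_less)
      hence "int m * 1 \<le> int m * Y\<^sup>2" by (intro mult_left_mono) auto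
      moreover have "(int h)\<^sup>2 * 1 \<le> (int h)\<^sup>2 * X'\<^sup>2" using Xp by (intro mult_left_mono) auto
      ultimately have "(int h)\<^sup>2 + int m \<le> 4 * int h" using eqn' by linarith
      moreover have "(int h - 2)\<^sup>2 \<ge> 0" by simp
      hence "(int h)\<^sup>2 - 4 * int h + 4 \<ge> 0" by (simp add: power2_eq_square algebra_simps)
      ultimately show False using m_gt by linarith
    qed
    have "int h * (int h * X'\<^sup>2) = int h * 4" using eqn' Y0 by (simp add: power2_eq_square mult_ac)
    hence hX4: "int h * X'\<^sup>2 = 4" using h0 by simp
    hence "int (h * (nat \<bar>X'\<bar>)\<^sup>2) = int 4" by simp
    hence h4: "h * (nat \<bar>X'\<bar>)\<^sup>2 = 1 * 2\<^sup>2" using of_nat_eq_iff by fastforce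
    have "h = 1" using squarefree_mult_square_unique(1)[OF sqh _ h4] False by simp
    hence "e1 = 1" "f1 = 1" unfolding h_def by auto
    thus ?thesis using ef by simp
  qed
qed

lemma torsion_eq: "{X \<in> carrier CG. X \<otimes>\<^bsub>CG\<^esub> X = \<one>\<^bsub>CG\<^esub>} = Dc ` {e. e dvd M}"
proof (intro equalityI subsetI)
  fix X assume "X \<in> {X \<in> carrier CG. X \<otimes>\<^bsub>CG\<^esub> X = \<one>\<^bsub>CG\<^esub>}"
  hence X: "X \<in> carrier CG" "X \<otimes>\<^bsub>CG\<^esub> X = \<one>\<^bsub>CG\<^esub>" by auto
  obtain I where I: "nzi I" "X = cls I" using carrier_cls[OF X(1)] .
  obtain e where "e dvd M" "cls I = Dc e" using ambiguous_class[OF I(1)] X(2) I(2) by metis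
  thus "X \<in> Dc ` {e. e dvd M}" using I(2) by blast
qed (auto simp: Dc_carrier Dc_square)

text \<open>By \<open>Dc_eqI\<close> and \<open>Dc_eqD\<close> the divisors of \<open>M\<close>
  label the classes in pairs related by the factor \<open>m\<close>. For a fixed prime
  \<open>p\<close> of \<open>m\<close> exactly one member of each pair avoids \<open>p\<close>, so
  the divisors of \<open>M div p\<close> label the classes bijectively.\<close>

lemma card_torsion:
  assumes "card (prime_factors M) = t + 1"
  shows "card {X \<in> carrier CG. X \<otimes>\<^bsub>CG\<^esub> X = \<one>\<^bsub>CG\<^esub>} = 2 ^ t"
proof -
  obtain p where p: "prime p" "p dvd m" using m_gt prime_factor_nat[of m] by auto
  have pM: "p dvd M" using p(2) m_dvd_M dvd_trans by blast
  define N where "N = M div p"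
  have MN: "M = p * N" using pM by (simp add: N_def)
  have pN: "coprime p N" using sqf_M squarefree_coprime_cofactor unfolding MN by blast
  have npN: "\<not> p dvd N" using pN p(1) by (metis coprime_common_divisor dvd_refl not_prime_unit)
  have sN: "squarefree N" using sqf_M squarefree_mono unfolding MN by (metis dvd_triv_right)
  have N0: "N > 0" using M_pos MN by simp
  have inj: "inj_on Dc {e. e dvd N}"
  proof (rule inj_onI)
    fix e f assume ef: "e \<in> {e. e dvd N}" "f \<in> {e. e dvd N}" "Dc e = Dc f"
    hence d: "e dvd M" "f dvd M" by (auto simp: MN)
    show "e = f"
    proof (rule ccontr)
      assume "e \<noteq> f"
      then obtain g where "e * f = g\<^sup>2 * m" using Dc_eqD[OF d ef(3)] by blast
      hence "p dvd e * f" using p(2) by simp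
      hence "p dvd e \<or> p dvd f" using p(1) by (simp add: prime_dvd_mult_iff)
      thus False using ef npN dvd_trans by blast
    qed
  qed
  have "Dc ` {e. e dvd M} = Dc ` {e. e dvd N}"
  proof (intro equalityI subsetI)
    fix X assume "X \<in> Dc ` {e. e dvd M}"
    then obtain e where e: "e dvd M" "X = Dc e" by blast
    show "X \<in> Dc ` {e. e dvd N}"
    proof (cases "p dvd e")
      case False
      hence "coprime e p" using p(1) by (metis coprime_commute prime_imp_coprime)
      hence "e dvd N" using e(1) unfolding MN by (simp add: coprime_dvd_mult_right_iff)
      thus ?thesis using e(2) by blast
    next
      case True
      define g where "g = gcd e m"
      have g0: "g > 0" using m_pos by (simp add: g_def)
      obtain a b where ab: "e = a * g" "m = b * g" "coprime a b"
        using gcd_coprime_exists[of e m] g0 unfolding g_def by auto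
      have "lcm b a = a * b" using ab(3) by (simp add: lcm_coprime coprime_commute mult.commute)
      hence "lcm e m = g * (a * b)" unfolding ab(1,2) by (simp add: lcm_mult_right mult.commute)
      moreover have "lcm e m dvd M" using e(1) m_dvd_M by simp
      ultimately have gM: "g * (a * b) dvd M" by simp
      have "p dvd g" using True p(2) by (simp add: g_def)
      then obtain g' where g': "g = p * g'" by blast
      have "p * (g' * (a * b)) dvd p * N" using gM unfolding g' MN by (simp add: mult.assoc)
      hence "g' * (a * b) dvd N" using prime_gt_0_nat[OF p(1)] by simp
      hence abN: "a * b dvd N" by (metis dvd_mult_right)
      hence abM: "a * b dvd M" unfolding MN by simp
      have "e * (a * b) = a\<^sup>2 * m" unfolding ab(1,2) by (simp add: power2_eq_square mult_ac)
      hence "Dc e = Dc (a * b)" by (rule Dc_eqI[OF e(1) abM])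
      thus ?thesis using e(2) abN by blast
    qed
  qed (auto simp: MN)
  hence "card {X \<in> carrier CG. X \<otimes>\<^bsub>CG\<^esub> X = \<one>\<^bsub>CG\<^esub>} = card {e. e dvd N}"
    unfolding torsion_eq using card_image[OF inj] by simp
  also have "\<dots> = 2 ^ card (prime_factors N)"
    using card_divisors_prod_primes[of "prime_factors N"] squarefree_prod_prime_factors[OF sN] by auto
  also have "card (prime_factors N) = t"
  proof -
    have "prime_factors M = insert p (prime_factors N)"
      unfolding MN using N0 p(1) by (subst prime_factors_product) (auto simp: prime_factorization_prime)
    moreover have "p \<notin> prime_factors N" using npN by auto
    ultimately show ?thesis using assms by simp
  qed
  finally show ?thesis .
qed

text \<open>With \<open>D = De e0\<close> and \<open>B = z D + (a)\<close> one has \<open>B \<odot> B = a D\<close> and \<open>B\<close> has norm \<open>e0 z\<close>: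
  an explicit square root of the class of \<open>D\<close>.\<close>

lemma square_root_class:
  assumes e0: "e0 dvd M" and z0: "z > 0" and a: "a \<in> De e0" and na: "(cmod a)\<^sup>2 = real (e0 * z\<^sup>2)"
    and tr: "2 * Re a = of_int (int e0 * s)" and cop: "coprime s (int z)"
  obtains B where "nzi B" "nrm B = e0 * z" "cls B \<otimes>\<^bsub>CG\<^esub> cls B = Dc e0"
proof -
  have e0p: "e0 > 0" using dvd_M_pos[OF e0] .
  let ?D = "De e0"
  have D: "nzi ?D" using nzi_De_M[OF e0] .
  define Z where "Z = (of_nat z :: complex)"
  have Z: "Z \<in> OK" "Z \<noteq> 0" "cnj Z = Z" using z0 by (auto simp: Z_def)
  have aO: "a \<in> OK" using a by (simp add: De_def)
  have a0: "a \<noteq> 0" using na z0 e0p by auto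
  have aa: "a * cnj a = of_nat e0 * (Z * Z)"
    using na by (metis Z_def complex_norm_square of_nat_mult of_real_of_nat_eq power2_eq_square)
  have nZ: "nzi (smul Z ?D)" and nA: "nzi (smul a OK)" using nzi_smul_OK D Z aO a0 by auto
  define B where "B = sm (smul Z ?D) (smul a OK)"
  have B: "nzi B" unfolding B_def by (rule nzi_sm[OF nZ nA])
  have cB: "nzi (cj B)" using B by blast
  \<comment> \<open>\<open>B B = a (B + cj B)\<close> follows by expanding the generators. That the
    sum \<open>C\<close> equals \<open>De e0\<close> is then shown by comparing norms.\<close>
  define C where "C = sm B (cj B)"
  have C: "nzi C" unfolding C_def by (rule nzi_sm[OF B cB])
  have BB: "nzi (B \<odot> B)" using B by blast
  have aC: "nzi (smul a C)" using nzi_smul_OK[OF C aO a0] .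
  have BE: "\<exists>d o'. d \<in> ?D \<and> o' \<in> OK \<and> b = Z * d + a * o'" if "b \<in> B" for b
    using that unfolding B_def sm_def smul_def by blast
  have BI: "Z * d + a * o' \<in> B" if "d \<in> ?D" "o' \<in> OK" for d o'
    unfolding B_def by (intro smI smulI that)
  have aB: "a \<in> B" using BI[OF nzi_0[OF D] OK_1] by simp
  have ZB: "Z * d \<in> B" if "d \<in> ?D" for d using BI[OF that OK_0] by simp
  have "B \<odot> B \<subseteq> smul a C"
  proof (rule prd_subset)
    fix b1 b2 assume "b1 \<in> B" "b2 \<in> B"
    then obtain d1 o1 d2 o2 where h: "d1 \<in> ?D" "o1 \<in> OK" "b1 = Z * d1 + a * o1" "d2 \<in> ?D" "o2 \<in> OK" "b2 = Z * d2 + a * o2"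
      using BE by metis
    obtain v where v: "v \<in> OK" "d1 * d2 = of_nat e0 * v" using De_mult[OF e0p h(1,4)] by (auto simp: smul_def)
    have "b1 * b2 = (Z * Z) * (d1 * d2) + Z * a * (d1 * o2 + d2 * o1) + a * a * (o1 * o2)"
      unfolding h(3,6) by (simp add: algebra_simps)
    also have "(Z * Z) * (d1 * d2) = (a * cnj a) * v" unfolding v(2) aa by (simp add: mult_ac)
    finally have e: "b1 * b2 = a * ((Z * (d1 * o2 + d2 * o1) + a * (o1 * o2)) + cnj (Z * 0 + a * cnj v))"
      by (simp add: algebra_simps)
    show "b1 * b2 \<in> smul a C" unfolding e C_def
      by (intro smulI smI cjI BI nzi_add[OF D] nzi_mult_right[OF D] nzi_0[OF D] OK_mult OK_cnj h v)
  qed (rule nzi_add[OF aC])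
  moreover have "smul a C \<subseteq> B \<odot> B"
  proof
    fix x assume "x \<in> smul a C"
    then obtain b1 b2 where b: "b1 \<in> B" "cnj b2 \<in> B" "x = a * (b1 + b2)"
      unfolding C_def sm_def smul_def cj_iff[symmetric] by (auto simp: cj_iff)
    obtain d o' where d: "d \<in> ?D" "o' \<in> OK" "cnj b2 = Z * d + a * o'" using BE[OF b(2)] by blast
    have b2: "b2 = Z * cnj d + cnj a * cnj o'" using arg_cong[OF d(3), of cnj] Z(3) by simp
    have "of_nat e0 \<in> ?D \<odot> ?D" unfolding De_prd[OF e0] using smulI[OF OK_1, of "of_nat e0"] by simp
    hence "(Z * Z) * of_nat e0 \<in> smul (Z * Z) (?D \<odot> ?D)" by (rule smulI)
    also have "smul (Z * Z) (?D \<odot> ?D) = smul Z ?D \<odot> smul Z ?D"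
      unfolding smul_prd[of Z ?D] prd_smul[OF D D Z(1,2)] by simp
    also have "\<dots> \<subseteq> B \<odot> B" by (rule prd_mono) (auto simp: smul_def intro: ZB)
    finally have ZZ: "(Z * Z) * of_nat e0 \<in> B \<odot> B" .
    have "x = a * b1 + (Z * cnj d) * a + ((Z * Z) * of_nat e0) * cnj o'"
      unfolding b(3) b2 using aa by (simp add: algebra_simps)
    also have "\<dots> \<in> B \<odot> B"
      by (intro nzi_add[OF BB] prd_mem nzi_mult_right[OF BB] ZZ aB b(1) ZB cnj_De OK_cnj d)
    finally show "x \<in> B \<odot> B" .
  qed
  ultimately have BBa: "B \<odot> B = smul a C" by blast
  have "real (nrm (B \<odot> B)) = real (e0 * z\<^sup>2) * real (nrm C)"
    using nrm_smul[OF C aC a0] na unfolding BBa by simp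
  hence "real ((nrm B)\<^sup>2) = real (e0 * z\<^sup>2 * nrm C)" using nrm_prd[OF B B] by (simp add: power2_eq_square)
  hence n1: "(nrm B)\<^sup>2 = e0 * z\<^sup>2 * nrm C" using of_nat_eq_iff by blast
  \<comment> \<open>Combined with \<open>B B = a C\<close> this gives \<open>nrm B = e0 z k\<close>
    and \<open>nrm C = e0 k^2\<close> for some \<open>k\<close>.\<close>
  have "e0 * z dvd nrm B"
  proof (rule nrm_greatest)
    fix b j assume b: "b \<in> B" "(cmod b)\<^sup>2 = real j"
    obtain d o' where d: "d \<in> ?D" "o' \<in> OK" "b = Z * d + a * o'" using BE[OF b(1)] by blast
    obtain i1 where i1: "(cmod d)\<^sup>2 = real i1" using OK_norm[OF nzi_OK_mem[OF D d(1)]] by metis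
    have "e0 dvd i1" using nrm_dvd[OF d(1) i1] nrm_De[OF e0] by simp
    then obtain i2 where i2: "i1 = e0 * i2" by blast
    obtain i3 where i3: "(cmod o')\<^sup>2 = real i3" using OK_norm[OF d(2)] by metis
    obtain v where v: "v \<in> OK" "d * cnj a = of_nat e0 * v" using De_mult[OF e0p d(1) cnj_De[OF a]] by (auto simp: smul_def)
    have vo: "v * cnj o' \<in> OK" using v(1) d(2) by auto
    obtain i4 where i4: "2 * Re (v * cnj o') = of_int i4" using vo by (auto simp: OK_def elim: Ints_cases)
    have R: "2 * Re (of_nat k * x) = real k * (2 * Re x)" for k x by simp
    have "(cmod b)\<^sup>2 = (cmod (Z * d))\<^sup>2 + (cmod (a * o'))\<^sup>2 + 2 * Re ((Z * d) * cnj (a * o'))"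
      unfolding d(3) by (rule cmod_sq_add)
    also have "(Z * d) * cnj (a * o') = of_nat (z * e0) * (v * cnj o')"
    proof -
      have "(Z * d) * cnj (a * o') = Z * (d * cnj a) * cnj o'" by simp
      thus ?thesis unfolding v(2) by (simp add: Z_def)
    qed
    also have "2 * Re (of_nat (z * e0) * (v * cnj o')) = real (z * e0) * (2 * Re (v * cnj o'))"
      by (rule R)
    also have "(cmod (Z * d))\<^sup>2 = real (z\<^sup>2 * e0 * i2)" using i1 unfolding i2 by (simp add: Z_def norm_mult power_mult_distrib)
    also have "(cmod (a * o'))\<^sup>2 = real (e0 * z\<^sup>2 * i3)" using i3 na by (simp add: norm_mult power_mult_distrib)
    finally have "real_of_int (int j) = of_int (int (e0 * z) * (int (z * i2) + int (z * i3) + i4))"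
      unfolding i4 b(2) by (simp add: power2_eq_square algebra_simps)
    hence "int j = int (e0 * z) * (int (z * i2) + int (z * i3) + i4)" using of_int_eq_iff by blast
    hence "int (e0 * z) dvd int j" by (metis dvd_triv_left)
    thus "e0 * z dvd j" by (simp only: int_dvd_int_iff)
  qed
  then obtain k where k: "nrm B = e0 * z * k" by blast
  have "e0 * z\<^sup>2 * (e0 * k\<^sup>2) = e0 * z\<^sup>2 * nrm C" using n1 unfolding k by (simp add: power2_eq_square mult_ac)
  hence nC: "nrm C = e0 * k\<^sup>2" using e0p z0 by simp
  have BD: "B \<subseteq> ?D"
  proof
    fix b assume "b \<in> B"
    then obtain d o' where d: "d \<in> ?D" "o' \<in> OK" "b = Z * d + a * o'" using BE by blast
    show "b \<in> ?D" unfolding d(3) by (intro nzi_add[OF D] nzi_mult[OF D] nzi_mult_right[OF D] d a Z)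
  qed
  have CD: "C \<subseteq> ?D"
  proof
    fix x assume "x \<in> C"
    then obtain b1 b2 where b: "b1 \<in> B" "cnj b2 \<in> B" "x = b1 + b2"
      unfolding C_def sm_def cj_iff[symmetric] by (auto simp: cj_iff)
    have "b2 \<in> ?D" using cnj_De[of "cnj b2" e0] b(2) BD by auto
    thus "x \<in> ?D" unfolding b(3) using nzi_add[OF D] b(1) BD by blast
  qed
  \<comment> \<open>\<open>C\<close> contains \<open>z e0\<close> and the trace \<open>e0 s\<close>
    of \<open>a\<close>. As \<open>s\<close> and \<open>z\<close> are coprime, \<open>k^2\<close>
    divides the squarefree number \<open>e0\<close>, so \<open>k = 1\<close>.\<close>
  have d1: "e0 * k\<^sup>2 dvd e0\<^sup>2 * z\<^sup>2"
  proof -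
    have "Z * of_nat e0 \<in> C" unfolding C_def by (rule sm_left[OF cB ZB[OF self_De]])
    moreover have "(cmod (Z * of_nat e0))\<^sup>2 = real (e0\<^sup>2 * z\<^sup>2)" by (simp add: Z_def norm_mult power_mult_distrib)
    ultimately show ?thesis using nrm_dvd unfolding nC[symmetric] by blast
  qed
  have d2: "e0 * k\<^sup>2 dvd e0\<^sup>2 * (nat \<bar>s\<bar>)\<^sup>2"
  proof -
    have aC': "a + cnj a \<in> C" unfolding C_def by (intro smI cjI aB)
    have "a + cnj a = of_int (int e0 * s)" using tr by (simp add: complex_eq_iff)
    hence "(cmod (a + cnj a))\<^sup>2 = (real_of_int (int e0 * s))\<^sup>2" by (simp only: norm_of_int power2_abs)
    also have "\<dots> = real (e0\<^sup>2 * (nat \<bar>s\<bar>)\<^sup>2)" by (simp add: power_mult_distrib)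
    finally show ?thesis using nrm_dvd[OF aC'] unfolding nC[symmetric] by blast
  qed
  have "k\<^sup>2 dvd e0 * z\<^sup>2" "k\<^sup>2 dvd e0 * (nat \<bar>s\<bar>)\<^sup>2"
    using d1 d2 e0p by (simp_all add: power2_eq_square mult.assoc)
  hence "k\<^sup>2 dvd gcd (e0 * z\<^sup>2) (e0 * (nat \<bar>s\<bar>)\<^sup>2)" by simp
  also have "gcd (e0 * z\<^sup>2) (e0 * (nat \<bar>s\<bar>)\<^sup>2) = e0 * gcd (z\<^sup>2) ((nat \<bar>s\<bar>)\<^sup>2)" by (rule gcd_mult_distrib_nat[symmetric])
  also have "gcd (z\<^sup>2) ((nat \<bar>s\<bar>)\<^sup>2) = 1"
  proof -
    have "coprime (int (nat \<bar>s\<bar>)) (int z)" using cop by simp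
    hence "coprime (nat \<bar>s\<bar>) z" by (simp only: coprime_int_iff)
    hence "coprime (z\<^sup>2) ((nat \<bar>s\<bar>)\<^sup>2)" by (simp add: coprime_commute)
    thus ?thesis by simp
  qed
  finally have "k\<^sup>2 dvd e0" by simp
  hence "k\<^sup>2 dvd M" using e0 dvd_trans by blast
  hence "k = 1" using sqf_M squarefreeD by fastforce
  hence nB: "nrm B = e0 * z" and nC': "nrm C = nrm ?D" using k nC nrm_De[OF e0] by simp_all
  have "C = ?D" by (rule eq_if_subset_nrm_eq[OF C D CD nC'])
  hence "cls B \<otimes>\<^bsub>CG\<^esub> cls B = Dc e0" using cls_mult[OF B B] BBa cls_smul[OF D aO a0] by simp
  thus ?thesis using that[OF B nB] by blast
qed

text \<open>By \<open>norms\<close> the only squares among the classes of order at most two are 1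
  and \<open>Dc e0\<close>. If \<open>B\<close> is the square root of \<open>Dc e0\<close>, then
  \<open>Dc e0\<close> is a fourth power iff \<open>B\<close> times some ambiguous class
  \<open>Dc e\<close> is a square, that is, iff \<open>e0 z e\<close> is a norm. Here
  \<open>e0\<close> drops out, being the norm of \<open>a / z\<close>.\<close>

theorem class_number_two_part:
  assumes t: "card (prime_factors M) = t + 1"
    and e0: "e0 dvd M" "e0 \<noteq> 1" "e0 \<noteq> m"
    and norms: "\<And>e. e dvd M \<Longrightarrow> knorm m e \<Longrightarrow> e = 1 \<or> e = m \<or> e = e0 \<or> (\<exists>g. e * e0 = g\<^sup>2 * m)"
    and z0: "z > 0" and a: "a \<in> De e0" and na: "(cmod a)\<^sup>2 = real (e0 * z\<^sup>2)"
    and tr: "2 * Re a = of_int (int e0 * s)" and cop: "coprime s (int z)"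
  shows "2 ^ (t + 1) dvd h_neg m" and "2 ^ (t + 2) dvd h_neg m \<longleftrightarrow> (\<exists>e. e dvd M \<and> knorm m (z * e))"
proof -
  let ?c = "Dc e0"
  have e0p: "e0 > 0" using dvd_M_pos[OF e0(1)] .
  obtain B where B: "nzi B" "nrm B = e0 * z" "cls B \<otimes>\<^bsub>CG\<^esub> cls B = ?c"
    using square_root_class[OF e0(1) z0 a na tr cop] .
  have Bc: "cls B \<in> carrier CG" using cls_carrier[OF B(1)] .
  have ne0: "knorm m e0"
  proof -
    have "a / of_nat z \<in> K" using a OK_K by (auto simp: De_def)
    moreover have "(cmod (a / of_nat z))\<^sup>2 = real e0" using na z0 by (simp add: norm_divide power_divide)
    moreover have "a \<noteq> 0" using na z0 e0p by auto
    hence "a / of_nat z \<noteq> 0" using z0 by simp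
    ultimately show ?thesis using knorm_iff_K[OF e0p] by blast
  qed
  have c1: "?c \<noteq> \<one>\<^bsub>CG\<^esub>"
  proof
    assume "?c = \<one>\<^bsub>CG\<^esub>"
    hence "Dc e0 = Dc 1" by (simp only: Dc_1)
    then obtain g where g: "e0 * 1 = g\<^sup>2 * m" using Dc_eqD[OF e0(1), of 1] e0(2) by auto
    hence "g\<^sup>2 dvd M" using e0(1) by (metis dvd_mult_left mult.right_neutral)
    hence "g = 1" using sqf_M squarefreeD by fastforce
    thus False using g e0(3) by simp
  qed
  have T: "{X \<in> carrier CG. X \<otimes>\<^bsub>CG\<^esub> X = \<one>\<^bsub>CG\<^esub>} \<inter> (\<lambda>x. x \<otimes>\<^bsub>CG\<^esub> x) ` carrier CG = {\<one>\<^bsub>CG\<^esub>, ?c}"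
  proof (intro equalityI subsetI)
    fix X assume X: "X \<in> {X \<in> carrier CG. X \<otimes>\<^bsub>CG\<^esub> X = \<one>\<^bsub>CG\<^esub>} \<inter> (\<lambda>x. x \<otimes>\<^bsub>CG\<^esub> x) ` carrier CG"
    then obtain e where e: "e dvd M" "X = Dc e" unfolding torsion_eq by blast
    obtain Y where "Y \<in> carrier CG" "X = Y \<otimes>\<^bsub>CG\<^esub> Y" using X by blast
    then obtain J where J: "nzi J" "Dc e = cls J \<otimes>\<^bsub>CG\<^esub> cls J" using carrier_cls e(2) by metis
    have "knorm m e" using knorm_nrm_if_square[OF nzi_De_M[OF e(1)] J] nrm_De[OF e(1)] by simp
    then consider "e = 1" | "e = m" | "e = e0" | g where "e * e0 = g\<^sup>2 * m" using norms[OF e(1)] by blast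
    thus "X \<in> {\<one>\<^bsub>CG\<^esub>, ?c}"
    proof cases
      case 1
      thus ?thesis using e(2) Dc_1 by simp
    next
      case 2
      have "Dc m = Dc 1" by (rule Dc_eqI[OF m_dvd_M, of 1 1]) simp_all
      thus ?thesis using 2 e(2) Dc_1 by simp
    next
      case 4
      thus ?thesis using Dc_eqI[OF e(1) e0(1)] e(2) by blast
    qed (use e in blast)
  next
    fix X assume "X \<in> {\<one>\<^bsub>CG\<^esub>, ?c}"
    moreover have "\<one>\<^bsub>CG\<^esub> = \<one>\<^bsub>CG\<^esub> \<otimes>\<^bsub>CG\<^esub> \<one>\<^bsub>CG\<^esub>" by simp
    hence "\<one>\<^bsub>CG\<^esub> \<in> (\<lambda>x. x \<otimes>\<^bsub>CG\<^esub> x) ` carrier CG" using CG.one_closed by (rule image_eqI)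
    moreover have "?c \<in> (\<lambda>x. x \<otimes>\<^bsub>CG\<^esub> x) ` carrier CG" using B(3)[symmetric] Bc by (rule image_eqI)
    ultimately show "X \<in> {X \<in> carrier CG. X \<otimes>\<^bsub>CG\<^esub> X = \<one>\<^bsub>CG\<^esub>} \<inter> (\<lambda>x. x \<otimes>\<^bsub>CG\<^esub> x) ` carrier CG"
      using Dc_carrier[OF e0(1)] Dc_square[OF e0(1)] by auto
  qed
  note two = CG.order_two_part[OF finite_CG card_torsion[OF t] c1 T]
  show "2 ^ (t + 1) dvd h_neg m" unfolding h_neg_card by (rule two(1))
  have "2 ^ (t + 2) dvd h_neg m \<longleftrightarrow> (\<exists>b\<in>carrier CG. ?c = (b \<otimes>\<^bsub>CG\<^esub> b) \<otimes>\<^bsub>CG\<^esub> (b \<otimes>\<^bsub>CG\<^esub> b))"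
    unfolding h_neg_card by (rule two(2))
  also have "\<dots> \<longleftrightarrow> (\<exists>e. e dvd M \<and> knorm m (z * e))"
  proof
    assume "\<exists>b\<in>carrier CG. ?c = (b \<otimes>\<^bsub>CG\<^esub> b) \<otimes>\<^bsub>CG\<^esub> (b \<otimes>\<^bsub>CG\<^esub> b)"
    then obtain b where b: "b \<in> carrier CG" "?c = (b \<otimes>\<^bsub>CG\<^esub> b) \<otimes>\<^bsub>CG\<^esub> (b \<otimes>\<^bsub>CG\<^esub> b)" by blast
    define y where "y = b \<otimes>\<^bsub>CG\<^esub> b"
    have y: "y \<in> carrier CG" "?c = y \<otimes>\<^bsub>CG\<^esub> y" using b by (auto simp: y_def)
    \<comment> \<open>\<open>cls B\<close> and \<open>y\<close> have the same square, so they differ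
      by an ambiguous class.\<close>
    define X where "X = cls B \<otimes>\<^bsub>CG\<^esub> inv\<^bsub>CG\<^esub> y"
    have X: "X \<in> carrier CG" using Bc y by (simp add: X_def)
    have "X \<otimes>\<^bsub>CG\<^esub> X = (cls B \<otimes>\<^bsub>CG\<^esub> cls B) \<otimes>\<^bsub>CG\<^esub> inv\<^bsub>CG\<^esub> (y \<otimes>\<^bsub>CG\<^esub> y)"
      unfolding X_def using Bc y(1) by (simp add: CG.m_ac CG.inv_mult)
    also have "\<dots> = ?c \<otimes>\<^bsub>CG\<^esub> inv\<^bsub>CG\<^esub> ?c" unfolding B(3) y(2)[symmetric] ..
    also have "\<dots> = \<one>\<^bsub>CG\<^esub>" using Dc_carrier[OF e0(1)] by simp
    finally have XX: "X \<otimes>\<^bsub>CG\<^esub> X = \<one>\<^bsub>CG\<^esub>" .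
    hence "X \<in> Dc ` {e. e dvd M}" unfolding torsion_eq[symmetric] using X by blast
    then obtain e where e: "e dvd M" "X = Dc e" by blast
    have De: "nzi (De e)" using nzi_De_M[OF e(1)] .
    have Xy: "X \<otimes>\<^bsub>CG\<^esub> y = cls B" unfolding X_def using Bc y(1) by (simp add: CG.m_assoc)
    have "cls B \<otimes>\<^bsub>CG\<^esub> X = (X \<otimes>\<^bsub>CG\<^esub> y) \<otimes>\<^bsub>CG\<^esub> X" unfolding Xy ..
    also have "\<dots> = (X \<otimes>\<^bsub>CG\<^esub> X) \<otimes>\<^bsub>CG\<^esub> y" using X y(1) by (simp add: CG.m_ac)
    also have "\<dots> = b \<otimes>\<^bsub>CG\<^esub> b" unfolding XX y_def using b(1) by simp
    finally have sq: "cls (B \<odot> De e) = b \<otimes>\<^bsub>CG\<^esub> b" unfolding e(2) using cls_mult[OF B(1) De] by simp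
    obtain J where J: "nzi J" "b = cls J" using carrier_cls[OF b(1)] .
    have BDe: "nzi (B \<odot> De e)" using B(1) De by blast
    have "knorm m (nrm (B \<odot> De e))" by (rule knorm_nrm_if_square[OF BDe J(1)]) (use sq J(2) in simp)
    hence "knorm m (z * e * e0)" using nrm_prd[OF B(1) De] B(2) nrm_De[OF e(1)] by (simp add: mult_ac)
    hence "knorm m (z * e)" by (rule knorm_cancel_right[OF e0p _ ne0])
    thus "\<exists>e. e dvd M \<and> knorm m (z * e)" using e(1) by blast
  next
    assume "\<exists>e. e dvd M \<and> knorm m (z * e)"
    then obtain e where e: "e dvd M" "knorm m (z * e)" by blast
    have De: "nzi (De e)" using nzi_De_M[OF e(1)] .
    have BDe: "nzi (B \<odot> De e)" using B(1) De by blast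
    have "knorm m (e0 * (z * e))" by (rule knorm_mult[OF ne0 e(2)])
    hence "knorm m (nrm (B \<odot> De e))" using nrm_prd[OF B(1) De] B(2) nrm_De[OF e(1)] by (simp add: mult_ac)
    then obtain J where J: "nzi J" "cls (B \<odot> De e) = cls J \<otimes>\<^bsub>CG\<^esub> cls J" using square_if_knorm_nrm[OF BDe] by blast
    have Jc: "cls J \<in> carrier CG" using cls_carrier[OF J(1)] .
    have Ec: "Dc e \<in> carrier CG" using Dc_carrier[OF e(1)] .
    have "(cls J \<otimes>\<^bsub>CG\<^esub> cls J) \<otimes>\<^bsub>CG\<^esub> (cls J \<otimes>\<^bsub>CG\<^esub> cls J) = (cls B \<otimes>\<^bsub>CG\<^esub> Dc e) \<otimes>\<^bsub>CG\<^esub> (cls B \<otimes>\<^bsub>CG\<^esub> Dc e)"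
      using J(2) cls_mult[OF B(1) De] by simp
    also have "\<dots> = (cls B \<otimes>\<^bsub>CG\<^esub> cls B) \<otimes>\<^bsub>CG\<^esub> (Dc e \<otimes>\<^bsub>CG\<^esub> Dc e)" using Bc Ec by (simp add: CG.m_ac)
    also have "\<dots> = ?c" unfolding B(3) Dc_square[OF e(1)] using Dc_carrier[OF e0(1)] by simp
    finally show "\<exists>b\<in>carrier CG. ?c = (b \<otimes>\<^bsub>CG\<^esub> b) \<otimes>\<^bsub>CG\<^esub> (b \<otimes>\<^bsub>CG\<^esub> b)" using Jc by metis
  qed
  finally show "2 ^ (t + 2) dvd h_neg m \<longleftrightarrow> (\<exists>e. e dvd M \<and> knorm m (z * e))" .
qed

end

section \<open>Linear algebra: matrices of corank one with vanishing row sums\<close>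

lemma corank_one_kernel:
  fixes A :: "'a :: field mat" and x :: "nat \<Rightarrow> 'a"
  assumes A: "A \<in> carrier_mat t t" and rk: "vec_space.rank t A = t - 1" and t: "t \<ge> 1"
    and rows: "\<And>r. r < t \<Longrightarrow> (\<Sum>i<t. A $$ (r, i)) = 0"
    and ker: "\<And>r. r < t \<Longrightarrow> (\<Sum>i<t. A $$ (r, i) * x i) = 0"
    and ij: "i < t" "j < t"
  shows "x i = x j"
proof -
  interpret vec_space "TYPE('a)" t .
  obtain S where S: "finite S" "maximal S (\<lambda>T. T \<subseteq> set (cols A) \<and> lin_indpt T)"
    using maximal_exists_superset[of "set (cols A)" "\<lambda>T. T \<subseteq> set (cols A) \<and> lin_indpt T" "{}"]
    by (auto simp: lin_dep_def)
  have SA: "S \<subseteq> set (cols A)" and Sli: "lin_indpt S" using S(2) unfolding maximal_def by blast+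
  have Scard: "card S = t - 1" using rank_card_indpt[OF A S(2)] rk by simp
  have "\<forall>s\<in>S. \<exists>i<t. s = col A i"
  proof
    fix s assume "s \<in> S"
    hence "s \<in> set (cols A)" using SA by blast
    then obtain i where "i < length (cols A)" "s = cols A ! i" by (metis in_set_conv_nth)
    thus "\<exists>i<t. s = col A i" using A by (intro exI[of _ i]) auto
  qed
  then obtain f where f: "\<And>s. s \<in> S \<Longrightarrow> f s < t \<and> s = col A (f s)" by metis
  have finj: "inj_on f S" by (rule inj_onI) (metis f)
  have "card (f ` S) = t - 1" using card_image[OF finj] Scard by simp
  moreover have fS: "f ` S \<subseteq> {..<t}" using f by auto
  ultimately have "card ({..<t} - f ` S) = 1" using t by (subst card_Diff_subset) (auto intro: finite_subset)
  then obtain i0 where i0: "{..<t} - f ` S = {i0}" using card_1_singletonE by blast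
  \<comment> \<open>Constant vectors lie in the kernel, so \<open>x\<close> can be made to vanish at
    the one index \<open>i0\<close> outside the chosen columns. What remains is a linear relation
    between independent columns.\<close>
  define y where "y = (\<lambda>i. x i - x i0)"
  have y0: "y i0 = 0" by (simp add: y_def)
  have kery: "(\<Sum>i<t. A $$ (r, i) * y i) = 0" if "r < t" for r
  proof -
    have "(\<Sum>i<t. A $$ (r, i) * y i) = (\<Sum>i<t. A $$ (r, i) * x i) - (\<Sum>i<t. A $$ (r, i)) * x i0"
      by (simp add: y_def right_diff_distrib sum_subtractf sum_distrib_right)
    thus ?thesis using rows ker that by simp
  qed
  have Scarr: "S \<subseteq> carrier_vec t" using SA A cols_dim[of A] by auto
  have lc: "lincomb (\<lambda>s. y (f s)) S = 0\<^sub>v t"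
  proof (rule eq_vecI)
    show "dim_vec (lincomb (\<lambda>s. y (f s)) S) = dim_vec (0\<^sub>v t)"
      using lincomb_dim[OF S(1) Scarr] by simp
    fix r assume "r < dim_vec (0\<^sub>v t :: 'a Matrix.vec)"
    hence r: "r < t" by simp
    have "lincomb (\<lambda>s. y (f s)) S $ r = (\<Sum>s\<in>S. y (f s) * s $ r)"
      by (rule lincomb_index[OF r Scarr])
    also have "\<dots> = (\<Sum>s\<in>S. A $$ (r, f s) * y (f s))"
    proof (rule sum.cong[OF refl])
      fix s assume s: "s \<in> S"
      have "s $ r = A $$ (r, f s)" using f[OF s] r A by (metis carrier_matD index_col)
      thus "y (f s) * s $ r = A $$ (r, f s) * y (f s)" by (simp add: mult.commute)
    qed
    also have "\<dots> = (\<Sum>i\<in>f ` S. A $$ (r, i) * y i)" using finj by (simp add: sum.reindex)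
    also have "\<dots> = (\<Sum>i<t. A $$ (r, i) * y i)"
      by (rule sum.mono_neutral_left) (use fS i0 y0 in auto)
    also have "\<dots> = 0" by (rule kery[OF r])
    finally show "lincomb (\<lambda>s. y (f s)) S $ r = 0\<^sub>v t $ r" using r by simp
  qed
  have yS: "y (f s) = 0" if s: "s \<in> S" for s
  proof (rule ccontr)
    assume "y (f s) \<noteq> 0"
    hence "lin_dep S" using lin_dep_crit[OF S(1) subset_refl _ s _ lc] by auto
    thus False using Sli by blast
  qed
  have "y i = 0" if "i < t" for i
  proof (cases "i \<in> f ` S")
    case False
    hence "i = i0" using i0 that by blast
    thus ?thesis using y0 by simp
  qed (use yS in auto)
  thus ?thesis using ij unfolding y_def by (metis eq_iff_diff_eq_0)
qed

lemma finite_UNIV_bit: "finite (UNIV :: bit set)"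
proof -
  have "(UNIV :: bit set) = {0, 1}" by (auto intro: bit.exhaust)
  thus ?thesis by (metis finite.emptyI finite_insert)
qed

text \<open>Zero row sums and symmetry confine the image to vectors of sum zero. Normalizing
  \<open>x 0 = 0\<close> and ignoring row 0 leaves an injective self-map of the finite set
  \<open>F\<close>, hence a surjective one; row 0 is then recovered from the total sum.\<close>

lemma corank_one_image:
  fixes A :: "bit mat" and b :: "nat \<Rightarrow> bit"
  assumes A: "A \<in> carrier_mat t t" and rk: "vec_space.rank t A = t - 1" and t: "t \<ge> 1"
    and rows: "\<And>r. r < t \<Longrightarrow> (\<Sum>i<t. A $$ (r, i)) = 0"
    and sym: "\<And>i j. i < t \<Longrightarrow> j < t \<Longrightarrow> A $$ (i, j) = A $$ (j, i)"
    and b: "(\<Sum>i<t. b i) = 0"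
  obtains x where "\<And>r. r < t \<Longrightarrow> (\<Sum>i<t. A $$ (r, i) * x i) = b r"
proof -
  have total: "(\<Sum>r<t. \<Sum>i<t. A $$ (r, i) * x i) = 0" for x
  proof -
    have "(\<Sum>r<t. \<Sum>i<t. A $$ (r, i) * x i) = (\<Sum>i<t. \<Sum>r<t. A $$ (r, i) * x i)" by (rule sum.swap)
    also have "\<dots> = (\<Sum>i<t. (\<Sum>r<t. A $$ (i, r)) * x i)"
      unfolding sum_distrib_right by (intro sum.cong refl) (simp add: sym)
    also have "\<dots> = 0" using rows by simp
    finally show ?thesis .
  qed
  have split0: "(\<Sum>r<t. g r) = g 0 + (\<Sum>r\<in>{1..<t}. g r)" for g :: "nat \<Rightarrow> bit"
    using t sum.atLeast_Suc_lessThan[of 0 t g] by (simp add: lessThan_atLeast0)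
  define F where "F = PiE {1..<t} (\<lambda>_. UNIV :: bit set)"
  have finF: "finite F" unfolding F_def by (intro finite_PiE) (auto intro: finite_UNIV_bit)
  define ext where "ext = (\<lambda>x :: nat \<Rightarrow> bit. x(0 := 0))"
  define g where "g = (\<lambda>x. restrict (\<lambda>r. \<Sum>i<t. A $$ (r, i) * ext x i) {1..<t})"
  have gF: "g ` F \<subseteq> F" unfolding g_def F_def by auto
  have inj: "inj_on g F"
  proof (rule inj_onI)
    fix x y assume xy: "x \<in> F" "y \<in> F" "g x = g y"
    define d where "d = (\<lambda>i. ext x i - ext y i)"
    have diff: "(\<Sum>i<t. A $$ (r, i) * d i) = (\<Sum>i<t. A $$ (r, i) * ext x i) - (\<Sum>i<t. A $$ (r, i) * ext y i)" for r
      unfolding d_def right_diff_distrib by (rule sum_subtractf)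
    have pos: "(\<Sum>i<t. A $$ (r, i) * d i) = 0" if "r \<in> {1..<t}" for r
      using fun_cong[OF xy(3), of r] that unfolding diff g_def by simp
    have "(\<Sum>i<t. A $$ (0, i) * d i) = 0"
      using total[of d] split0[of "\<lambda>r. \<Sum>i<t. A $$ (r, i) * d i"] pos by simp
    hence "(\<Sum>i<t. A $$ (r, i) * d i) = 0" if "r < t" for r using pos[of r] that by (cases "r = 0") auto
    hence "d i = d 0" if "i < t" for i
      using corank_one_kernel[OF A rk t rows, of d i 0] that t by simp
    moreover have "d 0 = 0" by (simp add: d_def ext_def)
    ultimately have d0: "d i = 0" if "i < t" for i using that by simp
    show "x = y"
    proof
      fix i
      show "x i = y i"
      proof (cases "i \<in> {1..<t}")
        case True
        hence "ext x i = x i" "ext y i = y i" by (auto simp: ext_def)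
        thus ?thesis using d0[of i] True unfolding d_def by (metis eq_iff_diff_eq_0 atLeastLessThan_iff)
      next
        case False
        thus ?thesis using xy(1,2) unfolding F_def by (auto simp: PiE_def extensional_def)
      qed
    qed
  qed
  have "restrict b {1..<t} \<in> F" unfolding F_def by auto
  then obtain x where x: "x \<in> F" "g x = restrict b {1..<t}"
    using endo_inj_surj[OF finF gF inj] by (metis imageE)
  have pos: "(\<Sum>i<t. A $$ (r, i) * ext x i) = b r" if "r \<in> {1..<t}" for r
    using fun_cong[OF x(2), of r] that unfolding g_def by simp
  have "(\<Sum>i<t. A $$ (0, i) * ext x i) = b 0"
  proof -
    have "(\<Sum>i<t. A $$ (0, i) * ext x i) + (\<Sum>r\<in>{1..<t}. b r) = 0"
      using total[of "ext x"] split0[of "\<lambda>r. \<Sum>i<t. A $$ (r, i) * ext x i"] pos by simp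
    moreover have "b 0 + (\<Sum>r\<in>{1..<t}. b r) = 0" using b split0[of b] by simp
    ultimately show ?thesis by (metis add_right_cancel)
  qed
  hence "(\<Sum>i<t. A $$ (r, i) * ext x i) = b r" if "r < t" for r using pos[of r] that by (cases "r = 0") auto
  thus ?thesis using that by blast
qed

section \<open>The matrix of Legendre symbols\<close>

definition sgb :: "bit \<Rightarrow> int" where "sgb b = (if b = 0 then 1 else - 1)"

lemma sgb_add: "sgb (a + b) = sgb a * sgb b"
  by (cases a; cases b) (simp_all add: sgb_def)

lemma sgb_sum: "sgb (\<Sum>i\<in>S. f i) = (\<Prod>i\<in>S. sgb (f i))"
proof (induction S rule: infinite_finite_induct)
  case (insert x F)
  thus ?case by (simp only: sum.insert[OF insert(1,2)] prod.insert[OF insert(1,2)] sgb_add)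
qed (simp_all add: sgb_def)

lemma bit_add_cancel: "a + b + a = (b :: bit)"
  by (cases a; cases b) simp_all

lemma sgb_inject: "sgb a = sgb b \<longleftrightarrow> a = b"
  by (cases a; cases b) (simp_all add: sgb_def)

locale redei =
  fixes t :: nat and p :: "nat \<Rightarrow> nat"
  assumes t1: "t \<ge> 1" and prime_p: "\<And>i. i < t \<Longrightarrow> prime (p i)" and inj_p: "inj_on p {..<t}"
    and p_mod: "\<And>i. i < t \<Longrightarrow> p i mod 8 = 1" and rk: "vec_space.rank t (A_mat t p) = t - 1"
begin

definition P :: "nat set \<Rightarrow> nat" where "P S = (\<Prod>i\<in>S. p i)"

text \<open>With \<open>S\<close> as a vector over \<open>GF(2)\<close>, this is the \<open>r\<close>-th entry of \<open>A_mat t p\<close> times \<open>S\<close>, written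
  multiplicatively.\<close>

definition sy :: "nat set \<Rightarrow> nat \<Rightarrow> int" where
  "sy S r = Legendre (int (P (if r \<in> S then {..<t} - S else S))) (int (p r))"

lemma p_gt_2: "i < t \<Longrightarrow> p i > 2"
  using prime_p[of i] p_mod[of i] prime_ge_2_nat[of "p i"] by (cases "p i = 2") auto

lemma p_mod_4: "i < t \<Longrightarrow> p i mod 4 = 1"
  using p_mod[of i] by presburger

lemma not_dvd_p: "i < t \<Longrightarrow> j < t \<Longrightarrow> i \<noteq> j \<Longrightarrow> \<not> p i dvd p j"
  using prime_p inj_p by (auto simp: primes_dvd_imp_eq inj_on_def dest: primes_dvd_imp_eq)

lemma Legendre_bit: "i < t \<Longrightarrow> j < t \<Longrightarrow> i \<noteq> j \<Longrightarrow> Legendre (int (p j)) (int (p i)) = sgb (legendre_bit p i j)"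
  using Legendre_values[of "int (p j)" "int (p i)"] Legendre_eq_0_iff[of "int (p j)" "int (p i)"] not_dvd_p[of i j]
  by (auto simp: legendre_bit_def sgb_def)

lemma legendre_bit_sym: "i < t \<Longrightarrow> j < t \<Longrightarrow> legendre_bit p i j = legendre_bit p j i"
  using Legendre_reciprocity_1_mod_4[of "p j" "p i"] prime_p p_mod_4 p_gt_2 by (auto simp: legendre_bit_def)

lemma Legendre_P:
  assumes "r < t" "S \<subseteq> {..<t}" "r \<notin> S"
  shows "Legendre (int (P S)) (int (p r)) = sgb (\<Sum>i\<in>S. legendre_bit p r i)"
proof -
  have "finite S" using assms(2) finite_subset by blast
  thus ?thesis using assms(2,3)
  proof (induction S rule: finite_induct)
    case empty
    show ?case using prime_gt_1_nat[OF prime_p[OF assms(1)]] by (simp add: P_def sgb_def Legendre_1)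
  next
    case (insert j S)
    have "P (insert j S) = p j * P S" using insert by (simp add: P_def)
    hence "Legendre (int (P (insert j S))) (int (p r)) = Legendre (int (p j)) (int (p r)) * Legendre (int (P S)) (int (p r))"
      using Legendre_mult[OF prime_p p_gt_2] assms(1) by simp
    also have "\<dots> = sgb (legendre_bit p r j) * sgb (\<Sum>i\<in>S. legendre_bit p r i)"
      using insert Legendre_bit[of r j] assms(1) by auto
    finally show ?case by (simp only: sgb_add sum.insert[OF insert(1,2)])
  qed
qed

definition ind :: "nat set \<Rightarrow> nat \<Rightarrow> bit" where "ind S i = (if i \<in> S then 1 else 0)"

lemma A_carrier: "A_mat t p \<in> carrier_mat t t" by (simp add: A_mat_def)

lemma A_entry: "i < t \<Longrightarrow> j < t \<Longrightarrow> A_mat t p $$ (i, j) =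
    (if i = j then (\<Sum>k\<in>{..<t} - {i}. legendre_bit p i k) else legendre_bit p i j)"
  by (simp add: A_mat_def)

lemma A_row_split:
  assumes "r < t"
  shows "(\<Sum>i<t. A_mat t p $$ (r, i) * x i) = (\<Sum>k\<in>{..<t} - {r}. legendre_bit p r k) * x r + (\<Sum>k\<in>{..<t} - {r}. legendre_bit p r k * x k)"
proof -
  have "(\<Sum>i<t. A_mat t p $$ (r, i) * x i) = A_mat t p $$ (r, r) * x r + (\<Sum>i\<in>{..<t} - {r}. A_mat t p $$ (r, i) * x i)"
    by (rule sum.remove) (use assms in auto)
  also have "(\<Sum>i\<in>{..<t} - {r}. A_mat t p $$ (r, i) * x i) = (\<Sum>k\<in>{..<t} - {r}. legendre_bit p r k * x k)"
    by (intro sum.cong refl) (use assms in \<open>auto simp: A_entry\<close>)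
  finally show ?thesis by (simp only: A_entry[OF assms assms] refl if_True)
qed

lemma A_rows: "r < t \<Longrightarrow> (\<Sum>i<t. A_mat t p $$ (r, i)) = 0"
  using A_row_split[of r "\<lambda>_. 1"] bit_add_cancel[of _ 0] by (simp only: mult_1_right add_0_right)

lemma A_sym: "i < t \<Longrightarrow> j < t \<Longrightarrow> A_mat t p $$ (i, j) = A_mat t p $$ (j, i)"
  using legendre_bit_sym by (simp add: A_entry)

text \<open>For \<open>r\<close> in \<open>S\<close> the diagonal entry is the sum of the whole rest
  of the row. Its part over \<open>S\<close> occurs twice and cancels, and the complement of
  \<open>S\<close> remains: hence the case distinction in \<open>sy\<close>.\<close>

lemma sy_A:
  assumes "r < t" "S \<subseteq> {..<t}"
  shows "sy S r = sgb (\<Sum>i<t. A_mat t p $$ (r, i) * ind S i)"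
proof -
  have fin: "finite S" using assms(2) finite_subset by blast
  have S: "(\<Sum>k\<in>{..<t} - {r}. legendre_bit p r k * ind S k) = (\<Sum>k\<in>S - {r}. legendre_bit p r k)"
    by (rule sum.mono_neutral_cong_right) (use assms in \<open>auto simp: ind_def\<close>)
  show ?thesis
  proof (cases "r \<in> S")
    case False
    thus ?thesis unfolding sy_def A_row_split[OF assms(1)] S using Legendre_P[OF assms False] by (simp add: ind_def)
  next
    case True
    have "{..<t} - {r} = (S - {r}) \<union> ({..<t} - S)" using True assms by auto
    hence "(\<Sum>k\<in>{..<t} - {r}. legendre_bit p r k) = (\<Sum>k\<in>S - {r}. legendre_bit p r k) + (\<Sum>k\<in>{..<t} - S. legendre_bit p r k)"
      using fin by (simp add: sum.union_disjoint[of "S - {r}" "{..<t} - S"] Diff_Int_distrib2 Int_Diff)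
    hence e: "(\<Sum>i<t. A_mat t p $$ (r, i) * ind S i) = (\<Sum>k\<in>{..<t} - S. legendre_bit p r k)"
      unfolding A_row_split[OF assms(1)] S using True by (simp only: ind_def if_True mult_1_right bit_add_cancel)
    show ?thesis unfolding e sy_def using Legendre_P[of r "{..<t} - S"] True assms(1) by auto
  qed
qed

lemma redei_kernel:
  assumes "S \<subseteq> {..<t}" "\<And>r. r < t \<Longrightarrow> sy S r = 1"
  shows "S = {} \<or> S = {..<t}"
proof -
  have "(\<Sum>i<t. A_mat t p $$ (r, i) * ind S i) = 0" if "r < t" for r
  proof -
    have "sgb (\<Sum>i<t. A_mat t p $$ (r, i) * ind S i) = sgb 0" using assms(2)[OF that] sy_A[OF that assms(1)] by (simp add: sgb_def)
    thus ?thesis using sgb_inject by blast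
  qed
  hence "ind S i = ind S j" if "i < t" "j < t" for i j
    using corank_one_kernel[OF A_carrier rk t1 A_rows] that by blast
  hence "i \<in> S \<longleftrightarrow> j \<in> S" if "i < t" "j < t" for i j using that unfolding ind_def by (metis zero_neq_one)
  thus ?thesis using assms(1) by blast
qed

lemma redei_image:
  assumes b: "\<And>r. r < t \<Longrightarrow> b r = 1 \<or> b r = - 1" "(\<Prod>r<t. b r) = 1"
  obtains S where "S \<subseteq> {..<t}" "\<And>r. r < t \<Longrightarrow> sy S r = b r"
proof -
  define c where "c = (\<lambda>r. if b r = 1 then 0 else 1 :: bit)"
  have bc: "b r = sgb (c r)" if "r < t" for r using b(1)[OF that] by (auto simp: c_def sgb_def)
  have "(\<Prod>r<t. sgb (c r)) = (\<Prod>r<t. b r)" by (rule prod.cong) (use bc in auto)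
  hence "sgb (\<Sum>r<t. c r) = 1" by (simp only: sgb_sum b(2))
  hence "sgb (\<Sum>r<t. c r) = sgb 0" by (simp only: sgb_def refl if_True)
  hence "(\<Sum>r<t. c r) = 0" using sgb_inject by blast
  then obtain x where x: "\<And>r. r < t \<Longrightarrow> (\<Sum>i<t. A_mat t p $$ (r, i) * x i) = c r"
    using corank_one_image[OF A_carrier rk t1 A_rows A_sym] by blast
  define S where "S = {i. i < t \<and> x i = 1}"
  have S: "S \<subseteq> {..<t}" by (auto simp: S_def)
  have "ind S i = x i" if "i < t" for i using that by (cases "x i") (auto simp: ind_def S_def)
  hence "(\<Sum>i<t. A_mat t p $$ (r, i) * ind S i) = (\<Sum>i<t. A_mat t p $$ (r, i) * x i)" for r by simp
  hence "sy S r = b r" if "r < t" for r using sy_A[OF that S] x[OF that] bc[OF that] by simp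
  thus ?thesis using that S by blast
qed

text \<open>By symmetry the column sums of the matrix vanish as well.\<close>

lemma redei_product:
  assumes "S \<subseteq> {..<t}"
  shows "(\<Prod>r<t. sy S r) = 1"
proof -
  have "(\<Prod>r<t. sy S r) = (\<Prod>r<t. sgb (\<Sum>i<t. A_mat t p $$ (r, i) * ind S i))"
    by (rule prod.cong) (use sy_A assms in \<open>blast+\<close>)
  also have "\<dots> = sgb (\<Sum>r<t. \<Sum>i<t. A_mat t p $$ (r, i) * ind S i)"
    by (rule sgb_sum[symmetric])
  also have "(\<Sum>r<t. \<Sum>i<t. A_mat t p $$ (r, i) * ind S i) = (\<Sum>i<t. \<Sum>r<t. A_mat t p $$ (r, i) * ind S i)"
    by (rule sum.swap)
  also have "\<dots> = (\<Sum>i<t. (\<Sum>r<t. A_mat t p $$ (i, r)) * ind S i)"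
    unfolding sum_distrib_right by (intro sum.cong refl) (simp add: A_sym)
  also have "\<dots> = 0" using A_rows by simp
  finally show ?thesis by (simp add: sgb_def)
qed

end

section \<open>The class numbers modulo powers of two\<close>

lemma nat_mod_8:
  fixes n :: nat
  shows "n mod 8 = 1 \<Longrightarrow> odd n" "n mod 8 = 1 \<Longrightarrow> n mod 4 = 1" "n mod 8 = 1 \<Longrightarrow> n > 2 \<Longrightarrow> n > 8"
    "n mod 8 = 3 \<Longrightarrow> odd n" "n mod 8 = 3 \<Longrightarrow> n mod 4 = 3"
proof -
  have m2: "n mod 2 = (n mod 8) mod 2" and m4: "n mod 4 = (n mod 8) mod 4" by (simp_all add: mod_mod_cancel)
  show "n mod 8 = 1 \<Longrightarrow> odd n" "n mod 8 = 3 \<Longrightarrow> odd n" using m2 by (simp_all add: odd_iff_mod_2_eq_one)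
  show "n mod 8 = 1 \<Longrightarrow> n mod 4 = 1" "n mod 8 = 3 \<Longrightarrow> n mod 4 = 3" using m4 by simp_all
  show "n > 8" if "n mod 8 = 1" "n > 2"
  proof (rule ccontr)
    assume "\<not> n > 8"
    hence "n = 8 \<or> n < 8" by linarith
    thus False using that by auto
  qed
qed

lemma coprime_intI:
  assumes "\<And>l. prime l \<Longrightarrow> l dvd z \<Longrightarrow> int l dvd X \<Longrightarrow> False"
  shows "coprime (int z) X"
proof (rule ccontr)
  assume "\<not> coprime (int z) X"
  hence "\<not> coprime z (nat \<bar>X\<bar>)" by (metis coprime_abs_right_iff coprime_int_iff int_nat_eq abs_ge_zero)
  then obtain l where l: "prime l" "l dvd z" "l dvd nat \<bar>X\<bar>" using not_coprime_common_prime by blast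
  hence "int l dvd X" by simp
  thus False using assms l by blast
qed

lemma coprime_int_prime_False:
  assumes "coprime (int z) X" "prime l" "l dvd z" "int l dvd X"
  shows False
proof -
  have "int l dvd int z" using assms(3) by simp
  hence "is_unit (int l)" using assms(1,4) by (meson coprime_common_divisor)
  thus False using assms(2) by simp
qed

lemma Legendre_eq_1_QuadRes: "Legendre a p = 1 \<Longrightarrow> QuadRes p a"
  by (auto simp: Legendre_def split: if_splits)

lemma QuadRes_squarefree:
  fixes b :: nat
  shows "squarefree b \<Longrightarrow> (\<And>l. prime l \<Longrightarrow> l dvd b \<Longrightarrow> QuadRes (int l) x) \<Longrightarrow> \<exists>r. [r\<^sup>2 = x] (mod int b)"
proof (induction b rule: prime_divisors_induct)
  case (unit b)
  hence "b = 1" by simp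
  thus ?case by simp
next
  case (factor l b)
  have sq: "squarefree b" using factor.prems(1) squarefree_mono by (metis dvd_triv_right)
  have cop: "coprime l b"
  proof (rule ccontr)
    assume "\<not> coprime l b"
    then obtain k where k: "prime k" "k dvd l" "k dvd b" using not_coprime_common_prime by blast
    then obtain l' b' where "l = k * l'" "b = k * b'" by (auto elim!: dvdE)
    hence "l * b = k\<^sup>2 * (l' * b')" by (simp add: power2_eq_square)
    hence "k\<^sup>2 dvd l * b" by simp
    hence "is_unit k" using factor.prems(1) squarefreeD by blast
    thus False using k(1) by simp
  qed
  obtain r where r: "[r\<^sup>2 = x] (mod int b)" using factor.IH[OF sq] factor.prems(2) by auto
  have "QuadRes (int l) x" using factor.prems(2)[OF factor(1)] by simp
  then obtain s where s: "[s\<^sup>2 = x] (mod int l)" unfolding QuadRes_def by blast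
  obtain y where y: "[y = s] (mod int l)" "[y = r] (mod int b)"
    using binary_chinese_remainder_int[of "int l" "int b" s r] cop by auto
  have "[y\<^sup>2 = x] (mod int l)" "[y\<^sup>2 = x] (mod int b)"
    using cong_trans[OF cong_pow[OF y(1), of 2] s] cong_trans[OF cong_pow[OF y(2), of 2] r] by auto
  hence "[y\<^sup>2 = x] (mod (int l * int b))" using cop by (intro coprime_cong_mult) auto
  thus ?case by auto
qed simp

lemma signs_mult_eq_1: "(a::int) * b = 1 \<Longrightarrow> a = b"
  by (metis mult_cancel_left zmult_eq_1_iff)

locale redei_q = redei +
  fixes q :: nat
  assumes prime_q: "prime q" and q_mod: "q mod 8 = 3" and p_ne_q: "\<And>i. i < t \<Longrightarrow> p i \<noteq> q"
    and leg_q: "\<And>i. i < t \<Longrightarrow> Legendre (int q) (int (p i)) = 1"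
begin

definition N :: nat where "N = P {..<t}"

lemma q_odd: "odd q" and q_gt_2: "q > 2" and q_mod_4: "q mod 4 = 3"
proof -
  show "odd q" using q_mod by presburger
  show "q > 2" using q_mod prime_ge_2_nat[OF prime_q] by (cases "q = 2") auto
  show "q mod 4 = 3" using q_mod by presburger
qed

lemma P_compl: "S \<subseteq> {..<t} \<Longrightarrow> P S * P ({..<t} - S) = N"
  unfolding N_def P_def using prod.subset_diff[of S "{..<t}" p] by (simp add: mult.commute)

lemma P_pos: "S \<subseteq> {..<t} \<Longrightarrow> P S > 0"
  unfolding P_def using prime_p prime_gt_0_nat by (intro prod_pos) blast

lemma prime_dvd_P:
  assumes "prime l" "S \<subseteq> {..<t}"
  shows "l dvd P S \<longleftrightarrow> (\<exists>r\<in>S. l = p r)"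
proof -
  have "finite S" using assms(2) finite_subset by blast
  hence "l dvd P S \<longleftrightarrow> (\<exists>r\<in>S. l dvd p r)" unfolding P_def using assms(1) by (simp add: prime_dvd_prod_iff)
  also have "\<dots> \<longleftrightarrow> (\<exists>r\<in>S. l = p r)" using assms prime_p primes_dvd_imp_eq by (metis dvd_refl lessThan_iff subsetD)
  finally show ?thesis .
qed

lemma p_dvd_P: "r < t \<Longrightarrow> S \<subseteq> {..<t} \<Longrightarrow> p r dvd P S \<longleftrightarrow> r \<in> S"
  using prime_dvd_P[of "p r" S] prime_p inj_p by (auto simp: inj_on_def)

lemma squarefree_P: "S \<subseteq> {..<t} \<Longrightarrow> squarefree (P S)"
  unfolding P_def
proof (rule squarefree_prod_coprime)
  fix i j assume "S \<subseteq> {..<t}" "i \<in> S" "j \<in> S" "i \<noteq> j"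
  thus "coprime (p i) (p j)" using prime_p inj_p by (intro primes_coprime) (auto simp: inj_on_def)
qed (use prime_p squarefree_prime in blast)

lemma P_mod_8: "S \<subseteq> {..<t} \<Longrightarrow> P S mod 8 = 1"
proof -
  assume S: "S \<subseteq> {..<t}"
  hence "finite S" using finite_subset by blast
  thus ?thesis using S
  proof (induction S rule: finite_induct)
    case (insert i S)
    have e: "P (insert i S) = p i * P S" using insert by (simp add: P_def)
    have "(p i * P S) mod 8 = (p i mod 8) * (P S mod 8) mod 8" by (rule mod_mult_eq[symmetric])
    thus ?case unfolding e using insert.IH insert.prems p_mod[of i] by simp
  qed (simp add: P_def)
qed

lemma N_mod_8: "N mod 8 = 1" unfolding N_def by (rule P_mod_8) simp
lemma odd_N: "odd N" using N_mod_8 by (rule nat_mod_8)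
lemma squarefree_N: "squarefree N" unfolding N_def by (rule squarefree_P) simp
lemma N_pos: "N > 0" unfolding N_def by (rule P_pos) simp

lemma P_dvd_N: "S \<subseteq> {..<t} \<Longrightarrow> P S dvd N" using P_compl by (metis dvd_triv_left)

lemma prime_dvd_N: "prime l \<Longrightarrow> l dvd N \<longleftrightarrow> (\<exists>r<t. l = p r)"
  using prime_dvd_P[of l "{..<t}"] unfolding N_def by auto

lemma q_ndvd_N: "\<not> q dvd N" using prime_dvd_N[OF prime_q] p_ne_q by auto

lemma N_gt_8: "N > 8"
proof -
  have "\<exists>r<t. p 0 = p r" using t1 by (intro exI[of _ 0]) auto
  hence "p 0 dvd N" using prime_dvd_N[of "p 0"] prime_p[of 0] t1 by simp
  hence "p 0 \<le> N" using N_pos by (rule dvd_imp_le)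
  hence "N > 2" using p_gt_2[of 0] t1 by linarith
  thus ?thesis using nat_mod_8(3)[OF N_mod_8] by blast
qed

lemma squarefree_Nq: "squarefree (N * q)"
proof (rule squarefree_mult_coprime)
  show "coprime N q" using q_ndvd_N prime_q by (metis coprime_commute prime_imp_coprime)
qed (use squarefree_N squarefree_prime prime_q in auto)

lemma dvd_N_cases:
  assumes "d dvd N"
  obtains S where "S \<subseteq> {..<t}" "d = P S"
proof -
  define S where "S = {r. r < t \<and> p r dvd d}"
  have S: "S \<subseteq> {..<t}" by (auto simp: S_def)
  have sd: "squarefree d" using assms squarefree_N squarefree_mono by blast
  have d0: "d > 0" using assms N_pos by (auto intro!: Nat.gr0I)
  have "d dvd P S"
  proof (rule squarefree_dvdI[OF sd P_pos[OF S]])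
    fix l assume l: "prime l" "l dvd d"
    then obtain r where "r < t" "l = p r" using prime_dvd_N assms dvd_trans by blast
    thus "l dvd P S" using l prime_dvd_P[OF l(1) S] by (auto simp: S_def)
  qed
  moreover have "P S dvd d"
  proof (rule squarefree_dvdI[OF squarefree_P[OF S] d0])
    fix l assume l: "prime l" "l dvd P S"
    thus "l dvd d" using prime_dvd_P[OF l(1) S] by (auto simp: S_def)
  qed
  ultimately show ?thesis using that[OF S] dvd_antisym by blast
qed

lemma card_prime_factors_N: "card (prime_factors N) = t"
proof -
  have "prime_factors N = p ` {..<t}" using N_pos prime_dvd_N prime_p by (auto simp: prime_factors_dvd)
  thus ?thesis using card_image[OF inj_p] by simp
qed

lemma card_prime_factors_mult:
  assumes "prime l" "\<not> l dvd N"
  shows "card (prime_factors (N * l)) = t + 1"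
proof -
  have "prime_factors (N * l) = insert l (prime_factors N)"
    using assms N_pos by (subst prime_factors_product) (auto simp: prime_factorization_prime)
  moreover have "l \<notin> prime_factors N" using assms by auto
  ultimately show ?thesis using card_prime_factors_N by simp
qed

definition psi :: "nat \<Rightarrow> int" where "psi z = (\<Prod>r<t. Legendre (int z) (int (p r)))"

text \<open>Each \<open>p r\<close> is 1 modulo 4, so reciprocity introduces no sign.\<close>

lemma psi_jac: assumes "odd z" shows "psi z = jac (int N) z"
proof -
  have "jac (int N) z = (\<Prod>r<t. jac (int (p r)) z)"
    unfolding N_def P_def of_nat_prod by (rule jac_prod_left) (use assms in auto)
  also have "\<dots> = psi z" unfolding psi_def
    by (rule prod.cong) (use jac_reciprocity_1_mod_4 prime_p p_mod_4 assms in auto)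
  finally show ?thesis by simp
qed

lemma Legendre_values_pm: "\<not> int l dvd a \<Longrightarrow> Legendre a (int l) = 1 \<or> Legendre a (int l) = - 1"
  using Legendre_values[of a "int l"] Legendre_eq_0_iff[of a "int l"] by auto

lemma Legendre_P_q: "S \<subseteq> {..<t} \<Longrightarrow> Legendre (int (P S)) (int q) = 1"
proof -
  assume S: "S \<subseteq> {..<t}"
  hence "finite S" using finite_subset by blast
  thus ?thesis using S
  proof (induction S rule: finite_induct)
    case empty
    thus ?case using prime_gt_1_nat[OF prime_q] by (simp add: P_def Legendre_1)
  next
    case (insert i S)
    have i: "i < t" using insert by auto
    have "Legendre (int (p i)) (int q) = 1"
      using Legendre_reciprocity_1_mod_4[OF prime_p[OF i] p_mod_4[OF i] prime_q q_gt_2] leg_q[OF i] by simp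
    moreover have "Legendre (int (P (insert i S))) (int q) = Legendre (int (p i)) (int q) * Legendre (int (P S)) (int q)"
      using insert Legendre_mult[OF prime_q q_gt_2, of "int (p i)" "int (P S)"] by (simp add: P_def)
    ultimately show ?case using insert by simp
  qed
qed

text \<open>The parameter \<open>c\<close> treats the fields of \<open>sqrt(-N)\<close> and
  \<open>sqrt(-N q)\<close> simultaneously.\<close>

lemma c_facts:
  assumes "c = 1 \<or> c = q"
  shows "squarefree (N * c)" "coprime N c" "c > 0" "r < t \<Longrightarrow> Legendre (int c) (int (p r)) = 1"
proof -
  show "squarefree (N * c)" using assms squarefree_N squarefree_Nq by auto
  show "coprime N c" using assms q_ndvd_N prime_q by (metis coprime_1_right coprime_commute prime_imp_coprime)
  show "c > 0" using assms prime_gt_0_nat[OF prime_q] by auto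
  show "r < t \<Longrightarrow> Legendre (int c) (int (p r)) = 1" using assms leg_q Legendre_1 prime_gt_1_nat[OF prime_p] by auto
qed

lemma knorm_Legendre:
  assumes c: "c = 1 \<or> c = q" and r: "r < t" and kn: "knorm (N * c) a" and nd: "\<not> p r dvd a"
  shows "Legendre (int a) (int (p r)) = 1"
proof -
  have "p r dvd N * c" using prime_dvd_N[OF prime_p[OF r]] r by auto
  moreover have "\<not> (p r)\<^sup>2 dvd N * c" using c_facts(1)[OF c] squarefreeD[of "N * c" "p r"] prime_p[OF r] by auto
  ultimately have "QuadRes (int (p r)) (int a)" using knorm_QuadRes[OF prime_p[OF r] _ _ nd kn] by blast
  thus ?thesis using nd by (simp add: Legendre_eq_1_iff)
qed

text \<open>For \<open>r\<close> outside \<open>S\<close> the norm \<open>z P S\<close> is prime to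
  \<open>p r\<close>, hence a residue. For \<open>r\<close> in \<open>S\<close> the divisor
  \<open>P S\<close> is first replaced by its complement in \<open>N c\<close>, which preserves
  norms; the factor \<open>c\<close> is a residue and drops out.\<close>

lemma knorm_imp_sy:
  assumes c: "c = 1 \<or> c = q" and S: "S \<subseteq> {..<t}" and z: "coprime z N" and kn: "knorm (N * c) (z * P S)" and r: "r < t"
  shows "Legendre (int z) (int (p r)) = sy S r"
proof -
  define S' where "S' = (if r \<in> S then {..<t} - S else S)"
  define c' where "c' = (if r \<in> S then c else 1)"
  have S': "S' \<subseteq> {..<t}" "r \<notin> S'" using S by (auto simp: S'_def)
  have c': "c' = 1 \<or> c' = q" using c by (auto simp: c'_def)
  have pN: "p r dvd N" using prime_dvd_N[OF prime_p[OF r]] r by auto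
  have "knorm (N * c) (z * (P S' * c'))"
  proof (cases "r \<in> S")
    case True
    have m0: "N * c > 0" using N_pos c_facts(3)[OF c] by simp
    have dv: "P S dvd N * c" using P_dvd_N[OF S] by simp
    have "N * c = P S * (P ({..<t} - S) * c)" using P_compl[OF S] by (simp flip: mult.assoc)
    hence "(N * c) div P S = P ({..<t} - S) * c" using P_pos[OF S] by (metis nonzero_mult_div_cancel_left less_irrefl)
    hence "(N * c) div P S = P S' * c'" using True by (simp add: S'_def c'_def)
    thus ?thesis using knorm_complement[OF m0 dv kn] by simp
  next
    case False
    thus ?thesis using kn by (simp add: S'_def c'_def)
  qed
  moreover have "\<not> p r dvd z * (P S' * c')"
  proof -
    have "\<not> p r dvd z" using z pN prime_p[OF r] by (meson coprime_common_divisor not_prime_unit)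
    moreover have "\<not> p r dvd P S'" using p_dvd_P[OF r S'(1)] S'(2) by simp
    moreover have "\<not> p r dvd c'" using c_facts(2)[OF c'] pN prime_p[OF r] by (meson coprime_common_divisor not_prime_unit)
    ultimately show ?thesis using prime_p[OF r] by (simp add: prime_dvd_mult_iff)
  qed
  ultimately have "Legendre (int (z * (P S' * c'))) (int (p r)) = 1" by (rule knorm_Legendre[OF c r])
  hence "Legendre (int z) (int (p r)) * Legendre (int (P S')) (int (p r)) = 1"
    using Legendre_mult[OF prime_p[OF r] p_gt_2[OF r]] c_facts(4)[OF c' r] by simp
  hence "Legendre (int z) (int (p r)) = Legendre (int (P S')) (int (p r))" by (rule signs_mult_eq_1)
  thus ?thesis unfolding sy_def S'_def .
qed

text \<open>Legendre's theorem with coefficients \<open>P S\<close>, \<open>N c / P S\<close> and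
  \<open>z\<close>: the symbols provide the square roots modulo the first two, and \<open>r3\<close>
  is the one modulo \<open>z\<close>.\<close>

lemma sy_imp_knorm:
  assumes c: "c = 1 \<or> c = q" and S: "S \<subseteq> {..<t}" and z: "z > 0" "coprime z N" "coprime z c"
    and sy: "\<And>r. r < t \<Longrightarrow> Legendre (int z) (int (p r)) = sy S r"
    and zq: "c = q \<Longrightarrow> Legendre (int z) (int q) = 1"
    and r3: "[r3\<^sup>2 = - int (N * c)] (mod int z)"
  shows "knorm (N * c) (z * P S)"
proof -
  let ?a = "P S"
  define S' where "S' = {..<t} - S"
  let ?b = "P S' * c"
  have S': "S' \<subseteq> {..<t}" by (auto simp: S'_def)
  have ab: "?a * ?b = N * c" using P_compl[OF S] by (simp add: S'_def flip: mult.assoc)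
  have Lz: "Legendre (int z) (int (p r)) = 1 \<or> Legendre (int z) (int (p r)) = - 1" if "r < t" for r
  proof -
    have "p r dvd N" using prime_dvd_N[OF prime_p[OF that]] that by auto
    hence "\<not> p r dvd z" using z(2) prime_p[OF that] by (meson coprime_common_divisor not_prime_unit)
    thus ?thesis using Legendre_values_pm[of "p r" "int z"] by simp
  qed
  have sq1: "squarefree ?a" by (rule squarefree_P[OF S])
  have sq2: "squarefree ?b" using c_facts(1)[OF c] ab by (metis squarefree_mono dvd_triv_right)
  have "\<exists>r1. [r1\<^sup>2 = int ?b * int z] (mod int ?a)"
  proof (rule QuadRes_squarefree[OF sq1])
    fix l assume l: "prime l" "l dvd ?a"
    then obtain r where r: "r \<in> S" "l = p r" using prime_dvd_P[OF l(1) S] by blast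
    hence rt: "r < t" using S by auto
    have "Legendre (int ?b * int z) (int l) = Legendre (int (P S')) (int l) * Legendre (int z) (int l)"
      using Legendre_mult[OF prime_p[OF rt] p_gt_2[OF rt]] c_facts(4)[OF c rt] r by simp
    also have "Legendre (int (P S')) (int l) = Legendre (int z) (int l)"
      using sy[OF rt] r unfolding sy_def S'_def by simp
    also have "Legendre (int z) (int l) * Legendre (int z) (int l) = 1" using Lz[OF rt] r by auto
    finally show "QuadRes (int l) (int ?b * int z)" by (rule Legendre_eq_1_QuadRes)
  qed
  then obtain r1 where r1: "[r1\<^sup>2 = int ?b * int z] (mod int ?a)" by blast
  have "\<exists>r2. [r2\<^sup>2 = int ?a * int z] (mod int ?b)"
  proof (rule QuadRes_squarefree[OF sq2])
    fix l assume l: "prime l" "l dvd ?b"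
    hence "l dvd P S' \<or> l dvd c" by (simp add: prime_dvd_mult_iff)
    hence "Legendre (int ?a * int z) (int l) = 1"
    proof
      assume "l dvd P S'"
      then obtain r where r: "r \<in> S'" "l = p r" using prime_dvd_P[OF l(1) S'] by blast
      hence rt: "r < t" "r \<notin> S" using S' by (auto simp: S'_def)
      have "Legendre (int ?a * int z) (int l) = Legendre (int ?a) (int l) * Legendre (int z) (int l)"
        using Legendre_mult[OF prime_p[OF rt(1)] p_gt_2[OF rt(1)]] r by simp
      also have "Legendre (int ?a) (int l) = Legendre (int z) (int l)"
        using sy[OF rt(1)] rt r unfolding sy_def by simp
      also have "Legendre (int z) (int l) * Legendre (int z) (int l) = 1" using Lz[OF rt(1)] r by auto
      finally show ?thesis .
    next
      assume "l dvd c"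
      hence "c = q" "l = q" using c l(1) prime_q primes_dvd_imp_eq by auto
      thus ?thesis using Legendre_mult[OF prime_q q_gt_2] Legendre_P_q[OF S] zq by simp
    qed
    thus "QuadRes (int l) (int ?a * int z)" by (rule Legendre_eq_1_QuadRes)
  qed
  then obtain r2 where r2: "[r2\<^sup>2 = int ?a * int z] (mod int ?b)" by blast
  have r3': "[r3\<^sup>2 = - (int ?a * int ?b)] (mod int z)" using r3 unfolding ab[symmetric] by simp
  have pos: "?a > 0" "?b > 0" using P_pos S S' c_facts(3)[OF c] by auto
  have cop1: "coprime ?a ?b"
  proof (rule ccontr)
    assume "\<not> coprime ?a ?b"
    then obtain l where l: "prime l" "l dvd ?a" "l dvd ?b" using not_coprime_common_prime by blast
    then obtain a' b' where "?a = l * a'" "?b = l * b'" by (auto elim!: dvdE)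
    hence "N * c = l\<^sup>2 * (a' * b')" unfolding ab[symmetric] by (simp add: power2_eq_square)
    hence "l\<^sup>2 dvd N * c" by simp
    thus False using c_facts(1)[OF c] squarefreeD l(1) not_prime_unit by blast
  qed
  have zNc: "coprime z (?a * ?b)" unfolding ab using z(2,3) by simp
  have cop2: "coprime ?a z" "coprime ?b z" using zNc by (simp_all add: coprime_commute)
  have nsq: "?a * ?b \<noteq> k\<^sup>2" for k
  proof
    assume "?a * ?b = k\<^sup>2"
    hence k: "N * c = k\<^sup>2" unfolding ab .
    hence "k\<^sup>2 dvd N * c" by simp
    hence "k = 1" using c_facts(1)[OF c] squarefreeD by fastforce
    thus False using k N_gt_8 by simp
  qed
  have "knorm (?a * ?b) (?a * z)" by (rule legendre_conic[OF pos z(1) cop1 cop2 nsq r1 r2 r3'])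
  thus ?thesis unfolding ab by (simp add: mult.commute)
qed

text \<open>The case \<open>z = 1\<close> of \<open>knorm_imp_sy\<close>. Through it the rank
  hypothesis limits the ambiguous classes that are squares.\<close>

lemma trivial_sy_divisors:
  assumes c: "c = 1 \<or> c = q" and S: "S \<subseteq> {..<t}" and kn: "knorm (N * c) (P S)"
  shows "S = {} \<or> S = {..<t}"
proof (rule redei_kernel[OF S])
  fix r assume r: "r < t"
  have "Legendre (int 1) (int (p r)) = sy S r" by (rule knorm_imp_sy[OF c S _ _ r]) (use kn in auto)
  thus "sy S r = 1" using Legendre_1[of "int (p r)"] prime_gt_1_nat[OF prime_p[OF r]] by simp
qed

text \<open>Necessity is \<open>redei_product\<close>. Conversely \<open>redei_image\<close> finds a
  set \<open>S\<close> whose values \<open>sy S r\<close> are the symbols of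
  \<open>z\<close>.\<close>

lemma knorm_iff_psi:
  assumes c: "c = 1 \<or> c = q" and z: "z > 0" "coprime z N" "coprime z c"
    and zq: "c = q \<Longrightarrow> psi z = Legendre (int z) (int q)"
    and r3: "[r3\<^sup>2 = - int (N * c)] (mod int z)"
  shows "(\<exists>S\<subseteq>{..<t}. knorm (N * c) (z * P S)) \<longleftrightarrow> psi z = 1"
proof
  assume "\<exists>S\<subseteq>{..<t}. knorm (N * c) (z * P S)"
  then obtain S where S: "S \<subseteq> {..<t}" "knorm (N * c) (z * P S)" by blast
  have "psi z = (\<Prod>r<t. sy S r)" unfolding psi_def
    by (rule prod.cong) (use knorm_imp_sy[OF c S(1) z(2) S(2)] in auto)
  thus "psi z = 1" using redei_product[OF S(1)] by simp
next
  assume psi: "psi z = 1"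
  have pm: "Legendre (int z) (int (p r)) = 1 \<or> Legendre (int z) (int (p r)) = - 1" if "r < t" for r
  proof -
    have "p r dvd N" using prime_dvd_N[OF prime_p[OF that]] that by auto
    hence "\<not> p r dvd z" using z(2) prime_p[OF that] by (meson coprime_common_divisor not_prime_unit)
    thus ?thesis using Legendre_values_pm[of "p r" "int z"] by simp
  qed
  obtain S where S: "S \<subseteq> {..<t}" "\<And>r. r < t \<Longrightarrow> sy S r = Legendre (int z) (int (p r))"
    using redei_image[of "\<lambda>r. Legendre (int z) (int (p r))"] pm psi unfolding psi_def by blast
  have "knorm (N * c) (z * P S)"
    by (rule sy_imp_knorm[OF c S(1) z _ _ r3]) (use S(2) zq psi in auto)
  thus "\<exists>S\<subseteq>{..<t}. knorm (N * c) (z * P S)" using S(1) by blast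
qed

text \<open>Equivalently, \<open>(N X + Y sqrt(-N q)) / 2\<close> has norm \<open>N z^2\<close>; the
  factor 4 admits the half-integers of this ring of integers.\<close>

definition sol1 :: "nat \<Rightarrow> int \<Rightarrow> int \<Rightarrow> bool" where
  "sol1 z X Y \<longleftrightarrow> z > 0 \<and> odd z \<and> int N * X\<^sup>2 + int q * Y\<^sup>2 = 4 * (int z)\<^sup>2 \<and> coprime (int z) X"

text \<open>Equivalently, \<open>x + y sqrt(-N)\<close> has norm \<open>2 z^2\<close>.\<close>

definition sol2 :: "nat \<Rightarrow> int \<Rightarrow> int \<Rightarrow> bool" where
  "sol2 z x y \<longleftrightarrow> z > 0 \<and> odd z \<and> x\<^sup>2 + int N * y\<^sup>2 = 2 * (int z)\<^sup>2 \<and> coprime (int z) x"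

lemma int_prime_dvd_square: "prime l \<Longrightarrow> int l dvd x\<^sup>2 \<longleftrightarrow> int l dvd x"
  using prime_dvd_power_iff[of "int l" 2 x] by simp

lemma square_dvd_mult_square:
  assumes l: "prime l" "l dvd n" "squarefree n" and d: "int (l\<^sup>2) dvd int n * X\<^sup>2"
  shows "int l dvd X"
proof -
  obtain k where k: "n = l * k" using l(2) by blast
  have nk: "\<not> l dvd k"
  proof
    assume "l dvd k"
    then obtain j where "k = l * j" by blast
    hence "l\<^sup>2 dvd n" unfolding k by (simp add: power2_eq_square)
    thus False using l squarefreeD not_prime_unit by blast
  qed
  have "int l * int l dvd int l * (int k * X\<^sup>2)" using d unfolding k by (simp add: power2_eq_square mult.assoc)
  hence "int l dvd int k * X\<^sup>2" using prime_gt_0_nat[OF l(1)] by simp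
  hence "int l dvd X\<^sup>2" using nk l(1) prime_dvd_mult_iff[of "int l" "int k" "X\<^sup>2"] by auto
  thus ?thesis using int_prime_dvd_square l(1) by blast
qed

lemma sqrt_mod_of_form:
  assumes "coprime (int z) Y" "[A\<^sup>2 = B * Y\<^sup>2] (mod int z)"
  obtains r where "[r\<^sup>2 = B] (mod int z)"
proof -
  have "coprime Y (int z)" using assms(1) by (simp add: coprime_commute)
  then obtain i where i: "[Y * i = 1] (mod int z)" using cong_solve_coprime_int by blast
  have "[A\<^sup>2 * i\<^sup>2 = B * Y\<^sup>2 * i\<^sup>2] (mod int z)" using assms(2) by (rule cong_scalar_right)
  hence "[(A * i)\<^sup>2 = B * (Y * i)\<^sup>2] (mod int z)" by (simp add: power_mult_distrib mult_ac)
  moreover have "[B * (Y * i)\<^sup>2 = B * 1\<^sup>2] (mod int z)" using i by (intro cong_mult cong_pow cong_refl)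
  ultimately have "[(A * i)\<^sup>2 = B] (mod int z)" by (metis cong_trans mult.right_neutral power_one)
  thus ?thesis using that by blast
qed

text \<open>\<open>-N q\<close> is a square modulo \<open>z\<close>, so
  \<open>(-1/z) (N/z) (q/z) = 1\<close>. Reciprocity turns \<open>(N/z)\<close> into
  \<open>psi z\<close> and \<open>(q/z)\<close> into \<open>(-1/z) (z/q)\<close>.\<close>

lemma sol1_facts:
  assumes s: "sol1 z X Y"
  shows "coprime z N" "coprime z q" "coprime (int z) Y" "psi z = Legendre (int z) (int q)"
    "\<exists>r. [r\<^sup>2 = - int (N * q)] (mod int z)"
proof -
  have z: "z > 0" "odd z" and eq: "int N * X\<^sup>2 + int q * Y\<^sup>2 = 4 * (int z)\<^sup>2" and zX: "coprime (int z) X"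
    using s by (auto simp: sol1_def)
  have eqX: "int N * X\<^sup>2 = 4 * (int z)\<^sup>2 - int q * Y\<^sup>2" and eqY: "int q * Y\<^sup>2 = 4 * (int z)\<^sup>2 - int N * X\<^sup>2"
    using eq by simp_all
  show zq: "coprime z q"
  proof (rule ccontr)
    assume "\<not> coprime z q"
    then obtain l where l: "prime l" "l dvd z" "l dvd q" using not_coprime_common_prime by blast
    hence lq: "l = q" using prime_q primes_dvd_imp_eq by blast
    have "int q dvd 4 * (int z)\<^sup>2 - int q * Y\<^sup>2" using l(2) lq by (intro dvd_diff) (auto simp: power2_eq_square)
    hence "int q dvd int N * X\<^sup>2" unfolding eqX .
    hence "int q dvd X\<^sup>2" using q_ndvd_N prime_q prime_dvd_mult_iff[of "int q" "int N" "X\<^sup>2"] by auto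
    hence "int q dvd X" using int_prime_dvd_square prime_q by blast
    thus False using coprime_int_prime_False[OF zX prime_q] l(2) lq by blast
  qed
  show zN: "coprime z N"
  proof (rule ccontr)
    assume "\<not> coprime z N"
    then obtain l where l: "prime l" "l dvd z" "l dvd N" using not_coprime_common_prime by blast
    have lq: "\<not> l dvd q" using l q_ndvd_N prime_q primes_dvd_imp_eq by blast
    have "int l dvd 4 * (int z)\<^sup>2 - int N * X\<^sup>2" using l(2,3) by (intro dvd_diff) (auto simp: power2_eq_square)
    hence "int l dvd int q * Y\<^sup>2" unfolding eqY .
    hence "int l dvd Y\<^sup>2" using lq l(1) prime_dvd_mult_iff[of "int l" "int q" "Y\<^sup>2"] by auto
    hence lY: "int l dvd Y" using int_prime_dvd_square l(1) by blast
    have "int (l\<^sup>2) dvd 4 * (int z)\<^sup>2 - int q * Y\<^sup>2"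
      using lY l(2) by (intro dvd_diff dvd_mult) (auto simp: power2_eq_square intro!: mult_dvd_mono)
    hence "int (l\<^sup>2) dvd int N * X\<^sup>2" unfolding eqX .
    hence "int l dvd X" by (rule square_dvd_mult_square[OF l(1,3) squarefree_N])
    thus False using coprime_int_prime_False[OF zX l(1,2)] by blast
  qed
  show zY: "coprime (int z) Y"
  proof (rule coprime_intI)
    fix l assume l: "prime l" "l dvd z" "int l dvd Y"
    have "int l dvd 4 * (int z)\<^sup>2 - int q * Y\<^sup>2" using l(2,3) by (intro dvd_diff) (auto simp: power2_eq_square)
    hence "int l dvd int N * X\<^sup>2" unfolding eqX .
    hence "l dvd N \<or> int l dvd X\<^sup>2" using l(1) prime_dvd_mult_iff[of "int l" "int N" "X\<^sup>2"] by auto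
    moreover have "\<not> l dvd N" using zN l(1,2) by (meson coprime_common_divisor not_prime_unit)
    ultimately have "int l dvd X" using int_prime_dvd_square l(1) by blast
    thus False using coprime_int_prime_False[OF zX l(1,2)] by blast
  qed
  have cg: "[(int N * X)\<^sup>2 = - int (N * q) * Y\<^sup>2] (mod int z)"
  proof -
    have "(int N * X)\<^sup>2 - (- int (N * q) * Y\<^sup>2) = int N * (int N * X\<^sup>2 + int q * Y\<^sup>2)"
      by (simp add: power2_eq_square algebra_simps)
    also have "\<dots> = int z * (int N * 4 * int z)" unfolding eq by (simp add: power2_eq_square)
    finally show ?thesis unfolding cong_iff_dvd_diff by simp
  qed
  show "\<exists>r. [r\<^sup>2 = - int (N * q)] (mod int z)" using sqrt_mod_of_form[OF zY cg] by blast
  have "coprime (int N * X) (int z)" using zN zX by (simp add: coprime_commute)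
  hence "jac (- int (N * q)) z = 1" using jac_square_class[OF z(2) cong_sym[OF cg]] by blast
  moreover have "- int (N * q) = (- 1) * (int N * int q)" by simp
  ultimately have "jac (- 1) z * (jac (int N) z * jac (int q) z) = 1" using jac_mult_left[OF z(2)] by metis
  hence "jac (- 1) z * jac (- 1) z * (psi z * Legendre (int z) (int q)) = 1"
    using psi_jac[OF z(2)] jac_reciprocity_3_mod_4[OF prime_q q_mod_4 z(2)] by (simp add: mult_ac)
  moreover have "jac (- 1) z * jac (- 1) z = 1" using jac_minus_1[OF z(2)] by simp
  ultimately have "psi z * Legendre (int z) (int q) = 1" by simp
  thus "psi z = Legendre (int z) (int q)" by (rule signs_mult_eq_1)
qed

text \<open>Here \<open>-N\<close> is a square modulo \<open>z\<close>, which gives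
  \<open>(-1/z) psi z = 1\<close>.\<close>

lemma sol2_facts:
  assumes s: "sol2 z x y"
  shows "coprime z N" "psi z = jac (- 1) z" "\<exists>r. [r\<^sup>2 = - int N] (mod int z)"
proof -
  have z: "z > 0" "odd z" and eq: "x\<^sup>2 + int N * y\<^sup>2 = 2 * (int z)\<^sup>2" and zx: "coprime (int z) x"
    using s by (auto simp: sol2_def)
  have eqx: "x\<^sup>2 = 2 * (int z)\<^sup>2 - int N * y\<^sup>2" using eq by simp
  show zN: "coprime z N"
  proof (rule ccontr)
    assume "\<not> coprime z N"
    then obtain l where l: "prime l" "l dvd z" "l dvd N" using not_coprime_common_prime by blast
    have "int l dvd 2 * (int z)\<^sup>2 - int N * y\<^sup>2" using l(2,3) by (intro dvd_diff) (auto simp: power2_eq_square)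
    hence "int l dvd x\<^sup>2" unfolding eqx .
    hence "int l dvd x" using int_prime_dvd_square l(1) by blast
    thus False using coprime_int_prime_False[OF zx l(1,2)] by blast
  qed
  have zy: "coprime (int z) y"
  proof (rule coprime_intI)
    fix l assume l: "prime l" "l dvd z" "int l dvd y"
    have "int l dvd 2 * (int z)\<^sup>2 - int N * y\<^sup>2" using l(2,3) by (intro dvd_diff) (auto simp: power2_eq_square)
    hence "int l dvd x\<^sup>2" unfolding eqx .
    hence "int l dvd x" using int_prime_dvd_square l(1) by blast
    thus False using coprime_int_prime_False[OF zx l(1,2)] by blast
  qed
  have cg: "[x\<^sup>2 = - int N * y\<^sup>2] (mod int z)"
  proof -
    have "x\<^sup>2 - (- int N * y\<^sup>2) = int z * (2 * int z)" using eq by (simp add: power2_eq_square)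
    thus ?thesis unfolding cong_iff_dvd_diff by simp
  qed
  show "\<exists>r. [r\<^sup>2 = - int N] (mod int z)" using sqrt_mod_of_form[OF zy cg] by blast
  have "coprime x (int z)" using zx by (simp add: coprime_commute)
  hence "jac (- int N) z = 1" using jac_square_class[OF z(2) cong_sym[OF cg]] by blast
  moreover have "- int N = (- 1) * int N" by simp
  ultimately have "jac (- 1) z * psi z = 1" using jac_mult_left[OF z(2)] psi_jac[OF z(2)] by metis
  thus "psi z = jac (- 1) z" using signs_mult_eq_1 by metis
qed

text \<open>\<open>class_number_two_part\<close> applies with \<open>M = N q\<close>, as 2 is
  unramified, and with \<open>e0 = N\<close>.\<close>

lemma class_number_Nq:
  assumes s: "sol1 z X Y"
  shows "2 ^ (t + 1) dvd h_neg (N * q)" "2 ^ (t + 2) dvd h_neg (N * q) \<longleftrightarrow> psi z = 1"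
proof -
  have z: "z > 0" "odd z" and eq: "int N * X\<^sup>2 + int q * Y\<^sup>2 = 4 * (int z)\<^sup>2" and zX: "coprime (int z) X"
    using s by (auto simp: sol1_def)
  have Nq8: "(N * q) mod 8 = 3"
  proof -
    have "(N * q) mod 8 = ((N mod 8) * (q mod 8)) mod 8" by (simp add: mod_mult_eq)
    thus ?thesis using N_mod_8 q_mod by simp
  qed
  have Nq0: "N * q > 8" using N_gt_8 prime_gt_1_nat[OF prime_q] by (metis less_le_trans mult.right_neutral mult_le_mono2 less_imp_le)
  interpret ramified "N * q" "N * q"
    by unfold_locales (use squarefree_Nq odd_N q_odd Nq8 Nq0 in auto)
  have m4: "(N * q) mod 4 = 3" using Nq8 by (rule nat_mod_8)
  have parity: "even (int N * X - Y)"
  proof -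
    have "even (int N * X\<^sup>2 + int q * Y\<^sup>2)" unfolding eq by simp
    thus ?thesis using odd_N q_odd by simp
  qed
  define a where "a = el (int N * X) Y"
  have "par (int N * X) Y" using parity m4 by (simp add: par_def)
  hence aO: "a \<in> OK" unfolding OK_iff a_def by blast
  have eq4: "(int N * X)\<^sup>2 + int (N * q) * Y\<^sup>2 = 4 * (int N * (int z)\<^sup>2)"
  proof -
    have "(int N * X)\<^sup>2 + int (N * q) * Y\<^sup>2 = int N * (int N * X\<^sup>2 + int q * Y\<^sup>2)"
      by (simp add: power2_eq_square algebra_simps)
    thus ?thesis unfolding eq by simp
  qed
  have "4 * (cmod a)\<^sup>2 = of_int (4 * (int N * (int z)\<^sup>2))" unfolding a_def el_norm eq4 ..
  hence na: "(cmod a)\<^sup>2 = real (N * z\<^sup>2)" by simp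
  have tr: "2 * Re a = of_int (int N * X)" unfolding a_def el_Re by simp
  \<comment> \<open>\<open>U\<close> is half of \<open>N X^2 - q Y^2\<close>, so that
    \<open>a^2 = N (U + X Y w) / 2\<close>. This puts \<open>a\<close> into
    \<open>De N\<close>.\<close>
  define U where "U = 2 * (int z)\<^sup>2 - int q * Y\<^sup>2"
  have "par U (X * Y)"
  proof -
    have "even (U - X * Y)" using parity q_odd odd_N by (auto simp: U_def)
    thus ?thesis using m4 by (simp add: par_def)
  qed
  hence bO: "el U (X * Y) \<in> OK" unfolding OK_iff by blast
  have aa: "a * a = of_nat N * el U (X * Y)"
  proof -
    have U2: "real_of_int (2 * U) = real N * (real_of_int X)\<^sup>2 - real q * (real_of_int Y)\<^sup>2"
    proof -
      have "2 * U = int N * X\<^sup>2 - int q * Y\<^sup>2" using eq unfolding U_def by simp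
      thus ?thesis by simp
    qed
    have s2: "sqrt (real N * real q) * sqrt (real N * real q) = real N * real q" by simp
    have "Re (a * a) = real N * (real_of_int (2 * U)) / 4"
      unfolding U2 a_def el_def by (simp add: power2_eq_square s2 field_simps)
    moreover have "Im (a * a) = real N * (real_of_int (X * Y)) / 2 * sqrt (real (N * q))"
      unfolding a_def el_def by (simp add: field_simps)
    ultimately show ?thesis by (simp add: complex_eq_iff el_def)
  qed
  have aD: "a \<in> De N" unfolding De_def aa using aO smulI[OF bO] aa by simp
  have e0: "N dvd N * q" "N \<noteq> 1" "N \<noteq> N * q" using N_gt_8 prime_gt_1_nat[OF prime_q] by auto
  \<comment> \<open>A divisor containing \<open>q\<close> is traded for its complement, a product of
    some \<open>p i\<close>; being a norm is unaffected.\<close>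
  have qcase: "\<exists>S\<subseteq>{..<t}. e = P S \<or> (e = q * P S \<and> (N * q) div e = P ({..<t} - S) \<and> e dvd N * q)" if e: "e dvd N * q" for e
  proof (cases "q dvd e")
    case False
    hence "coprime e q" using prime_q by (metis coprime_commute prime_imp_coprime)
    hence "e dvd N" using e by (simp add: coprime_dvd_mult_left_iff)
    then obtain S where "S \<subseteq> {..<t}" "e = P S" using dvd_N_cases by blast
    thus ?thesis by blast
  next
    case True
    then obtain f where f: "e = q * f" by blast
    have "f dvd N" using e prime_gt_0_nat[OF prime_q] unfolding f by (simp add: mult.commute)
    then obtain S where S: "S \<subseteq> {..<t}" "f = P S" using dvd_N_cases by blast
    have "N * q = (q * P S) * P ({..<t} - S)" using P_compl[OF S(1)] by (simp add: mult_ac)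
    hence "(N * q) div e = P ({..<t} - S)" unfolding f S(2) using P_pos[OF S(1)] prime_gt_0_nat[OF prime_q] by simp
    thus ?thesis using S f e by blast
  qed
  have norms: "e = 1 \<or> e = N * q \<or> e = N \<or> (\<exists>g. e * N = g\<^sup>2 * (N * q))" if e: "e dvd N * q" and kn: "knorm (N * q) e" for e
  proof -
    obtain S where S: "S \<subseteq> {..<t}" "e = P S \<or> (e = q * P S \<and> (N * q) div e = P ({..<t} - S) \<and> e dvd N * q)" using qcase[OF e] by blast
    from S(2) show ?thesis
    proof
      assume eS: "e = P S"
      hence "S = {} \<or> S = {..<t}" using trivial_sy_divisors[of q S] S(1) kn by auto
      thus ?thesis using eS by (auto simp: N_def P_def)
    next
      assume eS: "e = q * P S \<and> (N * q) div e = P ({..<t} - S) \<and> e dvd N * q"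
      have "knorm (N * q) (1 * ((N * q) div e))" by (rule knorm_complement) (use N_pos prime_gt_0_nat[OF prime_q] e kn in auto)
      moreover have "(N * q) div e = P ({..<t} - S)" using eS by blast
      ultimately have "knorm (N * q) (P ({..<t} - S))" by (simp only: mult_1)
      hence "{..<t} - S = {} \<or> {..<t} - S = {..<t}" using trivial_sy_divisors[of q "{..<t} - S"] by auto
      hence "S = {..<t} \<or> S = {}" using S(1) by auto
      thus ?thesis
      proof
        assume "S = {}"
        hence "e * N = 1\<^sup>2 * (N * q)" using eS by (simp add: P_def)
        thus ?thesis by blast
      qed (use eS in \<open>auto simp: N_def mult.commute\<close>)
    qed
  qed
  note crit = class_number_two_part[OF card_prime_factors_mult[OF prime_q q_ndvd_N] e0 norms z(1) aD na tr]
  have cXz: "coprime X (int z)" using zX by (simp add: coprime_commute)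
  show "2 ^ (t + 1) dvd h_neg (N * q)" by (rule crit(1)[OF _ _ cXz])
  have "2 ^ (t + 2) dvd h_neg (N * q) \<longleftrightarrow> (\<exists>e. e dvd N * q \<and> knorm (N * q) (z * e))" by (rule crit(2)[OF _ _ cXz])
  also have "\<dots> \<longleftrightarrow> (\<exists>S\<subseteq>{..<t}. knorm (N * q) (z * P S))"
  proof
    assume "\<exists>e. e dvd N * q \<and> knorm (N * q) (z * e)"
    then obtain e where e: "e dvd N * q" "knorm (N * q) (z * e)" by blast
    obtain S where S: "S \<subseteq> {..<t}" "e = P S \<or> (e = q * P S \<and> (N * q) div e = P ({..<t} - S) \<and> e dvd N * q)" using qcase[OF e(1)] by blast
    from S(2) show "\<exists>S\<subseteq>{..<t}. knorm (N * q) (z * P S)"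
    proof
      assume "e = q * P S \<and> (N * q) div e = P ({..<t} - S) \<and> e dvd N * q"
      moreover have "knorm (N * q) (z * ((N * q) div e))" by (rule knorm_complement) (use N_pos prime_gt_0_nat[OF prime_q] e in auto)
      ultimately have "knorm (N * q) (z * P ({..<t} - S))" by metis
      thus ?thesis by (intro exI[of _ "{..<t} - S"]) auto
    qed (use S(1) e(2) in blast)
  next
    assume "\<exists>S\<subseteq>{..<t}. knorm (N * q) (z * P S)"
    thus "\<exists>e. e dvd N * q \<and> knorm (N * q) (z * e)" using P_dvd_N by (meson dvd_mult2)
  qed
  also have "\<dots> \<longleftrightarrow> psi z = 1"
  proof -
    obtain r3 where "[r3\<^sup>2 = - int (N * q)] (mod int z)" using sol1_facts(5)[OF s] by blast
    thus ?thesis using knorm_iff_psi[of q z r3] z(1) sol1_facts[OF s] by blast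
  qed
  finally show "2 ^ (t + 2) dvd h_neg (N * q) \<longleftrightarrow> psi z = 1" .
qed

lemma class_number_N:
  assumes s: "sol2 z x y"
  shows "2 ^ (t + 1) dvd h_neg N" "2 ^ (t + 2) dvd h_neg N \<longleftrightarrow> psi z = 1"
proof -
  have z: "z > 0" "odd z" and eq: "x\<^sup>2 + int N * y\<^sup>2 = 2 * (int z)\<^sup>2" and zx: "coprime (int z) x"
    using s by (auto simp: sol2_def)
  have N4: "N mod 4 = 1" using N_mod_8 by (rule nat_mod_8)
  interpret ramified N "2 * N"
    by unfold_locales (use squarefree_N odd_N N4 N_gt_8 in auto)
  have kn2: "knorm N 2"
  proof -
    have "int 2 * (int z)\<^sup>2 = x\<^sup>2 + int N * y\<^sup>2" using eq by simp
    moreover have "int z \<noteq> 0" using z(1) by simp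
    ultimately show ?thesis unfolding knorm_def by blast
  qed
  define a where "a = of_int x + of_int y * w"
  have aO: "a \<in> OK" unfolding a_def by (intro OK_add OK_mult OK_of_int OK_w)
  have "(cmod a)\<^sup>2 = of_int (x\<^sup>2 + int N * y\<^sup>2)"
    unfolding a_def cmod_power2 by (simp add: w_def power_mult_distrib)
  hence na: "(cmod a)\<^sup>2 = real (2 * z\<^sup>2)" unfolding eq by simp
  have tr: "2 * Re a = of_int (int 2 * x)" unfolding a_def by (simp add: w_def)
  have bO: "of_int (x\<^sup>2 - (int z)\<^sup>2) + of_int (x * y) * w \<in> OK" by (intro OK_add OK_mult OK_of_int OK_w)
  have aa: "a * a = of_nat 2 * (of_int (x\<^sup>2 - (int z)\<^sup>2) + of_int (x * y) * w)"
  proof -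
    have "a * a = of_int (x\<^sup>2) + of_int (y\<^sup>2) * (w * w) + 2 * of_int (x * y) * w"
      unfolding a_def by (simp add: power2_eq_square algebra_simps)
    also have "of_int (x\<^sup>2) + of_int (y\<^sup>2) * (w * w) = (of_int (x\<^sup>2 - int N * y\<^sup>2) :: complex)"
      unfolding w_sq by simp
    also have "x\<^sup>2 - int N * y\<^sup>2 = 2 * (x\<^sup>2 - (int z)\<^sup>2)" using eq by simp
    finally show ?thesis by (simp add: algebra_simps)
  qed
  have aD: "a \<in> De 2" unfolding De_def using aO smulI[OF bO, of "of_nat 2"] aa by simp
  have e0: "2 dvd 2 * N" "(2::nat) \<noteq> 1" "2 \<noteq> N" using N_gt_8 by auto
  have ecase: "\<exists>S\<subseteq>{..<t}. e = P S \<or> e = P S * 2" if e: "e dvd 2 * N" for e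
  proof (cases "even e")
    case False
    hence "coprime e 2" by simp
    hence "e dvd N" using e by (simp add: coprime_dvd_mult_right_iff)
    thus ?thesis using dvd_N_cases by blast
  next
    case True
    then obtain f where f: "e = 2 * f" by blast
    have "f dvd N" using e unfolding f by simp
    then obtain S where "S \<subseteq> {..<t}" "f = P S" using dvd_N_cases by blast
    thus ?thesis using f by auto
  qed
  have norms: "e = 1 \<or> e = N \<or> e = 2 \<or> (\<exists>g. e * 2 = g\<^sup>2 * N)" if e: "e dvd 2 * N" and kn: "knorm N e" for e
  proof -
    obtain S where S: "S \<subseteq> {..<t}" "e = P S \<or> e = P S * 2" using ecase[OF e] by blast
    have "knorm N (P S)" using S(2) kn knorm_cancel_right[of 2 N "P S"] kn2 by auto
    hence "S = {} \<or> S = {..<t}" using trivial_sy_divisors[of 1 S] S(1) by auto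
    hence "P S = 1 \<or> P S = N" by (auto simp: N_def P_def)
    moreover have "N * 2 * 2 = 2\<^sup>2 * N" by simp
    ultimately show ?thesis using S(2) by (metis mult_1)
  qed
  have card: "card (prime_factors (2 * N)) = t + 1" using card_prime_factors_mult[of 2] odd_N by (simp add: mult.commute)
  note crit = class_number_two_part[OF card e0 norms z(1) aD na tr]
  have cxz: "coprime x (int z)" using zx by (simp add: coprime_commute)
  show "2 ^ (t + 1) dvd h_neg N" by (rule crit(1)[OF _ _ cxz])
  have "2 ^ (t + 2) dvd h_neg N \<longleftrightarrow> (\<exists>e. e dvd 2 * N \<and> knorm N (z * e))" by (rule crit(2)[OF _ _ cxz])
  also have "\<dots> \<longleftrightarrow> (\<exists>S\<subseteq>{..<t}. knorm (N * 1) (z * P S))"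
  proof
    assume "\<exists>e. e dvd 2 * N \<and> knorm N (z * e)"
    then obtain e where e: "e dvd 2 * N" "knorm N (z * e)" by blast
    obtain S where S: "S \<subseteq> {..<t}" "e = P S \<or> e = P S * 2" using ecase[OF e(1)] by blast
    have "knorm N (z * P S)" using S(2) e(2) knorm_cancel_right[of 2 N "z * P S"] kn2 by (auto simp: mult.assoc)
    thus "\<exists>S\<subseteq>{..<t}. knorm (N * 1) (z * P S)" using S(1) by auto
  next
    assume "\<exists>S\<subseteq>{..<t}. knorm (N * 1) (z * P S)"
    thus "\<exists>e. e dvd 2 * N \<and> knorm N (z * e)" using P_dvd_N by (metis dvd_mult mult.right_neutral)
  qed
  also have "\<dots> \<longleftrightarrow> psi z = 1"
  proof -
    obtain r3 where "[r3\<^sup>2 = - int (N * 1)] (mod int z)" using sol2_facts(3)[OF s] by auto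
    thus ?thesis using knorm_iff_psi[of 1 z r3] z(1) sol2_facts[OF s] prime_gt_1_nat[OF prime_q] by auto
  qed
  finally show "2 ^ (t + 2) dvd h_neg N \<longleftrightarrow> psi z = 1" .
qed

end

section \<open>Consequences of congruence\<close>

lemma odd_square_mod_8: "odd (x::nat) \<Longrightarrow> x\<^sup>2 mod 8 = 1"
proof -
  assume "odd x"
  then obtain j where j: "x = 2 * j + 1" by (auto elim: oddE)
  have "even (j * (j + 1))" by simp
  then obtain k where k: "j * (j + 1) = 2 * k" by blast
  have "x\<^sup>2 = 4 * (j * (j + 1)) + 1" unfolding j by (simp add: power2_eq_square algebra_simps)
  also have "\<dots> = 1 + k * 8" unfolding k by simp
  finally show ?thesis by (simp only: mod_mult_self1) simp
qed

lemma even_square_mod_8: "even (x::nat) \<Longrightarrow> x\<^sup>2 mod 8 = 0 \<and> 4 dvd x \<or> x\<^sup>2 mod 8 = 4"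
proof -
  assume "even x"
  then obtain j where j: "x = 2 * j" by blast
  show ?thesis
  proof (cases "even j")
    case True
    then obtain i where i: "j = 2 * i" by blast
    have x: "x = 4 * i" unfolding j i by simp
    have "x\<^sup>2 = (2 * i\<^sup>2) * 8" unfolding x by (simp add: power2_eq_square)
    hence "x\<^sup>2 mod 8 = 0" by (simp only: mod_mult_self2_is_0)
    thus ?thesis using x by simp
  next
    case False
    then obtain i where i: "j = 2 * i + 1" by (auto elim: oddE)
    have "x\<^sup>2 = 4 + (2 * (i\<^sup>2 + i)) * 8" unfolding j i by (simp add: power2_eq_square algebra_simps)
    hence "x\<^sup>2 mod 8 = 4" by (simp only: mod_mult_self1) simp
    thus ?thesis by simp
  qed
qed

lemma mod_8_form: "(a * r + b * s) mod 8 = ((a mod 8) * (r mod 8) + (b mod 8) * (s mod 8)) mod (8::nat)"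
proof -
  have "(a * r + b * s) mod 8 = ((a * r) mod 8 + (b * s) mod 8) mod 8" by (rule mod_add_eq[symmetric])
  also have "\<dots> = (((a mod 8) * (r mod 8)) mod 8 + ((b mod 8) * (s mod 8)) mod 8) mod 8" by (simp only: mod_mult_eq)
  also have "\<dots> = ((a mod 8) * (r mod 8) + (b mod 8) * (s mod 8)) mod 8" by (rule mod_add_eq)
  finally show ?thesis .
qed

lemma mod_8_form1: "(a * r) mod 8 = ((a mod 8) * (r mod 8)) mod (8::nat)"
  by (rule mod_mult_eq[symmetric])

lemma residue_table_form:
  fixes X Y :: nat
  assumes "X = 1 \<or> X = 0 \<or> X = 4" "Y = 1 \<or> Y = 0 \<or> Y = 4" "1 = (1 * X + 3 * Y) mod 8"
  shows "X = 1" "Y = 0"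
  using assms by (elim disjE; simp)+

text \<open>\<open>a\<close>, \<open>b\<close>, \<open>c\<close>, \<open>d\<close> stand for the
  coefficients modulo 8, \<open>r\<close> and \<open>s\<close> for squares modulo 8. The case
  \<open>a = c = 3\<close> is excluded because \<open>q\<close> would divide two
  coefficients.\<close>

lemma residue_table_system:
  fixes a b c d r s :: nat
  assumes a: "a = 1 \<or> a = 3" and b: "b = 1 \<or> b = 3" and c: "c = 1 \<or> c = 3" and d: "d = 1 \<or> d = 3"
    and r: "r = 1 \<or> r = 0 \<or> r = 4" and s: "s = 1 \<or> s = 0 \<or> s = 4"
    and e1: "(a * r + b * s) mod 8 = c mod 8" and e2: "(b * s + d) mod 8 = (a * r) mod 8"
    and ac: "\<not> (a = 3 \<and> c = 3)" and prod: "(((a * b) mod 8 * c) mod 8 * d) mod 8 = 3"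
  shows "r = 1 \<and> s = 0 \<and> b = 3"
proof -
  have r1: "r = 1"
  proof (rule ccontr)
    assume "r \<noteq> 1"
    hence "(a * r) mod 8 = 0 \<or> (a * r) mod 8 = 4" using r a by auto
    hence "s = 1" using s e2 d b by auto
    thus False using \<open>r \<noteq> 1\<close> r e1 e2 a b c d by auto
  qed
  have s0: "s = 0" using s e1 a b c unfolding r1 by auto
  have "a = c" "d = a" using e1 e2 a c d unfolding r1 s0 by auto
  hence "a = 1" "c = 1" "d = 1" using ac a by auto
  thus ?thesis using r1 s0 prod b by auto
qed

section \<open>Solvability of the conics and the possible shapes of the system\<close>

context redei_q
begin

text \<open>Legendre's theorem applies since 2 is a residue of each \<open>p i\<close>. After
  removal of common factors \<open>z\<close> is odd: for even \<open>z\<close> the left side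
  \<open>x^2 + N y^2\<close> would be 2 modulo 8 and the right side 0. And \<open>y > 0\<close>
  because 2 is not a rational square.\<close>

lemma sol2_exists: obtains z x y where "sol2 z (int x) (int y)" "y > 0"
proof -
  have "\<exists>r. [r\<^sup>2 = 2] (mod int N)"
  proof (rule QuadRes_squarefree[OF squarefree_N])
    fix l assume l: "prime l" "l dvd N"
    then obtain r where r: "r < t" "l = p r" using prime_dvd_N by blast
    have "Legendre 2 (int l) = 1" using Legendre_2[OF prime_p[OF r(1)] p_gt_2[OF r(1)]] p_mod[OF r(1)] r(2) by simp
    thus "QuadRes (int l) 2" by (rule Legendre_eq_1_QuadRes)
  qed
  then obtain r2 where r2: "[r2\<^sup>2 = 2] (mod int N)" by blast
  have "knorm (1 * N) (1 * 2)"
  proof (rule legendre_conic)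
    show "[r2\<^sup>2 = int 1 * int 2] (mod int N)" using r2 by simp
    show "[1\<^sup>2 = - (int 1 * int N)] (mod int 2)" using odd_N by (simp add: cong_iff_dvd_diff)
    show "1 * N \<noteq> k\<^sup>2" for k
    proof
      assume k: "1 * N = k\<^sup>2"
      hence "k\<^sup>2 dvd N" by simp
      hence "k = 1" using squarefree_N squarefreeD by fastforce
      thus False using k N_gt_8 by simp
    qed
  qed (use odd_N N_pos in \<open>auto simp: cong_def\<close>)
  then obtain u v y0 :: int where uvy: "u \<noteq> 0" "2 * u\<^sup>2 = v\<^sup>2 + int N * y0\<^sup>2" unfolding knorm_def by auto
  define g where "g = gcd u v"
  have g0: "g > 0" using uvy(1) by (simp add: g_def)
  obtain z x where zx: "u = z * g" "v = x * g" "coprime z x"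
    using gcd_coprime_exists[of u v] g0 unfolding g_def by auto
  have "int N * y0\<^sup>2 = g\<^sup>2 * (2 * z\<^sup>2 - x\<^sup>2)" using uvy(2) unfolding zx by (simp add: power_mult_distrib algebra_simps)
  hence "g\<^sup>2 dvd int N * y0\<^sup>2" by simp
  have gy: "g dvd y0"
  proof (cases "y0 = 0")
    case False
    have "int ((nat g)\<^sup>2) dvd int (N * (nat \<bar>y0\<bar>)\<^sup>2)" using \<open>g\<^sup>2 dvd _\<close> g0 by simp
    hence "(nat g)\<^sup>2 dvd N * (nat \<bar>y0\<bar>)\<^sup>2" by (simp only: int_dvd_int_iff)
    hence "nat g dvd nat \<bar>y0\<bar>" by (rule square_dvd_squarefree_mult_square[OF squarefree_N]) (use False in simp)
    hence "int (nat g) dvd y0" by simp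
    thus ?thesis using g0 by simp
  qed simp
  then obtain y where y: "y0 = y * g" by (metis dvd_def mult.commute)
  have "g\<^sup>2 * (2 * z\<^sup>2) = g\<^sup>2 * (x\<^sup>2 + int N * y\<^sup>2)" using uvy(2) unfolding zx y by (simp add: power_mult_distrib algebra_simps)
  hence eq: "2 * z\<^sup>2 = x\<^sup>2 + int N * y\<^sup>2" using g0 by simp
  have z0: "z \<noteq> 0" using uvy(1) zx by auto
  define z' x' y' where "z' = nat \<bar>z\<bar>" and "x' = nat \<bar>x\<bar>" and "y' = nat \<bar>y\<bar>"
  have sq: "(int z')\<^sup>2 = z\<^sup>2" "(int x')\<^sup>2 = x\<^sup>2" "(int y')\<^sup>2 = y\<^sup>2" by (simp_all add: z'_def x'_def y'_def)
  have eq': "(int x')\<^sup>2 + int N * (int y')\<^sup>2 = 2 * (int z')\<^sup>2" unfolding sq eq ..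
  have "int (x'\<^sup>2 + N * y'\<^sup>2) = int (2 * z'\<^sup>2)" using eq' by simp
  hence eqn: "x'\<^sup>2 + N * y'\<^sup>2 = 2 * z'\<^sup>2" using of_nat_eq_iff by blast
  have cop: "coprime (int z') (int x')" using zx(3) by (simp add: z'_def x'_def)
  hence copn: "coprime z' x'" by (simp only: coprime_int_iff)
  have "odd z'"
  proof
    assume ez: "even z'"
    hence ox: "odd x'" using copn by (meson coprime_common_divisor odd_one)
    have "odd y'"
    proof
      assume "even y'"
      hence "even (N * y'\<^sup>2)" by simp
      hence "odd (x'\<^sup>2 + N * y'\<^sup>2)" using ox by simp
      thus False unfolding eqn by simp
    qed
    have "(1 * x'\<^sup>2 + N * y'\<^sup>2) mod 8 = ((1 mod 8) * (x'\<^sup>2 mod 8) + (N mod 8) * (y'\<^sup>2 mod 8)) mod 8"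
      by (rule mod_8_form)
    also have "\<dots> = 2" unfolding odd_square_mod_8[OF ox] odd_square_mod_8[OF \<open>odd y'\<close>] N_mod_8 by simp
    finally have "(1 * x'\<^sup>2 + N * y'\<^sup>2) mod 8 = 2" .
    moreover have "(2 * z'\<^sup>2) mod 8 = 0"
      unfolding mod_8_form1[of 2] using even_square_mod_8[OF ez] by auto
    ultimately show False using eqn by simp
  qed
  moreover have "z' > 0" using z0 by (simp add: z'_def)
  ultimately have sol: "sol2 z' (int x') (int y')" unfolding sol2_def using eq' cop by blast
  have "y' \<noteq> 0"
  proof
    assume "y' = 0"
    hence e: "x'\<^sup>2 = 2 * z'\<^sup>2" using eqn by simp
    hence "even (x'\<^sup>2)" by simp
    hence "even x'" by simp
    then obtain i where "x' = 2 * i" by blast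
    hence "4 * i\<^sup>2 = 2 * z'\<^sup>2" using e by (simp add: power_mult_distrib)
    hence "2 * i\<^sup>2 = z'\<^sup>2" by simp
    hence "even (z'\<^sup>2)" by (metis dvd_triv_left)
    thus False using \<open>odd z'\<close> by simp
  qed
  thus ?thesis using that[OF sol] by simp
qed

text \<open>A primitive solution of \<open>z\<^sup>2 = N x\<^sup>2 + q y\<^sup>2\<close> may have \<open>z\<close> even; this is the second alternative,
  where \<open>z\<close> has been halved.\<close>

lemma sol1_exists:
  obtains z x y where "sol1 z (2 * int x) (2 * int y)" "x > 0" "odd x" "4 dvd y"
  | z x y where "sol1 z (int x) (int y)" "x > 0" "odd x" "odd y"
proof -
  have "\<exists>r. [r\<^sup>2 = int q] (mod int N)"
  proof (rule QuadRes_squarefree[OF squarefree_N])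
    fix l assume l: "prime l" "l dvd N"
    then obtain r where r: "r < t" "l = p r" using prime_dvd_N by blast
    show "QuadRes (int l) (int q)" using leg_q[OF r(1)] r(2) by (intro Legendre_eq_1_QuadRes) simp
  qed
  then obtain r1 where r1: "[r1\<^sup>2 = int q] (mod int N)" by blast
  have "Legendre (int N) (int q) = 1" unfolding N_def by (rule Legendre_P_q) simp
  hence "QuadRes (int q) (int N)" by (rule Legendre_eq_1_QuadRes)
  then obtain r2 where r2: "[r2\<^sup>2 = int N] (mod int q)" unfolding QuadRes_def by blast
  have "knorm (N * q) (N * 1)"
  proof (rule legendre_conic)
    show "[r1\<^sup>2 = int q * int 1] (mod int N)" using r1 by simp
    show "[r2\<^sup>2 = int N * int 1] (mod int q)" using r2 by simp
    show "[0\<^sup>2 = - (int N * int q)] (mod int 1)" by (simp add: cong_iff_dvd_diff)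
    show "coprime N q" using q_ndvd_N prime_q by (metis coprime_commute prime_imp_coprime)
    show "N * q \<noteq> k\<^sup>2" for k
    proof
      assume k: "N * q = k\<^sup>2"
      hence "k\<^sup>2 dvd N * q" by simp
      hence "k = 1" using squarefree_Nq squarefreeD by fastforce
      thus False using k N_gt_8 by simp
    qed
  qed (use N_pos prime_gt_0_nat[OF prime_q] in auto)
  then obtain u v y0 :: int where uvy: "u \<noteq> 0" "int N * u\<^sup>2 = v\<^sup>2 + int (N * q) * y0\<^sup>2" unfolding knorm_def by auto
  \<comment> \<open>As \<open>N\<close> is squarefree it divides \<open>v\<close>, and cancelling it
    turns the norm equation into the conic \<open>u^2 = N v1^2 + q y0^2\<close>.\<close>
  have "v\<^sup>2 = int N * (u\<^sup>2 - int q * y0\<^sup>2)" using uvy(2) by (simp add: algebra_simps)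
  hence Nv2: "int N dvd v\<^sup>2" by simp
  have "int N dvd v"
  proof (cases "v = 0")
    case False
    have "int N dvd int ((nat \<bar>v\<bar>)\<^sup>2)" using Nv2 by simp
    hence "N dvd (nat \<bar>v\<bar>)\<^sup>2" by (simp only: int_dvd_int_iff)
    hence "N dvd nat \<bar>v\<bar>" by (rule squarefree_dvd_square[OF squarefree_N]) (use False in simp)
    thus ?thesis by simp
  qed simp
  then obtain v1 where v1: "v = int N * v1" by blast
  have "int N * u\<^sup>2 = int N * (int N * v1\<^sup>2 + int q * y0\<^sup>2)" using uvy(2) unfolding v1 by (simp add: power2_eq_square algebra_simps)
  hence e0: "u\<^sup>2 = int N * v1\<^sup>2 + int q * y0\<^sup>2" using N_pos by simp
  define g where "g = gcd u v1"
  have g0: "g > 0" using uvy(1) by (simp add: g_def)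
  obtain z x where zx: "u = z * g" "v1 = x * g" "coprime z x"
    using gcd_coprime_exists[of u v1] g0 unfolding g_def by auto
  have "int q * y0\<^sup>2 = g\<^sup>2 * (z\<^sup>2 - int N * x\<^sup>2)" using e0 unfolding zx by (simp add: power_mult_distrib algebra_simps)
  hence "g\<^sup>2 dvd int q * y0\<^sup>2" by simp
  have gy: "g dvd y0"
  proof (cases "y0 = 0")
    case False
    have "int ((nat g)\<^sup>2) dvd int (q * (nat \<bar>y0\<bar>)\<^sup>2)" using \<open>g\<^sup>2 dvd _\<close> g0 by simp
    hence "(nat g)\<^sup>2 dvd q * (nat \<bar>y0\<bar>)\<^sup>2" by (simp only: int_dvd_int_iff)
    hence "nat g dvd nat \<bar>y0\<bar>"
      by (rule square_dvd_squarefree_mult_square[OF squarefree_prime[OF prime_q]]) (use False in simp)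
    hence "int (nat g) dvd y0" by simp
    thus ?thesis using g0 by simp
  qed simp
  then obtain y where y: "y0 = y * g" by (metis dvd_def mult.commute)
  have "g\<^sup>2 * z\<^sup>2 = g\<^sup>2 * (int N * x\<^sup>2 + int q * y\<^sup>2)" using e0 unfolding zx y by (simp add: power_mult_distrib algebra_simps)
  hence eq: "z\<^sup>2 = int N * x\<^sup>2 + int q * y\<^sup>2" using g0 by simp
  have z0: "z \<noteq> 0" using uvy(1) zx by auto
  define z' x' y' where "z' = nat \<bar>z\<bar>" and "x' = nat \<bar>x\<bar>" and "y' = nat \<bar>y\<bar>"
  have sq: "(int z')\<^sup>2 = z\<^sup>2" "(int x')\<^sup>2 = x\<^sup>2" "(int y')\<^sup>2 = y\<^sup>2" by (simp_all add: z'_def x'_def y'_def)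
  have eq': "(int z')\<^sup>2 = int N * (int x')\<^sup>2 + int q * (int y')\<^sup>2" unfolding sq eq ..
  have "int (z'\<^sup>2) = int (N * x'\<^sup>2 + q * y'\<^sup>2)" using eq' by simp
  hence eqn: "z'\<^sup>2 = N * x'\<^sup>2 + q * y'\<^sup>2" using of_nat_eq_iff by blast
  have cop: "coprime (int z') (int x')" using zx(3) by (simp add: z'_def x'_def)
  hence copn: "coprime z' x'" by (simp only: coprime_int_iff)
  have z'0: "z' > 0" using z0 by (simp add: z'_def)
  have form: "z'\<^sup>2 mod 8 = (1 * (x'\<^sup>2 mod 8) + 3 * (y'\<^sup>2 mod 8)) mod 8"
  proof -
    have "z'\<^sup>2 mod 8 = ((N mod 8) * (x'\<^sup>2 mod 8) + (q mod 8) * (y'\<^sup>2 mod 8)) mod 8" unfolding eqn by (rule mod_8_form)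
    thus ?thesis unfolding N_mod_8 q_mod .
  qed
  show ?thesis
  proof (cases "even z'")
    case False
    \<comment> \<open>Modulo 8 the conic reads \<open>1 = x'^2 + 3 y'^2\<close>, which leaves only
      \<open>x'\<close> odd and \<open>y'^2\<close> divisible by 8.\<close>
    have ox: "odd x'" and y4: "4 dvd y'"
    proof -
      have z8: "z'\<^sup>2 mod 8 = 1" using odd_square_mod_8 False by blast
      have px: "x'\<^sup>2 mod 8 = 1 \<or> x'\<^sup>2 mod 8 = 0 \<or> x'\<^sup>2 mod 8 = 4"
        using odd_square_mod_8[of x'] even_square_mod_8[of x'] by blast
      have py: "y'\<^sup>2 mod 8 = 1 \<or> y'\<^sup>2 mod 8 = 0 \<or> y'\<^sup>2 mod 8 = 4"
        using odd_square_mod_8[of y'] even_square_mod_8[of y'] by blast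
      note x1 = residue_table_form(1)[OF px py form[unfolded z8]] and y0 = residue_table_form(2)[OF px py form[unfolded z8]]
      show "odd x'" using even_square_mod_8[of x'] x1 by force
      show "4 dvd y'" using odd_square_mod_8[of y'] even_square_mod_8[of y'] y0 by force
    qed
    have "coprime (int z') (2 * int x')" using cop False by simp
    moreover have "int N * (2 * int x')\<^sup>2 + int q * (2 * int y')\<^sup>2 = 4 * (int z')\<^sup>2"
      unfolding eq' by (simp add: power_mult_distrib)
    ultimately have "sol1 z' (2 * int x') (2 * int y')" unfolding sol1_def using z'0 False by blast
    thus ?thesis using that(1) ox y4 by (metis odd_pos)
  next
    case True
    have ox: "odd x'" using copn True by (meson coprime_common_divisor odd_one)
    have oy: "odd y'"
    proof
      assume "even y'"
      hence "even (q * y'\<^sup>2)" by simp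
      moreover have "odd (N * x'\<^sup>2)" using odd_N ox by simp
      ultimately have "odd (N * x'\<^sup>2 + q * y'\<^sup>2)" by simp
      hence "odd (z'\<^sup>2)" unfolding eqn .
      thus False using True by simp
    qed
    have "z'\<^sup>2 mod 8 = 4" using form odd_square_mod_8[OF ox] odd_square_mod_8[OF oy] by simp
    obtain k where k: "z' = 2 * k" using True by blast
    have "odd k"
    proof
      assume "even k"
      then obtain i where "k = 2 * i" by blast
      hence "z'\<^sup>2 = (2 * i\<^sup>2) * 8" unfolding k by (simp add: power2_eq_square)
      hence "z'\<^sup>2 mod 8 = 0" by (simp only: mod_mult_self2_is_0)
      thus False using \<open>z'\<^sup>2 mod 8 = 4\<close> by simp
    qed
    have "coprime (int k) (int x')" using cop unfolding k by simp
    moreover have "int N * (int x')\<^sup>2 + int q * (int y')\<^sup>2 = 4 * (int k)\<^sup>2"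
      unfolding eq'[symmetric] k by (simp add: power_mult_distrib)
    ultimately have "sol1 k (int x') (int y')" unfolding sol1_def using z'0 k \<open>odd k\<close> by simp
    thus ?thesis using that(2) ox oy by (metis odd_pos)
  qed
qed

lemma divisor_mod_8:
  assumes "x dvd N * q"
  shows "(x mod 8 = 1 \<and> x dvd N) \<or> (x mod 8 = 3 \<and> (\<exists>f. f dvd N \<and> x = q * f))"
proof (cases "q dvd x")
  case False
  hence "coprime x q" using prime_q by (metis coprime_commute prime_imp_coprime)
  hence "x dvd N" using assms by (simp add: coprime_dvd_mult_left_iff)
  then obtain S where "S \<subseteq> {..<t}" "x = P S" using dvd_N_cases by blast
  thus ?thesis using P_mod_8 \<open>x dvd N\<close> by simp
next
  case True
  then obtain f where f: "x = q * f" by blast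
  have "f dvd N" using assms prime_gt_0_nat[OF prime_q] unfolding f by (simp add: mult.commute)
  then obtain S where "S \<subseteq> {..<t}" "f = P S" using dvd_N_cases by blast
  hence "f mod 8 = 1" using P_mod_8 by simp
  hence "x mod 8 = 3" unfolding f mod_8_form1[of q] q_mod by simp
  thus ?thesis using f \<open>f dvd N\<close> by blast
qed

text \<open>A divisor of \<open>N q\<close> is 3 or 1 modulo 8 according to whether \<open>q\<close>
  divides it, and modulo 8 the two equations leave a single pattern, in which \<open>q\<close>
  divides \<open>b\<close>.\<close>

lemma system_parity:
  fixes a b c d r s u w :: nat
  assumes prod: "a * b * c * d = N * q"
    and e1: "a * r\<^sup>2 + b * s\<^sup>2 = c * u\<^sup>2" and e2: "a * r\<^sup>2 = b * s\<^sup>2 + d * w\<^sup>2"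
    and odds: "odd (c * u\<^sup>2)" "odd (d * w\<^sup>2)"
  shows "odd r" "4 dvd s" "odd u" "odd w" "\<exists>f. f dvd N \<and> b = q * f \<and> a * f * c * d = N"
proof -
  have dv: "a dvd N * q" "b dvd N * q" "c dvd N * q" "d dvd N * q"
    unfolding prod[symmetric] by (simp_all add: mult.assoc)
  note A = divisor_mod_8[OF dv(1)] and B = divisor_mod_8[OF dv(2)] and C = divisor_mod_8[OF dv(3)] and D = divisor_mod_8[OF dv(4)]
  show "odd u" "odd w" using odds by auto
  hence uw: "u\<^sup>2 mod 8 = 1" "w\<^sup>2 mod 8 = 1" using odd_square_mod_8 by blast+
  have m8: "(a * b * c * d) mod 8 = 3" unfolding prod mod_8_form1[of N] N_mod_8 q_mod by simp
  have m8': "((((a mod 8) * (b mod 8)) mod 8 * (c mod 8)) mod 8 * (d mod 8)) mod 8 = 3"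
    using m8 by (simp only: mod_mult_eq)
  have f1: "((a mod 8) * (r\<^sup>2 mod 8) + (b mod 8) * (s\<^sup>2 mod 8)) mod 8 = (c mod 8) mod 8"
  proof -
    have "((a mod 8) * (r\<^sup>2 mod 8) + (b mod 8) * (s\<^sup>2 mod 8)) mod 8 = (a * r\<^sup>2 + b * s\<^sup>2) mod 8"
      by (rule mod_8_form[symmetric])
    also have "\<dots> = ((c mod 8) * (u\<^sup>2 mod 8)) mod 8" unfolding e1 by (rule mod_8_form1)
    finally show ?thesis unfolding uw by (simp only: mult_1_right)
  qed
  have f2: "((b mod 8) * (s\<^sup>2 mod 8) + (d mod 8)) mod 8 = ((a mod 8) * (r\<^sup>2 mod 8)) mod 8"
  proof -
    have "((b mod 8) * (s\<^sup>2 mod 8) + (d mod 8) * (w\<^sup>2 mod 8)) mod 8 = (b * s\<^sup>2 + d * w\<^sup>2) mod 8"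
      by (rule mod_8_form[symmetric])
    also have "\<dots> = ((a mod 8) * (r\<^sup>2 mod 8)) mod 8" unfolding e2[symmetric] by (rule mod_8_form1)
    finally show ?thesis unfolding uw by (simp only: mult_1_right)
  qed
  have R: "(r\<^sup>2 mod 8 = 1 \<and> odd r) \<or> r\<^sup>2 mod 8 = 0 \<or> r\<^sup>2 mod 8 = 4"
    using odd_square_mod_8[of r] even_square_mod_8[of r] by blast
  have S: "s\<^sup>2 mod 8 = 1 \<or> (s\<^sup>2 mod 8 = 0 \<and> 4 dvd s) \<or> s\<^sup>2 mod 8 = 4"
    using odd_square_mod_8[of s] even_square_mod_8[of s] by blast
  have a: "a mod 8 = 1 \<or> a mod 8 = 3" and b: "b mod 8 = 1 \<or> b mod 8 = 3"
    and c: "c mod 8 = 1 \<or> c mod 8 = 3" and d: "d mod 8 = 1 \<or> d mod 8 = 3" using A B C D by blast+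
  have "odd r \<and> 4 dvd s \<and> b mod 8 = 3"
  proof -
    have ac: "\<not> (a mod 8 = 3 \<and> c mod 8 = 3)"
    proof
      assume "a mod 8 = 3 \<and> c mod 8 = 3"
      then obtain f g where "a = q * f" "c = q * g" using A C by auto
      hence "q * (f * b * g * d * q) = q * N" using prod by (simp add: mult_ac)
      hence "f * b * g * d * q = N" using prime_gt_0_nat[OF prime_q] by simp
      thus False using q_ndvd_N by (metis dvd_triv_right)
    qed
    have "r\<^sup>2 mod 8 = 1 \<and> s\<^sup>2 mod 8 = 0 \<and> b mod 8 = 3"
      by (rule residue_table_system[OF a b c d _ _ f1 f2 ac m8']) (use R S in blast)+
    moreover from this have "odd r" "4 dvd s" using even_square_mod_8[of r] S by force+
    ultimately show ?thesis by blast
  qed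
  thus "odd r" "4 dvd s" by blast+
  have "b mod 8 = 3" using \<open>odd r \<and> 4 dvd s \<and> b mod 8 = 3\<close> by blast
  then obtain f where f: "f dvd N" "b = q * f" using B by auto
  have "q * (a * f * c * d) = q * N" using prod unfolding f(2) by (simp add: mult_ac)
  hence "a * f * c * d = N" using prime_gt_0_nat[OF prime_q] by simp
  thus "\<exists>f. f dvd N \<and> b = q * f \<and> a * f * c * d = N" using f by blast
qed

lemma Legendre_pair:
  assumes r: "r < t" and c: "[A * x\<^sup>2 = B * y\<^sup>2] (mod int (p r))" and nd: "\<not> int (p r) dvd A * x\<^sup>2"
  shows "Legendre A (int (p r)) * Legendre B (int (p r)) = 1"
proof -
  let ?p = "int (p r)"
  have nx: "\<not> ?p dvd x" using nd by (auto simp: power2_eq_square)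
  have ndB: "\<not> ?p dvd B * y\<^sup>2" using nd c unfolding cong_iff_dvd_diff by (metis diff_add_cancel dvd_add)
  hence ny: "\<not> ?p dvd y" by (auto simp: power2_eq_square)
  have "Legendre (A * x\<^sup>2) ?p = Legendre (B * y\<^sup>2) ?p" by (rule Legendre_cong[OF c])
  hence "Legendre A ?p = Legendre B ?p"
    using Legendre_mult[OF prime_p[OF r] p_gt_2[OF r]] Legendre_square[OF nx] Legendre_square[OF ny] prime_p[OF r] by simp
  moreover have "Legendre A ?p = 1 \<or> Legendre A ?p = - 1" using Legendre_values_pm nd by (meson dvd_mult2)
  ultimately show ?thesis by auto
qed

lemma Legendre_m1: "r < t \<Longrightarrow> Legendre (- 1) (int (p r)) = 1"
  using Legendre_minus_1[OF prime_p p_gt_2] p_mod_4 by simp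

lemma Legendre_two: "r < t \<Longrightarrow> Legendre 2 (int (p r)) = 1"
  using Legendre_2[OF prime_p p_gt_2] p_mod by simp

text \<open>If \<open>S\<close> is the set of primes dividing \<open>x y\<close>, with cofactor
  \<open>v v'\<close>, the two hypotheses say that \<open>sy S r = 1\<close> for all
  \<open>r\<close>, so \<open>S\<close> lies in the kernel.\<close>

lemma kernel_divisor:
  assumes prod: "x * y * (v * v') = N"
    and L: "\<And>r. r < t \<Longrightarrow> p r dvd x * y \<Longrightarrow> Legendre (int v) (int (p r)) * Legendre (int v') (int (p r)) = 1"
      "\<And>r. r < t \<Longrightarrow> \<not> p r dvd x * y \<Longrightarrow> Legendre (int x) (int (p r)) * Legendre (int y) (int (p r)) = 1"
  shows "x * y = 1 \<or> x * y = N"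
proof -
  have "x * y dvd N" unfolding prod[symmetric] by simp
  then obtain S where S: "S \<subseteq> {..<t}" "x * y = P S" using dvd_N_cases by blast
  have "P S * P ({..<t} - S) = P S * (v * v')" using P_compl[OF S(1)] prod unfolding S(2) by simp
  hence vv: "P ({..<t} - S) = v * v'" using P_pos[OF S(1)] by simp
  have "S = {} \<or> S = {..<t}"
  proof (rule redei_kernel[OF S(1)])
    fix r assume r: "r < t"
    note LM = Legendre_mult[OF prime_p[OF r] p_gt_2[OF r]]
    show "sy S r = 1"
    proof (cases "r \<in> S")
      case True
      hence "p r dvd x * y" using p_dvd_P[OF r S(1)] S(2) by simp
      thus ?thesis unfolding sy_def using True L(1)[OF r] LM by (simp add: vv)
    next
      case False
      hence "\<not> p r dvd x * y" using p_dvd_P[OF r S(1)] S(2) by simp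
      thus ?thesis unfolding sy_def using False L(2)[OF r] LM by (simp flip: S(2))
    qed
  qed
  thus ?thesis unfolding S(2) by (auto simp: N_def P_def)
qed

text \<open>Modulo a prime of one coefficient, the two equations and their sum
  \<open>2 a r^2 = c u^2 + d w^2\<close> relate the symbols of the other coefficients in pairs,
  since -1, 2 and \<open>q\<close> are residues. Hence \<open>a d\<close> and \<open>a c\<close>
  both meet the kernel condition and are 1 or \<open>N\<close>.\<close>

lemma system_cases:
  fixes a b c d r s u w :: nat
  assumes prod: "a * b * c * d = N * q"
    and e1: "a * r\<^sup>2 + b * s\<^sup>2 = c * u\<^sup>2" and e2: "a * r\<^sup>2 = b * s\<^sup>2 + d * w\<^sup>2"
    and cop: "coprime (a * r\<^sup>2) (b * s\<^sup>2)"
    and odds: "odd (c * u\<^sup>2)" "odd (d * w\<^sup>2)"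
    and nontriv: "\<not> (a = 1 \<and> c = 1 \<and> d = 1)"
  shows "b = q \<and> (a = N \<and> c = 1 \<and> d = 1 \<or> a = 1 \<and> c = N \<and> d = 1 \<or> a = 1 \<and> c = 1 \<and> d = N)"
proof -
  obtain f where f: "f dvd N" "b = q * f" "a * f * c * d = N" using system_parity(5)[OF prod e1 e2 odds] by blast
  have i1: "int a * (int r)\<^sup>2 + int b * (int s)\<^sup>2 = int c * (int u)\<^sup>2"
    and i2: "int a * (int r)\<^sup>2 = int b * (int s)\<^sup>2 + int d * (int w)\<^sup>2"
    using arg_cong[OF e1, of int] arg_cong[OF e2, of int] by simp_all
  let ?L = "\<lambda>r x. Legendre (int x) (int (p r))"
  have Lb: "?L k b = ?L k f" if k: "k < t" for k
    unfolding f(2) using Legendre_mult[OF prime_p[OF k] p_gt_2[OF k], of "int q" "int f"] leg_q[OF k] by simp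
  have ndr: "\<not> int (p k) dvd int a * (int r)\<^sup>2" if k: "k < t" "p k dvd b * s\<^sup>2" for k
  proof
    assume "int (p k) dvd int a * (int r)\<^sup>2"
    hence "int (p k) dvd int (a * r\<^sup>2)" by simp
    hence "p k dvd a * r\<^sup>2" by (simp only: int_dvd_int_iff)
    thus False using cop k(2) prime_p[OF k(1)] by (meson coprime_common_divisor not_prime_unit)
  qed
  have nds: "\<not> int (p k) dvd int b * (int s)\<^sup>2" if k: "k < t" "p k dvd a * r\<^sup>2" for k
  proof
    assume "int (p k) dvd int b * (int s)\<^sup>2"
    hence "int (p k) dvd int (b * s\<^sup>2)" by simp
    hence "p k dvd b * s\<^sup>2" by (simp only: int_dvd_int_iff)
    thus False using cop k(2) prime_p[OF k(1)] by (meson coprime_common_divisor not_prime_unit)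
  qed
  have La: "?L k f * ?L k c = 1 \<and> ?L k f * ?L k d = 1" if k: "k < t" "p k dvd a" for k
  proof -
    obtain i where i: "int a = int (p k) * i" using k(2) by (metis dvd_def of_nat_mult)
    have nd: "\<not> int (p k) dvd int b * (int s)\<^sup>2" by (rule nds[OF k(1)]) (use k in simp)
    have "[int b * (int s)\<^sup>2 = int c * (int u)\<^sup>2] (mod int (p k))"
    proof -
      have "int c * (int u)\<^sup>2 - int b * (int s)\<^sup>2 = int (p k) * (i * (int r)\<^sup>2)" using i1 unfolding i by simp
      thus ?thesis by (metis cong_iff_dvd_diff cong_sym dvd_triv_left)
    qed
    hence 1: "?L k b * ?L k c = 1" using Legendre_pair[OF k(1) _ nd] by blast
    have "[int b * (int s)\<^sup>2 = (- int d) * (int w)\<^sup>2] (mod int (p k))"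
    proof -
      have "int b * (int s)\<^sup>2 - (- int d) * (int w)\<^sup>2 = int (p k) * (i * (int r)\<^sup>2)" using i2 unfolding i by simp
      thus ?thesis by (metis cong_iff_dvd_diff dvd_triv_left)
    qed
    hence "?L k b * Legendre (- int d) (int (p k)) = 1" using Legendre_pair[OF k(1) _ nd] by blast
    moreover have "Legendre (- int d) (int (p k)) = ?L k d"
      using Legendre_mult[OF prime_p[OF k(1)] p_gt_2[OF k(1)], of "- 1" "int d"] Legendre_m1[OF k(1)] by simp
    ultimately show ?thesis using 1 Lb[OF k(1)] by simp
  qed
  have Lf: "?L k a * ?L k c = 1 \<and> ?L k a * ?L k d = 1" if k: "k < t" "p k dvd f" for k
  proof -
    have pb: "p k dvd b" using k(2) f(2) by simp
    obtain i where i: "int b = int (p k) * i" using pb by (metis dvd_def of_nat_mult)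
    have nd: "\<not> int (p k) dvd int a * (int r)\<^sup>2" by (rule ndr[OF k(1)]) (use pb in simp)
    have "[int a * (int r)\<^sup>2 = int c * (int u)\<^sup>2] (mod int (p k))"
    proof -
      have "int c * (int u)\<^sup>2 - int a * (int r)\<^sup>2 = int (p k) * (i * (int s)\<^sup>2)" using i1 unfolding i by simp
      thus ?thesis by (metis cong_iff_dvd_diff cong_sym dvd_triv_left)
    qed
    moreover have "[int a * (int r)\<^sup>2 = int d * (int w)\<^sup>2] (mod int (p k))"
    proof -
      have "int a * (int r)\<^sup>2 - int d * (int w)\<^sup>2 = int (p k) * (i * (int s)\<^sup>2)" using i2 unfolding i by simp
      thus ?thesis by (metis cong_iff_dvd_diff dvd_triv_left)
    qed
    ultimately show ?thesis using Legendre_pair[OF k(1) _ nd] by blast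
  qed
  have Lc: "?L k a * ?L k f = 1 \<and> ?L k a * ?L k d = 1" if k: "k < t" "p k dvd c" for k
  proof -
    obtain i where i: "int c = int (p k) * i" using k(2) by (metis dvd_def of_nat_mult)
    have nd: "\<not> int (p k) dvd int a * (int r)\<^sup>2"
    proof
      assume h: "int (p k) dvd int a * (int r)\<^sup>2"
      hence "int (p k) dvd int c * (int u)\<^sup>2 - int a * (int r)\<^sup>2" unfolding i by (intro dvd_diff) auto
      moreover have "int c * (int u)\<^sup>2 - int a * (int r)\<^sup>2 = int (b * s\<^sup>2)" using i1 by simp
      ultimately have "int (p k) dvd int (b * s\<^sup>2)" by metis
      hence "p k dvd b * s\<^sup>2" by (simp only: int_dvd_int_iff)
      thus False using ndr[OF k(1)] h by blast
    qed
    have "[int a * (int r)\<^sup>2 = (- int b) * (int s)\<^sup>2] (mod int (p k))"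
    proof -
      have "int a * (int r)\<^sup>2 - (- int b) * (int s)\<^sup>2 = int (p k) * (i * (int u)\<^sup>2)" using i1 unfolding i by simp
      thus ?thesis by (metis cong_iff_dvd_diff dvd_triv_left)
    qed
    hence "?L k a * Legendre (- int b) (int (p k)) = 1" using Legendre_pair[OF k(1) _ nd] by blast
    moreover have "Legendre (- int b) (int (p k)) = ?L k b"
      using Legendre_mult[OF prime_p[OF k(1)] p_gt_2[OF k(1)], of "- 1" "int b"] Legendre_m1[OF k(1)] by simp
    ultimately have 1: "?L k a * ?L k f = 1" using Lb[OF k(1)] by simp
    have nd2: "\<not> int (p k) dvd (2 * int a) * (int r)\<^sup>2"
    proof
      assume "int (p k) dvd (2 * int a) * (int r)\<^sup>2"
      hence "int (p k) dvd 2 * (int a * (int r)\<^sup>2)" by (simp add: mult.assoc)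
      hence "int (p k) dvd 2" using nd prime_p[OF k(1)] prime_dvd_mult_iff[of "int (p k)" 2 "int a * (int r)\<^sup>2"] by simp
      hence "int (p k) \<le> 2" by (rule zdvd_imp_le) simp
      thus False using p_gt_2[OF k(1)] by simp
    qed
    have "[(2 * int a) * (int r)\<^sup>2 = int d * (int w)\<^sup>2] (mod int (p k))"
    proof -
      have "(2 * int a) * (int r)\<^sup>2 - int d * (int w)\<^sup>2 = int (p k) * (i * (int u)\<^sup>2)" using i1 i2 unfolding i by simp
      thus ?thesis by (metis cong_iff_dvd_diff dvd_triv_left)
    qed
    hence "Legendre (2 * int a) (int (p k)) * ?L k d = 1" by (rule Legendre_pair[OF k(1) _ nd2])
    thus ?thesis using 1 Legendre_mult[OF prime_p[OF k(1)] p_gt_2[OF k(1)], of 2 "int a"] Legendre_two[OF k(1)] by simp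
  qed
  have Ld: "?L k a * ?L k f = 1 \<and> ?L k a * ?L k c = 1" if k: "k < t" "p k dvd d" for k
  proof -
    obtain i where i: "int d = int (p k) * i" using k(2) by (metis dvd_def of_nat_mult)
    have nd: "\<not> int (p k) dvd int a * (int r)\<^sup>2"
    proof
      assume h: "int (p k) dvd int a * (int r)\<^sup>2"
      hence "int (p k) dvd int a * (int r)\<^sup>2 - int d * (int w)\<^sup>2" unfolding i by (intro dvd_diff) auto
      moreover have "int a * (int r)\<^sup>2 - int d * (int w)\<^sup>2 = int (b * s\<^sup>2)" using i2 by simp
      ultimately have "int (p k) dvd int (b * s\<^sup>2)" by metis
      hence "p k dvd b * s\<^sup>2" by (simp only: int_dvd_int_iff)
      thus False using ndr[OF k(1)] h by blast
    qed
    have "[int a * (int r)\<^sup>2 = int b * (int s)\<^sup>2] (mod int (p k))"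
    proof -
      have "int a * (int r)\<^sup>2 - int b * (int s)\<^sup>2 = int (p k) * (i * (int w)\<^sup>2)" using i2 unfolding i by simp
      thus ?thesis by (metis cong_iff_dvd_diff dvd_triv_left)
    qed
    hence 1: "?L k a * ?L k f = 1" using Legendre_pair[OF k(1) _ nd] Lb[OF k(1)] by metis
    have nd2: "\<not> int (p k) dvd (2 * int a) * (int r)\<^sup>2"
    proof
      assume "int (p k) dvd (2 * int a) * (int r)\<^sup>2"
      hence "int (p k) dvd 2 * (int a * (int r)\<^sup>2)" by (simp add: mult.assoc)
      hence "int (p k) dvd 2" using nd prime_p[OF k(1)] prime_dvd_mult_iff[of "int (p k)" 2 "int a * (int r)\<^sup>2"] by simp
      hence "int (p k) \<le> 2" by (rule zdvd_imp_le) simp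
      thus False using p_gt_2[OF k(1)] by simp
    qed
    have "[(2 * int a) * (int r)\<^sup>2 = int c * (int u)\<^sup>2] (mod int (p k))"
    proof -
      have "(2 * int a) * (int r)\<^sup>2 - int c * (int u)\<^sup>2 = int (p k) * (i * (int w)\<^sup>2)" using i1 i2 unfolding i by simp
      thus ?thesis by (metis cong_iff_dvd_diff dvd_triv_left)
    qed
    hence "Legendre (2 * int a) (int (p k)) * ?L k c = 1" by (rule Legendre_pair[OF k(1) _ nd2])
    thus ?thesis using 1 Legendre_mult[OF prime_p[OF k(1)] p_gt_2[OF k(1)], of 2 "int a"] Legendre_two[OF k(1)] by simp
  qed
  have one: "p k dvd a \<or> p k dvd f \<or> p k dvd c \<or> p k dvd d" if k: "k < t" for k
  proof -
    have "p k dvd a * f * c * d" unfolding f(3) using prime_dvd_N[OF prime_p[OF k]] k by blast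
    thus ?thesis using prime_p[OF k] by (simp add: prime_dvd_mult_iff)
  qed
  have tr: "x * y = 1 \<Longrightarrow> x * v = 1 \<Longrightarrow> y * v = (1 :: int)" for x y v
    by (metis signs_mult_eq_1)
  have ad: "a * d = 1 \<or> a * d = N"
  proof (rule kernel_divisor[of a d f c])
    show "a * d * (f * c) = N" using f(3) by (simp add: mult_ac)
    show "?L k f * ?L k c = 1" if k: "k < t" "p k dvd a * d" for k
    proof -
      have "p k dvd a \<or> p k dvd d" using k prime_p[OF k(1)] by (simp add: prime_dvd_mult_iff)
      thus ?thesis using La[OF k(1)] Ld[OF k(1)] tr by blast
    qed
    show "?L k a * ?L k d = 1" if k: "k < t" "\<not> p k dvd a * d" for k
      using one[OF k(1)] k(2) Lf[OF k(1)] Lc[OF k(1)] by (meson dvd_mult dvd_mult2)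
  qed
  have ac: "a * c = 1 \<or> a * c = N"
  proof (rule kernel_divisor[of a c f d])
    show "a * c * (f * d) = N" using f(3) by (simp add: mult_ac)
    show "?L k f * ?L k d = 1" if k: "k < t" "p k dvd a * c" for k
    proof -
      have "p k dvd a \<or> p k dvd c" using k prime_p[OF k(1)] by (simp add: prime_dvd_mult_iff)
      thus ?thesis using La[OF k(1)] Lc[OF k(1)] tr by blast
    qed
    show "?L k a * ?L k c = 1" if k: "k < t" "\<not> p k dvd a * c" for k
      using one[OF k(1)] k(2) Lf[OF k(1)] Ld[OF k(1)] by (meson dvd_mult dvd_mult2)
  qed
  have N1: "N \<noteq> 1" "N > 0" using N_gt_8 by auto
  show ?thesis
  proof (cases "a * d = 1")
    case True
    hence a1: "a = 1" "d = 1" by auto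
    hence "c = N" using ac nontriv by auto
    hence "f = 1" using f(3) a1 N1 by simp
    thus ?thesis using a1 \<open>c = N\<close> f(2) by simp
  next
    case False
    hence adN: "a * d = N" using ad by blast
    have "(a * d) * (f * c) = N" using f(3) by (simp add: mult_ac)
    hence fc: "f = 1" "c = 1" using adN N1 by auto
    show ?thesis
    proof (cases "a * c = 1")
      case True
      thus ?thesis using adN fc f(2) by simp
    next
      case False
      hence "a = N" using ac fc by simp
      thus ?thesis using adN fc f(2) N1 by simp
    qed
  qed
qed

end

section \<open>Comparison of the two conics in the three remaining cases\<close>

lemma coprime_nat_prime_False:
  fixes a b l :: nat
  shows "coprime a b \<Longrightarrow> prime l \<Longrightarrow> l dvd a \<Longrightarrow> l dvd b \<Longrightarrow> False"
  by (meson coprime_common_divisor not_prime_unit)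

lemma coprime_natI:
  fixes a b :: nat
  assumes "\<And>l. prime l \<Longrightarrow> l dvd a \<Longrightarrow> l dvd b \<Longrightarrow> False"
  shows "coprime a b"
  using assms not_coprime_common_prime by blast

lemma prime_dvd_square_nat: "prime l \<Longrightarrow> l dvd (x::nat)\<^sup>2 \<longleftrightarrow> l dvd x"
  by (simp add: prime_dvd_power_iff)

lemma jac_square_class_nat:
  fixes a e :: int and x y n :: nat
  assumes "odd n" "a * (int x)\<^sup>2 - (int y)\<^sup>2 = int n * e" "coprime y n"
  shows "jac a n = 1"
proof (rule jac_square_class[OF assms(1)])
  show "[a * (int x)\<^sup>2 = (int y)\<^sup>2] (mod int n)" unfolding cong_iff_dvd_diff assms(2) by simp
  show "coprime (int y) (int n)" using assms(3) by simp
qed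

lemma Legendre_square_class_nat:
  fixes a e :: int and x y l :: nat
  assumes "prime l" "odd l" "a * (int x)\<^sup>2 - (int y)\<^sup>2 = int l * e" "\<not> l dvd y"
  shows "Legendre a (int l) = 1"
  using jac_square_class_nat[OF assms(2,3)] assms(1,4) prime_imp_coprime[of l y]
  by (simp add: jac_prime coprime_commute)

text \<open>Modulo \<open>q\<close> the number \<open>V\<close> is \<open>U\<close> or
  \<open>-U\<close>. As -1 is a nonresidue, the symbols detect which of the two factors
  \<open>q\<close> divides.\<close>

lemma Legendre_sum_of_square_roots:
  fixes U V :: int
  assumes q: "prime q" "q > 2" "q mod 4 = 3" and d: "int q dvd (U + V) * (U - V)" and U: "\<not> int q dvd U"
  shows "Legendre U (int q) * Legendre V (int q) = (if int q dvd U + V then - 1 else 1)"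
proof -
  have pm: "Legendre U (int q) = 1 \<or> Legendre U (int q) = - 1"
    using Legendre_values[of U "int q"] Legendre_eq_0_iff[of U "int q"] U by auto
  hence sq: "Legendre U (int q) * Legendre U (int q) = 1" by auto
  show ?thesis
  proof (cases "int q dvd U + V")
    case True
    hence "[V = (- 1) * U] (mod int q)" unfolding cong_iff_dvd_diff by (simp add: add.commute)
    hence "Legendre V (int q) = Legendre (- 1) (int q) * Legendre U (int q)"
      using Legendre_cong Legendre_mult[OF q(1,2)] by metis
    thus ?thesis using True Legendre_minus_1[OF q(1,2)] q(3) sq by simp
  next
    case False
    hence "int q dvd U - V" using d q(1) prime_dvd_mult_iff[of "int q" "U + V" "U - V"] by simp
    hence "Legendre U (int q) = Legendre V (int q)" by (intro Legendre_cong) (simp add: cong_iff_dvd_diff)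
    thus ?thesis using False sq by simp
  qed
qed

text \<open>As \<open>r\<close> is 1 modulo 4, \<open>m\<close> is \<open>2 z + u y\<close> modulo
  8, and \<open>2 z\<close> modulo 8 depends on \<open>z\<close> modulo 4 only. The two sides of the
  conclusion are \<open>(2/u) = 1\<close> and \<open>(-1/z) = 1\<close>.\<close>

lemma residue_table_psi:
  fixes r z u y m :: nat
  assumes "r mod 4 = 1" "odd z" "odd u" "y mod 8 = 1 \<or> y mod 8 = 7" "m = 2 * r * z + u * y" "m mod 8 = 1 \<or> m mod 8 = 3"
  shows "(u mod 8 = 1 \<or> u mod 8 = 7) \<longleftrightarrow> z mod 4 = 1"
proof -
  obtain i where r: "r = 4 * i + 1" using assms(1) by (metis mult_div_mod_eq)
  have z4: "z mod 4 = 1 \<or> z mod 4 = 3" using assms(2) by presburger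
  have u8: "u mod 8 = 1 \<or> u mod 8 = 3 \<or> u mod 8 = 5 \<or> u mod 8 = 7" using assms(3) by presburger
  have "m = (2 * z + u * y) + (i * z) * 8" unfolding assms(5) r by (simp add: algebra_simps)
  hence "m mod 8 = (2 * z + u * y) mod 8" by (simp only: mod_mult_self1)
  also have "\<dots> = (2 * (z mod 4) + (u * y) mod 8) mod 8"
  proof -
    have "2 * z = 2 * (z mod 4) + 8 * (z div 4)" by presburger
    hence "2 * z + u * y = (2 * (z mod 4) + u * y) + (z div 4) * 8" by simp
    hence "(2 * z + u * y) mod 8 = (2 * (z mod 4) + u * y) mod 8" by (simp only: mod_mult_self1)
    thus ?thesis by (simp add: mod_add_right_eq)
  qed
  also have "(u * y) mod 8 = ((u mod 8) * (y mod 8)) mod 8" by (rule mod_8_form1)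
  finally have m8: "m mod 8 = (2 * (z mod 4) + ((u mod 8) * (y mod 8)) mod 8) mod 8" .
  have table: "(uu = 1 \<or> uu = 7) \<longleftrightarrow> zz = 1"
    if "zz = 1 \<or> zz = 3" "uu = 1 \<or> uu = 3 \<or> uu = 5 \<or> uu = 7" "yy = 1 \<or> yy = 7" "k = 1 \<or> k = 3"
      "k = (2 * zz + (uu * yy) mod 8) mod 8" for zz uu yy k :: nat
    using that by auto
  show ?thesis by (rule table[OF z4 u8 assms(4,6) m8])
qed

context redei_q
begin

text \<open>The second equation is the first conic, and eliminating \<open>q s^2\<close> from both
  equations gives the second conic. Both solutions share the number \<open>r\<close>, so the two
  products of symbols are literally the same.\<close>

lemma case_d_solutions:
  assumes e1: "r\<^sup>2 + q * s\<^sup>2 = u\<^sup>2" and e2: "r\<^sup>2 = q * s\<^sup>2 + N * w\<^sup>2"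
    and cop: "coprime (r\<^sup>2) (q * s\<^sup>2)" and pos: "r > 0" "odd r"
  shows "sol1 r (2 * int w) (2 * int s)" "sol2 r (int u) (int w)"
proof -
  have i1: "(int r)\<^sup>2 + int q * (int s)\<^sup>2 = (int u)\<^sup>2" and i2: "(int r)\<^sup>2 = int q * (int s)\<^sup>2 + int N * (int w)\<^sup>2"
    using arg_cong[OF e1, of int] arg_cong[OF e2, of int] by simp_all
  have "coprime r w"
  proof (rule coprime_natI)
    fix l assume l: "prime l" "l dvd r" "l dvd w"
    have "l dvd r\<^sup>2" "l dvd N * w\<^sup>2" using l by (simp_all add: power2_eq_square)
    hence "l dvd q * s\<^sup>2" unfolding e2 by (metis dvd_add_left_iff)
    thus False using coprime_nat_prime_False[OF cop l(1) \<open>l dvd r\<^sup>2\<close>] by blast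
  qed
  hence "coprime (int r) (2 * int w)" using pos by simp
  moreover have "int N * (2 * int w)\<^sup>2 + int q * (2 * int s)\<^sup>2 = 4 * (int r)\<^sup>2" unfolding i2 by (simp add: power_mult_distrib)
  ultimately show "sol1 r (2 * int w) (2 * int s)" unfolding sol1_def using pos by blast
  have "coprime r u"
  proof (rule coprime_natI)
    fix l assume l: "prime l" "l dvd r" "l dvd u"
    have "l dvd r\<^sup>2" "l dvd u\<^sup>2" using l by (simp_all add: power2_eq_square)
    hence "l dvd q * s\<^sup>2" unfolding e1[symmetric] by (metis dvd_add_right_iff)
    thus False using coprime_nat_prime_False[OF cop l(1) \<open>l dvd r\<^sup>2\<close>] by blast
  qed
  moreover have "(int u)\<^sup>2 + int N * (int w)\<^sup>2 = 2 * (int r)\<^sup>2" using i1 i2 by simp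
  ultimately show "sol2 r (int u) (int w)" unfolding sol2_def using pos by simp
qed

text \<open>From \<open>2 N r^2 = u^2 + w^2\<close> follows \<open>psi u = (2/u)\<close>, while
  \<open>psi z = (-1/z)\<close>. The link between them is \<open>m = 2 r z + u y\<close>: it is a
  factor of \<open>(w y)^2 + 2 (r x)^2\<close>, so \<open>(-2/m) = 1\<close> and \<open>m\<close> is
  1 or 3 modulo 8.\<close>

lemma psi_eq_case_a:
  assumes e1: "N * r\<^sup>2 + q * s\<^sup>2 = u\<^sup>2" and e2: "N * r\<^sup>2 = q * s\<^sup>2 + w\<^sup>2"
    and cop: "coprime (N * r\<^sup>2) (q * s\<^sup>2)" and cop2: "coprime u w"
    and pos: "u > 0" "odd r" "odd u"
    and sol: "sol2 z (int x) (int y)" "y > 0"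
  shows "sol1 u (2 * int r) (2 * int s)" "psi u = psi z"
proof -
  have i1: "int N * (int r)\<^sup>2 + int q * (int s)\<^sup>2 = (int u)\<^sup>2" and i2: "int N * (int r)\<^sup>2 = int q * (int s)\<^sup>2 + (int w)\<^sup>2"
    using arg_cong[OF e1, of int] arg_cong[OF e2, of int] by simp_all
  have uw: "2 * int N * (int r)\<^sup>2 = (int u)\<^sup>2 + (int w)\<^sup>2" using i1 i2 by simp
  have z: "z > 0" "odd z" and eq: "(int x)\<^sup>2 + int N * (int y)\<^sup>2 = 2 * (int z)\<^sup>2" and zx: "coprime z x"
    using sol by (auto simp: sol2_def)
  have "int (x\<^sup>2 + N * y\<^sup>2) = int (2 * z\<^sup>2)" using eq by simp
  hence eqn: "x\<^sup>2 + N * y\<^sup>2 = 2 * z\<^sup>2" using of_nat_eq_iff by blast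
  have ur: "coprime u r"
  proof (rule coprime_natI)
    fix l assume l: "prime l" "l dvd u" "l dvd r"
    have "l dvd N * r\<^sup>2" "l dvd u\<^sup>2" using l by (simp_all add: power2_eq_square)
    hence "l dvd q * s\<^sup>2" unfolding e1[symmetric] by (metis dvd_add_right_iff)
    thus False using coprime_nat_prime_False[OF cop l(1) \<open>l dvd N * r\<^sup>2\<close>] by blast
  qed
  have wr: "coprime w r"
  proof (rule coprime_natI)
    fix l assume l: "prime l" "l dvd w" "l dvd r"
    have "l dvd N * r\<^sup>2" "l dvd w\<^sup>2" using l by (simp_all add: power2_eq_square)
    hence "l dvd q * s\<^sup>2" unfolding e2 by (metis dvd_add_left_iff)
    thus False using coprime_nat_prime_False[OF cop l(1) \<open>l dvd N * r\<^sup>2\<close>] by blast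
  qed
  have xy: "odd y"
  proof
    assume ey: "even y"
    hence "even (2 * z\<^sup>2 - N * y\<^sup>2)" by simp
    hence "even (x\<^sup>2)" unfolding eqn[symmetric] by simp
    then obtain i j where "x = 2 * i" "y = 2 * j" using ey by (auto elim!: evenE)
    hence "2 * z\<^sup>2 = 2 * (2 * (i\<^sup>2 + N * j\<^sup>2))" using eqn by (simp add: power_mult_distrib)
    hence "z\<^sup>2 = 2 * (i\<^sup>2 + N * j\<^sup>2)" by simp
    hence "even (z\<^sup>2)" by simp
    thus False using z(2) by simp
  qed
  have xy_cop: "coprime x y"
  proof (rule coprime_natI)
    fix l assume l: "prime l" "l dvd x" "l dvd y"
    have "l dvd 2 * z\<^sup>2" unfolding eqn[symmetric] using l by (simp add: power2_eq_square)
    moreover have "\<not> l dvd 2" using l(1,3) xy by (metis primes_dvd_imp_eq two_is_prime_nat)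
    ultimately have "l dvd z" using l(1) by (simp add: prime_dvd_mult_iff prime_dvd_square_nat)
    thus False using coprime_nat_prime_False[OF zx l(1)] l(2) by blast
  qed
  have "coprime (int u) (2 * int r)" using ur pos by simp
  moreover have "int N * (2 * int r)\<^sup>2 + int q * (2 * int s)\<^sup>2 = 4 * (int u)\<^sup>2" unfolding i1[symmetric] by (simp add: power_mult_distrib)
  ultimately show "sol1 u (2 * int r) (2 * int s)" unfolding sol1_def using pos by blast
  have "jac (2 * int N) u = 1"
  proof (rule jac_square_class_nat[of u _ r w "int u"])
    show "2 * int N * (int r)\<^sup>2 - (int w)\<^sup>2 = int u * int u" unfolding uw by (simp add: power2_eq_square)
  qed (use pos cop2 in \<open>simp_all add: coprime_commute\<close>)
  hence psi_u: "psi u = jac 2 u" using jac_mult_left[OF pos(3)] psi_jac[OF pos(3)] signs_mult_eq_1 by metis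
  have psi_z: "psi z = jac (- 1) z" by (rule sol2_facts(2)[OF sol(1)])
  \<comment> \<open>The product \<open>4 r^2 z^2 - u^2 y^2\<close> becomes
    \<open>(w y)^2 + 2 (r x)^2\<close> on inserting \<open>2 z^2 = x^2 + N y^2\<close> and
    \<open>2 N r^2 = u^2 + w^2\<close>.\<close>
  define m m' where "m = 2 * r * z + u * y" and "m' = 2 * int r * int z - int u * int y"
  have mi: "int m = 2 * int r * int z + int u * int y" by (simp add: m_def)
  have om: "odd m" using pos xy by (simp add: m_def)
  have mm: "int m * m' = (int (w * y))\<^sup>2 + 2 * (int (r * x))\<^sup>2"
  proof -
    have "(int (w * y))\<^sup>2 + 2 * (int (r * x))\<^sup>2 = ((int w)\<^sup>2) * (int y)\<^sup>2 + 2 * (int r)\<^sup>2 * ((int x)\<^sup>2)" by (simp add: power_mult_distrib)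
    also have "(int w)\<^sup>2 = 2 * int N * (int r)\<^sup>2 - (int u)\<^sup>2" using uw by simp
    also have "(int x)\<^sup>2 = 2 * (int z)\<^sup>2 - int N * (int y)\<^sup>2" using eq by simp
    finally show ?thesis unfolding mi m'_def by (simp add: power2_eq_square algebra_simps)
  qed
  have "jac (- 2) m = 1"
  proof (rule jac_factor_of_form[OF om _ mm])
    fix l assume l: "prime l" "l dvd m"
    have ol: "odd l" using l(2) om by (meson dvd_trans)
    show "\<not> int l dvd 2"
    proof
      assume "int l dvd 2"
      hence "int l dvd int 2" by simp
      hence "l dvd 2" by (simp only: int_dvd_int_iff)
      thus False using ol l(1) by (metis primes_dvd_imp_eq two_is_prime_nat dvd_refl)
    qed
    hence l2: "\<not> int l dvd 2" "\<not> l dvd 2" by (simp_all flip: int_dvd_int_iff)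
    \<comment> \<open>Coprimality leaves only primes \<open>l\<close> dividing \<open>y\<close> and
      \<open>r\<close>. Modulo such \<open>l\<close> the conic makes 2 a square and
      \<open>u^2 + w^2 = 2 N r^2\<close> makes -1 a square, so \<open>l\<close> is not bad.\<close>
    assume bad: "int l dvd m'" "int l dvd int (w * y)" "int l dvd int (r * x)" "Legendre (- 2) (int l) = - 1"
    have lm: "int l dvd int m" using l(2) by simp
    have "int l dvd int m + m'" "int l dvd int m - m'" using lm bad(1) by (simp_all add: dvd_diff)
    moreover have "int m + m' = 2 * (2 * int (r * z))" "int m - m' = 2 * int (u * y)" unfolding mi m'_def by simp_all
    ultimately have "int l dvd int (r * z)" "int l dvd int (u * y)"
      using l(1) l2 by (metis prime_dvd_mult_iff prime_int_nat_transfer prime_nat_int_transfer)+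
    hence rz: "l dvd r \<or> l dvd z" and uy: "l dvd u \<or> l dvd y" and wy: "l dvd w \<or> l dvd y" and rx: "l dvd r \<or> l dvd x"
      using bad(2,3) l(1) by (simp_all only: int_dvd_int_iff prime_dvd_mult_iff)
    show False
    proof (cases "l dvd u")
      case True
      hence "l dvd y" "l dvd x"
        using wy rx coprime_nat_prime_False[OF cop2 l(1)] coprime_nat_prime_False[OF ur l(1)] by blast+
      thus False using coprime_nat_prime_False[OF xy_cop l(1)] by blast
    next
      case False
      hence ly: "l dvd y" using uy by blast
      have lx: "\<not> l dvd x" using coprime_nat_prime_False[OF xy_cop l(1)] ly by blast
      hence lr: "l dvd r" using rx by blast
      have lw: "\<not> l dvd w" using coprime_nat_prime_False[OF wr l(1)] lr by blast
      obtain i where i: "int y = int l * i" using ly by (metis dvd_def of_nat_mult)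
      obtain j where j: "int r = int l * j" using lr by (metis dvd_def of_nat_mult)
      have "Legendre 2 (int l) = 1"
      proof (rule Legendre_square_class_nat[OF l(1) ol _ lx])
        show "2 * (int z)\<^sup>2 - (int x)\<^sup>2 = int l * (int N * i * int y)"
          unfolding eq[symmetric] using i by (simp add: power2_eq_square)
      qed
      moreover have "Legendre (- 1) (int l) = 1"
      proof (rule Legendre_square_class_nat[OF l(1) ol _ lw])
        have "- 1 * (int u)\<^sup>2 - (int w)\<^sup>2 = - (2 * int N * (int r)\<^sup>2)" unfolding uw by simp
        thus "- 1 * (int u)\<^sup>2 - (int w)\<^sup>2 = int l * (- 2 * int N * j * int r)"
          using j by (simp add: power2_eq_square)
      qed
      moreover have "l > 2" using l(1) ol by (metis prime_ge_2_nat le_neq_implies_less even_numeral)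
      ultimately have "Legendre (- 2) (int l) = 1" using Legendre_mult[OF l(1), of "- 1" 2] by simp
      thus False using bad(4) by simp
    qed
  qed
  hence "jac ((- 1) * 2) m = 1" by simp
  hence "jac (- 1) m = jac 2 m" using jac_mult_left[OF om] signs_mult_eq_1 by metis
  hence m8: "m mod 8 = 1 \<or> m mod 8 = 3"
  proof -
    assume "jac (- 1) m = jac 2 m"
    moreover have "m mod 4 = m mod 8 mod 4" by (simp add: mod_mod_cancel)
    moreover have "m mod 8 = 1 \<or> m mod 8 = 3 \<or> m mod 8 = 5 \<or> m mod 8 = 7" using om by presburger
    ultimately show ?thesis unfolding jac_minus_1[OF om] jac_2[OF om] by auto
  qed
  \<comment> \<open>The other inputs of the residue table: \<open>u^2 + w^2\<close> vanishes modulo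
    \<open>r\<close>, and \<open>x^2\<close> is \<open>2 z^2\<close> modulo
    \<open>y\<close>.\<close>
  have "jac (- 1) r = 1"
  proof (rule jac_square_class_nat[OF pos(2) _ wr])
    have "- 1 * (int u)\<^sup>2 - (int w)\<^sup>2 = - (2 * int N * (int r)\<^sup>2)" unfolding uw by simp
    thus "- 1 * (int u)\<^sup>2 - (int w)\<^sup>2 = int r * (- 2 * int N * int r)" by (simp add: power2_eq_square)
  qed
  hence r4: "r mod 4 = 1" unfolding jac_minus_1[OF pos(2)] by (auto split: if_splits)
  have "jac 2 y = 1"
  proof (rule jac_square_class_nat[OF xy _ xy_cop])
    show "2 * (int z)\<^sup>2 - (int x)\<^sup>2 = int y * (int N * int y)" unfolding eq[symmetric] by (simp add: power2_eq_square)
  qed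
  hence y8: "y mod 8 = 1 \<or> y mod 8 = 7" unfolding jac_2[OF xy] by (auto split: if_splits)
  show "psi u = psi z" unfolding psi_u psi_z jac_2[OF pos(3)] jac_minus_1[OF z(2)]
    using residue_table_psi[OF r4 z(2) pos(3) y8 m_def m8] by simp
qed

text \<open>Exactly one of \<open>m\<close> and \<open>m'\<close> is divisible by \<open>q\<close>.
  Cancelling this \<open>q\<close> leaves a factor of a sum of two squares, at which -1 has symbol
  1, whereas \<open>(-1/q) = -1\<close>.\<close>

lemma jac_factor_of_q_form:
  fixes m m' E F :: nat
  assumes om: "odd m" and m': "m' > 0" and form: "m * m' = q * (E\<^sup>2 + F\<^sup>2)" and one: "\<not> (q dvd m \<and> q dvd m')"
    and good: "\<And>l. prime l \<Longrightarrow> odd l \<Longrightarrow> l dvd m \<Longrightarrow> l dvd m' \<Longrightarrow> l dvd E \<Longrightarrow> l dvd F \<Longrightarrow> Legendre (- 1) (int l) = 1"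
  shows "jac (- 1) m = (if q dvd m then - 1 else 1)"
proof -
  have q0: "q > 0" using q_gt_2 by simp
  have *: "jac (- 1) k = 1" if k: "k dvd m" "k' dvd m'" "k * k' = E\<^sup>2 + F\<^sup>2" for k k'
  proof -
    have "int k * int k' = int (E\<^sup>2 + F\<^sup>2)" unfolding k(3)[symmetric] by simp
    hence kk: "int k * int k' = (int E)\<^sup>2 + 1 * (int F)\<^sup>2" by simp
    have ok: "odd k" using om k(1) by (meson dvd_trans)
    show ?thesis
    proof (rule jac_factor_of_form[OF ok _ kk])
      fix l assume l: "prime l" "l dvd k"
      show "\<not> int l dvd 1" using l(1) by (metis not_prime_unit prime_nat_int_transfer)
      assume "int l dvd int k'" "int l dvd int E" "int l dvd int F" and L: "Legendre (- 1) (int l) = - 1"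
      hence d: "l dvd m'" "l dvd E" "l dvd F" using k(2) by (auto intro: dvd_trans)
      have "l dvd m" using l(2) k(1) by (rule dvd_trans)
      moreover from this have "odd l" using om by (meson dvd_trans)
      ultimately show False using good[OF l(1) _ _ d] L by simp
    qed
  qed
  show ?thesis
  proof (cases "q dvd m")
    case True
    then obtain k where k: "m = q * k" by blast
    have "q * (k * m') = q * (E\<^sup>2 + F\<^sup>2)" using form unfolding k by (simp add: mult_ac)
    hence "k * m' = E\<^sup>2 + F\<^sup>2" using q0 by simp
    hence "jac (- 1) k = 1" using *[of k m'] k by simp
    moreover have "k > 0" using om k by (cases k) auto
    ultimately have "jac (- 1) m = jac (- 1) q" unfolding k using jac_mult_right[OF q0] by simp
    thus ?thesis using True jac_minus_1[OF q_odd] q_mod_4 by simp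
  next
    case False
    have "q dvd m * m'" unfolding form by simp
    hence "q dvd m'" using False prime_q by (simp add: prime_dvd_mult_iff)
    then obtain k where k: "m' = q * k" by blast
    have "q * (m * k) = q * (E\<^sup>2 + F\<^sup>2)" using form unfolding k by (simp add: mult_ac)
    hence "m * k = E\<^sup>2 + F\<^sup>2" using q0 by simp
    thus ?thesis using *[of m k] k False by simp
  qed
qed

end

context redei_q
begin

text \<open>\<open>-q\<close> is a square modulo \<open>n\<close>, and \<open>(-q/n) = (n/q)\<close>
  because the sign \<open>(-1/n)\<close> enters twice.\<close>

lemma Legendre_q_of_form:
  assumes n: "odd n" and e: "- int q * (int s)\<^sup>2 - (int y)\<^sup>2 = int n * e" and c: "coprime y n"
  shows "Legendre (int n) (int q) = 1"
proof -
  have "jac (- int q) n = 1" by (rule jac_square_class_nat[OF n e c])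
  moreover have "jac (- int q) n = jac (- 1) n * (jac (- 1) n * Legendre (int n) (int q))"
    using jac_mult_left[OF n, of "- 1" "int q"] jac_reciprocity_3_mod_4[OF prime_q q_mod_4 n] by simp
  moreover have "jac (- 1) n * jac (- 1) n = 1" using jac_minus_1[OF n] by simp
  ultimately show ?thesis by (metis mult.assoc mult_1)
qed

text \<open>Prepares the case \<open>c = N\<close> of the system. A prime dividing \<open>m\<close>,
  \<open>m'\<close> and \<open>E\<close> divides \<open>u\<close> and \<open>x\<close>; modulo it
  the conic makes \<open>q\<close> a square and the system makes \<open>-q\<close> a square, hence
  -1 is one.\<close>

lemma jac_minus_1_of_q_form_factor:
  fixes r s u Z x y m m' :: nat
  assumes e1: "r\<^sup>2 + q * s\<^sup>2 = N * u\<^sup>2" and cop: "coprime (r\<^sup>2) (q * s\<^sup>2)"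
    and eZ: "N * x\<^sup>2 + q * y\<^sup>2 = Z\<^sup>2" and Zx: "coprime Z x" and Zy: "coprime Z y" and Zq: "coprime Z q"
    and m: "odd m" "m' > 0"
    and md: "\<And>l. prime l \<Longrightarrow> odd l \<Longrightarrow> l dvd m \<Longrightarrow> l dvd m' \<Longrightarrow> l dvd Z * u \<and> l dvd x * r"
    and form: "m * m' = q * (E\<^sup>2 + F\<^sup>2)" and E: "\<And>l. prime l \<Longrightarrow> odd l \<Longrightarrow> l dvd E \<Longrightarrow> l dvd y * u"
  shows "jac (- 1) m = (if q dvd m then - 1 else 1)"
proof (rule jac_factor_of_q_form[OF m form])
  have i1: "(int r)\<^sup>2 + int q * (int s)\<^sup>2 = int N * (int u)\<^sup>2" and iZ: "int N * (int x)\<^sup>2 + int q * (int y)\<^sup>2 = (int Z)\<^sup>2"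
    using arg_cong[OF e1, of int] arg_cong[OF eZ, of int] by simp_all
  show "\<not> (q dvd m \<and> q dvd m')"
  proof
    assume "q dvd m \<and> q dvd m'"
    hence "q dvd Z * u" using md[OF prime_q q_odd] by blast
    hence "q dvd u" using prime_q coprime_nat_prime_False[OF Zq prime_q] by (auto simp: prime_dvd_mult_iff)
    hence "q dvd N * u\<^sup>2" by (simp add: power2_eq_square)
    moreover have dq: "q dvd q * s\<^sup>2" by simp
    ultimately have "q dvd r\<^sup>2" unfolding e1[symmetric] by (metis dvd_add_left_iff)
    thus False using coprime_nat_prime_False[OF cop prime_q] dq by blast
  qed
  have ru: "coprime r u"
  proof (rule coprime_natI)
    fix l assume l: "prime l" "l dvd r" "l dvd u"
    have "l dvd r\<^sup>2" "l dvd N * u\<^sup>2" using l by (simp_all add: power2_eq_square)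
    hence "l dvd q * s\<^sup>2" unfolding e1[symmetric] by (metis dvd_add_right_iff)
    thus False using coprime_nat_prime_False[OF cop l(1) \<open>l dvd r\<^sup>2\<close>] by blast
  qed
  fix l assume l: "prime l" "odd l" "l dvd m" "l dvd m'" "l dvd E"
  have Zu: "l dvd Z \<or> l dvd u" and xr: "l dvd x \<or> l dvd r" and yu: "l dvd y \<or> l dvd u"
    using md[OF l(1,2,3,4)] E[OF l(1,2,5)] l(1) by (auto simp: prime_dvd_mult_iff)
  have lu: "l dvd u" using Zu yu coprime_nat_prime_False[OF Zy l(1)] by blast
  have lr: "\<not> l dvd r" using coprime_nat_prime_False[OF ru l(1)] lu by blast
  have lx: "l dvd x" using lr xr by blast
  have lZ: "\<not> l dvd Z" using coprime_nat_prime_False[OF Zx l(1)] lx by blast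
  obtain i where i: "int u = int l * i" using lu by (metis dvd_def of_nat_mult)
  obtain j where j: "int x = int l * j" using lx by (metis dvd_def of_nat_mult)
  have "Legendre (int q) (int l) = 1"
  proof (rule Legendre_square_class_nat[OF l(1,2) _ lZ])
    show "int q * (int y)\<^sup>2 - (int Z)\<^sup>2 = int l * (- int N * j * int x)"
      unfolding iZ[symmetric] using j by (simp add: power2_eq_square)
  qed
  moreover have "Legendre (- int q) (int l) = 1"
  proof (rule Legendre_square_class_nat[OF l(1,2) _ lr])
    have "- int q * (int s)\<^sup>2 - (int r)\<^sup>2 = - (int N * (int u)\<^sup>2)" unfolding i1[symmetric] by simp
    thus "- int q * (int s)\<^sup>2 - (int r)\<^sup>2 = int l * (- int N * i * int u)"
      using i by (simp add: power2_eq_square)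
  qed
  moreover have "l > 2" using l(1,2) by (metis prime_ge_2_nat le_neq_implies_less even_numeral)
  ultimately show "Legendre (- 1) (int l) = 1" using Legendre_mult[OF l(1), of "- 1" "int q"] by simp
qed

text \<open>Here \<open>psi r = (-1/r)\<close> and \<open>psi z = (z/q)\<close>. With
  \<open>Z\<close> equal to \<open>z\<close> or \<open>2 z\<close>, the two equations combine to
  \<open>(Z u)^2 - (x r)^2 = q ((y u)^2 + (x s)^2)\<close>. Whether \<open>q\<close> divides
  \<open>Z u + x r\<close> is thus expressed twice: by \<open>(Z u/q) (x r/q)\<close>, and by the
  symbol of -1 at an odd factor of the left side, which depends on that factor modulo 4.\<close>

lemma psi_eq_case_c:
  assumes e1: "r\<^sup>2 + q * s\<^sup>2 = N * u\<^sup>2" and e2: "r\<^sup>2 = q * s\<^sup>2 + w\<^sup>2"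
    and cop: "coprime (r\<^sup>2) (q * s\<^sup>2)" and pos: "r > 0" "s > 0" "u > 0" "odd r" "odd u" "4 dvd s"
    and sol: "(\<exists>x y. sol1 z (2 * int x) (2 * int y) \<and> x > 0 \<and> odd x \<and> 4 dvd y)
      \<or> (\<exists>x y. sol1 z (int x) (int y) \<and> x > 0 \<and> odd x \<and> odd y)"
  shows "sol2 r (int w) (int u)" "psi z = psi r"
proof -
  have i1: "(int r)\<^sup>2 + int q * (int s)\<^sup>2 = int N * (int u)\<^sup>2" and i2: "(int r)\<^sup>2 = int q * (int s)\<^sup>2 + (int w)\<^sup>2"
    using arg_cong[OF e1, of int] arg_cong[OF e2, of int] by simp_all
  have rw: "coprime r w"
  proof (rule coprime_natI)
    fix l assume l: "prime l" "l dvd r" "l dvd w"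
    have "l dvd r\<^sup>2" "l dvd w\<^sup>2" using l by (simp_all add: power2_eq_square)
    hence "l dvd q * s\<^sup>2" unfolding e2 by (metis dvd_add_left_iff)
    thus False using coprime_nat_prime_False[OF cop l(1) \<open>l dvd r\<^sup>2\<close>] by blast
  qed
  have ru: "coprime r u"
  proof (rule coprime_natI)
    fix l assume l: "prime l" "l dvd r" "l dvd u"
    have "l dvd r\<^sup>2" "l dvd N * u\<^sup>2" using l by (simp_all add: power2_eq_square)
    hence "l dvd q * s\<^sup>2" unfolding e1[symmetric] by (metis dvd_add_right_iff)
    thus False using coprime_nat_prime_False[OF cop l(1) \<open>l dvd r\<^sup>2\<close>] by blast
  qed
  have "(int w)\<^sup>2 + int N * (int u)\<^sup>2 = 2 * (int r)\<^sup>2" using i1 i2 by simp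
  thus s2: "sol2 r (int w) (int u)" unfolding sol2_def using pos rw by simp
  have psi_r: "psi r = jac (- 1) r" by (rule sol2_facts(2)[OF s2])
  have Lr: "Legendre (int r) (int q) = 1"
  proof (rule Legendre_q_of_form[OF pos(4)])
    show "- int q * (int s)\<^sup>2 - (int w)\<^sup>2 = int r * (- int r)"
      using i2 by (simp add: power2_eq_square)
  qed (use rw in \<open>simp add: coprime_commute\<close>)
  have Lu: "Legendre (int u) (int q) = 1"
  proof (rule Legendre_q_of_form[OF pos(5) _ ru])
    show "- int q * (int s)\<^sup>2 - (int r)\<^sup>2 = int u * (- int N * int u)"
      using i1 by (simp add: power2_eq_square mult_ac)
  qed
  \<comment> \<open>\<open>q\<close> is a square modulo \<open>x\<close>, and reciprocity for
    \<open>q\<close>, which is 3 modulo 4, brings in \<open>(-1/x)\<close>.\<close>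
  have Lx: "Legendre (int x) (int q) = jac (- 1) x"
    if eZ: "N * x\<^sup>2 + q * y\<^sup>2 = Z\<^sup>2" and x: "odd x" and Zx: "coprime Z x" for x y Z
  proof -
    have iZ: "int N * (int x)\<^sup>2 + int q * (int y)\<^sup>2 = (int Z)\<^sup>2" using arg_cong[OF eZ, of int] by simp
    have "jac (int q) x = 1"
    proof (rule jac_square_class_nat[OF x _ Zx])
      show "int q * (int y)\<^sup>2 - (int Z)\<^sup>2 = int x * (- int N * int x)"
        unfolding iZ[symmetric] by (simp add: power2_eq_square)
    qed
    hence "jac (- 1) x * Legendre (int x) (int q) = 1"
      using jac_reciprocity_3_mod_4[OF prime_q q_mod_4 x] by simp
    thus ?thesis using signs_mult_eq_1 by metis
  qed
  have jm: "jac (- 1) (x * r) = jac (- 1) x * jac (- 1) r" if "odd x" for x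
    using jac_mult_right pos(1) that odd_pos by blast
  have L2: "Legendre 2 (int q) = - 1" using Legendre_2[OF prime_q q_gt_2] q_mod by simp
  note LM = Legendre_mult[OF prime_q q_gt_2]
  have key: "(Z * u)\<^sup>2 = q * ((y * u)\<^sup>2 + (x * s)\<^sup>2) + (x * r)\<^sup>2" if eZ: "N * x\<^sup>2 + q * y\<^sup>2 = Z\<^sup>2" for x y Z
  proof -
    have "(Z * u)\<^sup>2 = Z\<^sup>2 * u\<^sup>2" by (simp add: power_mult_distrib)
    also have "\<dots> = x\<^sup>2 * (N * u\<^sup>2) + q * y\<^sup>2 * u\<^sup>2" unfolding eZ[symmetric] by (simp add: algebra_simps)
    finally show ?thesis unfolding e1[symmetric] by (simp add: algebra_simps power_mult_distrib)
  qed
  have sumroot: "Legendre (int (Z * u)) (int q) * Legendre (int (x * r)) (int q) = (if q dvd Z * u + x * r then - 1 else 1)"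
    if eZ: "N * x\<^sup>2 + q * y\<^sup>2 = Z\<^sup>2" and Zq: "coprime Z q" for x y Z
  proof -
    have "int ((Z * u)\<^sup>2) = int (q * ((y * u)\<^sup>2 + (x * s)\<^sup>2) + (x * r)\<^sup>2)" using key[OF eZ] by (simp only:)
    hence "(int (Z * u))\<^sup>2 = int q * int ((y * u)\<^sup>2 + (x * s)\<^sup>2) + (int (x * r))\<^sup>2" by (simp only: of_nat_add of_nat_mult of_nat_power)
    hence "(int (Z * u) + int (x * r)) * (int (Z * u) - int (x * r)) = int q * int ((y * u)\<^sup>2 + (x * s)\<^sup>2)"
      by (simp add: power2_eq_square algebra_simps)
    hence d: "int q dvd (int (Z * u) + int (x * r)) * (int (Z * u) - int (x * r))" by (metis dvd_triv_left)
    have qu: "\<not> q dvd u"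
    proof
      assume "q dvd u"
      hence "q dvd N * u\<^sup>2" by (simp add: power2_eq_square)
      hence "q dvd r\<^sup>2" unfolding e1[symmetric] by (metis dvd_add_left_iff dvd_triv_left)
      thus False using coprime_nat_prime_False[OF cop prime_q] by simp
    qed
    have qZ: "\<not> q dvd Z" using coprime_nat_prime_False[OF Zq prime_q] by auto
    have "\<not> q dvd Z * u" using qu qZ prime_q by (simp add: prime_dvd_mult_iff)
    hence nd: "\<not> int q dvd int (Z * u)" by (simp only: int_dvd_int_iff not_False_eq_True)
    have "int q dvd int (Z * u) + int (x * r) \<longleftrightarrow> q dvd Z * u + x * r"
      by (simp only: int_dvd_int_iff flip: of_nat_add)
    thus ?thesis using Legendre_sum_of_square_roots[OF prime_q q_gt_2 q_mod_4 d nd] by (simp only:)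
  qed
  have Zx_gt: "Z * u > x * r" if eZ: "N * x\<^sup>2 + q * y\<^sup>2 = Z\<^sup>2" and x: "x > 0" for x y Z
  proof -
    have "q * ((y * u)\<^sup>2 + (x * s)\<^sup>2) > 0" using x pos(2) q_gt_2 by simp
    hence "(x * r)\<^sup>2 < (Z * u)\<^sup>2" unfolding key[OF eZ] by simp
    thus ?thesis by (rule power_less_imp_less_base) simp
  qed
  have "Legendre (int z) (int q) = jac (- 1) r"
    using sol
  proof
    assume "\<exists>x y. sol1 z (int x) (int y) \<and> x > 0 \<and> odd x \<and> odd y"
    then obtain x y where s1: "sol1 z (int x) (int y)" and x: "x > 0" "odd x" and y: "odd y" by blast
    have z: "z > 0" "odd z" and ez: "int N * (int x)\<^sup>2 + int q * (int y)\<^sup>2 = 4 * (int z)\<^sup>2" and zx: "coprime z x"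
      using s1 by (auto simp: sol1_def)
    have zq: "coprime z q" and zy: "coprime z y" using sol1_facts[OF s1] by simp_all
    have "int (N * x\<^sup>2 + q * y\<^sup>2) = int ((2 * z)\<^sup>2)" using ez by simp
    hence eZ: "N * x\<^sup>2 + q * y\<^sup>2 = (2 * z)\<^sup>2" by (simp only: of_nat_eq_iff)
    have Zx: "coprime (2 * z) x" and Zy: "coprime (2 * z) y" and Zq: "coprime (2 * z) q" using zx zy zq x y q_odd by simp_all
    note gt = Zx_gt[OF eZ x(1)]
    \<comment> \<open>With \<open>Z = 2 z\<close> both factors are odd. The sign
      \<open>(2/q) = -1\<close> is balanced by \<open>m\<close> being \<open>x r + 2\<close> modulo
      4.\<close>
    define m m' where "m = 2 * z * u + x * r" and "m' = 2 * z * u - x * r"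
    have om: "odd m" using x pos by (simp add: m_def)
    have m'0: "m' > 0" using gt by (simp add: m'_def)
    have mm: "m * m' = q * ((y * u)\<^sup>2 + (x * s)\<^sup>2)"
    proof -
      have "int m' = int (2 * z * u) - int (x * r)" using gt unfolding m'_def by (simp add: of_nat_diff)
      moreover have "int m = int (2 * z * u) + int (x * r)" unfolding m_def by (rule of_nat_add)
      moreover have "(U + V) * (U - V) = U\<^sup>2 - V\<^sup>2" for U V :: int by (simp add: power2_eq_square algebra_simps)
      ultimately have "int m * int m' = (int (2 * z * u))\<^sup>2 - (int (x * r))\<^sup>2" by (simp only:)
      also have "\<dots> = int ((2 * z * u)\<^sup>2) - int ((x * r)\<^sup>2)" by simp
      also have "\<dots> = int (q * ((y * u)\<^sup>2 + (x * s)\<^sup>2))" unfolding key[OF eZ] by simp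
      finally have "int (m * m') = int (q * ((y * u)\<^sup>2 + (x * s)\<^sup>2))" by simp
      thus ?thesis by (simp only: of_nat_eq_iff)
    qed
    have "jac (- 1) m = (if q dvd m then - 1 else 1)"
    proof (rule jac_minus_1_of_q_form_factor[OF e1 cop eZ Zx Zy Zq om m'0 _ mm])
      fix l assume l: "prime l" "odd l" "l dvd m" "l dvd m'"
      have l2: "\<not> l dvd 2" using l(1,2) by (metis primes_dvd_imp_eq two_is_prime_nat dvd_refl)
      have "m + m' = 2 * (2 * z * u)" "m - m' = 2 * (x * r)" using gt unfolding m_def m'_def by simp_all
      moreover have "l dvd m + m'" "l dvd m - m'" using l by (simp_all add: dvd_diff_nat)
      ultimately have "l dvd 2 * (2 * z * u)" "l dvd 2 * (x * r)" by metis+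
      thus "l dvd 2 * z * u \<and> l dvd x * r" using l(1) l2 prime_dvd_mult_iff[OF l(1), of 2] by blast
    qed
    also have "\<dots> = Legendre (int (2 * z * u)) (int q) * Legendre (int (x * r)) (int q)"
      unfolding sumroot[OF eZ Zq] m_def ..
    also have "\<dots> = - (Legendre (int z) (int q) * jac (- 1) x)"
      using LM[of 2 "int z"] LM[of "2 * int z" "int u"] LM[of "int x" "int r"] Lr Lu L2 Lx[OF eZ x(2) Zx] by simp
    finally have A: "jac (- 1) m = - (Legendre (int z) (int q) * jac (- 1) x)" .
    have oxr: "odd (x * r)" using x pos by simp
    have "jac (- 1) m = - jac (- 1) (x * r)"
    proof -
      have "odd (z * u)" using z pos by simp
      then obtain j where "z * u = 2 * j + 1" by (elim oddE)
      hence "m = 4 * j + 2 + x * r" by (simp add: m_def mult.assoc)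
      hence "m mod 4 = 1 \<longleftrightarrow> (x * r) mod 4 \<noteq> 1" using oxr by presburger
      thus ?thesis unfolding jac_minus_1[OF om] jac_minus_1[OF oxr] by simp
    qed
    hence "Legendre (int z) (int q) * jac (- 1) x = jac (- 1) r * jac (- 1) x" using A jm[OF x(2)] by simp
    thus ?thesis unfolding jac_minus_1[OF x(2)] by (auto split: if_splits)
  next
    assume "\<exists>x y. sol1 z (2 * int x) (2 * int y) \<and> x > 0 \<and> odd x \<and> 4 dvd y"
    then obtain x y where s1: "sol1 z (2 * int x) (2 * int y)" and x: "x > 0" "odd x" and y: "4 dvd y" by blast
    have z: "z > 0" "odd z" and ez: "int N * (2 * int x)\<^sup>2 + int q * (2 * int y)\<^sup>2 = 4 * (int z)\<^sup>2" and Zx: "coprime z x"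
      using s1 by (auto simp: sol1_def)
    have Zq: "coprime z q" and Zy: "coprime z y" using sol1_facts[OF s1] by simp_all
    have "int (N * x\<^sup>2 + q * y\<^sup>2) = int (z\<^sup>2)" using ez by (simp add: power_mult_distrib)
    hence eZ: "N * x\<^sup>2 + q * y\<^sup>2 = z\<^sup>2" by (simp only: of_nat_eq_iff)
    note gt = Zx_gt[OF eZ x(1)]
    obtain y1 s1 where ys: "y = 4 * y1" "s = 4 * s1" using y pos(6) by (auto elim!: dvdE)
    have oV: "odd (x * r)" and oU: "odd (z * u)" using x z pos by simp_all
    \<comment> \<open>With \<open>Z = z\<close> both factors are even and are halved. As 4 divides
      \<open>y\<close> and \<open>s\<close>, it divides \<open>A B\<close>, while
      \<open>A - B = x r\<close> is odd. So one of \<open>A\<close>, \<open>B\<close> is divisible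
      by 4, and the other is \<open>x r\<close> or \<open>- x r\<close> modulo 4.\<close>
    define A B where "A = (z * u + x * r) div 2" and "B = (z * u - x * r) div 2"
    have AB: "2 * A = z * u + x * r" "2 * B = z * u - x * r" using oV oU gt by (simp_all add: A_def B_def)
    have AmB: "A = B + x * r" and ApB: "z * u = A + B" using AB gt by linarith+
    have prodAB: "A * B = q * ((2 * y1 * u)\<^sup>2 + (2 * x * s1)\<^sup>2)"
    proof -
      have "(z * u)\<^sup>2 = 4 * (A * B) + (x * r)\<^sup>2" unfolding ApB AmB by (simp add: power2_eq_square algebra_simps)
      hence "4 * (A * B) = q * ((y * u)\<^sup>2 + (x * s)\<^sup>2)" using key[OF eZ] by simp
      also have "\<dots> = 4 * (q * ((2 * y1 * u)\<^sup>2 + (2 * x * s1)\<^sup>2))" unfolding ys by (simp add: power_mult_distrib algebra_simps)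
      finally show ?thesis by simp
    qed
    have d4: "4 dvd A * B" unfolding prodAB by (simp add: power_mult_distrib)
    have A0: "A > 0" and B0: "B > 0" using AB gt by linarith+
    have common: "l dvd z * u \<and> l dvd x * r" if "l dvd A" "l dvd B" for l
      using that ApB AmB by (metis dvd_add dvd_add_right_iff)
    have yu: "l dvd y * u" if "l dvd 2 * y1 * u" for l
    proof -
      have "y * u = 2 * (2 * y1 * u)" unfolding ys by simp
      thus ?thesis using that by (metis dvd_mult)
    qed
    have sr: "(if q dvd 2 * A then - 1 else 1) = Legendre (int z) (int q) * jac (- 1) x"
    proof -
      have "(if q dvd 2 * A then - 1 else 1) = Legendre (int (z * u)) (int q) * Legendre (int (x * r)) (int q)"
        unfolding sumroot[OF eZ Zq] AB ..
      also have "\<dots> = Legendre (int z) (int q) * jac (- 1) x"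
        using LM[of "int z" "int u"] LM[of "int x" "int r"] Lr Lu Lx[OF eZ x(2) Zx] by simp
      finally show ?thesis .
    qed
    have "q \<noteq> 2" using q_gt_2 by simp
    hence q2: "q dvd 2 * A \<longleftrightarrow> q dvd A" using prime_q by (metis dvd_mult prime_dvd_mult_iff primes_dvd_imp_eq two_is_prime_nat)
    have x1: "jac (- 1) x = 1 \<or> jac (- 1) x = - 1" unfolding jac_minus_1[OF x(2)] by simp
    show ?thesis
    proof (cases "odd A")
      case oA: True
      have "coprime A 4" using oA by (metis coprime_mult_right_iff coprime_right_2_iff_odd mult_2_right numeral_Bit0)
      hence "4 dvd B" using d4 by (simp add: coprime_commute coprime_dvd_mult_right_iff)
      hence "A mod 4 = (x * r) mod 4" unfolding AmB by (auto elim!: dvdE)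
      hence "jac (- 1) A = jac (- 1) (x * r)" unfolding jac_minus_1[OF oA] jac_minus_1[OF oV] by simp
      moreover have "jac (- 1) A = (if q dvd A then - 1 else 1)"
        by (rule jac_minus_1_of_q_form_factor[OF e1 cop eZ Zx Zy Zq oA B0 _ prodAB]) (use common yu in blast)+
      ultimately have "jac (- 1) x * jac (- 1) r = Legendre (int z) (int q) * jac (- 1) x" using sr q2 jm[OF x(2)] by simp
      thus ?thesis using x1 by auto
    next
      case False
      hence oB: "odd B" using AmB oV by simp
      have "coprime B 4" using oB by (metis coprime_mult_right_iff coprime_right_2_iff_odd mult_2_right numeral_Bit0)
      hence "4 dvd A" using d4 by (simp add: coprime_commute coprime_dvd_mult_left_iff)
      hence "(B mod 4 + (x * r) mod 4) mod 4 = 0" unfolding AmB mod_add_eq by simp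
      moreover have "B mod 4 = 1 \<or> B mod 4 = 3" using oB by presburger
      moreover have "(x * r) mod 4 < 4" by simp
      ultimately have "B mod 4 = 1 \<longleftrightarrow> (x * r) mod 4 \<noteq> 1" by presburger
      hence "jac (- 1) B = - jac (- 1) (x * r)" unfolding jac_minus_1[OF oB] jac_minus_1[OF oV] by simp
      moreover have BA: "B * A = q * ((2 * y1 * u)\<^sup>2 + (2 * x * s1)\<^sup>2)" using prodAB by (simp add: mult.commute)
      have "jac (- 1) B = (if q dvd B then - 1 else 1)"
        by (rule jac_minus_1_of_q_form_factor[OF e1 cop eZ Zx Zy Zq oB A0 _ BA]) (use common yu in blast)+
      \<comment> \<open>Exactly one of \<open>A\<close> and \<open>B\<close> is divisible by
        \<open>q\<close>, so the sign attached to \<open>B\<close> is opposite to that of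
        \<open>A\<close>. This offsets the sign from \<open>B\<close> being \<open>- x r\<close>
        modulo 4.\<close>
      moreover have "q dvd B \<longleftrightarrow> \<not> q dvd A"
      proof
        assume "q dvd B"
        show "\<not> q dvd A"
        proof
          assume "q dvd A"
          hence "q dvd z * u" using common \<open>q dvd B\<close> by blast
          moreover have "\<not> int q dvd int z" "\<not> int q dvd int u"
            using Lu Legendre_eq_0_iff[of "int u" "int q"] coprime_nat_prime_False[OF Zq prime_q] by auto
          ultimately show False using prime_q by (simp add: prime_dvd_mult_iff)
        qed
      next
        assume "\<not> q dvd A"
        moreover have "q dvd A * B" unfolding prodAB by simp
        ultimately show "q dvd B" using prime_q by (simp add: prime_dvd_mult_iff)
      qed
      ultimately have "jac (- 1) (x * r) = Legendre (int z) (int q) * jac (- 1) x" using sr q2 by (auto split: if_splits)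
      thus ?thesis using x1 unfolding jm[OF x(2)] by auto
    qed
  qed
  moreover have "psi z = Legendre (int z) (int q)" using sol sol1_facts(4) by blast
  ultimately show "psi z = psi r" using psi_r by simp
qed

lemma cong_power_Suc_of_dvd_iff:
  fixes a b :: nat
  assumes "2 ^ k dvd a" "2 ^ k dvd b" "2 ^ Suc k dvd a \<longleftrightarrow> 2 ^ Suc k dvd b"
  shows "[a = b] (mod 2 ^ Suc k)"
proof -
  obtain i j where ij: "a = 2 ^ k * i" "b = 2 ^ k * j" using assms(1,2) by (auto elim!: dvdE)
  have "even i \<longleftrightarrow> even j" using assms(3) unfolding ij by (simp add: mult.commute)
  hence "i mod 2 = j mod 2" by presburger
  hence "(2 ^ k * i) mod (2 ^ k * 2) = (2 ^ k * j) mod (2 ^ k * 2)" by (simp only: mult_mod_right[symmetric])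
  thus ?thesis unfolding ij Cong.unique_euclidean_semiring_class.cong_def by (simp only: power_Suc2)
qed

lemma class_numbers_congruent:
  assumes k: "triple_area (N * q) k"
  shows "[h_neg (N * q) = h_neg N] (mod 2 ^ (t + 2))"
proof -
  have on: "odd (N * q)" using odd_N q_odd by simp
  obtain a b c d r s u w :: nat where prod: "a * b * c * d = N * q"
    and e1: "a * r\<^sup>2 + b * s\<^sup>2 = c * u\<^sup>2" and e2: "a * r\<^sup>2 = b * s\<^sup>2 + d * w\<^sup>2" and cop: "coprime (a * r\<^sup>2) (b * s\<^sup>2)"
    and odds: "odd (c * u\<^sup>2)" "odd (d * w\<^sup>2)" and cop2: "coprime (c * u\<^sup>2) (d * w\<^sup>2)" and pos: "r > 0" "s > 0" "u > 0" "w > 0"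
    and nontriv: "\<not> (a = 1 \<and> c = 1 \<and> d = 1)"
    using nontrivial_quadratic_system[OF squarefree_Nq on k] by metis
  note par = system_parity[OF prod e1 e2 odds]
  have bq: "b = q" and cases: "a = N \<and> c = 1 \<and> d = 1 \<or> a = 1 \<and> c = N \<and> d = 1 \<or> a = 1 \<and> c = 1 \<and> d = N"
    using system_cases[OF prod e1 e2 cop odds nontriv] by blast+
  obtain z1 X Y z2 X' Y' where s1: "sol1 z1 X Y" and s2: "sol2 z2 X' Y'" and eq: "psi z1 = psi z2"
  proof -
    consider "a = 1 \<and> c = 1 \<and> d = N" | "a = N \<and> c = 1 \<and> d = 1" | "a = 1 \<and> c = N \<and> d = 1" using cases by blast
    then have "\<exists>z1 X Y z2 X' Y'. sol1 z1 X Y \<and> sol2 z2 X' Y' \<and> psi z1 = psi z2"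
    proof cases
      case 1
      have "r\<^sup>2 + q * s\<^sup>2 = u\<^sup>2" "r\<^sup>2 = q * s\<^sup>2 + N * w\<^sup>2" "coprime (r\<^sup>2) (q * s\<^sup>2)" using e1 e2 cop 1 bq by simp_all
      thus ?thesis using case_d_solutions[of r s u w] pos par(1) by blast
    next
      case 2
      have e: "N * r\<^sup>2 + q * s\<^sup>2 = u\<^sup>2" "N * r\<^sup>2 = q * s\<^sup>2 + w\<^sup>2" "coprime (N * r\<^sup>2) (q * s\<^sup>2)" "coprime u w"
        using e1 e2 cop cop2 2 bq by simp_all
      obtain z x y where "sol2 z (int x) (int y)" "y > 0" by (rule sol2_exists)
      thus ?thesis using psi_eq_case_a[OF e pos(3) par(1,3)] by blast
    next
      case 3
      have e: "r\<^sup>2 + q * s\<^sup>2 = N * u\<^sup>2" "r\<^sup>2 = q * s\<^sup>2 + w\<^sup>2" "coprime (r\<^sup>2) (q * s\<^sup>2)" using e1 e2 cop 3 bq by simp_all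
      obtain z where z: "(\<exists>x y. sol1 z (2 * int x) (2 * int y) \<and> x > 0 \<and> odd x \<and> 4 dvd y)
          \<or> (\<exists>x y. sol1 z (int x) (int y) \<and> x > 0 \<and> odd x \<and> odd y)"
        using sol1_exists by metis
      show ?thesis using psi_eq_case_c[OF e pos(1-3) par(1,3,2) z] z by blast
    qed
    thus thesis using that by blast
  qed
  have "[h_neg (N * q) = h_neg N] (mod 2 ^ Suc (t + 1))"
    by (rule cong_power_Suc_of_dvd_iff)
      (use class_number_Nq[OF s1] class_number_N[OF s2] eq in auto)
  thus ?thesis by simp
qed

end

theorem theorem1p1:
  fixes t n q :: nat and p :: "nat \<Rightarrow> nat"
  assumes "t \<ge> 1"
    and "n = (\<Prod>i<t. p i) * q"
    and "\<And>i. i < t \<Longrightarrow> prime (p i)"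
    and "prime q"
    and "inj_on p {..<t}"
    and "\<And>i. i < t \<Longrightarrow> p i \<noteq> q"
    and "\<And>i. i < t \<Longrightarrow> [p i = 1] (mod 8)"
    and "[q = 3] (mod 8)"
    and "\<And>i. i < t \<Longrightarrow> Legendre (int q) (int (p i)) = 1"
    and "vec_space.rank t (A_mat t p) = t - 1"
    and "congruent_number n"
  shows "[h_neg n = h_neg (n div q)] (mod 2 ^ (t + 2))"
proof -
  interpret redei_q t p q
    by unfold_locales (use assms in \<open>simp_all add: Cong.unique_euclidean_semiring_class.cong_def\<close>)
  have n: "n = N * q" using assms(2) by (simp add: N_def P_def)
  obtain a b c :: rat where abc: "a\<^sup>2 + b\<^sup>2 = c\<^sup>2" "of_nat n = a * b / 2"
    using assms(11) unfolding congruent_number_def by blast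
  obtain k where "triple_area n k"
    by (rule triple_area_of_rational_triangle[OF _ _ abc]) (use squarefree_Nq odd_N q_odd n in auto)
  hence "[h_neg n = h_neg N] (mod 2 ^ (t + 2))" unfolding n by (rule class_numbers_congruent)
  moreover have "n div q = N" unfolding n using q_gt_2 by simp
  ultimately show ?thesis by (simp only:)
qed

end
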